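(* For any odd positive integer $r\ge7$, consider the lens spaces $$L=L(r^2;\,1,\,1+r,\,1+2r,\,1+4r),\qquad L'=L(r^2;\,1,\,1-r,\,1-2r,\,1-4r),$$ endowed with their unique spin structures (note that $q:=r^2$ is odd). Then $L$ and $L'$ are non-isometric and Dirac isospectral.
   Context: For $q\in\mathbb N$ and $s=(s_1,\dots,s_m)\in\mathbb Z^m$ with every $s_j$ coprime to $q$, let $\gamma\in \mathrm{SO}(2m)$ be the block diagonal matrix whose $j$-th $2\times2$ block is the rotation by angle $2\pi s_j/q$, let $\Gamma=\langle\gamma\rangle$ (cyclic of order $q$), and $L(q;s)=\Gamma\backslash S^{2m-1}$, where $S^{2m-1}$ is the unit sphere of constant curvature one; all lens spaces carry the orientation induced from one fixed orientation of $S^{2m-1}$. Let $\Theta:\mathrm{Spin}(2m)\to \mathrm{SO}(2m)$ be the universal covering, $\mathrm{Spin}(2m)$ being inside the Clifford algebra of $\mathbb R^{2m}$ (canonical basis $e_1,\dots,e_{2m}$, $e_i^2=-1$). A homomorphism $\tau:\Gamma\to\mathrm{Spin}(2m)$ with $\Theta\circ\tau=\mathrm{Id}_\Gamma$ induces the spin structure $\tau(\Gamma)\backslash \mathrm{Spin}(2m)\to\Gamma\backslash \mathrm{SO}(2m)$ on $L(q;s)$. For $q$ odd there is exactly one spin structure, given by $\tau(\gamma^k)=\prod_{j=1}^m\big(\cos(\tfrac{(q+1)ks_j\pi}{q})+\sin(\tfrac{(q+1)ks_j\pi}{q})\,e_{2j-1}e_{2j}\big)$. Two spin lens spaces are Dirac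 isospectral if their (spin) Dirac operators (with the fixed orientations and the same Clifford multiplication convention) have the same eigenvalues with the same multiplicities. *)

theory Defs
  imports "HOL-Analysis.Analysis" "HOL-Library.FuncSet" "HOL-Library.Function_Algebras"
begin

text \<open>
  Vectors of \<open>\<real>\<^sup>N\<close> have type \<open>real ^ 'n\<close> with \<open>'n\<close> finite and linearly ordered, \<open>N = CARD('n)\<close>;
  the order of \<open>'n\<close> numbers the canonical basis.
\<close>

type_synonym 'n rvector = "(real, 'n) vec"
type_synonym 'n rmatrix = "((real, 'n) vec, 'n) vec"
type_synonym 'n clifford = "(real, 'n set) vec"

section \<open>Smooth maps\<close>

fun differentiable_times_on :: "nat \<Rightarrow> ('a::real_normed_vector \<Rightarrow> 'b::real_normed_vector) \<Rightarrow> 'a set \<Rightarrow> bool"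
  where
    "differentiable_times_on 0 f U \<longleftrightarrow> continuous_on U f"
  | "differentiable_times_on (Suc k) f U \<longleftrightarrow>
       (\<forall>x\<in>U. f differentiable (at x)) \<and>
       (\<forall>v. differentiable_times_on k (\<lambda>x. frechet_derivative f (at x) v) U)"

text \<open>Only meant for open \<open>U\<close>.\<close>
definition smooth_on_open :: "('a::real_normed_vector \<Rightarrow> 'b::real_normed_vector) \<Rightarrow> 'a set \<Rightarrow> bool"
  where "smooth_on_open f U \<longleftrightarrow> (\<forall>k. differentiable_times_on k f U)"

text \<open>Smoothness on an arbitrary subset (below: an embedded submanifold) means local smooth
  extendability to the ambient space.\<close>
definition smooth_on_subset :: "('a::real_normed_vector \<Rightarrow> 'b::real_normed_vector) \<Rightarrow> 'a set \<Rightarrow> bool"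
  where "smooth_on_subset f S \<longleftrightarrow>
    (\<forall>x\<in>S. \<exists>U F. open U \<and> x \<in> U \<and> smooth_on_open F U \<and> (\<forall>y\<in>U \<inter> S. F y = f y))"

section \<open>Lens spaces and their isometries\<close>

text \<open>The 0-based position of \<open>i\<close>; block \<open>j < m\<close> occupies the positions \<open>2 * j\<close> and \<open>2 * j + 1\<close>.\<close>
definition position :: "'n::{finite,linorder} \<Rightarrow> nat"
  where "position i = card {j. j < i}"

definition lens_generator :: "nat \<Rightarrow> int list \<Rightarrow> 'n::{finite,linorder} rmatrix"
  where "lens_generator q s = (\<chi> i k.
    let \<theta> = 2 * pi * real_of_int (s ! (position i div 2)) / real q in
    if position i div 2 \<noteq> position k div 2 then 0
    else if i = k then cos \<theta>
    else if i < k then - sin \<theta>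
    else sin \<theta>)"

text \<open>The generator has finite order, so its non-negative powers form the generated group.\<close>
definition lens_group :: "nat \<Rightarrow> int list \<Rightarrow> 'n::{finite,linorder} rmatrix set"
  where "lens_group q s = range (\<lambda>k::nat. ((\<lambda>A. lens_generator q s ** A) ^^ k) (mat 1))"

definition orbit :: "'n::finite rmatrix set \<Rightarrow> 'n rvector \<Rightarrow> 'n rvector set"
  where "orbit G x = (\<lambda>A. A *v x) ` G"

text \<open>The point set of the spherical space form \<open>G\<close> acting freely on the unit sphere.\<close>
definition space_form :: "'n::finite rmatrix set \<Rightarrow> 'n rvector set set"
  where "space_form G = orbit G ` sphere 0 1"

text \<open>The quotient carries the smooth structure and the metric for which the projection from the
  sphere is a local isometry.  Hence a map between two quotients is smooth iff it lifts locally to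
  smooth maps between open subsets of the spheres, and its differential is that of any such lift.\<close>
definition smooth_local_lift ::
    "'n::finite rmatrix set \<Rightarrow> 'n rmatrix set \<Rightarrow> ('n rvector set \<Rightarrow> 'n rvector set)
      \<Rightarrow> 'n rvector set \<Rightarrow> ('n rvector \<Rightarrow> 'n rvector) \<Rightarrow> bool"
  where "smooth_local_lift G H F U \<phi> \<longleftrightarrow> open U \<and> smooth_on_open \<phi> U \<and>
    (\<forall>y \<in> U \<inter> sphere 0 1. \<phi> y \<in> sphere 0 1 \<and> F (orbit G y) = orbit H (\<phi> y))"

definition smooth_quotient_map ::
    "'n::finite rmatrix set \<Rightarrow> 'n rmatrix set \<Rightarrow> ('n rvector set \<Rightarrow> 'n rvector set) \<Rightarrow> bool"
  where "smooth_quotient_map G H F \<longleftrightarrow>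
    (\<forall>x \<in> sphere 0 1. \<exists>U \<phi>. x \<in> U \<and> smooth_local_lift G H F U \<phi>)"

definition preserves_metric ::
    "'n::finite rmatrix set \<Rightarrow> 'n rmatrix set \<Rightarrow> ('n rvector set \<Rightarrow> 'n rvector set) \<Rightarrow> bool"
  where "preserves_metric G H F \<longleftrightarrow>
    (\<forall>U \<phi>. smooth_local_lift G H F U \<phi> \<longrightarrow>
      (\<forall>x \<in> U \<inter> sphere 0 1. \<forall>v w. v \<bullet> x = 0 \<longrightarrow> w \<bullet> x = 0 \<longrightarrow>
        frechet_derivative \<phi> (at x) v \<bullet> frechet_derivative \<phi> (at x) w = v \<bullet> w))"

text \<open>Riemannian isometries: diffeomorphisms preserving the metric (orientation plays no role).\<close>
definition isometric_space_forms :: "'n::finite rmatrix set \<Rightarrow> 'n rmatrix set \<Rightarrow> bool"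
  where "isometric_space_forms G H \<longleftrightarrow>
    (\<exists>F. bij_betw F (space_form G) (space_form H) \<and>
      smooth_quotient_map G H F \<and>
      smooth_quotient_map H G (inv_into (space_form G) F) \<and>
      preserves_metric G H F)"

section \<open>The Clifford algebra and the spin group\<close>

text \<open>The coefficient of \<open>a :: real ^ ('n set)\<close> at \<open>A\<close> belongs to the product \<open>e\<^sub>A\<close> of the \<open>e\<^sub>i\<close>,
  \<open>i \<in> A\<close>, in increasing order.  Reordering \<open>e\<^sub>A e\<^sub>B\<close> costs a sign for each pair \<open>b < a\<close> and the
  relation \<open>e\<^sub>i\<^sup>2 = -1\<close> costs one for each pair \<open>b = a\<close>.\<close>
definition clifford_sign :: "'n::{finite,linorder} set \<Rightarrow> 'n set \<Rightarrow> real"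
  where "clifford_sign A B = (-1) ^ card {(a, b). a \<in> A \<and> b \<in> B \<and> b \<le> a}"

definition clifford_mult ::
    "'n::{finite,linorder} clifford \<Rightarrow> 'n clifford \<Rightarrow> 'n clifford"  (infixl \<open>\<star>\<close> 70)
  where "a \<star> b = (\<Sum>A\<in>UNIV. \<Sum>B\<in>UNIV.
    (a $ A * b $ B * clifford_sign A B) *\<^sub>R axis ((A - B) \<union> (B - A)) 1)"

definition clifford_one :: "'n::{finite,linorder} clifford"
  where "clifford_one = axis {} 1"

definition clifford_vec :: "'n::{finite,linorder} rvector \<Rightarrow> 'n clifford"
  where "clifford_vec v = (\<Sum>i\<in>UNIV. v $ i *\<^sub>R axis {i} 1)"

text \<open>Reversal of the order of factors; on the spin group it is the inverse.\<close>
definition clifford_reverse :: "'n::{finite,linorder} clifford \<Rightarrow> 'n clifford"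
  where "clifford_reverse a = (\<chi> A. (-1) ^ (card A * (card A - 1) div 2) * a $ A)"

text \<open>\<open>spin_group W\<close> is the spin group of the linear subspace \<open>W\<close>.\<close>
definition spin_group :: "'n::{finite,linorder} rvector set \<Rightarrow> 'n clifford set"
  where "spin_group W = {foldr (\<lambda>v a. clifford_vec v \<star> a) vs clifford_one | vs.
    even (length vs) \<and> (\<forall>v\<in>set vs. v \<in> W \<and> norm v = 1)}"

text \<open>The covering \<open>\<Theta>\<close> of the special orthogonal group: the matrix of \<open>v \<mapsto> g v g\<^sup>-\<^sup>1\<close>.\<close>
definition spin_cover :: "'n::{finite,linorder} clifford \<Rightarrow> 'n rmatrix"
  where "spin_cover g = (\<chi> i j. (g \<star> clifford_vec (axis j 1) \<star> clifford_reverse g) $ {i})"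

text \<open>Values outside \<open>G\<close> are fixed by extensionality, so that uniqueness is meaningful.\<close>
definition spin_structure ::
    "'n::{finite,linorder} rmatrix set \<Rightarrow> ('n rmatrix \<Rightarrow> 'n clifford) \<Rightarrow> bool"
  where "spin_structure G \<tau> \<longleftrightarrow>
    \<tau> \<in> G \<rightarrow>\<^sub>E spin_group UNIV \<and>
    (\<forall>A\<in>G. \<forall>B\<in>G. \<tau> (A ** B) = \<tau> A \<star> \<tau> B) \<and>
    (\<forall>A\<in>G. spin_cover (\<tau> A) = A)"

section \<open>Spinor fields and the Dirac operator\<close>

definition last_index :: "'n::{finite,linorder}"
  where "last_index = Max UNIV"

text \<open>Complex representations of the Clifford algebra of \<open>\<real>\<^sup>N\<^sup>-\<^sup>1\<close>, spanned by all \<open>e\<^sub>i\<close> except the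
  last one; \<open>c i\<close> is Clifford multiplication by \<open>e\<^sub>i\<close> (the value at the last index is irrelevant).
  For \<open>N\<close> even there are two irreducible ones up to equivalence, both of dimension \<open>2 ^ (N div 2 - 1)\<close>;
  choosing one of them is the choice of a Clifford multiplication convention.\<close>
definition irreducible_clifford_module :: "('n::{finite,linorder} \<Rightarrow> complex ^ 'k ^ 'k) \<Rightarrow> bool"
  where "irreducible_clifford_module c \<longleftrightarrow>
    (\<forall>i j. i \<noteq> last_index \<longrightarrow> j \<noteq> last_index \<longrightarrow>
      c i ** c j + c j ** c i = (if i = j then mat (-2) else 0)) \<and>
    (\<forall>W. vec.subspace W \<longrightarrow> (\<forall>i. i \<noteq> last_index \<longrightarrow> (\<forall>x\<in>W. c i *v x \<in> W)) \<longrightarrow>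
      W = {0} \<or> W = UNIV)"

definition clifford_action ::
    "('n::{finite,linorder} \<Rightarrow> complex ^ 'k ^ 'k) \<Rightarrow> 'n clifford \<Rightarrow> complex ^ 'k ^ 'k"
  where "clifford_action c a =
    (\<Sum>A\<in>UNIV. a $ A *\<^sub>R foldr (\<lambda>i M. c i ** M) (sorted_list_of_set A) (mat 1))"

text \<open>
  The point \<open>g\<close> of the spin group of \<open>\<real>\<^sup>N\<close> is a spin frame over the point \<open>\<Theta> g e\<^sub>N\<close> of the sphere,
  lying above the orthonormal frame \<open>\<Theta> g e\<^sub>1, \<dots>, \<Theta> g e\<^sub>N\<^sub>-\<^sub>1\<close> of its tangent space.  This makes
  the spin group of \<open>\<real>\<^sup>N\<close> the spin structure of the sphere, with structure group the spin group of
  \<open>\<real>\<^sup>N\<^sup>-\<^sup>1\<close> acting from the right.  The orientation of the sphere is the one in which a frame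
  \<open>v\<^sub>1, \<dots>, v\<^sub>N\<^sub>-\<^sub>1\<close> at \<open>x\<close> is positive iff \<open>det (v\<^sub>1, \<dots>, v\<^sub>N\<^sub>-\<^sub>1, x) > 0\<close>.

  A section of the spinor bundle of the quotient by \<open>G\<close>, associated with the spin structure \<open>\<tau>\<close>, is
  an equivariant map from the spin group to the spinor module that is invariant under \<open>\<tau> ` G\<close>.
  Such maps are extended by zero to the whole Clifford algebra, to be determined as functions.
\<close>
definition spinor_field ::
    "('n::{finite,linorder} \<Rightarrow> complex ^ 'k ^ 'k) \<Rightarrow> 'n rmatrix set
      \<Rightarrow> ('n rmatrix \<Rightarrow> 'n clifford) \<Rightarrow> ('n clifford \<Rightarrow> complex ^ 'k) \<Rightarrow> bool"
  where "spinor_field c G \<tau> f \<longleftrightarrow>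
    smooth_on_subset f (spin_group UNIV) \<and>
    (\<forall>g. g \<notin> spin_group UNIV \<longrightarrow> f g = 0) \<and>
    (\<forall>g\<in>spin_group UNIV. \<forall>h\<in>spin_group {v. v $ last_index = 0}.
      clifford_action c h *v f (g \<star> h) = f g) \<and>
    (\<forall>A\<in>G. \<forall>g\<in>spin_group UNIV. f (\<tau> A \<star> g) = f g)"

text \<open>
  The right factor in the horizontal lift of a geodesic.  The linear map \<open>\<Theta> (horizontal_step i t)\<close>
  sends \<open>e\<^sub>N\<close> to \<open>cos t e\<^sub>N + sin t e\<^sub>i\<close>, \<open>e\<^sub>i\<close> to \<open>cos t e\<^sub>i - sin t e\<^sub>N\<close>, and fixes the other basis vectors.
  Therefore the frames below \<open>g \<star> horizontal_step i t\<close> are based on the geodesic with initial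
  velocity \<open>\<Theta> g e\<^sub>i\<close>, and the derivative of each frame vector is normal to the sphere, i.e. they are
  parallel for the Levi-Civita connection.
\<close>
definition horizontal_step :: "'n::{finite,linorder} \<Rightarrow> real \<Rightarrow> 'n clifford"
  where "horizontal_step i t = cos (t / 2) *\<^sub>R clifford_one +
    sin (t / 2) *\<^sub>R (clifford_vec (axis last_index 1) \<star> clifford_vec (axis i 1))"

definition covariant_derivative ::
    "'n::{finite,linorder} \<Rightarrow> ('n clifford \<Rightarrow> complex ^ 'k) \<Rightarrow> 'n clifford \<Rightarrow> complex ^ 'k"
  where "covariant_derivative i f g =
    vector_derivative (\<lambda>t. f (g \<star> horizontal_step i t)) (at 0)"

definition dirac_operator ::
    "('n::{finite,linorder} \<Rightarrow> complex ^ 'k ^ 'k) \<Rightarrow> ('n clifford \<Rightarrow> complex ^ 'k)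
      \<Rightarrow> 'n clifford \<Rightarrow> complex ^ 'k"
  where "dirac_operator c f g =
    (if g \<in> spin_group UNIV
     then \<Sum>i \<in> UNIV - {last_index}. c i *v covariant_derivative i f g else 0)"

interpretation complex_fun: vector_space "\<lambda>(a::complex) (f :: 'a \<Rightarrow> complex ^ 'k) x. a *s f x"
  by unfold_locales
    (auto simp: fun_eq_iff vector_add_ldistrib vector_sadd_rdistrib vector_smult_assoc)

definition dirac_eigenspace ::
    "('n::{finite,linorder} \<Rightarrow> complex ^ 'k ^ 'k) \<Rightarrow> 'n rmatrix set
      \<Rightarrow> ('n rmatrix \<Rightarrow> 'n clifford) \<Rightarrow> complex \<Rightarrow> ('n clifford \<Rightarrow> complex ^ 'k) set"
  where "dirac_eigenspace c G \<tau> \<mu> =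
    {f. spinor_field c G \<tau> f \<and> dirac_operator c f = (\<lambda>g. \<mu> *s f g)}"

definition dirac_eigenvalue ::
    "('n::{finite,linorder} \<Rightarrow> complex ^ 'k ^ 'k) \<Rightarrow> 'n rmatrix set
      \<Rightarrow> ('n rmatrix \<Rightarrow> 'n clifford) \<Rightarrow> complex \<Rightarrow> bool"
  where "dirac_eigenvalue c G \<tau> \<mu> \<longleftrightarrow> (\<exists>f \<in> dirac_eigenspace c G \<tau> \<mu>. f \<noteq> (\<lambda>_. 0))"

text \<open>The Dirac operator of a closed manifold is elliptic, so its eigenspaces have finite dimension.\<close>
definition dirac_multiplicity ::
    "('n::{finite,linorder} \<Rightarrow> complex ^ 'k ^ 'k) \<Rightarrow> 'n rmatrix set
      \<Rightarrow> ('n rmatrix \<Rightarrow> 'n clifford) \<Rightarrow> complex \<Rightarrow> nat"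
  where "dirac_multiplicity c G \<tau> \<mu> = complex_fun.dim (dirac_eigenspace c G \<tau> \<mu>)"

definition dirac_isospectral ::
    "('n::{finite,linorder} \<Rightarrow> complex ^ 'k ^ 'k)
      \<Rightarrow> 'n rmatrix set \<Rightarrow> ('n rmatrix \<Rightarrow> 'n clifford)
      \<Rightarrow> 'n rmatrix set \<Rightarrow> ('n rmatrix \<Rightarrow> 'n clifford) \<Rightarrow> bool"
  where "dirac_isospectral c G \<tau> H \<sigma> \<longleftrightarrow>
    (\<forall>\<mu>. dirac_eigenvalue c G \<tau> \<mu> \<longleftrightarrow> dirac_eigenvalue c H \<sigma> \<mu>) \<and>
    (\<forall>\<mu>. dirac_multiplicity c G \<tau> \<mu> = dirac_multiplicity c H \<sigma> \<mu>)"

end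

theory Submission
 imports Defs
begin

text \<open>
 A spinor on the sphere becomes a spinor-valued function on \<open>\<real>\<^sup>8\<close> when the spinor bundle is trivialised by
 the constant spinors of \<open>\<real>\<^sup>8\<close>.  In this trivialisation the eigenspinors of the Dirac operator are, up to
 Clifford multiplication by the position vector, the homogeneous polynomial solutions of the Euclidean
 Dirac equation; they are complete by the Stone-Weierstrass theorem and the symmetry of the operator.
 The eigenspinors of a lens space are those commuting with the lift of the generator.  By the Fischer
 decomposition \<open>P = H + x Q\<close> their multiplicities are determined by the numbers of equivariant homogeneous
 polynomials, which count the weights \<open>n = 2 (\<alpha> - \<beta>) - \<epsilon>\<close> with \<open>r\<^sup>2\<close> dividing \<open>\<Sum> s\<^sub>j n\<^sub>j\<close>.  These counts
 agree for the two spaces by a character sum over the \<open>r\<close>-th roots of unity, in which the offsets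
 \<open>0, 1, 2, 4\<close> enter only through being distinct modulo every divisor of \<open>r\<close> other than \<open>1\<close> and \<open>3\<close>;
 the divisor \<open>3\<close> is settled by an explicit symmetry.  An isometry lifts to a linear map
 that intertwines the groups, and comparing eigenvalues gives the non-isometry.
\<close>

text \<open>All parameters are 1 modulo r. So \<open>r\<^sup>2\<close> divides
  \<open>\<Sum> s\<^sub>j n\<^sub>j\<close> exactly if r divides T = \<open>\<Sum> n\<^sub>j\<close>
  and also T / r + O for the first space, T / r - O for the second, where O is the sum of the
  \<open>n\<^sub>j\<close> multiplied by the offsets. Negating all weights turns T / r - O into O -
  T / r, so it remains to reverse the sign of T / r alone. For fixed \<epsilon>, T depends only on
  the degrees of \<alpha> and \<beta>, and a character of O summed over \<alpha> and \<beta> becomes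
  a product of two complete homogeneous functions, each of four r-th roots of unity. If the four
  roots are distinct, such a function has period r in its degree. A multiple of r can then be moved
  from one degree to the other, and this reverses T / r. The counts are compared for both half spin
  modules, because x in the Fischer decomposition exchanges them: the monogenic polynomials for one
  module are counted by subtracting polynomials with values in the other one. The bound 7 on r
  separates the sets of offsets in the proof of non-isometry.\<close>

abbreviation SpinG :: "'n::{finite,linorder} clifford set" where "SpinG \<equiv> spin_group UNIV"

abbreviation egen :: "'n::{finite,linorder} => 'n clifford" where "egen i \<equiv> clifford_vec (axis i 1)"

abbreviation "cts_sphere \<equiv> continuous_on (sphere 0 1)"

section \<open>Counting weights\<close>

definition compositions :: "nat => nat => nat list set"
 where "compositions n p = {\<alpha>. length \<alpha> = n \<and> sum_list \<alpha> = p}"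

lemma compositions_0: "compositions 0 p = (if p = 0 then {[]} else {})"
 by (auto simp: compositions_def)

lemma compositions_Suc: "compositions (Suc n) p = (\<Union>a\<le>p. (#) a ` compositions n (p - a))"
 by (force simp: compositions_def length_Suc_conv image_iff)

lemma finite_compositions [simp]: "finite (compositions n p)"
 by (induction n arbitrary: p) (auto simp: compositions_0 compositions_Suc)

fun complete_homogeneous :: "complex list => nat => complex"
 where
  "complete_homogeneous [] p = (if p = 0 then 1 else 0)"
 | "complete_homogeneous (y # ys) p = (\<Sum>a\<le>p. y ^ a * complete_homogeneous ys (p - a))"

lemma complete_homogeneous_eq_sum:
 "(\<Sum>\<alpha>\<in>compositions (length ys) p. \<Prod>i<length ys. ys ! i ^ (\<alpha> ! i)) = complete_homogeneous ys p"
proof (induction ys arbitrary: p)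
 case Nil
 thus ?case by (simp add: compositions_0)
next
 case (Cons y ys)
 have "(\<Sum>\<alpha>\<in>compositions (Suc (length ys)) p. \<Prod>i<Suc (length ys). (y # ys) ! i ^ (\<alpha> ! i))
   = (\<Sum>a\<le>p. \<Sum>\<alpha>\<in>(#) a ` compositions (length ys) (p - a).
     \<Prod>i<Suc (length ys). (y # ys) ! i ^ (\<alpha> ! i))"
  unfolding compositions_Suc by (rule sum.UNION_disjoint) auto
 also have "\<dots> = (\<Sum>a\<le>p. y ^ a * complete_homogeneous ys (p - a))"
  by (simp add: sum.reindex prod.lessThan_Suc_shift Cons.IH del: prod.lessThan_Suc flip: sum_distrib_left)
 finally show ?case by simp
qed

text \<open>Degrees are integers, with value zero below degree 0, so that the recurrence and the
  divided difference formula hold in every degree without boundary cases.\<close>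

definition hom_int :: "complex list => int => complex"
 where "hom_int ys p = (if p < 0 then 0 else complete_homogeneous ys (nat p))"

lemma hom_int_Cons: "hom_int (y # ys) (p + 1) = y * hom_int (y # ys) p + hom_int ys (p + 1)"
proof (cases "p \<ge> 0")
 case True
 then obtain n where p: "p = int n" using nonneg_int_cases by blast
 have "(\<Sum>a\<le>Suc n. y ^ a * complete_homogeneous ys (Suc n - a))
   = complete_homogeneous ys (Suc n) + y * (\<Sum>a\<le>n. y ^ a * complete_homogeneous ys (n - a))"
  by (subst sum.atMost_Suc_shift) (simp add: sum_distrib_left algebra_simps)
 moreover have "nat (int n + 1) = Suc n" by simp
 ultimately show ?thesis using p unfolding hom_int_def by simp
next
 case False
 then consider "p = -1" | "p < -1" by linarith
 thus ?thesis by cases (auto simp: hom_int_def)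
qed

text \<open>The divided difference formula: one more variable costs one degree. Upward induction
  from degree -1, using the recurrence in the first variable; below that every term
  vanishes.\<close>

lemma hom_int_difference:
 "(y - z) * hom_int (y # z # ys) p = hom_int (y # ys) (p + 1) - hom_int (z # ys) (p + 1)"
proof (cases "p \<ge> -1")
 case True
 thus ?thesis
 proof (induction p rule: int_ge_induct)
  case base
  show ?case using hom_int_Cons[of y ys "-1"] hom_int_Cons[of z ys "-1"] by (simp add: hom_int_def)
 next
  case (step p)
  have "(y - z) * hom_int (y # z # ys) (p + 1)
    = y * ((y - z) * hom_int (y # z # ys) p) + (y - z) * hom_int (z # ys) (p + 1)"
   by (subst hom_int_Cons) (simp add: algebra_simps)
  also have "\<dots> = y * hom_int (y # ys) (p + 1) - z * hom_int (z # ys) (p + 1)"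
   unfolding step.IH by (simp add: algebra_simps)
  also have "\<dots> = hom_int (y # ys) (p + 1 + 1) - hom_int (z # ys) (p + 1 + 1)"
   using hom_int_Cons[of y ys "p + 1"] hom_int_Cons[of z ys "p + 1"] by simp
  finally show ?case .
 qed
next
 case False
 thus ?thesis by (simp add: hom_int_def)
qed

lemma hom_int_singleton: "p \<ge> 0 ==> hom_int [y] p = y ^ nat p"
proof -
 assume "p \<ge> 0"
 have "(\<Sum>a\<le>n. y ^ a * (if n - a = 0 then 1 else 0)) = y ^ n" for n
 proof -
  have "(\<Sum>a\<le>n. y ^ a * (if n - a = 0 then 1 else 0)) = (\<Sum>a\<le>n. if a = n then y ^ n else 0)"
   by (rule sum.cong) auto
  thus ?thesis by simp
 qed
 thus ?thesis using \<open>p \<ge> 0\<close> by (simp add: hom_int_def)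
qed

text \<open>For a single root the function is \<open>y ^ p\<close>, periodic from degree 0 on. Each
  further variable divides a difference of periodic functions by the nonzero number
  \<open>y - z\<close> and lets the periodicity start one degree lower.\<close>

lemma hom_int_periodic:
 assumes "distinct (y # ys)" "\<And>z. z \<in> set (y # ys) ==> z ^ r = 1" "p \<ge> - int (length ys)"
 shows "hom_int (y # ys) (p + int r) = hom_int (y # ys) p"
 using assms
proof (induction ys arbitrary: y p)
 case Nil
 thus ?case by (simp add: hom_int_singleton nat_add_distrib power_add)
next
 case (Cons z ys)
 have "(y - z) * hom_int (y # z # ys) (p + int r)
   = hom_int (y # ys) ((p + 1) + int r) - hom_int (z # ys) ((p + 1) + int r)"
  by (subst hom_int_difference) (simp add: algebra_simps)
 also have "\<dots> = hom_int (y # ys) (p + 1) - hom_int (z # ys) (p + 1)"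
  using Cons.IH[of y "p + 1"] Cons.IH[of z "p + 1"] Cons.prems by auto
 also have "\<dots> = (y - z) * hom_int (y # z # ys) p"
  by (rule hom_int_difference[symmetric])
 finally show ?case using Cons.prems(1) by simp
qed

lemma hom_int_periodic_mult:
 assumes "length ys = 4" "distinct ys" "\<And>z. z \<in> set ys ==> z ^ r = 1" "p \<ge> -3"
 shows "hom_int ys (p + int r * int m) = hom_int ys p"
proof (induction m)
 case (Suc m)
 obtain y zs where ys: "ys = y # zs" "length zs = 3" using assms(1) by (cases ys) auto
 have "0 \<le> int r * int m" by simp
 hence "p + int r * int m \<ge> -3" using assms(4) by linarith
 hence "hom_int ys ((p + int r * int m) + int r) = hom_int ys (p + int r * int m)"
  unfolding ys(1) by (intro hom_int_periodic) (use assms ys in auto)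
 thus ?case using Suc by (simp add: algebra_simps)
qed auto

text \<open>The complete homogeneous functions of degrees \<open>-3, -2, -1\<close> vanish, so that the periodicity
 reaches far enough down to absorb the shift by \<open>\<bar>\<kappa>\<bar> \<le> 2\<close> coming from the spinor weights.\<close>
lemma hom_int_product_swap:
 assumes ys: "length ys = 4" "distinct ys" "\<And>z. z \<in> set ys ==> z ^ r = 1"
  and zs: "length zs = 4" "distinct zs" "\<And>z. z \<in> set zs ==> z ^ r = 1"
  and \<kappa>: "\<bar>p - p'\<bar> \<le> 2"
 shows "hom_int ys (p + int r * int m) * hom_int zs p' = hom_int ys p * hom_int zs (p' + int r * int m)"
proof -
 have per: "hom_int ys (p + int r * int m) = hom_int ys p" if "p \<ge> -3"
  by (rule hom_int_periodic_mult) (use ys that in auto)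
 have per': "hom_int zs (p' + int r * int m) = hom_int zs p'" if "p' \<ge> -3"
  by (rule hom_int_periodic_mult) (use zs that in auto)
 \<comment> \<open>If one degree is below -3, the other one is negative as well, and then each side
   has a factor of negative degree.\<close>
 consider "p \<ge> -3" "p' \<ge> -3" | "p < -3" "p' < 0" "p' \<ge> -3" | "p' < -3" "p < 0" "p \<ge> -3"
  | "p < -3" "p' < -3" using \<kappa> by linarith
 thus ?thesis
  by cases (use per per' in \<open>simp_all add: hom_int_def\<close>)
qed

section \<open>Weights of spinor valued polynomials\<close>

definition spin_signs :: "int => int list set"
 where "spin_signs \<eta> = {\<epsilon>. length \<epsilon> = 4 \<and> set \<epsilon> \<subseteq> {1, -1} \<and> prod_list \<epsilon> = \<eta>}"

lemma finite_spin_signs [simp]: "finite (spin_signs \<eta>)"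
 by (rule finite_subset[OF _ finite_lists_length_eq[of "{1, -1}" 4]]) (auto simp: spin_signs_def)

text \<open>Indices of a basis of weight vectors in degree \<open>K\<close>: \<alpha> and \<beta>
  are the exponents of the complex coordinates and of their conjugates, and \<epsilon> is a weight
  of the half spin module on which the volume element acts as \<eta>. The weights of that module are
  the sign vectors with product \<eta>.\<close>

definition weight_index :: "nat => int => ((nat list \<times> nat list) \<times> int list) set"
 where "weight_index K \<eta> =
  {(\<alpha>, \<beta>). length \<alpha> = 4 \<and> length \<beta> = 4 \<and> sum_list \<alpha> + sum_list \<beta> = K} \<times> spin_signs \<eta>"

text \<open>The weight for the torus of the spin group, doubled to make it an integer. The spinor
  part enters negatively, because equivariance compares the action on the argument with the action
  on the value.\<close>

definition weight :: "(nat list \<times> nat list) \<times> int list => nat => int"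
 where "weight = (\<lambda>((\<alpha>, \<beta>), \<epsilon>) j. 2 * (int (\<alpha> ! j) - int (\<beta> ! j)) - \<epsilon> ! j)"

lemma bidegree_eq:
 "{(\<alpha>, \<beta>). length \<alpha> = 4 \<and> length \<beta> = 4 \<and> sum_list \<alpha> + sum_list \<beta> = K}
  = (\<Union>p\<le>K. compositions 4 p \<times> compositions 4 (K - p))"
 by (force simp: compositions_def)

lemma finite_weight_index [simp]: "finite (weight_index K \<eta>)"
 unfolding weight_index_def bidegree_eq by simp

section \<open>Characters of the cyclic group of order r\<close>

definition unity :: "nat => int => complex"
 where "unity r x = cis (2 * pi * real_of_int x / real r)"

lemma unity_add: "unity r (x + y) = unity r x * unity r y"
 by (simp add: unity_def cis_mult add_divide_distrib ring_distribs)

lemma unity_0 [simp]: "unity r 0 = 1"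
 by (simp add: unity_def)

lemma unity_nonzero [simp]: "unity r x \<noteq> 0"
 by (simp add: unity_def)

lemma unity_mult_nat: "unity r (int n * x) = unity r x ^ n"
 by (induction n) (simp_all add: unity_add ring_distribs)

lemma unity_eq_1_iff: "r > 0 ==> unity r x = 1 \<longleftrightarrow> int r dvd x"
proof
 assume r: "r > 0" and "unity r x = 1"
 hence "cos (2 * pi * real_of_int x / real r) = 1"
  by (simp add: unity_def complex_eq_iff)
 then obtain n :: int where "2 * pi * real_of_int x / real r = real_of_int n * 2 * pi"
  using cos_one_2pi_int by blast
 hence "real_of_int x = real_of_int (n * int r)"
  using r by (simp add: field_simps)
 hence "x = n * int r" by linarith
 thus "int r dvd x" by simp
next
 assume "r > 0" "int r dvd x"
 then obtain n where "x = int r * n" by blast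
 with \<open>r > 0\<close> have "2 * pi * real_of_int x / real r = 2 * pi * real_of_int n"
  by simp
 hence "unity r x = cis (2 * pi * real_of_int n)"
  by (simp only: unity_def)
 also have "\<dots> = 1" by (rule cis_multiple_2pi) simp
 finally show "unity r x = 1" .
qed

lemma unity_power_self: "r > 0 ==> unity r x ^ r = 1"
 by (simp add: unity_eq_1_iff flip: unity_mult_nat)

lemma unity_cong: "r > 0 ==> int r dvd x - y ==> unity r x = unity r y"
 using unity_add[of r "x - y" y] unity_eq_1_iff[of r "x - y"] by simp

lemma unity_eq_iff: "r > 0 ==> unity r x = unity r y \<longleftrightarrow> int r dvd x - y"
 using unity_add[of r "x - y" y] unity_eq_1_iff[of r "x - y"] by auto

lemma sum_unity:
 assumes "r > 0"
 shows "(\<Sum>t<r. unity r (int t * x)) = (if int r dvd x then of_nat r else 0)"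
proof (cases "int r dvd x")
 case True
 hence "unity r x = 1" using assms by (simp add: unity_eq_1_iff)
 thus ?thesis using True by (simp add: unity_mult_nat)
next
 case False
 hence "unity r x \<noteq> 1" using assms by (simp add: unity_eq_1_iff)
 thus ?thesis
  using False assms by (simp add: unity_mult_nat geometric_sum unity_power_self)
qed

text \<open>The parameters of the two spaces are 1 + a r and 1 - a r for these a. Up to sign, the
  differences of the offsets are 1, 2 and 4, which are invertible modulo an odd r, and 3.\<close>

definition lens_offset :: "nat => int"
 where "lens_offset j = [0, 1, 2, 4] ! j"

definition total_weight :: "(nat list \<times> nat list) \<times> int list => int"
 where "total_weight i = (\<Sum>j<4. weight i j)"

definition offset_weight :: "(nat list \<times> nat list) \<times> int list => int"
 where "offset_weight i = (\<Sum>j<4. lens_offset j * weight i j)"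

text \<open>One term of the character sum. Once r divides the total weight, divisibility of
  \<open>total_weight i + r \<sigma> offset_weight i\<close> by the square of r means that r divides
  \<open>total_weight i div r + \<sigma> offset_weight i\<close>, which is detected by summing over
  t.\<close>

definition weight_sum :: "nat => nat => int => int => int => complex"
 where "weight_sum r K \<eta> t \<sigma> = (\<Sum>i\<in>{i \<in> weight_index K \<eta>. int r dvd total_weight i}.
  unity r (t * (total_weight i div int r + \<sigma> * offset_weight i)))"

lemma sum_lessThan_4: "(\<Sum>j<4. f j) = f 0 + f 1 + f 2 + f (3::nat)"
 by (simp add: eval_nat_numeral)

lemma prod_lessThan_4: "(\<Prod>j<4. f j) = f 0 * f 1 * f 2 * f (3::nat)"
 by (simp add: eval_nat_numeral)

lemma length_4_cases:
 assumes "length xs = 4"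
 obtains a b c d where "xs = [a, b, c, d]"
 using assms by (auto simp: eval_nat_numeral length_Suc_conv)

lemma sum_list_4: "length xs = 4 ==> sum_list xs = (\<Sum>j<4. xs ! j)"
 by (erule length_4_cases) (simp add: sum_lessThan_4 add.assoc)

text \<open>Negating all weights, by exchanging \<alpha> with \<beta> and negating \<epsilon>, keeps
  the product of the four signs. It moves the minus sign from the offset part to the quotient, which
  depends only on the two degrees and \<epsilon>.\<close>

lemma weight_sum_neg:
 "weight_sum r K \<eta> t (-1) = (\<Sum>i\<in>{i \<in> weight_index K \<eta>. int r dvd total_weight i}.
  unity r (t * (- (total_weight i div int r) + offset_weight i)))"
proof -
 let ?f = "\<lambda>((\<alpha>, \<beta>), \<epsilon>). ((\<beta>, \<alpha>), map uminus \<epsilon>)"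
 let ?I = "{i \<in> weight_index K \<eta>. int r dvd total_weight i}"
 have neg: "weight (?f i) j = - weight i j" if "i \<in> weight_index K \<eta>" "j < 4" for i j
  using that by (auto simp: weight_def weight_index_def spin_signs_def)

 have tot: "total_weight (?f i) = - total_weight i" "offset_weight (?f i) = - offset_weight i"
  if "i \<in> weight_index K \<eta>" for i
  using neg[OF that] by (simp_all add: total_weight_def offset_weight_def sum_negf cong: sum.cong_simp)
 have prod: "prod_list (map uminus \<epsilon>) = prod_list \<epsilon>" if "length \<epsilon> = 4" for \<epsilon> :: "int list"
  using that by (rule length_4_cases) simp
 have mem: "?f i \<in> weight_index K \<eta>" if "i \<in> weight_index K \<eta>" for i
  using that prod unfolding weight_index_def spin_signs_def by (auto, blast+)
 have inv: "?f (?f i) = i" for i :: "(nat list \<times> nat list) \<times> int list"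
  by (auto simp: o_def split: prod.splits)
 have memI: "?f i \<in> ?I" if "i \<in> ?I" for i
 proof -
  from that have i: "i \<in> weight_index K \<eta>" "int r dvd total_weight i" by auto
  show ?thesis using mem[OF i(1)] tot(1)[OF i(1)] i(2) by simp
 qed
 show ?thesis unfolding weight_sum_def
 proof (rule sum.reindex_bij_witness[where i = ?f and j = ?f])
  fix i assume i: "i \<in> ?I"
  hence d: "int r dvd total_weight i" and m: "i \<in> weight_index K \<eta>" by auto
  from d have "(- total_weight i) div int r = - (total_weight i div int r)"
   by (simp add: dvd_neg_div)
  thus "unity r (t * (- (total_weight (?f i) div int r) + offset_weight (?f i)))
   = unity r (t * (total_weight i div int r + - 1 * offset_weight i))"
   using tot[OF m] by simp
 qed (use inv memI in blast)+
qed

text \<open>For r dividing 3 t only the offsets modulo 3 matter. Exchanging the planes 0 and 2 turns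
  the offsets 0, 1, 2, 4 into 2, 1, 0, 4, which is the map from a to 2 - a modulo 3. So the offset
  weight is replaced by its negative plus twice the total weight, and the latter is divisible by
  r.\<close>

lemma weight_sum_cube:
 assumes r: "r > 0" and t: "int r dvd 3 * t"
 shows "weight_sum r K \<eta> t 1 = weight_sum r K \<eta> t (-1)"
proof -
 let ?s = "\<lambda>xs. [xs ! 2, xs ! 1, xs ! 0, xs ! (3::nat)]"
 let ?f = "\<lambda>((\<alpha>, \<beta>), \<epsilon>). ((?s \<alpha>, ?s \<beta>), ?s \<epsilon>)"
 let ?I = "{i \<in> weight_index K \<eta>. int r dvd total_weight i}"
 have mem: "?f i \<in> weight_index K \<eta>" and inv: "?f (?f i) = i"
  and tot: "total_weight (?f i) = total_weight i"
  and off: "3 dvd - offset_weight i - offset_weight (?f i) - total_weight i"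
  if "i \<in> weight_index K \<eta>" for i
 proof -
  obtain \<alpha> \<beta> \<epsilon> where i: "i = ((\<alpha>, \<beta>), \<epsilon>)" by (metis prod.exhaust)
  with that have len: "length \<alpha> = 4" "length \<beta> = 4" "length \<epsilon> = 4"
   by (auto simp: weight_index_def spin_signs_def)
  obtain a0 a1 a2 a3 where a: "\<alpha> = [a0, a1, a2, a3]" using length_4_cases[OF len(1)] .
  obtain b0 b1 b2 b3 where b: "\<beta> = [b0, b1, b2, b3]" using length_4_cases[OF len(2)] .
  obtain e0 e1 e2 e3 where e: "\<epsilon> = [e0, e1, e2, e3]" using length_4_cases[OF len(3)] .
  show "?f i \<in> weight_index K \<eta>"
   using that unfolding i a b e by (auto simp: weight_index_def spin_signs_def algebra_simps)
  show "?f (?f i) = i" unfolding i a b e by simp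
  show "total_weight (?f i) = total_weight i"
   unfolding i a b e by (simp add: total_weight_def sum_lessThan_4 weight_def)
  show "3 dvd - offset_weight i - offset_weight (?f i) - total_weight i"
   unfolding i a b e
   by (simp add: offset_weight_def total_weight_def sum_lessThan_4 weight_def lens_offset_def)
 qed
 have distribute: "t * (- x - y - z) + t * z = t * (w + - 1 * y) - t * (w + 1 * x)" for x y z w
  by (simp add: algebra_simps)
 show ?thesis unfolding weight_sum_def
 proof (rule sum.reindex_bij_witness[where i = ?f and j = ?f])
  fix i assume i: "i \<in> ?I"
  hence d: "int r dvd total_weight i" and m: "i \<in> weight_index K \<eta>" by auto
  have "int r dvd 3 * t * ((- offset_weight i - offset_weight (?f i) - total_weight i) div 3)"
   using t by (rule dvd_mult2)
  moreover have "3 * t * (x div 3) = t * x" if "3 dvd x" for x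
   using that by auto
  note this[OF off[OF m]]
  ultimately have "int r dvd t * (- offset_weight i - offset_weight (?f i) - total_weight i)"
   by (simp only:)
  moreover have "int r dvd t * total_weight i" using d by simp
  ultimately have "int r dvd t * (- offset_weight i - offset_weight (?f i) - total_weight i) + t * total_weight i"
   by (rule dvd_add)
  hence "int r dvd t * (total_weight i div int r + - 1 * offset_weight (?f i))
    - t * (total_weight i div int r + 1 * offset_weight i)"
   using distribute[of "offset_weight i" "offset_weight (?f i)" "total_weight i" "total_weight i div int r"]
   by (simp only:)
  hence "unity r (t * (total_weight i div int r + - 1 * offset_weight (?f i)))
    = unity r (t * (total_weight i div int r + 1 * offset_weight i))"
   by (rule unity_cong[OF r])
  thus "unity r (t * (total_weight (?f i) div int r + - 1 * offset_weight (?f i)))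
   = unity r (t * (total_weight i div int r + 1 * offset_weight i))"
   unfolding tot[OF m] .
 qed (use inv mem tot in auto)
qed

text \<open>Grouped by the degree p of \<alpha>, the sum over exponents factors into complete
  homogeneous functions of \<open>Y\<close> and \<open>Z\<close> in the degrees p and
  \<open>K - p\<close>, while the total weight depends on p alone. Reversing the quotient is then
  the symmetry of \<open>G \<kappa> m\<close> in m, which follows from periodicity.\<close>

lemma weight_sum_generic:
 assumes r: "odd r" and t: "\<not> int r dvd 3 * t"
 shows "weight_sum r K \<eta> t 1 = weight_sum r K \<eta> t (-1)"
proof -
 have r0: "r > 0" using r by (cases r) auto
 \<comment> \<open>The factors by which the character changes when an exponent in \<alpha>,
   respectively in \<beta>, grows by one.\<close>
 define Y where "Y = map (\<lambda>j. unity r (2 * t * lens_offset j)) [0..<4]"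
 define Z where "Z = map (\<lambda>j. unity r (- (2 * t * lens_offset j))) [0..<4]"
 have len: "length Y = 4" "length Z = 4" by (simp_all add: Y_def Z_def)
 have root: "z ^ r = 1" if "z \<in> set Y \<or> z \<in> set Z" for z
  using that r0 by (auto simp: Y_def Z_def unity_power_self)
 have cop: "coprime (int r) 2" using r by simp
 \<comment> \<open>All differences of offsets occur among these d. Powers of two cancel because r is
   odd, which leaves t itself or the excluded 3 t.\<close>
 have nd: "\<not> int r dvd 2 * t * d" if "d \<in> {1, 2, 3, 4, -1, -2, -3, -4}" for d
 proof
  assume a: "int r dvd 2 * t * d"
  hence "int r dvd 2 * (t * d)" by (simp add: mult.assoc)
  hence b: "int r dvd t * d" using cop coprime_dvd_mult_right_iff by blast
  hence c: "int r dvd 2 * (t * (d div 2))" if "even d" using that by (auto elim!: evenE simp: algebra_simps)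
  hence c: "int r dvd t * (d div 2)" if "even d" using that cop coprime_dvd_mult_right_iff by blast
  hence c': "int r dvd t * (d div 2 div 2)" if "even d" "even (d div 2)"
   using that cop coprime_dvd_mult_right_iff[of "int r" 2 "t * (d div 2 div 2)"]
   by (metis dvd_mult_div_cancel mult.left_commute)
  have "int r dvd t \<or> int r dvd 3 * t"
   using that b c c' by (auto simp: algebra_simps)
  thus False using t by auto
 qed
 have dist: "distinct Y" "distinct Z"
  using nd[of 1] nd[of 2] nd[of 3] nd[of 4]
  by (simp_all add: Y_def Z_def lens_offset_def upt_rec unity_eq_iff[OF r0] unity_eq_1_iff[OF r0]
    eval_nat_numeral mult.commute)
 \<comment> \<open>The bidegrees whose half total weight is r m. The condition determines p, so that
   the sum has at most one term, and \<open>hom_int\<close> supplies zero when p falls outside the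
   range.\<close>
 define G where "G \<kappa> m = (\<Sum>p\<le>K. if 2 * int p - int K - \<kappa> = int r * m
   then complete_homogeneous Y p * complete_homogeneous Z (K - p) else 0)" for \<kappa> m
 have G: "G \<kappa> m = (if even (int K + \<kappa> + int r * m)
   then hom_int Y ((int K + \<kappa> + int r * m) div 2) * hom_int Z (int K - (int K + \<kappa> + int r * m) div 2) else 0)"
  for \<kappa> m
 proof (cases "even (int K + \<kappa> + int r * m)")
  case True
  define P where "P = (int K + \<kappa> + int r * m) div 2"
  have P: "2 * P = int K + \<kappa> + int r * m" using True by (simp add: P_def)
  have "G \<kappa> m = (\<Sum>p\<le>K. if int p = P then complete_homogeneous Y p * complete_homogeneous Z (K - p) else 0)"
   unfolding G_def using P by (intro sum.cong if_cong) auto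
  also have "\<dots> = hom_int Y P * hom_int Z (int K - P)"
  proof (cases "0 \<le> P \<and> P \<le> int K")
   case True
   then obtain n where n: "P = int n" using nonneg_int_cases by blast
   with True have "n \<le> K" by simp
   with n show ?thesis by (simp add: hom_int_def nat_diff_distrib')
  next
   case False
   hence "(\<Sum>p\<le>K. if int p = P then complete_homogeneous Y p * complete_homogeneous Z (K - p) else 0) = 0"
    by (intro sum.neutral) auto
   moreover from False have "P < 0 \<or> int K - P < 0" by auto
   hence "hom_int Y P * hom_int Z (int K - P) = 0" by (auto simp: hom_int_def)
   ultimately show ?thesis by simp
  qed
  finally show ?thesis using True by (simp add: P_def)
 next
  case False
  have "2 * int p - int K - \<kappa> \<noteq> int r * m" for p
  proof
   assume "2 * int p - int K - \<kappa> = int r * m"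
   hence "int K + \<kappa> + int r * m = 2 * int p" by linarith
   with False show False by simp
  qed
  hence "G \<kappa> m = 0" unfolding G_def by (simp only: if_False sum.neutral_const)
  with False show ?thesis by (simp only: if_False)
 qed
 have Gsym_nat: "G \<kappa> (int n) = G \<kappa> (- int n)" if \<kappa>: "\<bar>\<kappa>\<bar> \<le> 2" for \<kappa> n
 proof (cases "even (int K + \<kappa> + int r * int n)")
  case True
  define P where "P = (int K + \<kappa> + int r * - int n) div 2"
  have ev: "even (int K + \<kappa> + int r * - int n)" using True by simp
  have P: "2 * P = int K + \<kappa> - int r * int n" using ev by (simp add: P_def)
  have P': "(int K + \<kappa> + int r * int n) div 2 = P + int r * int n" using P by linarith
  \<comment> \<open>The difference of the two degrees is exactly \<kappa>, because 2 P + r n = K +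
    \<kappa>.\<close>
  have "\<bar>P - (int K - (P + int r * int n))\<bar> \<le> 2" using P \<kappa> by linarith
  from hom_int_product_swap[OF len(1) dist(1) _ len(2) dist(2) _ this, of r n] root
  have "hom_int Y (P + int r * int n) * hom_int Z (int K - (P + int r * int n))
    = hom_int Y P * hom_int Z (int K - (P + int r * int n) + int r * int n)" by blast
  thus ?thesis unfolding G P' using True ev by (simp add: P_def)
 next
  case False
  hence "odd (int K + \<kappa> + int r * - int n)" by simp
  with False show ?thesis unfolding G by (simp only: if_False)
 qed
 have Gsym: "G \<kappa> m = G \<kappa> (- m)" if "\<bar>\<kappa>\<bar> \<le> 2" for \<kappa> m
  using Gsym_nat[OF that, of "nat \<bar>m\<bar>"] by (cases "m \<ge> 0") auto
 \<comment> \<open>A bound for the half total weight 2 p - K - \<kappa>, hence for its quotient by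
   r; the quotients thus range over a symmetric interval.\<close>
 define B where "B = int K + 2"
 define T where "T \<epsilon> s = (\<Sum>ab\<in>{(\<alpha>, \<beta>). length \<alpha> = 4 \<and> length \<beta> = 4 \<and> sum_list \<alpha> + sum_list \<beta> = K}.
   if int r dvd total_weight (ab, \<epsilon>)
   then unity r (t * (s * (total_weight (ab, \<epsilon>) div int r) + offset_weight (ab, \<epsilon>))) else 0)" for \<epsilon> s
 have ws: "(\<Sum>i\<in>{i \<in> weight_index K \<eta>. int r dvd total_weight i}.
   unity r (t * (s * (total_weight i div int r) + offset_weight i))) = (\<Sum>\<epsilon>\<in>spin_signs \<eta>. T \<epsilon> s)" for s
  unfolding T_def sum.inter_filter[OF finite_weight_index] unfolding weight_index_def
  by (subst sum.swap) (simp add: sum.cartesian_product split_def cong: if_cong)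
 have T: "T \<epsilon> s = unity r (- t * (\<Sum>j<4. lens_offset j * \<epsilon> ! j)) * (\<Sum>m=-B..B. unity r (2 * t * s * m) * G \<kappa> m)"
  if \<epsilon>: "\<epsilon> \<in> spin_signs \<eta>" and \<kappa>: "sum_list \<epsilon> = 2 * \<kappa>" "\<bar>\<kappa>\<bar> \<le> 2" for \<epsilon> \<kappa> s
 proof -
  let ?C = "unity r (- t * (\<Sum>j<4. lens_offset j * \<epsilon> ! j))"
  \<comment> \<open>Half of the total weight; it is an integer because four signs have an even sum 2
    \<kappa>.\<close>
  define x where "x p = 2 * int p - int K - \<kappa>" for p
  have len\<epsilon>: "length \<epsilon> = 4" using \<epsilon> by (simp add: spin_signs_def)
  have term_eq: "(if int r dvd total_weight ((\<alpha>, \<beta>), \<epsilon>)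
    then unity r (t * (s * (total_weight ((\<alpha>, \<beta>), \<epsilon>) div int r) + offset_weight ((\<alpha>, \<beta>), \<epsilon>))) else 0)
    = ?C * (if int r dvd x p then unity r (2 * t * s * (x p div int r)) else 0)
     * ((\<Prod>i<4. Y ! i ^ (\<alpha> ! i)) * (\<Prod>i<4. Z ! i ^ (\<beta> ! i)))"
   if "p \<le> K" "\<alpha> \<in> compositions 4 p" "\<beta> \<in> compositions 4 (K - p)" for \<alpha> \<beta> p
  proof -
   have l: "length \<alpha> = 4" "length \<beta> = 4" "sum_list \<alpha> = p" "sum_list \<beta> = K - p"
    using that by (auto simp: compositions_def)
   have "total_weight ((\<alpha>, \<beta>), \<epsilon>) = 2 * (int (sum_list \<alpha>) - int (sum_list \<beta>)) - sum_list \<epsilon>"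
    using l len\<epsilon> by (simp add: total_weight_def weight_def sum_list_4 sum_lessThan_4)
   hence tot: "total_weight ((\<alpha>, \<beta>), \<epsilon>) = 2 * x p"
    using l \<open>p \<le> K\<close> \<kappa> by (simp add: x_def of_nat_diff)
   have dvd: "int r dvd 2 * x p \<longleftrightarrow> int r dvd x p"
    using cop coprime_dvd_mult_right_iff by blast
   have dv: "2 * x p div int r = 2 * (x p div int r)" if "int r dvd x p"
    using that by (simp add: div_mult_swap)
   have off: "t * offset_weight ((\<alpha>, \<beta>), \<epsilon>) = - t * (\<Sum>j<4. lens_offset j * \<epsilon> ! j)
     + (int (\<alpha> ! 0) * (2 * t * lens_offset 0) + int (\<alpha> ! 1) * (2 * t * lens_offset 1)
     + int (\<alpha> ! 2) * (2 * t * lens_offset 2) + int (\<alpha> ! 3) * (2 * t * lens_offset 3))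
     + (int (\<beta> ! 0) * (- (2 * t * lens_offset 0)) + int (\<beta> ! 1) * (- (2 * t * lens_offset 1))
     + int (\<beta> ! 2) * (- (2 * t * lens_offset 2)) + int (\<beta> ! 3) * (- (2 * t * lens_offset 3)))"
    by (simp add: offset_weight_def weight_def sum_lessThan_4 algebra_simps)
   have "unity r (t * offset_weight ((\<alpha>, \<beta>), \<epsilon>))
    = ?C * ((\<Prod>i<4. Y ! i ^ (\<alpha> ! i)) * (\<Prod>i<4. Z ! i ^ (\<beta> ! i)))"
    unfolding off unity_add unity_mult_nat prod_lessThan_4 by (simp add: Y_def Z_def numeral_2_eq_2)
   thus ?thesis
    unfolding tot dvd using dv by (simp add: distrib_left unity_add mult_ac)
  qed
  have "T \<epsilon> s = (\<Sum>p\<le>K. \<Sum>ab\<in>compositions 4 p \<times> compositions 4 (K - p).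
    if int r dvd total_weight (ab, \<epsilon>)
    then unity r (t * (s * (total_weight (ab, \<epsilon>) div int r) + offset_weight (ab, \<epsilon>))) else 0)"
   unfolding T_def bidegree_eq by (rule sum.UNION_disjoint) (simp, simp, auto simp: compositions_def)
  also have "\<dots> = (\<Sum>p\<le>K. \<Sum>\<alpha>\<in>compositions 4 p. \<Sum>\<beta>\<in>compositions 4 (K - p).
    ?C * (if int r dvd x p then unity r (2 * t * s * (x p div int r)) else 0)
     * ((\<Prod>i<4. Y ! i ^ (\<alpha> ! i)) * (\<Prod>i<4. Z ! i ^ (\<beta> ! i))))"
  proof (rule sum.cong[OF refl])
   fix p assume "p \<in> {..K}"
   hence "p \<le> K" by simp
   show "(\<Sum>ab\<in>compositions 4 p \<times> compositions 4 (K - p).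
    if int r dvd total_weight (ab, \<epsilon>)
    then unity r (t * (s * (total_weight (ab, \<epsilon>) div int r) + offset_weight (ab, \<epsilon>))) else 0)
    = (\<Sum>\<alpha>\<in>compositions 4 p. \<Sum>\<beta>\<in>compositions 4 (K - p).
    ?C * (if int r dvd x p then unity r (2 * t * s * (x p div int r)) else 0)
     * ((\<Prod>i<4. Y ! i ^ (\<alpha> ! i)) * (\<Prod>i<4. Z ! i ^ (\<beta> ! i))))"
    unfolding sum.cartesian_product
   proof (rule sum.cong[OF refl], clarify)
    fix \<alpha> \<beta> assume "\<alpha> \<in> compositions 4 p" "\<beta> \<in> compositions 4 (K - p)"
    from term_eq[OF \<open>p \<le> K\<close> this]
    show "(if int r dvd total_weight ((\<alpha>, \<beta>), \<epsilon>)
     then unity r (t * (s * (total_weight ((\<alpha>, \<beta>), \<epsilon>) div int r) + offset_weight ((\<alpha>, \<beta>), \<epsilon>))) else 0)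
     = ?C * (if int r dvd x p then unity r (2 * t * s * (x p div int r)) else 0)
     * ((\<Prod>i<4. Y ! i ^ (\<alpha> ! i)) * (\<Prod>i<4. Z ! i ^ (\<beta> ! i)))" .
   qed
  qed
  also have "\<dots> = (\<Sum>p\<le>K. ?C * (if int r dvd x p then unity r (2 * t * s * (x p div int r)) else 0)
    * (complete_homogeneous Y p * complete_homogeneous Z (K - p)))"
   using complete_homogeneous_eq_sum[of Y] complete_homogeneous_eq_sum[of Z] len
   by (simp flip: sum_distrib_left sum_distrib_right)
  also have "\<dots> = ?C * (\<Sum>p\<le>K. \<Sum>m=-B..B. if x p = int r * m then unity r (2 * t * s * m)
    * (complete_homogeneous Y p * complete_homogeneous Z (K - p)) else 0)"
  proof -
   have "(if int r dvd x p then unity r (2 * t * s * (x p div int r)) else 0)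
    * (complete_homogeneous Y p * complete_homogeneous Z (K - p))
    = (\<Sum>m=-B..B. if x p = int r * m then unity r (2 * t * s * m)
     * (complete_homogeneous Y p * complete_homogeneous Z (K - p)) else 0)" if "p \<le> K" for p
   proof (cases "int r dvd x p")
    case True
    then obtain m where m: "x p = int r * m" by blast
    have "\<bar>x p\<bar> \<le> B" using that \<kappa>(2) unfolding x_def B_def by linarith
    hence "int r * \<bar>m\<bar> \<le> B" unfolding m by (simp add: abs_mult)
    moreover have "\<bar>m\<bar> \<le> int r * \<bar>m\<bar>" using r0 by (simp add: mult_le_cancel_right1)
    ultimately have "m \<in> {-B..B}" by auto
    thus ?thesis using m r0 by simp
   next
    case False
    hence "x p \<noteq> int r * m" for m by auto
    with False show ?thesis by simp
   qed
   note expand = this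
   show ?thesis
    by (subst sum_distrib_left, intro sum.cong refl, subst mult.assoc, rule arg_cong[where f = "(*) ?C"],
      rule expand, simp)
  qed
  also have "(\<Sum>p\<le>K. \<Sum>m=-B..B. if x p = int r * m then unity r (2 * t * s * m)
    * (complete_homogeneous Y p * complete_homogeneous Z (K - p)) else 0)
    = (\<Sum>m=-B..B. unity r (2 * t * s * m) * G \<kappa> m)"
   unfolding G_def x_def sum_distrib_left by (subst sum.swap) (intro sum.cong refl, simp)
  finally show ?thesis .
 qed
 have "T \<epsilon> 1 = T \<epsilon> (-1)" if \<epsilon>: "\<epsilon> \<in> spin_signs \<eta>" for \<epsilon>
 proof -
  have len\<epsilon>: "length \<epsilon> = 4" "set \<epsilon> \<subseteq> {1, -1}" using \<epsilon> by (auto simp: spin_signs_def)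
  obtain e0 e1 e2 e3 where "\<epsilon> = [e0, e1, e2, e3]" using length_4_cases[OF len\<epsilon>(1)] .
  hence "even (sum_list \<epsilon>)" "\<bar>sum_list \<epsilon>\<bar> \<le> 4" using len\<epsilon>(2) by auto
  then obtain \<kappa> where \<kappa>: "sum_list \<epsilon> = 2 * \<kappa>" "\<bar>\<kappa>\<bar> \<le> 2" by (auto elim!: evenE)
  have "(\<Sum>m=-B..B. unity r (2 * t * 1 * m) * G \<kappa> m) = (\<Sum>m=-B..B. unity r (2 * t * -1 * m) * G \<kappa> m)"
   by (rule sum.reindex_bij_witness[where i = uminus and j = uminus])
    (simp_all flip: Gsym[OF \<kappa>(2)])
  thus ?thesis unfolding T[OF \<epsilon> \<kappa>] by simp
 qed
 hence "(\<Sum>\<epsilon>\<in>spin_signs \<eta>. T \<epsilon> 1) = (\<Sum>\<epsilon>\<in>spin_signs \<eta>. T \<epsilon> (-1))"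
  by (rule sum.cong[OF refl])
 thus ?thesis
  unfolding weight_sum_neg using ws[of 1] ws[of "-1"] by (simp add: weight_sum_def)
qed

text \<open>Orthogonality of characters expresses r times each count as the sum of
  \<open>weight_sum\<close> over t. The terms agree one by one: those with r dividing 3 t by the
  exchange of planes, the others by periodicity.\<close>

theorem card_lens_weights:
 assumes r: "odd r"
 shows "card {i \<in> weight_index K \<eta>. int (r\<^sup>2) dvd (\<Sum>j<4. (1 + lens_offset j * int r) * weight i j)}
  = card {i \<in> weight_index K \<eta>. int (r\<^sup>2) dvd (\<Sum>j<4. (1 - lens_offset j * int r) * weight i j)}"
proof -
 have r0: "r > 0" using r by (cases r) auto
 have main: "of_nat r * of_nat (card {i \<in> weight_index K \<eta>. int (r\<^sup>2) dvd (\<Sum>j<4. (1 + \<sigma> * lens_offset j * int r) * weight i j)})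
   = (\<Sum>t<r. weight_sum r K \<eta> (int t) \<sigma>)" for \<sigma>
 proof -
  have split: "(\<Sum>j<4. (1 + \<sigma> * lens_offset j * int r) * weight i j)
    = total_weight i + int r * (\<sigma> * offset_weight i)" for i
   by (simp add: total_weight_def offset_weight_def sum_lessThan_4 algebra_simps)
  have dvd: "int (r\<^sup>2) dvd total_weight i + int r * (\<sigma> * offset_weight i) \<longleftrightarrow>
    int r dvd total_weight i \<and> int r dvd total_weight i div int r + \<sigma> * offset_weight i" for i
  proof (cases "int r dvd total_weight i")
   case True
   then obtain m where m: "total_weight i = int r * m" by blast
   have "int (r\<^sup>2) dvd int r * (m + \<sigma> * offset_weight i) \<longleftrightarrow> int r dvd m + \<sigma> * offset_weight i"
    using r0 by (simp add: power2_eq_square)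
   thus ?thesis using True r0 by (simp add: m distrib_left)
  next
   case False
   have "int r dvd total_weight i" if "int (r\<^sup>2) dvd total_weight i + int r * (\<sigma> * offset_weight i)"
   proof -
    have "int r dvd total_weight i + int r * (\<sigma> * offset_weight i)"
     using that by (rule dvd_trans[rotated]) (simp add: power2_eq_square)
    thus ?thesis by (simp add: dvd_add_left_iff)
   qed
   with False show ?thesis by blast
  qed
  have "(\<Sum>t<r. weight_sum r K \<eta> (int t) \<sigma>)
   = (\<Sum>i\<in>{i \<in> weight_index K \<eta>. int r dvd total_weight i}.
     if int r dvd total_weight i div int r + \<sigma> * offset_weight i then of_nat r else 0)"
   unfolding weight_sum_def by (subst sum.swap) (simp add: sum_unity[OF r0])
  also have "\<dots> = (\<Sum>i\<in>{i \<in> weight_index K \<eta>. int (r\<^sup>2) dvd total_weight i + int r * (\<sigma> * offset_weight i)}. of_nat r)"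
   unfolding dvd by (rule sum.mono_neutral_cong_right) auto
  finally show ?thesis unfolding split by simp
 qed
 have "weight_sum r K \<eta> (int t) 1 = weight_sum r K \<eta> (int t) (-1)" for t
  using weight_sum_cube[OF r0] weight_sum_generic[OF r] by blast
 hence "(of_nat r :: complex) * of_nat (card {i \<in> weight_index K \<eta>. int (r\<^sup>2) dvd (\<Sum>j<4. (1 + 1 * lens_offset j * int r) * weight i j)})
  = of_nat r * of_nat (card {i \<in> weight_index K \<eta>. int (r\<^sup>2) dvd (\<Sum>j<4. (1 + -1 * lens_offset j * int r) * weight i j)})"
  unfolding main by simp
 thus ?thesis using r0 by simp
qed

section \<open>Local isometries of spheres\<close>

lemma smooth_on_open_has_derivative:
 assumes "smooth_on_open f U" "x \<in> U"
 shows "(f has_derivative frechet_derivative f (at x)) (at x)"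
proof -
 have "differentiable_times_on (Suc 0) f U" using assms(1) unfolding smooth_on_open_def by blast
 hence "f differentiable (at x)" using assms(2) by simp
 thus ?thesis by (simp add: frechet_derivative_works)
qed

lemma smooth_on_open_continuous_derivative:
 assumes "smooth_on_open f U"
 shows "continuous_on U (\<lambda>x. frechet_derivative f (at x) v)"
proof -
 have "differentiable_times_on (Suc 0) f U" using assms(1) unfolding smooth_on_open_def by blast
 thus ?thesis by simp
qed

lemma smooth_on_open_continuous:
 assumes "smooth_on_open f U"
 shows "continuous_on U f"
 using assms unfolding smooth_on_open_def by (metis differentiable_times_on.simps(1))

text \<open>Smoothness provides continuity of the derivative in each fixed direction. Expanding the
  direction in a basis lets the base point and the direction vary together.\<close>

lemma continuous_on_derivative_apply:
 fixes f :: "'a::euclidean_space => 'b::real_normed_vector"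
 assumes f: "smooth_on_open f U" and g: "continuous_on S g" "g ` S \<subseteq> U" and v: "continuous_on S v"
 shows "continuous_on S (\<lambda>x. frechet_derivative f (at (g x)) (v x))"
proof -
 have expand: "frechet_derivative f (at (g x)) (v x)
   = (\<Sum>b\<in>Basis. (v x \<bullet> b) *\<^sub>R frechet_derivative f (at (g x)) b)" if "x \<in> S" for x
 proof -
  have "linear (frechet_derivative f (at (g x)))"
   using smooth_on_open_has_derivative[OF f] g(2) that
   by (meson has_derivative_linear image_subset_iff)
  hence "frechet_derivative f (at (g x)) (\<Sum>b\<in>Basis. (v x \<bullet> b) *\<^sub>R b)
   = (\<Sum>b\<in>Basis. (v x \<bullet> b) *\<^sub>R frechet_derivative f (at (g x)) b)"
   by (simp add: linear_sum linear_cmul)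
  thus ?thesis by (simp add: euclidean_representation)
 qed
 have "continuous_on S (\<lambda>x. frechet_derivative f (at (g x)) b)" for b
  by (rule continuous_on_compose2[OF smooth_on_open_continuous_derivative[OF f] g])
 hence "continuous_on S (\<lambda>x. \<Sum>b\<in>Basis. (v x \<bullet> b) *\<^sub>R frechet_derivative f (at (g x)) b)"
  by (intro continuous_on_sum continuous_on_scaleR continuous_on_inner v continuous_on_const)
 thus ?thesis
  by (rule continuous_on_eq) (simp add: expand)
qed

text \<open>By polarisation a distance preserving map that fixes the centre preserves inner
  products. It is therefore determined by its inner products with the images of small multiples of
  the basis vectors.\<close>

lemma isometry_on_ball_affine:
 fixes \<Phi> :: "'a::euclidean_space => 'a"
 assumes iso: "\<And>a b. a \<in> ball x \<epsilon> ==> b \<in> ball x \<epsilon> ==> norm (\<Phi> a - \<Phi> b) = norm (a - b)"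
  and \<epsilon>: "\<epsilon> > 0"
 obtains A where "orthogonal_transformation A" "\<And>b. b \<in> ball x \<epsilon> ==> \<Phi> b = \<Phi> x + A (b - x)"
proof -
 define \<Psi> where "\<Psi> a = \<Phi> (x + a) - \<Phi> x" for a
 have \<Psi>: "\<Psi> a \<bullet> \<Psi> b = a \<bullet> b" if "norm a < \<epsilon>" "norm b < \<epsilon>" for a b
 proof -
  have "norm (\<Psi> a) = norm a" "norm (\<Psi> b) = norm b" "norm (\<Psi> a - \<Psi> b) = norm (a - b)"
   using iso[of "x + a" x] iso[of "x + b" x] iso[of "x + a" "x + b"] that \<epsilon>
   by (simp_all add: \<Psi>_def dist_norm)
  thus ?thesis by (simp add: dot_norm_neg)
 qed
 \<comment> \<open>Any radius smaller than \<open>\<epsilon>\<close> would do; it brings multiples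
   of the basis vectors into the ball.\<close>
 define \<delta> where "\<delta> = \<epsilon> / 2"
 have \<delta>: "0 < \<delta>" "\<delta> < \<epsilon>" using \<epsilon> by (auto simp: \<delta>_def)
 define u where "u i = \<Psi> (\<delta> *\<^sub>R i) /\<^sub>R \<delta>" for i
 have \<Psi>u: "\<Psi> b \<bullet> u i = b \<bullet> i" if "norm b < \<epsilon>" "i \<in> Basis" for b i
  using \<Psi>[of b "\<delta> *\<^sub>R i"] that \<delta> by (simp add: u_def)
 have uu: "u i \<bullet> u j = i \<bullet> j" if "i \<in> Basis" "j \<in> Basis" for i j
  using \<Psi>u[of "\<delta> *\<^sub>R i" j] that \<delta> by (simp add: u_def)
 define A where "A v = (\<Sum>i\<in>Basis. (v \<bullet> i) *\<^sub>R u i)" for v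
 have A: "A v \<bullet> A w = v \<bullet> w" for v w
 proof -
  have "A v \<bullet> A w = (\<Sum>i\<in>Basis. \<Sum>j\<in>Basis. (v \<bullet> i) * (w \<bullet> j) * (i \<bullet> j))"
   unfolding A_def inner_sum_left inner_sum_right
   by (subst sum.swap) (intro sum.cong refl, simp add: uu)
  also have "\<dots> = (\<Sum>i\<in>Basis. \<Sum>j\<in>Basis. if i = j then (v \<bullet> i) * (w \<bullet> j) else 0)"
   by (intro sum.cong refl) (auto simp: inner_Basis)
  also have "\<dots> = v \<bullet> w"
   by (simp add: euclidean_inner[of v w])
  finally show ?thesis .
 qed
 have "linear A"
  unfolding A_def by (rule linearI) (simp_all add: inner_add_left scaleR_add_left sum.distrib scaleR_sum_right)
 hence orth: "orthogonal_transformation A"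
  by (simp add: orthogonal_transformation_def A)
 have "\<Psi> b = A b" if b: "norm b < \<epsilon>" for b
 proof -
  have "\<Psi> b \<bullet> A b = (\<Sum>i\<in>Basis. (b \<bullet> i) * (b \<bullet> i))"
   unfolding A_def by (simp add: inner_sum_right \<Psi>u b cong: sum.cong_simp)
  hence "\<Psi> b \<bullet> A b = b \<bullet> b" by (simp add: euclidean_inner[of b b])
  hence "(\<Psi> b - A b) \<bullet> (\<Psi> b - A b) = 0"
   using \<Psi>[OF b b] A[of b b] by (simp add: inner_diff_left inner_diff_right inner_commute)
  thus ?thesis by simp
 qed
 hence "\<Phi> b = \<Phi> x + A (b - x)" if "b \<in> ball x \<epsilon>" for b
  using that[unfolded mem_ball dist_norm] \<open>\<And>b. norm b < \<epsilon> ==> \<Psi> b = A b\<close>[of "b - x"]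
  by (simp add: \<Psi>_def norm_minus_commute diff_eq_eq add.commute)
 with orth show ?thesis using that by blast
qed

text \<open>The derivatives of the map and of its local inverse have norm at most one, so on small
  balls both are 1-Lipschitz by the mean value inequality. Together the two estimates make the map
  distance preserving.\<close>

lemma orthogonal_derivative_locally_affine:
 fixes \<Phi> :: "'a::euclidean_space => 'a"
 assumes W: "open W" "x0 \<in> W"
  and der: "\<And>x. x \<in> W ==> (\<Phi> has_derivative \<Phi>' x) (at x)"
  and orth: "\<And>x. x \<in> W ==> orthogonal_transformation (\<Phi>' x)"
  and cont: "\<And>v. continuous_on W (\<lambda>x. \<Phi>' x v)"
 obtains A \<epsilon> where "orthogonal_transformation A" "\<epsilon> > 0"
  "\<And>b. b \<in> ball x0 \<epsilon> ==> \<Phi> b = \<Phi> x0 + A (b - x0)"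
proof -
 define F where "F x = Blinfun (\<Phi>' x)" for x
 have bl: "bounded_linear f" if "orthogonal_transformation f" for f :: "'a => 'a"
  using that by (simp add: orthogonal_transformation_linear linear_conv_bounded_linear[symmetric])
 have F: "blinfun_apply (F x) = \<Phi>' x" if "x \<in> W" for x
  unfolding F_def by (rule bounded_linear_Blinfun_apply[OF bl[OF orth[OF that]]])
 have contF: "continuous_on W F"
 proof (rule continuous_on_blinfun_componentwise)
  fix i :: 'a
  show "continuous_on W (\<lambda>x. blinfun_apply (F x) i)"
   using cont[of i] F by (simp cong: continuous_on_cong)
 qed
 have inv: "Blinfun (inv (\<Phi>' x0)) o\<^sub>L F x0 = id_blinfun"
 proof (rule blinfun_eqI)
  fix v
  have "blinfun_apply (Blinfun (inv (\<Phi>' x0))) = inv (\<Phi>' x0)"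
   by (rule bounded_linear_Blinfun_apply[OF bl[OF orthogonal_transformation_inv[OF orth[OF W(2)]]]])
  thus "blinfun_apply (Blinfun (inv (\<Phi>' x0)) o\<^sub>L F x0) v = blinfun_apply id_blinfun v"
   using F[OF W(2)] orthogonal_transformation_inj[OF orth[OF W(2)]] by simp
 qed
 have der': "(\<Phi> has_derivative blinfun_apply (F x)) (at x)" if "x \<in> W" for x
  using der[OF that] F[OF that] by simp
 obtain U' V g g' where IF: "open U'" "U' \<subseteq> W" "x0 \<in> U'" "open V" "\<Phi> x0 \<in> V" "homeomorphism U' V \<Phi> g"
  "\<And>y. y \<in> V ==> (g has_derivative (g' y)) (at y)"
  "\<And>y. y \<in> V ==> g' y = inv (blinfun_apply (F (g y)))"
  "\<And>y. y \<in> V ==> bij (blinfun_apply (F (g y)))"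
  by (rule inverse_function_theorem[OF W(1) der' contF W(2) inv]) (assumption, rule that)
 obtain \<epsilon>1 where \<epsilon>1: "\<epsilon>1 > 0" "ball (\<Phi> x0) \<epsilon>1 \<subseteq> V"
  using IF(4,5) open_contains_ball by blast
 obtain \<epsilon>2 where \<epsilon>2: "\<epsilon>2 > 0" "ball x0 \<epsilon>2 \<subseteq> U'"
  using IF(1,3) open_contains_ball by blast
 \<comment> \<open>One radius for both balls: the Lipschitz estimate for \<open>\<Phi>\<close> maps
   the first ball into the second, where the estimate for the inverse applies.\<close>
 define \<epsilon> where "\<epsilon> = min \<epsilon>1 \<epsilon>2"
 have \<epsilon>: "\<epsilon> > 0" "ball (\<Phi> x0) \<epsilon> \<subseteq> V" "ball x0 \<epsilon> \<subseteq> U'"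
  using \<epsilon>1 \<epsilon>2 by (auto simp: \<epsilon>_def)
 have onorm: "onorm f \<le> 1" if "orthogonal_transformation f" for f :: "'a => 'a"
  by (rule onorm_bound) (use orthogonal_transformation_norm[OF that] in auto)
 have lip: "norm (\<Phi> a - \<Phi> b) \<le> norm (a - b)" if "a \<in> ball x0 \<epsilon>" "b \<in> ball x0 \<epsilon>" for a b
 proof -
  have "norm (\<Phi> a - \<Phi> b) \<le> 1 * norm (a - b)"
  proof (rule differentiable_bound[where S = "ball x0 \<epsilon>" and f' = \<Phi>'])
   fix x assume "x \<in> ball x0 \<epsilon>"
   hence "x \<in> W" using \<epsilon> IF by blast
   thus "(\<Phi> has_derivative \<Phi>' x) (at x within ball x0 \<epsilon>)" "onorm (\<Phi>' x) \<le> 1"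
    using der has_derivative_at_withinI onorm orth by blast+
  qed (use that in auto)
  thus ?thesis by simp
 qed
 have im: "\<Phi> a \<in> ball (\<Phi> x0) \<epsilon>" if "a \<in> ball x0 \<epsilon>" for a
  using lip[of x0 a] that \<epsilon>(1) by (simp add: dist_norm)
 have lipg: "norm (g a - g b) \<le> norm (a - b)" if "a \<in> ball (\<Phi> x0) \<epsilon>" "b \<in> ball (\<Phi> x0) \<epsilon>" for a b
 proof -
  have "norm (g a - g b) \<le> 1 * norm (a - b)"
  proof (rule differentiable_bound[where S = "ball (\<Phi> x0) \<epsilon>" and f' = g'])
   fix y assume "y \<in> ball (\<Phi> x0) \<epsilon>"
   hence y: "y \<in> V" using \<epsilon> by blast
   hence gy: "g y \<in> W" using IF(2,6) unfolding homeomorphism_def by blast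
   have "orthogonal_transformation (g' y)"
    unfolding IF(8)[OF y] F[OF gy] by (rule orthogonal_transformation_inv[OF orth[OF gy]])
   thus "(g has_derivative g' y) (at y within ball (\<Phi> x0) \<epsilon>)" "onorm (g' y) \<le> 1"
    using IF(7)[OF y] has_derivative_at_withinI onorm by blast+
  qed (use that in auto)
  thus ?thesis by simp
 qed
 have "norm (\<Phi> a - \<Phi> b) = norm (a - b)" if "a \<in> ball x0 \<epsilon>" "b \<in> ball x0 \<epsilon>" for a b
 proof (rule antisym[OF lip[OF that]])
  have "g (\<Phi> a) = a" "g (\<Phi> b) = b"
   using that \<epsilon>(3) IF(6) unfolding homeomorphism_def by blast+
  thus "norm (a - b) \<le> norm (\<Phi> a - \<Phi> b)"
   using lipg[OF im im, OF that] by simp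
 qed
 thus ?thesis
  using isometry_on_ball_affine[OF _ \<epsilon>(1), of x0 \<Phi>] that \<epsilon>(1) by blast
qed

text \<open>The radial extension \<open>y \<mapsto> \<bar>y\<bar> \<phi> (y / \<bar>y\<bar>)\<close> of an isometric immersion of the sphere is an
 isometric immersion of Euclidean space, where rigidity is elementary.\<close>
lemma sphere_isometry_locally_linear:
 fixes \<phi> :: "'a::euclidean_space => 'a"
 assumes U: "open U" "x0 \<in> U" "norm x0 = 1" and \<phi>: "smooth_on_open \<phi> U"
  and sph: "\<And>y. y \<in> U ==> norm y = 1 ==> norm (\<phi> y) = 1"
  and met: "\<And>x v w. x \<in> U ==> norm x = 1 ==> v \<bullet> x = 0 ==> w \<bullet> x = 0 ==>
   frechet_derivative \<phi> (at x) v \<bullet> frechet_derivative \<phi> (at x) w = v \<bullet> w"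
 obtains A \<epsilon> where "orthogonal_transformation A" "\<epsilon> > 0"
  "\<And>b. b \<in> ball x0 \<epsilon> ==> norm b = 1 ==> \<phi> b = A b"
proof -
 let ?D = "\<lambda>x. frechet_derivative \<phi> (at x)"
 define n where "n y = y /\<^sub>R norm y" for y :: 'a
 define W where "W = {y. y \<noteq> 0 \<and> n y \<in> U}"
 have contn: "continuous_on (- {0}) n"
  unfolding n_def by (intro continuous_intros) auto
 have "open ((- {0}) \<inter> n -` U)"
  using continuous_open_preimage[OF contn _ U(1)] by (simp add: open_Compl)
 moreover have "(- {0}) \<inter> n -` U = W" by (auto simp: W_def)
 ultimately have W: "open W" by simp
 have x0: "x0 \<noteq> 0" "n x0 = x0" using U(3) by (auto simp: n_def)
 hence x0W: "x0 \<in> W" using U by (simp add: W_def)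
 have nn: "norm (n y) = 1" if "y \<noteq> 0" for y using that by (simp add: n_def)
 have der\<phi>: "(\<phi> has_derivative ?D x) (at x)" if "x \<in> U" for x
  using smooth_on_open_has_derivative[OF \<phi> that] .
 have lin: "linear (?D x)" if "x \<in> U" for x
  using der\<phi>[OF that] has_derivative_linear by blast
 have dern: "(n has_derivative (\<lambda>h. (h - (n y \<bullet> h) *\<^sub>R n y) /\<^sub>R norm y)) (at y)" if "y \<noteq> 0" for y
 proof -
  have "((\<lambda>y. y /\<^sub>R norm y) has_derivative
   (\<lambda>h. - (inverse (norm y) * (sgn y \<bullet> h) * inverse (norm y)) *\<^sub>R y + inverse (norm y) *\<^sub>R h)) (at y)"
   using that by (auto intro!: derivative_eq_intros has_derivative_norm simp: inner_commute)
  moreover have "- (inverse (norm y) * (sgn y \<bullet> h) * inverse (norm y)) *\<^sub>R y + inverse (norm y) *\<^sub>R h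
    = (h - (n y \<bullet> h) *\<^sub>R n y) /\<^sub>R norm y" for h
   using that by (simp add: n_def sgn_div_norm scaleR_diff_right field_simps)
  ultimately show ?thesis by (simp add: n_def[abs_def])
 qed
 define \<Phi> where "\<Phi> y = norm y *\<^sub>R \<phi> (n y)" for y
 define \<Phi>' where "\<Phi>' y h = (n y \<bullet> h) *\<^sub>R \<phi> (n y) + ?D (n y) (h - (n y \<bullet> h) *\<^sub>R n y)" for y h
 have der: "(\<Phi> has_derivative \<Phi>' y) (at y)" if "y \<in> W" for y
 proof -
  have y: "y \<noteq> 0" "n y \<in> U" using that by (auto simp: W_def)
  have 1: "((\<lambda>y. \<phi> (n y)) has_derivative (\<lambda>h. ?D (n y) ((h - (n y \<bullet> h) *\<^sub>R n y) /\<^sub>R norm y))) (at y)"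
   using diff_chain_at[OF dern[OF y(1)] der\<phi>[OF y(2)]] by (simp add: o_def)
  have 2: "(norm has_derivative (\<lambda>h. n y \<bullet> h)) (at y)"
   using has_derivative_norm[OF y(1)] by (simp add: n_def sgn_div_norm inner_commute)
  have "(\<Phi> has_derivative (\<lambda>h. norm y *\<^sub>R ?D (n y) ((h - (n y \<bullet> h) *\<^sub>R n y) /\<^sub>R norm y) + (n y \<bullet> h) *\<^sub>R \<phi> (n y))) (at y)"
   unfolding \<Phi>_def by (rule has_derivative_scaleR[OF 2 1])
  moreover have "norm y *\<^sub>R ?D (n y) ((h - (n y \<bullet> h) *\<^sub>R n y) /\<^sub>R norm y) + (n y \<bullet> h) *\<^sub>R \<phi> (n y) = \<Phi>' y h" for h
   using y lin[OF y(2)] by (simp add: \<Phi>'_def linear_cmul)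
  ultimately show ?thesis by simp
 qed
 \<comment> \<open>Along the curve \<open>n (x + t v)\<close> in the sphere \<open>\<phi>\<close>
   has constant length one, so its derivative is orthogonal to its value.\<close>
 have perp: "\<phi> x \<bullet> ?D x v = 0" if x: "x \<in> U" "norm x = 1" and v: "v \<bullet> x = 0" for x v
 proof -
  let ?c = "\<lambda>t. n (x + t *\<^sub>R v)"
  have x0: "x \<noteq> 0" using x by auto
  have nx: "n x = x" using x by (simp add: n_def)
  have "((\<lambda>t. x + t *\<^sub>R v) has_derivative (\<lambda>t. t *\<^sub>R v)) (at 0)"
   by (auto intro!: derivative_eq_intros)
  moreover have "(n has_derivative (\<lambda>h. (h - (n x \<bullet> h) *\<^sub>R n x) /\<^sub>R norm x)) (at (x + 0 *\<^sub>R v))"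
   using dern[OF x0] by simp
  ultimately have "(?c has_derivative (\<lambda>t. (t *\<^sub>R v - (n x \<bullet> (t *\<^sub>R v)) *\<^sub>R n x) /\<^sub>R norm x)) (at 0)"
   by (rule has_derivative_compose)
  hence c: "(?c has_derivative (\<lambda>t. t *\<^sub>R v)) (at 0)"
   using v x nx by (simp add: inner_commute)
  have "((\<lambda>t. \<phi> (?c t)) has_derivative (\<lambda>t. ?D x (t *\<^sub>R v))) (at 0)"
   using has_derivative_compose[OF c, of \<phi> "?D x"] der\<phi>[OF x(1)] nx by simp
  hence "((\<lambda>t. \<phi> (?c t) \<bullet> \<phi> (?c t)) has_derivative (\<lambda>t. \<phi> (?c 0) \<bullet> ?D x (t *\<^sub>R v) + ?D x (t *\<^sub>R v) \<bullet> \<phi> (?c 0))) (at 0)"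
   by (intro has_derivative_inner)
  hence d1: "((\<lambda>t. \<phi> (?c t) \<bullet> \<phi> (?c t)) has_derivative (\<lambda>t. t * (2 * (\<phi> x \<bullet> ?D x v)))) (at 0)"
   using nx lin[OF x(1)] by (simp add: linear_cmul inner_commute algebra_simps)
  have "\<forall>\<^sub>F t in at 0. ?c t \<in> U \<and> x + t *\<^sub>R v \<noteq> 0"
  proof -
   have "isCont (\<lambda>t. x + t *\<^sub>R v) 0" by simp
   hence "(\<lambda>t. x + t *\<^sub>R v) \<midarrow>0\<rightarrow> x" unfolding isCont_def by simp
   moreover have "x \<in> W" using x x0 nx by (simp add: W_def)
   ultimately have "\<forall>\<^sub>F t in at 0. x + t *\<^sub>R v \<in> W"
    using W by (intro topological_tendstoD)
   thus ?thesis by eventually_elim (simp add: W_def)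
  qed
  hence ev: "\<forall>\<^sub>F t in at 0. \<phi> (?c t) \<bullet> \<phi> (?c t) = 1"
  proof eventually_elim
   case (elim t)
   hence "norm (\<phi> (?c t)) = 1" using sph nn by blast
   thus ?case by (simp add: dot_square_norm)
  qed
  have "((\<lambda>t. 1::real) has_derivative (\<lambda>t. t * (2 * (\<phi> x \<bullet> ?D x v)))) (at 0)"
   using has_derivative_transform_eventually[OF d1 ev] sph[OF x] nx by (simp add: dot_square_norm)
  hence "(\<lambda>t. t * (2 * (\<phi> x \<bullet> ?D x v))) = (\<lambda>t::real. 0)"
   using has_derivative_unique has_derivative_const by blast
  thus ?thesis by (metis mult_1 mult_eq_0_iff zero_neq_numeral)
 qed
 \<comment> \<open>The radial part goes to a multiple of the unit vector
   \<open>\<phi> (n y)\<close>, the tangential part isometrically to vectors orthogonal to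
   it.\<close>
 have orth: "orthogonal_transformation (\<Phi>' y)" if "y \<in> W" for y
 proof -
  have y: "y \<noteq> 0" "n y \<in> U" "norm (n y) = 1" using that nn by (auto simp: W_def)
  have lin\<Phi>: "linear (\<Phi>' y)" using der[OF that] has_derivative_linear by blast
  have "\<Phi>' y v \<bullet> \<Phi>' y w = v \<bullet> w" for v w
  proof -
   let ?v = "v - (n y \<bullet> v) *\<^sub>R n y" and ?w = "w - (n y \<bullet> w) *\<^sub>R n y"
   have nn1: "n y \<bullet> n y = 1" using y(3) by (simp add: dot_square_norm)
   have t: "?v \<bullet> n y = 0" "?w \<bullet> n y = 0" using nn1 by (simp_all add: inner_diff_left) (simp_all add: inner_commute)
   have p: "\<phi> (n y) \<bullet> ?D (n y) ?v = 0" "\<phi> (n y) \<bullet> ?D (n y) ?w = 0"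
    using perp[OF y(2,3)] t by auto
   have s: "\<phi> (n y) \<bullet> \<phi> (n y) = 1" using sph[OF y(2,3)] by (simp add: dot_square_norm)
   have "\<Phi>' y v \<bullet> \<Phi>' y w = (n y \<bullet> v) * (n y \<bullet> w) + ?v \<bullet> ?w"
    unfolding \<Phi>'_def using p s met[OF y(2,3) t]
    by (simp add: inner_add_left inner_add_right inner_commute)
   also have "\<dots> = v \<bullet> w"
    using nn1 by (simp add: inner_diff_left inner_diff_right inner_commute)
   finally show ?thesis .
  qed
  with lin\<Phi> show ?thesis by (simp add: orthogonal_transformation_def)
 qed
 have cont: "continuous_on W (\<lambda>y. \<Phi>' y v)" for v
 proof -
  have sub: "W \<subseteq> - {0}" "n ` W \<subseteq> U" by (auto simp: W_def)
  have cn: "continuous_on W n" using contn sub(1) continuous_on_subset by blast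
  have c1: "continuous_on W (\<lambda>y. \<phi> (n y))"
   by (rule continuous_on_compose2[OF smooth_on_open_continuous[OF \<phi>] cn sub(2)])
  have c2: "continuous_on W (\<lambda>y. n y \<bullet> v)"
   by (intro continuous_on_inner cn continuous_on_const)
  have "continuous_on W (\<lambda>y. ?D (n y) (v - (n y \<bullet> v) *\<^sub>R n y))"
   by (intro continuous_on_derivative_apply[OF \<phi> cn sub(2)] continuous_on_diff continuous_on_const
     continuous_on_scaleR c2 cn)
  thus ?thesis unfolding \<Phi>'_def
   by (intro continuous_on_add continuous_on_scaleR c1 c2)
 qed
 obtain A \<epsilon> where A: "orthogonal_transformation A" "\<epsilon> > 0"
  "\<And>b. b \<in> ball x0 \<epsilon> ==> \<Phi> b = \<Phi> x0 + A (b - x0)"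
  using orthogonal_derivative_locally_affine[OF W x0W der orth cont] by blast
 have linA: "linear A" using A(1) orthogonal_transformation_linear by blast
 \<comment> \<open>\<open>\<Phi>\<close> is positively homogeneous of degree one; comparison along
   the ray through \<open>x0\<close> removes the constant of the affine map.\<close>
 have "\<Phi> x0 = A x0"
 proof -
  define \<delta> where "\<delta> = \<epsilon> / 2"
  have \<delta>: "\<delta> > 0" "\<delta> < \<epsilon>" using A(2) by (auto simp: \<delta>_def)
  have "x0 + \<delta> *\<^sub>R x0 \<in> ball x0 \<epsilon>" using \<delta> U(3) by (simp add: dist_norm)
  from A(3)[OF this] have "\<Phi> (x0 + \<delta> *\<^sub>R x0) = \<Phi> x0 + \<delta> *\<^sub>R A x0"
   using linA by (simp add: linear_cmul)
  moreover have "x0 + \<delta> *\<^sub>R x0 = (1 + \<delta>) *\<^sub>R x0" by (simp add: scaleR_add_left)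
  moreover have "\<Phi> ((1 + \<delta>) *\<^sub>R x0) = (1 + \<delta>) *\<^sub>R \<Phi> x0"
   using \<delta> U(3) by (simp add: \<Phi>_def n_def)
  ultimately have "(1 + \<delta>) *\<^sub>R \<Phi> x0 = \<Phi> x0 + \<delta> *\<^sub>R A x0" by metis
  hence "\<delta> *\<^sub>R \<Phi> x0 = \<delta> *\<^sub>R A x0" by (simp add: scaleR_add_left)
  thus ?thesis using \<delta> by simp
 qed
 hence "\<Phi> b = A b" if "b \<in> ball x0 \<epsilon>" for b
  using A(3)[OF that] linA by (simp add: linear_diff)
 hence "\<phi> b = A b" if "b \<in> ball x0 \<epsilon>" "norm b = 1" for b
  using that by (metis \<Phi>_def n_def inverse_1 scaleR_one)
 thus ?thesis using that A by blast
qed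

text \<open>The cone over an open piece of the sphere is open, hence not a null set, while the
  spaces where \<open>A\<close> agrees with a different linear map are proper subspaces and null
  sets. Finitely many of these cannot cover the cone.\<close>

lemma finite_cover_linear:
 fixes A :: "'a::euclidean_space => 'b::euclidean_space" and B :: "'c => 'a => 'b"
 assumes V: "open V" "y \<in> V" "norm y = 1" and H: "finite H"
  and A: "linear A" and B: "\<And>h. h \<in> H ==> linear (B h)"
  and cover: "\<And>z. z \<in> V ==> norm z = 1 ==> \<exists>h\<in>H. A z = B h z"
 shows "\<exists>h\<in>H. A = B h"
proof (rule ccontr)
 assume a: "\<not> (\<exists>h\<in>H. A = B h)"
 define n where "n y = y /\<^sub>R norm y" for y :: 'a
 define W where "W = {y. y \<noteq> 0 \<and> n y \<in> V}"
 have contn: "continuous_on (- {0}) n"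
  unfolding n_def by (intro continuous_intros) auto
 have "open ((- {0}) \<inter> n -` V)"
  using continuous_open_preimage[OF contn _ V(1)] by (simp add: open_Compl)
 moreover have "(- {0}) \<inter> n -` V = W" by (auto simp: W_def)
 ultimately have W: "open W" by simp
 have y: "y \<noteq> 0" "n y = y" using V(3) by (auto simp: n_def)
 hence "y \<in> W" using V by (simp add: W_def)
 have neg: "negligible {z. A z = B h z}" if h: "h \<in> H" for h
 proof -
  from a h obtain z where z: "A z \<noteq> B h z" by (metis ext)
  define L where "L z = A z - B h z" for z
  have L: "linear L" unfolding L_def[abs_def] by (intro linear_compose_sub A B h)
  \<comment> \<open>The kernel of \<open>L\<close> lies in the hyperplane orthogonal to
    \<open>adjoint L (L z)\<close>, and this vector is nonzero.\<close>
  have "adjoint L (L z) \<bullet> z = L z \<bullet> L z"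
   using adjoint_works[OF L] by (simp add: inner_commute)
  hence "adjoint L (L z) \<noteq> 0" using z by (auto simp: L_def)
  hence "negligible {w. adjoint L (L z) \<bullet> w = 0}" by (simp add: negligible_hyperplane)
  moreover have "{z. A z = B h z} \<subseteq> {w. adjoint L (L z) \<bullet> w = 0}"
   using adjoint_works[OF L] by (auto simp: L_def inner_commute)
  ultimately show ?thesis using negligible_subset by blast
 qed
 have "W \<subseteq> (\<Union>h\<in>H. {z. A z = B h z})"
 proof
  fix w assume "w \<in> W"
  hence w: "w \<noteq> 0" "n w \<in> V" "norm (n w) = 1" by (auto simp: W_def n_def)
  obtain h where h: "h \<in> H" "A (n w) = B h (n w)" using cover[OF w(2,3)] by blast
  hence "A w /\<^sub>R norm w = B h w /\<^sub>R norm w"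
   using A B by (simp add: n_def linear_cmul)
  hence "A w = B h w" using w by simp
  with h show "w \<in> (\<Union>h\<in>H. {z. A z = B h z})" by blast
 qed
 moreover have "negligible (\<Union>h\<in>H. {z. A z = B h z})"
  using H neg by (intro negligible_Union) auto
 ultimately have "negligible W" using negligible_subset by blast
 thus False using open_not_negligible[OF W] \<open>y \<in> W\<close> by blast
qed

text \<open>Local lifts are restrictions of orthogonal maps, and two of them at the same point
  differ by an element of the group \<open>H\<close>, which orbits do not see. So the set of points
  near which one fixed orthogonal map is a lift is open and closed in the connected sphere.\<close>

lemma isometry_linear_lift:
 fixes G H :: "'n::finite rmatrix set"
 assumes H: "finite H" "\<And>h x. h \<in> H ==> orbit H (h *v x) = orbit H x" "mat 1 \<in> H"
  and n: "CARD('n) \<ge> 2"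
  and F: "smooth_quotient_map G H F" "preserves_metric G H F"
 obtains A where "orthogonal_transformation A" "\<And>x. norm x = 1 ==> F (orbit G x) = orbit H (A x)"
proof -
 let ?S = "sphere (0::'n rvector) 1"
 define good where "good A x \<longleftrightarrow> orthogonal_transformation A \<and>
  (\<exists>\<epsilon>>0. \<forall>y\<in>ball x \<epsilon>. norm y = 1 \<longrightarrow> F (orbit G y) = orbit H (A y))" for A x
 have self: "x \<in> orbit H x" for x
  unfolding orbit_def using H(3) by (metis image_eqI matrix_vector_mul_lid)
 have ex: "\<exists>A. good A x" if nx: "norm x = 1" for x
 proof -
  from F(1) nx obtain U \<phi> where U: "x \<in> U" "smooth_local_lift G H F U \<phi>"
   unfolding smooth_quotient_map_def by (metis mem_sphere_0)
  hence L: "open U" "smooth_on_open \<phi> U" "\<And>y. y \<in> U ==> norm y = 1 ==> norm (\<phi> y) = 1 \<and> F (orbit G y) = orbit H (\<phi> y)"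
   unfolding smooth_local_lift_def by auto
  have met: "frechet_derivative \<phi> (at x) v \<bullet> frechet_derivative \<phi> (at x) w = v \<bullet> w"
   if "x \<in> U" "norm x = 1" "v \<bullet> x = 0" "w \<bullet> x = 0" for x v w
   using F(2) U(2) that unfolding preserves_metric_def by auto
  obtain A \<epsilon> where A: "orthogonal_transformation A" "\<epsilon> > 0"
   "\<And>b. b \<in> ball x \<epsilon> ==> norm b = 1 ==> \<phi> b = A b"
   using sphere_isometry_locally_linear[OF L(1) U(1) nx L(2) conjunct1[OF L(3)] met] by blast
  obtain \<epsilon>' where \<epsilon>': "\<epsilon>' > 0" "ball x \<epsilon>' \<subseteq> U" using L(1) U(1) open_contains_ball by blast
  have "F (orbit G y) = orbit H (A y)" if "y \<in> ball x (min \<epsilon> \<epsilon>')" "norm y = 1" for y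
   using that A(3)[of y] L(3)[of y] \<epsilon>' by auto
  hence "good A x" unfolding good_def using A(1,2) \<epsilon>'(1)
   by (intro conjI exI[of _ "min \<epsilon> \<epsilon>'"]) simp_all
  thus ?thesis by blast
 qed
 have unique: "\<exists>h\<in>H. A = (\<lambda>x. h *v B x)" if "good A y" "good B y" "norm y = 1" for A B y
 proof -
  from that obtain \<epsilon>1 \<epsilon>2 where e: "\<epsilon>1 > 0" "\<epsilon>2 > 0"
   "\<And>z. z \<in> ball y \<epsilon>1 ==> norm z = 1 ==> F (orbit G z) = orbit H (A z)"
   "\<And>z. z \<in> ball y \<epsilon>2 ==> norm z = 1 ==> F (orbit G z) = orbit H (B z)"
   unfolding good_def by blast
  show ?thesis
  proof (rule finite_cover_linear[where V = "ball y (min \<epsilon>1 \<epsilon>2)" and B = "\<lambda>h x. h *v B x", OF _ _ that(3) H(1)])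
   show "linear A" "\<And>h. linear (\<lambda>x. h *v B x)"
    using that unfolding good_def orthogonal_transformation_def
    by (auto intro!: linear_compose[of B "(*v) _", unfolded o_def] matrix_vector_mul_linear)
   fix z assume "z \<in> ball y (min \<epsilon>1 \<epsilon>2)" "norm z = 1"
   hence "orbit H (A z) = orbit H (B z)" using e(3,4)[of z] by auto
   hence "A z \<in> orbit H (B z)" using self by blast
   thus "\<exists>h\<in>H. A z = h *v B z" unfolding orbit_def by blast
  qed (use e in auto)
 qed
 define e where "e = (axis undefined 1 :: 'n rvector)"
 have e: "norm e = 1" by (simp add: e_def norm_axis_1)
 obtain A where A: "good A e" using ex[OF e] by blast
 define Z where "Z = {x \<in> ?S. good A x}"
 have op: "\<exists>\<delta>>0. \<forall>y\<in>ball x \<delta>. norm y = 1 \<longrightarrow> good B y" if "good B x" for B x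
 proof -
  from that obtain \<epsilon> where \<epsilon>: "\<epsilon> > 0" "\<And>z. z \<in> ball x \<epsilon> ==> norm z = 1 ==> F (orbit G z) = orbit H (B z)"
   unfolding good_def by blast
  have "good B y" if y: "y \<in> ball x \<epsilon>" for y
  proof -
   obtain \<delta> where "\<delta> > 0" "ball y \<delta> \<subseteq> ball x \<epsilon>"
    using openE[OF open_ball y] by blast
   thus ?thesis using \<open>good B x\<close> \<epsilon>(2) unfolding good_def by blast
  qed
  thus ?thesis using \<epsilon>(1) by blast
 qed
 have conn: "connected ?S" by (rule connected_sphere) (use n in simp)
 have "openin (top_of_set ?S) Z"
  unfolding openin_contains_ball
 proof (intro conjI ballI)
  fix x assume "x \<in> Z"
  then obtain \<delta> where "\<delta> > 0" "\<And>y. y \<in> ball x \<delta> ==> norm y = 1 ==> good A y"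
   using op unfolding Z_def by blast
  thus "\<exists>e>0. ball x e \<inter> ?S \<subseteq> Z" by (intro exI[of _ \<delta>]) (auto simp: Z_def)
 qed (auto simp: Z_def)
 moreover
 have "openin (top_of_set ?S) (?S - Z)"
  unfolding openin_contains_ball
 proof (intro conjI ballI)
  fix x assume x: "x \<in> ?S - Z"
  hence nx: "norm x = 1" by simp
  obtain B where B: "good B x" using ex[OF nx] by blast
  then obtain \<delta> where \<delta>: "\<delta> > 0" "\<And>y. y \<in> ball x \<delta> ==> norm y = 1 ==> good B y" using op by blast
  have "\<not> good A y" if y: "y \<in> ball x \<delta>" "norm y = 1" for y
  proof
   assume "good A y"
   then obtain h where h: "h \<in> H" "A = (\<lambda>x. h *v B x)" using unique \<delta>(2)[OF y] y(2) by blast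
   \<comment> \<open>\<open>A\<close> and \<open>B\<close> differ by an element of \<open>H\<close>
     and give the same orbits, so that the validity of \<open>B\<close> around \<open>x\<close>
     passes to \<open>A\<close>.\<close>
   have "good A x"
    using B \<open>good A y\<close> unfolding good_def h(2) by (simp add: H(2)[OF h(1)])
   thus False using x by (simp add: Z_def)
  qed
  thus "\<exists>e>0. ball x e \<inter> ?S \<subseteq> ?S - Z" using \<delta>(1) by (auto simp: Z_def intro!: exI[of _ \<delta>])
 qed auto
 hence "closedin (top_of_set ?S) Z"
  by (auto simp: closedin_def Z_def)
 ultimately have "Z = {} \<or> Z = ?S"
  using conn unfolding connected_clopen by blast
 moreover have "e \<in> Z" using A e by (simp add: Z_def)
 ultimately have "Z = ?S" by blast
 hence "F (orbit G x) = orbit H (A x)" if "norm x = 1" for x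
 proof -
  have "x \<in> Z" unfolding \<open>Z = ?S\<close> using that by simp
  then obtain \<epsilon> where "\<epsilon> > 0" "\<forall>y\<in>ball x \<epsilon>. norm y = 1 \<longrightarrow> F (orbit G y) = orbit H (A y)"
   unfolding Z_def good_def by blast
  thus ?thesis using that centre_in_ball by blast
 qed
 moreover have "orthogonal_transformation A" using A unfolding good_def by blast
 ultimately show ?thesis by (intro that)
qed

section \<open>Lens spaces\<close>

lemma position_mono: "i < j ==> position i < position (j :: 'n::{finite,linorder})"
 unfolding position_def by (rule psubset_card_mono) auto

lemma position_less_iff: "position i < position j \<longleftrightarrow> i < (j :: 'n::{finite,linorder})"
 using position_mono by (metis less_asym linorder_less_linear)

lemma position_eq_iff: "position i = position j \<longleftrightarrow> i = (j :: 'n::{finite,linorder})"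
 by (metis less_irrefl linorder_less_linear position_mono)

lemma position_less_card: "position (i :: 'n::{finite,linorder}) < CARD('n)"
 unfolding position_def by (rule psubset_card_mono) auto

lemma bij_position: "bij_betw position (UNIV :: 'n::{finite,linorder} set) {..<CARD('n)}"
proof -
 have "inj (position :: 'n => nat)" by (simp add: inj_def position_eq_iff)
 moreover from this have "range (position :: 'n => nat) = {..<CARD('n)}"
  by (intro card_subset_eq) (auto simp: position_less_card card_image)
 ultimately show ?thesis by (simp add: bij_betw_def)
qed

definition idx :: "nat => 'n::{finite,linorder}"
 where "idx p = inv_into UNIV position p"

lemma position_idx: "p < CARD('n) ==> position (idx p :: 'n::{finite,linorder}) = p"
 unfolding idx_def using bij_position[where 'n = 'n]
 by (metis bij_betw_inv_into_right lessThan_iff)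

lemma idx_position: "idx (position i) = i"
 unfolding idx_def using bij_position by (metis bij_betw_inv_into_left UNIV_I)

lemma idx_eq_iff: "p < CARD('n) ==> p' < CARD('n) ==> (idx p :: 'n::{finite,linorder}) = idx p' \<longleftrightarrow> p = p'"
 by (metis position_idx)

lemma idx_less_iff: "p < CARD('n) ==> p' < CARD('n) ==> (idx p :: 'n::{finite,linorder}) < idx p' \<longleftrightarrow> p < p'"
 by (metis position_idx position_less_iff)

lemma bij_idx: "bij_betw idx {..<CARD('n)} (UNIV :: 'n::{finite,linorder} set)"
 unfolding idx_def[abs_def] by (rule bij_betw_inv_into[OF bij_position])

lemma sum_idx: "(\<Sum>i\<in>UNIV. f i) = (\<Sum>p<CARD('n). f (idx p :: 'n::{finite,linorder}))"
 using sum.reindex_bij_betw[OF bij_idx, of f] by simp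

lemma last_index_idx: "(last_index :: 'n::{finite,linorder}) = idx (CARD('n) - 1)"
proof -
 have "i \<le> (idx (CARD('n) - 1) :: 'n)" for i
 proof (rule ccontr)
  assume "\<not> i \<le> (idx (CARD('n) - 1) :: 'n)"
  hence "position (idx (CARD('n) - 1) :: 'n) < position i" by (simp add: position_less_iff)
  thus False using position_less_card[of i] by (simp add: position_idx)
 qed
 thus ?thesis unfolding last_index_def by (intro Max_eqI) auto
qed

section \<open>Lens spaces in complex coordinates\<close>

definition zcoord :: "nat => 'n::{finite,linorder} rvector => complex"
 where "zcoord j x = Complex (x $ idx (2 * j)) (x $ idx (2 * j + 1))"

lemma zcoord_0 [simp]: "zcoord j 0 = 0"
 by (simp add: zcoord_def complex_eq_iff)

lemma sum_pairs: "(\<Sum>p<2 * m. f p) = (\<Sum>j<m. f (2 * j) + f (2 * j + 1 :: nat))"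
 by (induction m) (simp_all add: algebra_simps)

lemma zcoord_eqI:
 assumes "CARD('n) = 2 * m" "\<And>j. j < m ==> zcoord j x = zcoord j (y :: 'n::{finite,linorder} rvector)"
 shows "x = y"
proof (rule vec_eq_iff[THEN iffD2], rule allI)
 fix i :: 'n
 define p where "p = position i"
 have p: "p < 2 * m" "idx p = i" using assms(1) position_less_card[of i] by (auto simp: p_def idx_position)
 have "p div 2 < m" using p by linarith
 hence "zcoord (p div 2) x = zcoord (p div 2) y" by (rule assms(2))
 moreover have "p = 2 * (p div 2) \<or> p = 2 * (p div 2) + 1" by linarith
 ultimately show "x $ i = y $ i" unfolding p(2)[symmetric] zcoord_def by (metis complex.inject)
qed

lemma norm_zcoord:
 assumes "CARD('n) = 2 * m"
 shows "(norm (x :: 'n::{finite,linorder} rvector))\<^sup>2 = (\<Sum>j<m. (cmod (zcoord j x))\<^sup>2)"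
 by (simp add: norm_vec_def L2_set_def sum_nonneg sum_idx assms sum_pairs zcoord_def cmod_power2)

lemma lens_generator_zcoord:
 fixes x :: "'n::{finite,linorder} rvector"
 assumes n: "CARD('n) = 2 * m" and j: "j < m"
 shows "zcoord j (lens_generator q s *v x) = unity q (s ! j) * zcoord j x"
proof -
 let ?\<theta> = "2 * pi * real_of_int (s ! j) / real q"
 have pos: "position (idx p :: 'n) = p" if "p < 2 * m" for p using that n by (simp add: position_idx)
 have less: "(idx p :: 'n) < idx p' \<longleftrightarrow> p < p'" "(idx p :: 'n) = idx p' \<longleftrightarrow> p = p'"
  if "p < 2 * m" "p' < 2 * m" for p p' using that n by (simp_all add: idx_less_iff idx_eq_iff)
 have entry: "lens_generator q s $ idx p $ (idx p' :: 'n) =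
   (if p div 2 \<noteq> p' div 2 then 0
   else if p = p' then cos (2 * pi * real_of_int (s ! (p div 2)) / real q)
   else if p < p' then - sin (2 * pi * real_of_int (s ! (p div 2)) / real q)
   else sin (2 * pi * real_of_int (s ! (p div 2)) / real q))" if "p < 2 * m" "p' < 2 * m" for p p'
  using that by (simp add: lens_generator_def Let_def pos less)
 have row: "(lens_generator q s *v x) $ idx p
   = (\<Sum>k<m. lens_generator q s $ idx p $ (idx (2 * k) :: 'n) * x $ idx (2 * k)
       + lens_generator q s $ idx p $ (idx (2 * k + 1) :: 'n) * x $ idx (2 * k + 1))" for p
  by (simp add: matrix_vector_mult_def sum_idx n sum_pairs)
 have r0: "(lens_generator q s *v x) $ idx (2 * j) = cos ?\<theta> * x $ idx (2 * j) - sin ?\<theta> * x $ idx (2 * j + 1)"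
 proof -
  have "(lens_generator q s *v x) $ idx (2 * j)
   = (\<Sum>k<m. if k = j then cos ?\<theta> * x $ idx (2 * j) - sin ?\<theta> * x $ idx (2 * j + 1) else 0)"
   unfolding row using j by (intro sum.cong refl) (auto simp: entry)
  thus ?thesis using j by simp
 qed
 have r1: "(lens_generator q s *v x) $ idx (2 * j + 1) = sin ?\<theta> * x $ idx (2 * j) + cos ?\<theta> * x $ idx (2 * j + 1)"
 proof -
  have "(lens_generator q s *v x) $ idx (2 * j + 1)
   = (\<Sum>k<m. if k = j then sin ?\<theta> * x $ idx (2 * j) + cos ?\<theta> * x $ idx (2 * j + 1) else 0)"
   unfolding row using j by (intro sum.cong refl) (auto simp: entry)
  thus ?thesis using j by simp
 qed
 show ?thesis using r0 r1 by (simp add: zcoord_def unity_def complex_eq_iff)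
qed

definition lens_power :: "nat => int list => nat => 'n::{finite,linorder} rmatrix"
 where "lens_power q s k = ((\<lambda>A. lens_generator q s ** A) ^^ k) (mat 1)"

lemma lens_group_eq: "lens_group q s = range (lens_power q s)"
 by (simp add: lens_group_def lens_power_def[abs_def])

lemma lens_power_0 [simp]: "lens_power q s 0 = mat 1"
 by (simp add: lens_power_def)

lemma lens_power_Suc: "lens_power q s (Suc k) = lens_generator q s ** lens_power q s k"
 by (simp add: lens_power_def)

lemma lens_power_1: "lens_power q s (Suc 0) = lens_generator q s"
 by (simp add: lens_power_Suc)

lemma lens_power_add: "lens_power q s (k + l) = lens_power q s k ** lens_power q s l"
 by (induction k) (simp_all add: lens_power_Suc matrix_mul_assoc)

lemma lens_power_zcoord:
 fixes x :: "'n::{finite,linorder} rvector"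
 assumes "CARD('n) = 2 * m" "j < m"
 shows "zcoord j (lens_power q s k *v x) = unity q (int k * s ! j) * zcoord j x"
proof (induction k)
 case (Suc k)
 have "zcoord j (lens_power q s (Suc k) *v x) = zcoord j (lens_generator q s *v (lens_power q s k *v x))"
  by (simp add: lens_power_Suc matrix_vector_mul_assoc)
 also have "\<dots> = unity q (s ! j) * (unity q (int k * s ! j) * zcoord j x)"
  by (simp add: lens_generator_zcoord[OF assms] Suc)
 also have "\<dots> = unity q (int (Suc k) * s ! j) * zcoord j x"
  by (simp add: unity_add algebra_simps)
 finally show ?case .
qed auto

lemma lens_power_cong:
 assumes "CARD('n) = 2 * m" "q > 0" "k mod q = l mod q"
 shows "(lens_power q s k :: 'n::{finite,linorder} rmatrix) = lens_power q s l"
 unfolding matrix_eq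
proof (intro allI zcoord_eqI[OF assms(1)])
 fix x :: "'n rvector" and j assume j: "j < m"
 have "int q dvd int k - int l" using assms(3) by (metis mod_eq_dvd_iff of_nat_mod)
 hence "int q dvd int k * s ! j - int l * s ! j"
  by (metis dvd_mult2 left_diff_distrib)
 hence "unity q (int k * s ! j) = unity q (int l * s ! j)"
  by (rule unity_cong[OF assms(2)])
 thus "zcoord j (lens_power q s k *v x) = zcoord j (lens_power q s l *v x)"
  by (simp add: lens_power_zcoord[OF assms(1) j])
qed

lemma lens_group_finite:
 assumes "CARD('n) = 2 * m" "q > 0"
 shows "finite (lens_group q s :: 'n::{finite,linorder} rmatrix set)"
proof -
 have "(lens_power q s k :: 'n rmatrix) \<in> lens_power q s ` {..<q}" for k
 proof (rule image_eqI)
  show "(lens_power q s k :: 'n rmatrix) = lens_power q s (k mod q)"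
   by (rule lens_power_cong[OF assms]) simp
 qed (use assms(2) in simp)
 hence "(lens_group q s :: 'n rmatrix set) \<subseteq> lens_power q s ` {..<q}" unfolding lens_group_eq by blast
 thus ?thesis by (rule finite_subset) simp
qed

lemma orbit_lens_group:
 fixes x :: "'n::{finite,linorder} rvector"
 assumes "CARD('n) = 2 * m" "q > 0" "h \<in> lens_group q s"
 shows "orbit (lens_group q s) (h *v x) = orbit (lens_group q s) x"
proof -
 obtain k where h: "h = lens_power q s k" using assms(3) unfolding lens_group_eq by blast
 have "\<exists>l'. lens_power q s l *v x = lens_power q s l' *v (h *v x)" for l
 proof -
  \<comment> \<open>Exponents are natural numbers; (q - 1) k serves as the negative of k modulo
    q.\<close>
  have "l + (q - 1) * k + k = l + q * k"
   using assms(2) by (cases q) auto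
  hence "(l + (q - 1) * k + k) mod q = l mod q" by (metis mod_mult_self2)
  hence "lens_power q s l = (lens_power q s (l + (q - 1) * k + k) :: 'n rmatrix)"
   using lens_power_cong[OF assms(1,2)] by metis
  thus ?thesis unfolding h by (metis lens_power_add matrix_vector_mul_assoc)
 qed
 moreover have "\<exists>l'. lens_power q s l *v (h *v x) = lens_power q s l' *v x" for l
  unfolding h by (metis lens_power_add matrix_vector_mul_assoc)
 ultimately show ?thesis unfolding orbit_def lens_group_eq image_image
  by (intro set_eqI iffI) (metis (mono_tags) imageE rangeI)+
qed

lemma lens_group_one: "mat 1 \<in> lens_group q s"
 unfolding lens_group_eq by (metis lens_power_0 rangeI)

lemma norm_lens_generator:
 fixes x :: "'n::{finite,linorder} rvector"
 assumes "CARD('n) = 2 * m"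
 shows "norm (lens_generator q s *v x) = norm x"
proof -
 have "(norm (lens_generator q s *v x))\<^sup>2 = (norm x)\<^sup>2"
  by (simp add: norm_zcoord[OF assms] lens_generator_zcoord[OF assms] norm_mult unity_def)
 thus ?thesis by simp
qed

text \<open>The linear lift sends \<open>\<gamma> x\<close> into the orbit of \<open>A x\<close>. As
  only finitely many group elements are available, a single power of the other generator intertwines
  with \<gamma> through \<open>A\<close>. Every eigenvalue of \<gamma> is then an eigenvalue of that
  power.\<close>

lemma isometric_lens_spaces:
 assumes n: "CARD('n) = 2 * m" "m > 0" and q: "q > 0"
  and iso: "isometric_space_forms (lens_group q s :: 'n::{finite,linorder} rmatrix set) (lens_group q s')"
 obtains t :: nat where "\<And>j. j < m ==> \<exists>k<m. int q dvd int t * s' ! k - s ! j \<or> int q dvd int t * s' ! k + s ! j"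
proof -
 let ?\<gamma> = "lens_generator q s :: 'n rmatrix"
 let ?H = "lens_group q s' :: 'n rmatrix set"
 obtain F where F: "smooth_quotient_map (lens_group q s) ?H F" "preserves_metric (lens_group q s) ?H F"
  using iso unfolding isometric_space_forms_def by blast
 have fin: "finite ?H" by (rule lens_group_finite[OF n(1) q])
 have "CARD('n) \<ge> 2" using n by simp
 then obtain A where A: "orthogonal_transformation A" "\<And>x. norm x = 1 ==> F (orbit (lens_group q s) x) = orbit ?H (A x)"
  using isometry_linear_lift[OF fin orbit_lens_group[OF n(1) q] lens_group_one _ F] by blast
 have linA: "linear A" using A(1) by (rule orthogonal_transformation_linear)
 have \<gamma>: "?\<gamma> \<in> lens_group q s" unfolding lens_group_eq by (metis lens_power_1 rangeI)
 have "\<exists>h\<in>?H. A \<circ> (*v) ?\<gamma> = (*v) h \<circ> A"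
 proof (rule finite_cover_linear[where V = UNIV and y = "axis undefined 1"])
  show "norm (axis undefined 1 :: 'n rvector) = 1" by (simp add: norm_axis_1)
  fix z :: "'n rvector" assume z: "norm z = 1"
  have "orbit ?H (A (?\<gamma> *v z)) = orbit ?H (A z)"
   using A(2)[of z] A(2)[of "?\<gamma> *v z"] z norm_lens_generator[OF n(1)] orbit_lens_group[OF n(1) q \<gamma>] by metis
  moreover have "A (?\<gamma> *v z) \<in> orbit ?H (A (?\<gamma> *v z))"
   unfolding orbit_def using lens_group_one by (metis image_eqI matrix_vector_mul_lid)
  ultimately have "A (?\<gamma> *v z) \<in> orbit ?H (A z)" by simp
  thus "\<exists>h\<in>?H. (A \<circ> (*v) ?\<gamma>) z = ((*v) h \<circ> A) z" unfolding orbit_def by auto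
 qed (use fin linA in \<open>auto intro!: linear_compose matrix_vector_mul_linear\<close>)
 then obtain t where t: "\<And>x. A (?\<gamma> *v x) = lens_power q s' t *v A x"
  unfolding lens_group_eq by (metis comp_apply imageE)
 have "\<exists>k<m. int q dvd int t * s' ! k - s ! j \<or> int q dvd int t * s' ! k + s ! j" if j: "j < m" for j
 proof -
  define \<theta> where "\<theta> = 2 * pi * real_of_int (s ! j) / real q"
  have un: "unity q (s ! j) = Complex (cos \<theta>) (sin \<theta>)" "unity q (- s ! j) = Complex (cos \<theta>) (- sin \<theta>)"
   by (simp_all add: unity_def complex_eq_iff \<theta>_def)
  define u :: "'n rvector" where "u = axis (idx (2 * j)) 1"
  define w :: "'n rvector" where "w = axis (idx (2 * j + 1)) 1"
  have z: "zcoord k u = (if k = j then 1 else 0)" "zcoord k w = (if k = j then \<i> else 0)" if "k < m" for k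
   using that j n by (auto simp: zcoord_def u_def w_def axis_def idx_eq_iff complex_eq_iff)
  have lin_z: "zcoord k (a *\<^sub>R x + b *\<^sub>R y) = of_real a * zcoord k x + of_real b * zcoord k y" for k a b and x y :: "'n rvector"
   by (simp add: zcoord_def complex_eq_iff)
  have \<gamma>u: "?\<gamma> *v u = cos \<theta> *\<^sub>R u + sin \<theta> *\<^sub>R w" and \<gamma>w: "?\<gamma> *v w = (- sin \<theta>) *\<^sub>R u + cos \<theta> *\<^sub>R w"
   by (rule zcoord_eqI[OF n(1)]; simp add: lens_generator_zcoord[OF n(1)] z lin_z un complex_eq_iff del: scaleR_minus_left)+
  have "norm u = 1" unfolding u_def by (simp add: norm_axis_1)
  hence "norm (A u) = 1" using A(1) by (simp add: orthogonal_transformation_norm)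
  hence "A u \<noteq> 0" by auto
  then obtain k where k: "k < m" "zcoord k (A u) \<noteq> 0"
   using zcoord_eqI[OF n(1), of "A u" 0] by auto
  let ?a = "zcoord k (A u)" and ?b = "zcoord k (A w)" and ?e = "unity q (int t * s' ! k)"
  have "lens_power q s' t *v A u = cos \<theta> *\<^sub>R A u + sin \<theta> *\<^sub>R A w"
   unfolding t[symmetric] \<gamma>u using linA by (simp add: linear_add linear_cmul)
  hence ea: "?e * ?a = of_real (cos \<theta>) * ?a + of_real (sin \<theta>) * ?b"
   using lens_power_zcoord[OF n(1) k(1), of q s' t "A u"] lin_z by metis
  have "lens_power q s' t *v A w = (- sin \<theta>) *\<^sub>R A u + cos \<theta> *\<^sub>R A w"
   unfolding t[symmetric] \<gamma>w linear_add[OF linA] linear_cmul[OF linA] ..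
  hence eb: "?e * ?b = of_real (- sin \<theta>) * ?a + of_real (cos \<theta>) * ?b"
   using lens_power_zcoord[OF n(1) k(1), of q s' t "A w"] lin_z by metis
  have c: "unity q (s ! j) = of_real (cos \<theta>) + \<i> * of_real (sin \<theta>)"
   "unity q (- s ! j) = of_real (cos \<theta>) - \<i> * of_real (sin \<theta>)"
   unfolding un by (simp_all add: complex_eq_iff)
  have rot: "(e - (c + \<i> * d)) * (a - \<i> * b) = (e * a - (c * a + d * b)) - \<i> * (e * b - (- d * a + c * b))"
   "(e - (c - \<i> * d)) * (a + \<i> * b) = (e * a - (c * a + d * b)) + \<i> * (e * b - (- d * a + c * b))"
   for a b c d e :: complex by (simp_all add: algebra_simps)
  \<comment> \<open>The vectors \<open>u - \<i> w\<close> and \<open>u + \<i> w\<close> are the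
    complex eigenvectors of \<gamma> in plane j. The second factors are the k-th coordinates of
    their images under \<open>A\<close>, extended complex linearly; their sum is twice the nonzero
    \<open>?a\<close>, so one of them is nonzero.\<close>
  have "(?e - unity q (s ! j)) * (?a - \<i> * ?b) = 0" "(?e - unity q (- s ! j)) * (?a + \<i> * ?b) = 0"
   unfolding c rot using ea eb by simp_all
  moreover have "?a - \<i> * ?b \<noteq> 0 \<or> ?a + \<i> * ?b \<noteq> 0"
  proof (rule ccontr)
   assume "\<not> ?thesis"
   hence "(?a - \<i> * ?b) + (?a + \<i> * ?b) = 0" by simp
   thus False using k(2) by simp
  qed
  ultimately have "?e = unity q (s ! j) \<or> ?e = unity q (- s ! j)" by auto
  hence "int q dvd int t * s' ! k - s ! j \<or> int q dvd int t * s' ! k - - s ! j"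
   using unity_eq_iff[OF q] by blast
  thus ?thesis using k(1) by auto
 qed
 thus ?thesis by (rule that)
qed

text \<open>All parameters are 1 modulo r, so t is 1 or -1 modulo r. If t = 1 + c r, then comparison
  modulo the square of r asks for every offset a that c - a be again an offset modulo r. The set 0,
  1, 2, 4 has no such reflection modulo r when r is at least 7.\<close>

lemma lens_parameters_not_equivalent:
 fixes r t :: int
 assumes r: "odd r" "r \<ge> 7"
  and t: "\<And>a. a \<in> {0, 1, 2, 4} ==> \<exists>b\<in>{0, 1, 2, 4}. r\<^sup>2 dvd t * (1 - b * r) - (1 + a * r) \<or> r\<^sup>2 dvd t * (1 - b * r) + (1 + a * r)"
 shows False
proof -
 have main: False
  if t1: "r dvd t - 1" and t: "\<And>a. a \<in> {0, 1, 2, 4} ==> \<exists>b\<in>{0, 1, 2, 4}. r\<^sup>2 dvd t * (1 - b * r) - (1 + a * r) \<or> r\<^sup>2 dvd t * (1 - b * r) + (1 + a * r)"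
  for t
 proof -
  obtain c where "t - 1 = r * c" using t1 by (rule dvdE)
  hence c: "t = 1 + c * r" by (simp add: algebra_simps)
  have small: "\<not> r dvd x" if "x \<noteq> 0" "\<bar>x\<bar> < 7" for x
   using that r dvd_imp_le_int[of x r] by auto
  have *: "\<exists>b\<in>{0, 1, 2, 4}. r dvd c - b - a" if a: "a \<in> {0, 1, 2, 4}" for a
  proof -
   obtain b where b: "b \<in> {0, 1, 2, 4}"
    "r\<^sup>2 dvd t * (1 - b * r) - (1 + a * r) \<or> r\<^sup>2 dvd t * (1 - b * r) + (1 + a * r)"
    using t[OF a] by blast
   have rr: "r dvd r\<^sup>2" by (simp add: power2_eq_square)
   have "\<not> r\<^sup>2 dvd t * (1 - b * r) + (1 + a * r)"
   proof
    assume "r\<^sup>2 dvd t * (1 - b * r) + (1 + a * r)"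
    hence "r dvd t * (1 - b * r) + (1 + a * r)" using rr dvd_trans by blast
    moreover have "t * (1 - b * r) + (1 + a * r) = 2 + r * (c - b - c * b * r + a)"
     unfolding c by (simp add: algebra_simps)
    ultimately have "r dvd 2" by (simp add: dvd_add_left_iff)
    thus False using small[of 2] by simp
   qed
   hence "r\<^sup>2 dvd t * (1 - b * r) - (1 + a * r)" using b(2) by blast
   moreover have "t * (1 - b * r) - (1 + a * r) = r * (c - b - a) - r\<^sup>2 * (c * b)"
    unfolding c by (simp add: algebra_simps power2_eq_square)
   ultimately have "r\<^sup>2 dvd r * (c - b - a)" by (simp add: dvd_diff_left_iff)
   hence "r dvd c - b - a" using r by (simp add: power2_eq_square)
   with b(1) show ?thesis by blast
  qed
  have "\<exists>b\<in>{0, 1, 2, 4}. r dvd c - b - 0" by (rule *) simp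
  then obtain b0 where b0: "b0 \<in> {0, 1, 2, 4}" "r dvd c - b0" unfolding diff_0_right by blast
  \<comment> \<open>For c = \<open>b0\<close> the choice makes \<open>b0 - a\<close> equal to -1,
    -1, -2 or 3. None of these is an offset modulo r: the differences \<open>a + b - b0\<close> are
    nonzero and at most 6 in absolute value.\<close>
  define a :: int where "a = (if b0 = 0 then 1 else if b0 = 1 then 2 else if b0 = 2 then 4 else 1)"
  have "a \<in> {0, 1, 2, 4}" by (simp add: a_def)
  then obtain b where b: "b \<in> {0, 1, 2, 4}" "r dvd c - b - a" using * by blast
  from dvd_diff[OF b0(2) b(2)] have "r dvd a + b - b0" by (simp add: algebra_simps)
  moreover have "a + b - b0 \<noteq> 0" "\<bar>a + b - b0\<bar> < 7" using b0(1) b(1) by (auto simp: a_def)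
  ultimately show False using small by blast
 qed
 obtain b where b: "r\<^sup>2 dvd t * (1 - b * r) - 1 \<or> r\<^sup>2 dvd t * (1 - b * r) + 1"
  using t[of 0] by (metis add_0_right insertI1 mult_zero_left)
 have rr: "r dvd r\<^sup>2" by (simp add: power2_eq_square)
 have e: "t * (1 - b * r) - 1 = (t - 1) - r * (t * b)" "t * (1 - b * r) + 1 = (t + 1) - r * (t * b)"
  by (simp_all add: algebra_simps)
 from b show False
 proof
  assume "r\<^sup>2 dvd t * (1 - b * r) - 1"
  hence "r dvd (t - 1) - r * (t * b)" using rr dvd_trans e by metis
  hence "r dvd t - 1" by (simp add: dvd_diff_left_iff)
  thus False using main t by blast
 next
  assume "r\<^sup>2 dvd t * (1 - b * r) + 1"
  hence "r dvd (t + 1) - r * (t * b)" using rr dvd_trans e by metis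
  hence "r dvd t + 1" by (simp add: dvd_diff_left_iff)
  \<comment> \<open>The assumption is symmetric under negation of t, which exchanges its two
    alternatives; so this case reduces to the first one.\<close>
  hence "r dvd - (t + 1)" by (simp only: dvd_minus_iff)
  also have "- (t + 1) = - t - 1" by simp
  finally have "r dvd - t - 1" .
  moreover have "\<exists>b\<in>{0, 1, 2, 4}. r\<^sup>2 dvd - t * (1 - b * r) - (1 + a * r) \<or> r\<^sup>2 dvd - t * (1 - b * r) + (1 + a * r)"
   if a: "a \<in> {0, 1, 2, 4}" for a
  proof -
   obtain b where b: "b \<in> {0, 1, 2, 4}" "r\<^sup>2 dvd t * (1 - b * r) - (1 + a * r) \<or> r\<^sup>2 dvd t * (1 - b * r) + (1 + a * r)"
    using t[OF a] by blast
   have "- t * (1 - b * r) - (1 + a * r) = - (t * (1 - b * r) + (1 + a * r))"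
    "- t * (1 - b * r) + (1 + a * r) = - (t * (1 - b * r) - (1 + a * r))" by (simp_all add: algebra_simps)
   thus ?thesis using b by (metis dvd_minus_iff)
  qed
  ultimately show False using main by blast
 qed
qed

lemma lens_spaces_not_isometric:
 assumes "odd r" "r \<ge> 7"
 shows "\<not> isometric_space_forms (lens_group (r\<^sup>2) [1, 1 + int r, 1 + 2 * int r, 1 + 4 * int r] :: (real ^ 8 ^ 8) set)
   (lens_group (r\<^sup>2) [1, 1 - int r, 1 - 2 * int r, 1 - 4 * int r])"
proof
 let ?s = "[1, 1 + int r, 1 + 2 * int r, 1 + 4 * int r]" and ?s' = "[1, 1 - int r, 1 - 2 * int r, 1 - 4 * int r]"
 assume iso: "isometric_space_forms (lens_group (r\<^sup>2) ?s :: (real ^ 8 ^ 8) set) (lens_group (r\<^sup>2) ?s')"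
 obtain t :: nat where t: "\<And>j. j < 4 ==> \<exists>k<4. int (r\<^sup>2) dvd int t * ?s' ! k - ?s ! j \<or> int (r\<^sup>2) dvd int t * ?s' ! k + ?s ! j"
  by (rule isometric_lens_spaces[OF _ _ _ iso, where m = 4]) (use assms in auto)
 have four: "(\<exists>k<4. P k) \<longleftrightarrow> P 0 \<or> P 1 \<or> P 2 \<or> P (3::nat)" for P
  by (auto simp: eval_nat_numeral less_Suc_eq)
 show False
 proof (rule lens_parameters_not_equivalent[of "int r" "int t"])
  fix a :: int assume "a \<in> {0, 1, 2, 4}"
  then consider "a = 0" | "a = 1" | "a = 2" | "a = 4" by blast
  thus "\<exists>b\<in>{0, 1, 2, 4}. (int r)\<^sup>2 dvd int t * (1 - b * int r) - (1 + a * int r) \<or>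
    (int r)\<^sup>2 dvd int t * (1 - b * int r) + (1 + a * int r)"
   using t[of 0] t[of 1] t[of 2] t[of 3] unfolding four by cases (simp_all add: disj_ac)
 qed (use assms in auto)
qed

section \<open>The Clifford algebra and the spin group\<close>

abbreviation sym_diff :: "'a set => 'a set => 'a set" (infixl \<open>\<oplus>\<close> 65)
 where "A \<oplus> B \<equiv> (A - B) \<union> (B - A)"

lemma sym_diff_cancel [simp]: "A \<oplus> (A \<oplus> B) = B" by blast

text \<open>As a product over pairs, the sign is multiplicative for symmetric differences in each
  argument, since pairs in the overlap contribute squares. Associativity of the Clifford product on
  basis elements is this bimultiplicativity.\<close>

lemma clifford_sign_eq_prod:
 "clifford_sign A B = (\<Prod>a\<in>A. \<Prod>b\<in>B. if b \<le> a then -1 else 1)"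
 for A B :: "'n::{finite,linorder} set"
proof -
 have "(\<Prod>a\<in>A. \<Prod>b\<in>B. if b \<le> a then -1 else 1 :: real)
   = (\<Prod>p\<in>A \<times> B. if snd p \<le> fst p then -1 else 1)"
  by (simp add: prod.cartesian_product split_def)
 also have "\<dots> = (\<Prod>p\<in>{p \<in> A \<times> B. snd p \<le> fst p}. -1)"
  by (rule prod.inter_filter[symmetric]) simp
 also have "{p \<in> A \<times> B. snd p \<le> fst p} = {(a, b). a \<in> A \<and> b \<in> B \<and> b \<le> a}" by auto
 finally show ?thesis by (simp add: clifford_sign_def)
qed

lemma prod_sym_diff:
 fixes f :: "'a::finite => real"
 assumes "\<And>a. f a * f a = 1"
 shows "prod f (A \<oplus> B) = prod f A * prod f B"
proof -
 have "prod f (A \<oplus> B) = prod f (A - B) * prod f (B - A)"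
  by (rule prod.union_disjoint) auto
 moreover have "prod f A = prod f (A - B) * prod f (A \<inter> B)"
  by (subst prod.union_disjoint[symmetric]) (auto intro: prod.cong)
 moreover have "prod f B = prod f (B - A) * prod f (A \<inter> B)"
  by (subst prod.union_disjoint[symmetric]) (auto intro: prod.cong)
 moreover have "prod f (A \<inter> B) * prod f (A \<inter> B) = 1"
  by (simp add: assms flip: prod.distrib)
 ultimately show ?thesis by (simp add: mult_ac)
qed

lemma clifford_sign_square [simp]: "clifford_sign A B * clifford_sign A B = 1"
 by (simp add: clifford_sign_def flip: power_add)

lemma clifford_sign_left: "clifford_sign (A \<oplus> A') B = clifford_sign A B * clifford_sign A' B"
 unfolding clifford_sign_eq_prod
 by (rule prod_sym_diff) (auto simp flip: prod.distrib intro: prod.neutral)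

lemma clifford_sign_right: "clifford_sign A (B \<oplus> B') = clifford_sign A B * clifford_sign A B'"
proof -
 have "clifford_sign A B = (\<Prod>b\<in>B. \<Prod>a\<in>A. if b \<le> a then -1 else 1)" for B
  unfolding clifford_sign_eq_prod by (rule prod.swap)
 thus ?thesis
  by (simp only:) (rule prod_sym_diff, auto simp flip: prod.distrib intro: prod.neutral)
qed

lemma clifford_sign_empty [simp]: "clifford_sign {} B = 1" "clifford_sign A {} = 1"
 by (simp_all add: clifford_sign_eq_prod)

lemma clifford_sign_single: "clifford_sign {i} {j} = (if j \<le> i then -1 else 1)"
 by (simp add: clifford_sign_eq_prod)

abbreviation eprod :: "'n set => 'n::{finite,linorder} clifford"
 where "eprod A \<equiv> axis A 1"

lemma vec_expand: "(a :: real ^ 'n) = (\<Sum>A\<in>UNIV. a $ A *\<^sub>R axis A 1)"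
 by (simp add: vec_eq_iff axis_def if_distrib cong: if_cong)

lemma bounded_bilinear_clifford: "bounded_bilinear ((\<star>) :: 'n::{finite,linorder} clifford => _)"
proof -
 have "bilinear ((\<star>) :: 'n clifford => _)"
  unfolding bilinear_def clifford_mult_def
  by (auto intro!: linearI simp: algebra_simps sum.distrib scaleR_sum_right scaleR_add_left)
 thus ?thesis by (simp add: bilinear_conv_bounded_bilinear)
qed

interpretation clifford: bounded_bilinear "(\<star>) :: 'n::{finite,linorder} clifford => _"
 by (rule bounded_bilinear_clifford)

lemma axis_component: "axis i x $ j = (if j = i then x else 0)"
 by (simp add: axis_def)

lemma eprod_mult: "eprod A \<star> eprod B = clifford_sign A B *\<^sub>R eprod (A \<oplus> B)"
proof -
 have "(eprod A $ A' * eprod B $ B' * clifford_sign A' B') *\<^sub>R eprod (A' \<oplus> B')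
   = (if B' = B then if A' = A then clifford_sign A B *\<^sub>R eprod (A \<oplus> B) else 0 else 0)" for A' B'
  by (simp add: axis_component)
 thus ?thesis unfolding clifford_mult_def by (simp only:) simp
qed

lemma clifford_linear_eqI:
 assumes "linear f" "linear g" "\<And>A. f (eprod A) = g (eprod A)"
 shows "f a = g a"
proof -
 have "f a = (\<Sum>A\<in>UNIV. a $ A *\<^sub>R f (eprod A))"
  by (subst vec_expand[of a]) (simp add: linear_sum[OF assms(1)] linear_cmul[OF assms(1)])
 also have "\<dots> = g a"
  by (subst (2) vec_expand[of a]) (simp add: linear_sum[OF assms(2)] linear_cmul[OF assms(2)] assms(3))
 finally show ?thesis .
qed

lemma linear_clifford:
 "linear (\<lambda>a. a \<star> b)" "linear (\<lambda>b. a \<star> b)"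
 using clifford.bounded_linear_left clifford.bounded_linear_right bounded_linear.linear by blast+

lemma clifford_assoc: "(a \<star> b) \<star> c = a \<star> (b \<star> c)"
proof -
 have basis: "(eprod A \<star> eprod B) \<star> eprod C = eprod A \<star> (eprod B \<star> eprod C)" for A B C :: "'a set"
 proof -
  have "(A \<oplus> B) \<oplus> C = A \<oplus> (B \<oplus> C)" by blast
  thus ?thesis
   by (simp add: eprod_mult clifford.scaleR_left clifford.scaleR_right clifford_sign_left clifford_sign_right)
 qed
 have 1: "(eprod A \<star> eprod B) \<star> c = eprod A \<star> (eprod B \<star> c)" for A B :: "'a set" and c
  by (rule clifford_linear_eqI[where f = "\<lambda>c. (eprod A \<star> eprod B) \<star> c" and g = "\<lambda>c. eprod A \<star> (eprod B \<star> c)"])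
   (auto intro!: linear_clifford linear_compose[OF linear_clifford(2) linear_clifford(2), unfolded o_def] simp: basis)
 have 2: "(eprod A \<star> b) \<star> c = eprod A \<star> (b \<star> c)" for A :: "'a set" and b c
  by (rule clifford_linear_eqI[where f = "\<lambda>b. (eprod A \<star> b) \<star> c" and g = "\<lambda>b. eprod A \<star> (b \<star> c)"])
   (auto intro!: linear_compose[OF linear_clifford(2) linear_clifford(1), unfolded o_def]
    linear_compose[OF linear_clifford(1) linear_clifford(2), unfolded o_def] simp: 1)
 show ?thesis
  by (rule clifford_linear_eqI[where f = "\<lambda>a. (a \<star> b) \<star> c" and g = "\<lambda>a. a \<star> (b \<star> c)"])
   (auto intro!: linear_clifford linear_compose[OF linear_clifford(1) linear_clifford(1), unfolded o_def] simp: 2)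
qed

lemma clifford_one_left [simp]: "clifford_one \<star> a = a"
 by (rule clifford_linear_eqI) (auto intro: linear_clifford linear_ident simp: clifford_one_def eprod_mult)

lemma clifford_one_right [simp]: "a \<star> clifford_one = a"
 by (rule clifford_linear_eqI) (auto intro: linear_clifford linear_ident simp: clifford_one_def eprod_mult)

lemma linear_clifford_vec: "linear clifford_vec"
 unfolding clifford_vec_def
 by (rule linearI) (simp_all add: scaleR_add_left sum.distrib scaleR_sum_right)

lemmas clifford_vec_add = linear_add[OF linear_clifford_vec]
 and clifford_vec_diff = linear_diff[OF linear_clifford_vec]
 and clifford_vec_scaleR = linear_cmul[OF linear_clifford_vec]
 and clifford_vec_minus = linear_neg[OF linear_clifford_vec]
 and clifford_vec_zero = linear_0[OF linear_clifford_vec]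

lemma clifford_vec_axis: "egen i = eprod {i}"
proof -
 have "egen i = (\<Sum>j\<in>UNIV. if j = i then eprod {i} else 0)"
  unfolding clifford_vec_def by (intro sum.cong) (auto simp: axis_def)
 thus ?thesis by simp
qed

lemma clifford_vec_nth: "clifford_vec v $ {i} = v $ i" "card A \<noteq> 1 ==> clifford_vec v $ A = 0"
proof -
 have "clifford_vec v $ {i} = (\<Sum>j\<in>UNIV. if j = i then v $ i else 0)"
  unfolding clifford_vec_def sum_component by (intro sum.cong) (auto simp: axis_def)
 thus "clifford_vec v $ {i} = v $ i" by simp
 show "clifford_vec v $ A = 0" if "card A \<noteq> 1"
  unfolding clifford_vec_def sum_component using that by (intro sum.neutral) (auto simp: axis_def)
qed

lemma clifford_vec_inject: "clifford_vec v = clifford_vec w \<longleftrightarrow> v = w"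
 by (metis clifford_vec_nth(1) vec_eq_iff)

lemma clifford_vec_anticommute:
 "clifford_vec v \<star> clifford_vec w + clifford_vec w \<star> clifford_vec v = (- 2 * (v \<bullet> w)) *\<^sub>R clifford_one"
proof -
 have ee: "eprod {i} \<star> eprod {j} + eprod {j} \<star> eprod {i} = (if i = j then (-2) *\<^sub>R clifford_one else 0)"
  for i j :: 'a
 proof (cases "i = j")
  case True
  thus ?thesis by (simp add: eprod_mult clifford_sign_single clifford_one_def scaleR_2)
 next
  case False
  hence "{i} \<oplus> {j} = {j} \<oplus> {i}" by auto
  with False show ?thesis by (auto simp: eprod_mult clifford_sign_single simp flip: scaleR_add_left)
 qed
 have expand: "clifford_vec v \<star> clifford_vec w = (\<Sum>i\<in>UNIV. \<Sum>j\<in>UNIV. (v $ i * w $ j) *\<^sub>R (eprod {i} \<star> eprod {j}))"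
  for v w :: "'a rvector"
  unfolding clifford_vec_def clifford.sum_left
  by (simp add: clifford.sum_right clifford.scaleR_left clifford.scaleR_right scaleR_sum_right mult.commute)
 have swapped: "clifford_vec w \<star> clifford_vec v = (\<Sum>i\<in>UNIV. \<Sum>j\<in>UNIV. (v $ i * w $ j) *\<^sub>R (eprod {j} \<star> eprod {i}))"
  unfolding expand by (subst sum.swap) (simp add: mult.commute)
 have "clifford_vec v \<star> clifford_vec w + clifford_vec w \<star> clifford_vec v
   = (\<Sum>i\<in>UNIV. \<Sum>j\<in>UNIV. (v $ i * w $ j) *\<^sub>R (eprod {i} \<star> eprod {j} + eprod {j} \<star> eprod {i}))"
  unfolding expand[of v w] swapped scaleR_add_right sum.distrib ..
 also have "\<dots> = (\<Sum>i\<in>UNIV. \<Sum>j\<in>UNIV. if i = j then (- 2 * (v $ i * w $ i)) *\<^sub>R clifford_one else 0)"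
  by (intro sum.cong refl) (simp add: ee)
 also have "\<dots> = (- 2 * (v \<bullet> w)) *\<^sub>R clifford_one"
  by (simp add: inner_vec_def scaleR_sum_left sum_distrib_left)
 finally show ?thesis .
qed

lemma clifford_vec_square: "clifford_vec v \<star> clifford_vec v = (- (v \<bullet> v)) *\<^sub>R clifford_one"
proof -
 have "2 *\<^sub>R (clifford_vec v \<star> clifford_vec v) = 2 *\<^sub>R ((- (v \<bullet> v)) *\<^sub>R clifford_one)"
  using clifford_vec_anticommute[of v v] by (simp add: scaleR_2)
 thus ?thesis by (simp only: scaleR_cancel_left) simp
qed

lemma clifford_vec_unit_square: "norm v = 1 ==> clifford_vec v \<star> clifford_vec v = - clifford_one"
 by (simp add: clifford_vec_square dot_square_norm)

lemma clifford_vec_reflection: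
 assumes "norm u = 1"
 shows "clifford_vec u \<star> clifford_vec x \<star> clifford_vec u = clifford_vec (x - (2 * (u \<bullet> x)) *\<^sub>R u)"
proof -
 have "clifford_vec u \<star> clifford_vec x = (- 2 * (u \<bullet> x)) *\<^sub>R clifford_one - clifford_vec x \<star> clifford_vec u"
  using clifford_vec_anticommute[of u x] by (simp add: eq_diff_eq)
 thus ?thesis
  by (simp add: clifford.diff_left clifford.scaleR_left clifford_assoc clifford_vec_unit_square[OF assms]
    clifford.minus_right clifford.minus_left clifford_vec_diff clifford_vec_scaleR)
qed

section \<open>Reversal, the spin group and its covering\<close>

definition reversal_sign :: "nat => real"
 where "reversal_sign k = (-1) ^ (k * (k - 1) div 2)"

lemma reversal_sign_Suc: "reversal_sign (Suc k) = (-1) ^ k * reversal_sign k"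
proof -
 have "Suc k * k div 2 = k + k * (k - 1) div 2"
  by (cases k) (simp_all add: algebra_simps)
 thus ?thesis by (simp add: reversal_sign_def power_add)
qed

lemma linear_reverse: "linear clifford_reverse"
 unfolding clifford_reverse_def by (rule linearI) (simp_all add: vec_eq_iff algebra_simps)

lemma clifford_reverse_eprod: "clifford_reverse (eprod A) = reversal_sign (card A) *\<^sub>R eprod A"
 by (simp add: clifford_reverse_def vec_eq_iff axis_def reversal_sign_def)

lemma clifford_reverse_one [simp]: "clifford_reverse clifford_one = clifford_one"
 by (simp add: clifford_one_def clifford_reverse_eprod reversal_sign_def)

text \<open>This is the sign of moving a basis vector past a basis product: each factor different
  from it contributes -1.\<close>

lemma clifford_sign_swap:
 fixes A :: "'n::{finite,linorder} set"
 shows "clifford_sign {i} A * clifford_sign A {i} = (-1) ^ (card A + (if i \<in> A then 1 else 0))"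
proof -
 have "clifford_sign {i} A * clifford_sign A {i} = (\<Prod>a\<in>A. (if a \<le> i then -1 else 1) * (if i \<le> a then -1 else 1))"
  by (simp add: clifford_sign_eq_prod prod.distrib)
 also have "\<dots> = (\<Prod>a\<in>A. if a = i then 1 else -1)"
  by (intro prod.cong refl) auto
 also have "\<dots> = (-1) ^ (card A + (if i \<in> A then 1 else 0))"
 proof (cases "i \<in> A")
  case True
  hence "(\<Prod>a\<in>A. if a = i then 1 else -1 :: real) = (\<Prod>a\<in>A - {i}. -1)"
   by (subst prod.remove[of A i]) (auto intro: prod.cong)
  also have "\<dots> = (-1) ^ (card A - 1)" using True by simp
  also have "\<dots> = (-1) ^ (card A + 1)"
   using True by (cases "card A") auto
  finally show ?thesis using True by simp
 next
  case False
  hence "(\<Prod>a\<in>A. if a = i then 1 else -1 :: real) = (\<Prod>a\<in>A. -1)"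
   by (intro prod.cong) auto
  thus ?thesis using False by simp
 qed
 finally show ?thesis .
qed

text \<open>The anti-automorphism property against a single vector; by induction it reverses all
  products of vectors, hence the whole spin group.\<close>

lemma clifford_reverse_vec_mult: "clifford_reverse (clifford_vec v \<star> a) = clifford_reverse a \<star> clifford_vec v"
proof -
 have basis: "clifford_reverse (eprod {i} \<star> eprod A) = clifford_reverse (eprod A) \<star> eprod {i}" for i A
 proof -
  have "reversal_sign (card ({i} \<oplus> A)) * clifford_sign {i} A = reversal_sign (card A) * clifford_sign A {i}"
  proof (cases "i \<in> A")
   case True
   then obtain k where k: "card A = Suc k" by (metis card_Suc_Diff1 finite)
   have "{i} \<oplus> A = A - {i}" using True by auto
   hence "card ({i} \<oplus> A) = k" using True k by simp
   moreover have "clifford_sign {i} A * clifford_sign A {i} = (-1) ^ k"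
    using clifford_sign_swap[of i A] True k by simp
   hence "clifford_sign {i} A = (-1) ^ k * clifford_sign A {i}"
    by (metis clifford_sign_square mult.assoc mult.right_neutral)
   ultimately show ?thesis by (simp add: k reversal_sign_Suc)
  next
   case False
   have "{i} \<oplus> A = insert i A" using False by auto
   hence "card ({i} \<oplus> A) = Suc (card A)" using False by simp
   moreover have "clifford_sign {i} A * clifford_sign A {i} = (-1) ^ card A"
    using clifford_sign_swap[of i A] False by simp
   hence "clifford_sign {i} A = (-1) ^ card A * clifford_sign A {i}"
    by (metis clifford_sign_square mult.assoc mult.right_neutral)
   ultimately show ?thesis by (simp add: reversal_sign_Suc)
  qed
  moreover have "A \<oplus> {i} = {i} \<oplus> A" by auto
  ultimately show ?thesis
   by (simp add: eprod_mult clifford_reverse_eprod linear_cmul[OF linear_reverse] clifford.scaleR_left mult.commute)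
 qed
 have 1: "clifford_reverse (eprod {i} \<star> a) = clifford_reverse a \<star> eprod {i}" for i
  by (rule clifford_linear_eqI[where f = "\<lambda>a. clifford_reverse (eprod {i} \<star> a)" and g = "\<lambda>a. clifford_reverse a \<star> eprod {i}"])
   (auto intro!: linear_compose[OF linear_clifford(2) linear_reverse, unfolded o_def]
    linear_compose[OF linear_reverse linear_clifford(1), unfolded o_def] simp: basis)
 show ?thesis
  unfolding clifford_vec_def
  by (simp add: clifford.sum_left clifford.sum_right clifford.scaleR_left clifford.scaleR_right
    linear_sum[OF linear_reverse] linear_cmul[OF linear_reverse] 1)
qed

definition vprod :: "'n::{finite,linorder} rvector list => 'n clifford"
 where "vprod vs = foldr (\<lambda>v a. clifford_vec v \<star> a) vs clifford_one"

lemma vprod_simps [simp]: "vprod [] = clifford_one" "vprod (v # vs) = clifford_vec v \<star> vprod vs"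
 by (simp_all add: vprod_def)

lemma vprod_append: "vprod (us @ vs) = vprod us \<star> vprod vs"
 by (induction us) (simp_all add: clifford_assoc)

lemma clifford_reverse_vprod: "clifford_reverse (vprod vs) = vprod (rev vs)"
 by (induction vs) (simp_all add: clifford_reverse_vec_mult vprod_append)

lemma spin_group_iff: "g \<in> spin_group W \<longleftrightarrow> (\<exists>vs. g = vprod vs \<and> even (length vs) \<and> (\<forall>v\<in>set vs. v \<in> W \<and> norm v = 1))"
 by (auto simp: spin_group_def vprod_def)

lemma vprod_rev:
 assumes "\<forall>v\<in>set vs. norm v = 1"
 shows "vprod vs \<star> vprod (rev vs) = (-1) ^ length vs *\<^sub>R clifford_one"
 using assms
proof (induction vs)
 case (Cons v vs)
 have "vprod (v # vs) \<star> vprod (rev (v # vs)) = clifford_vec v \<star> (vprod vs \<star> vprod (rev vs)) \<star> clifford_vec v"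
  by (simp add: vprod_append clifford_assoc)
 thus ?case
  using Cons by (simp add: clifford.scaleR_left clifford.scaleR_right clifford_vec_unit_square)
qed auto

lemma spin_group_mono: "W \<subseteq> W' ==> spin_group W \<subseteq> spin_group W'"
 unfolding subset_iff spin_group_iff by blast

lemma spin_group_one: "clifford_one \<in> spin_group W"
 unfolding spin_group_iff by (rule exI[of _ "[]"]) simp

lemma spin_group_mult: "g \<in> spin_group W ==> h \<in> spin_group W ==> g \<star> h \<in> spin_group W"
 unfolding spin_group_iff
proof clarify
 fix us vs assume "even (length us)" "\<forall>v\<in>set us. v \<in> W \<and> norm v = 1"
  "even (length vs)" "\<forall>v\<in>set vs. v \<in> W \<and> norm v = 1"
 thus "\<exists>ws. vprod us \<star> vprod vs = vprod ws \<and> even (length ws) \<and> (\<forall>v\<in>set ws. v \<in> W \<and> norm v = 1)"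
  by (intro exI[of _ "us @ vs"]) (auto simp: vprod_append)
qed

lemma spin_group_pair: "norm u = 1 ==> norm v = 1 ==> u \<in> W ==> v \<in> W ==> clifford_vec u \<star> clifford_vec v \<in> spin_group W"
 unfolding spin_group_iff by (rule exI[of _ "[u, v]"]) simp

lemma spin_group_reverse: "g \<in> spin_group W ==> clifford_reverse g \<in> spin_group W"
 unfolding spin_group_iff by (metis clifford_reverse_vprod length_rev set_rev)

lemma spin_group_inverse:
 assumes "g \<in> spin_group W"
 shows "g \<star> clifford_reverse g = clifford_one" "clifford_reverse g \<star> g = clifford_one"
proof -
 obtain vs where vs: "g = vprod vs" "even (length vs)" "\<forall>v\<in>set vs. norm v = 1"
  using assms unfolding spin_group_iff by blast
 show "g \<star> clifford_reverse g = clifford_one"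
  using vprod_rev[OF vs(3)] vs(2) by (simp add: vs(1) clifford_reverse_vprod)
 show "clifford_reverse g \<star> g = clifford_one"
  using vprod_rev[of "rev vs"] vs by (simp add: clifford_reverse_vprod)
qed

text \<open>With the reversed product in place of the inverse, a single unit vector acts as the
  reflection in its orthogonal hyperplane without an extra sign, so that a product of vectors acts
  as a product of reflections.\<close>

lemma vprod_conjugation:
 assumes "\<forall>v\<in>set vs. norm v = 1"
 shows "\<exists>R. orthogonal_transformation R \<and> (\<forall>x. vprod vs \<star> clifford_vec x \<star> vprod (rev vs) = clifford_vec (R x))"
 using assms
proof (induction vs)
 case Nil
 show ?case by (rule exI[of _ "\<lambda>x. x"]) simp
next
 case (Cons v vs)
 then obtain R where R: "orthogonal_transformation R"
  "\<And>x. vprod vs \<star> clifford_vec x \<star> vprod (rev vs) = clifford_vec (R x)" by auto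
 have v: "norm v = 1" "v \<bullet> v = 1" using Cons.prems by (simp_all add: dot_square_norm)
 define S where "S x = x - (2 * (v \<bullet> x)) *\<^sub>R v" for x
 have "linear S" unfolding S_def
  by (rule linearI) (simp_all add: inner_add_right algebra_simps)
 moreover have "S x \<bullet> S y = x \<bullet> y" for x y
  using v by (simp add: S_def inner_diff_left inner_diff_right inner_commute)
 ultimately have S: "orthogonal_transformation S" by (simp add: orthogonal_transformation_def)
 have "vprod (v # vs) \<star> clifford_vec x \<star> vprod (rev (v # vs)) = clifford_vec (S (R x))" for x
 proof -
  have "vprod (v # vs) \<star> clifford_vec x \<star> vprod (rev (v # vs))
    = clifford_vec v \<star> (vprod vs \<star> clifford_vec x \<star> vprod (rev vs)) \<star> clifford_vec v"
   by (simp add: vprod_append clifford_assoc)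
  thus ?thesis using clifford_vec_reflection[OF v(1)] by (simp add: R(2) S_def)
 qed
 moreover have "orthogonal_transformation (\<lambda>x. S (R x))"
  using orthogonal_transformation_compose[OF S R(1)] by (simp add: o_def)
 ultimately show ?case by blast
qed

lemma spin_cover:
 assumes "g \<in> spin_group W"
 shows "g \<star> clifford_vec x \<star> clifford_reverse g = clifford_vec (spin_cover g *v x)"
  and "orthogonal_transformation ((*v) (spin_cover g))"
proof -
 obtain vs where vs: "g = vprod vs" "\<forall>v\<in>set vs. norm v = 1"
  using assms unfolding spin_group_iff by blast
 obtain R where R: "orthogonal_transformation R" "\<And>x. g \<star> clifford_vec x \<star> clifford_reverse g = clifford_vec (R x)"
  using vprod_conjugation[OF vs(2)] vs(1) by (auto simp: clifford_reverse_vprod)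
 have "spin_cover g = matrix R"
  unfolding spin_cover_def matrix_def R(2) by (simp add: clifford_vec_nth)
 hence "(*v) (spin_cover g) = R"
  using R(1) orthogonal_transformation_linear matrix_works by fastforce
 with R show "g \<star> clifford_vec x \<star> clifford_reverse g = clifford_vec (spin_cover g *v x)"
  "orthogonal_transformation ((*v) (spin_cover g))" by simp_all
qed

lemma clifford_reverse_mult_spin:
 assumes "g \<in> spin_group W" "h \<in> spin_group W'"
 shows "clifford_reverse (g \<star> h) = clifford_reverse h \<star> clifford_reverse g"
proof -
 obtain us vs where "g = vprod us" "h = vprod vs"
  using assms unfolding spin_group_iff by blast
 thus ?thesis by (simp add: clifford_reverse_vprod vprod_append flip: vprod_append)
qed

lemma spin_cover_mult:
 assumes "g \<in> spin_group W" "h \<in> spin_group W"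
 shows "spin_cover (g \<star> h) = spin_cover g ** spin_cover h"
proof (rule matrix_eq[THEN iffD2], rule allI)
 fix x
 have "clifford_vec (spin_cover (g \<star> h) *v x) = g \<star> (h \<star> clifford_vec x \<star> clifford_reverse h) \<star> clifford_reverse g"
  unfolding spin_cover(1)[OF spin_group_mult[OF assms], symmetric]
  by (simp add: clifford_reverse_mult_spin[OF assms] clifford_assoc)
 also have "\<dots> = clifford_vec (spin_cover g *v (spin_cover h *v x))"
  by (simp add: spin_cover(1)[OF assms(1)] spin_cover(1)[OF assms(2)])
 finally show "spin_cover (g \<star> h) *v x = (spin_cover g ** spin_cover h) *v x"
  by (simp add: clifford_vec_inject matrix_vector_mul_assoc)
qed

lemma clifford_vec_mult_nth: "(clifford_vec v \<star> a) $ C = (\<Sum>i\<in>UNIV. v $ i * clifford_sign {i} ({i} \<oplus> C) * a $ ({i} \<oplus> C))"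
proof -
 have "(eprod {i} \<star> a) $ C = clifford_sign {i} ({i} \<oplus> C) * a $ ({i} \<oplus> C)" for i
 proof -
  have "eprod {i} \<star> a = (\<Sum>A\<in>UNIV. a $ A *\<^sub>R (clifford_sign {i} A *\<^sub>R eprod ({i} \<oplus> A)))"
   by (subst vec_expand[of a]) (simp add: clifford.sum_right clifford.scaleR_right eprod_mult)
  hence "(eprod {i} \<star> a) $ C = (\<Sum>A\<in>UNIV. if A = {i} \<oplus> C then clifford_sign {i} A * a $ A else 0)"
   by (simp only: sum_component) (intro sum.cong refl, auto simp: axis_def)
  thus ?thesis by simp
 qed
 thus ?thesis
  by (simp add: clifford_vec_def clifford.sum_left clifford.scaleR_left sum_component mult.assoc)
qed

lemma card_sym_diff_single: "odd (card ({i} \<oplus> C)) \<longleftrightarrow> even (card C)" for C :: "'a::finite set"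
proof (cases "i \<in> C")
 case True
 hence "{i} \<oplus> C = C - {i}" by auto
 moreover have "card C = Suc (card (C - {i}))" using True by (metis card_Suc_Diff1 finite)
 ultimately show ?thesis by simp
next
 case False
 hence "{i} \<oplus> C = insert i C" by auto
 thus ?thesis using False by simp
qed

lemma vprod_parity: "odd (card A + length vs) ==> vprod vs $ A = 0"
proof (induction vs arbitrary: A)
 case Nil
 thus ?case by (auto simp: clifford_one_def axis_def)
next
 case (Cons v vs)
 have "vprod vs $ ({i} \<oplus> A) = 0" for i
  using Cons.prems card_sym_diff_single[of i A] by (intro Cons.IH) auto
 thus ?case by (simp add: clifford_vec_mult_nth)
qed

lemma spin_group_even: "g \<in> spin_group W ==> odd (card A) ==> g $ A = 0"
 using vprod_parity unfolding spin_group_iff by (metis even_add)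

lemma vprod_support: "\<forall>v\<in>set vs. v $ l = 0 ==> l \<in> A ==> vprod vs $ A = 0"
proof (induction vs arbitrary: A)
 case Nil
 thus ?case by (auto simp: clifford_one_def axis_def)
next
 case (Cons v vs)
 have "v $ i * clifford_sign {i} ({i} \<oplus> A) * vprod vs $ ({i} \<oplus> A) = 0" for i
 proof (cases "i = l")
  case False
  hence "l \<in> {i} \<oplus> A" using Cons.prems by auto
  thus ?thesis using Cons by simp
 qed (use Cons.prems in simp)
 thus ?case unfolding vprod_simps clifford_vec_mult_nth by (intro sum.neutral) blast
qed

lemma spin_group_support:
 assumes "g \<in> spin_group {v. v $ l = 0}" "l \<in> A"
 shows "g $ A = 0"
proof -
 obtain vs where "g = vprod vs" "\<forall>v\<in>set vs. v $ l = 0"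
  using assms(1) unfolding spin_group_iff by blast
 thus ?thesis using vprod_support[OF _ assms(2)] by simp
qed

section \<open>The kernel of the covering and the stabilizer of a basis vector\<close>

lemma eprod_single_mult_nth:
 "(eprod {i} \<star> a) $ ({i} \<oplus> A) = clifford_sign {i} A * a $ A"
 "(a \<star> eprod {i}) $ ({i} \<oplus> A) = clifford_sign A {i} * a $ A"
proof -
 have "eprod {i} \<star> a = (\<Sum>B\<in>UNIV. a $ B *\<^sub>R (clifford_sign {i} B *\<^sub>R eprod ({i} \<oplus> B)))"
  by (subst vec_expand[of a]) (simp add: clifford.sum_right clifford.scaleR_right eprod_mult)
 hence "(eprod {i} \<star> a) $ ({i} \<oplus> A) = (\<Sum>B\<in>UNIV. if B = A then clifford_sign {i} A * a $ A else 0)"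
  by (simp only: sum_component) (intro sum.cong refl, auto simp: axis_component)
 thus "(eprod {i} \<star> a) $ ({i} \<oplus> A) = clifford_sign {i} A * a $ A" by simp
 have "a \<star> eprod {i} = (\<Sum>B\<in>UNIV. a $ B *\<^sub>R (clifford_sign B {i} *\<^sub>R eprod ({i} \<oplus> B)))"
  by (subst vec_expand[of a]) (simp add: clifford.sum_left clifford.scaleR_left eprod_mult Un_commute)
 hence "(a \<star> eprod {i}) $ ({i} \<oplus> A) = (\<Sum>B\<in>UNIV. if B = A then clifford_sign A {i} * a $ A else 0)"
  by (simp only: sum_component) (intro sum.cong refl, auto simp: axis_component)
 thus "(a \<star> eprod {i}) $ ({i} \<oplus> A) = clifford_sign A {i} * a $ A" by simp
qed

text \<open>An element over the identity commutes with all vectors. For nonempty A of even size, a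
  basis vector with index in A anticommutes with the basis product of A, so that coefficient
  vanishes; those of odd size vanish by parity. A scalar remains, and its square is 1 because
  reversal is inversion.\<close>

lemma spin_cover_kernel:
 assumes g: "g \<in> spin_group W" and cov: "spin_cover g = mat 1"
 shows "g = clifford_one \<or> g = - clifford_one"
proof -
 have comm: "g \<star> clifford_vec x = clifford_vec x \<star> g" for x
 proof -
  have "g \<star> clifford_vec x = (g \<star> clifford_vec x \<star> clifford_reverse g) \<star> g"
   by (simp add: clifford_assoc spin_group_inverse[OF g])
  thus ?thesis by (simp add: spin_cover(1)[OF g] cov)
 qed
 have "g $ A = 0" if A: "A \<noteq> {}" for A
 proof (cases "odd (card A)")
  case False
  obtain i where i: "i \<in> A" using A by blast
  have "clifford_sign {i} A * g $ A = clifford_sign A {i} * g $ A"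
   using arg_cong[OF comm[of "axis i 1"], of "\<lambda>a. a $ ({i} \<oplus> A)"]
   by (simp only: clifford_vec_axis eprod_single_mult_nth)
  moreover have "clifford_sign {i} A * clifford_sign A {i} = -1"
   using clifford_sign_swap[of i A] i False by simp
  hence "clifford_sign {i} A \<noteq> clifford_sign A {i}"
   using clifford_sign_square[of A "{i}"] by auto
  ultimately show ?thesis by simp
 qed (use spin_group_even[OF g] in blast)
 hence sc: "g = g $ {} *\<^sub>R clifford_one"
  by (auto simp: vec_eq_iff clifford_one_def axis_component)
 define l where "l = g $ {}"
 have "g \<star> clifford_reverse g = (l * l) *\<^sub>R clifford_one"
  by (subst (1 2) sc) (simp add: linear_cmul[OF linear_reverse] clifford.scaleR_left clifford.scaleR_right l_def)
 hence "(l * l) *\<^sub>R clifford_one = (clifford_one :: 'a clifford)"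
  using spin_group_inverse(1)[OF g] by simp
 hence "((l * l) *\<^sub>R (clifford_one :: 'a clifford)) $ {} = (clifford_one :: 'a clifford) $ {}" by simp
 hence "l * l = 1" by (simp add: clifford_one_def axis_component)
 hence "l = 1 \<or> l = -1" by (simp add: square_eq_1_iff)
 thus ?thesis using sc by (auto simp: l_def)
qed

text \<open>A plane spanned by two unit vectors meets every hyperplane, so that their product, a rotation
 of the plane, is also the product of a unit vector of the plane with one of the hyperplane.\<close>
lemma vec_mult_split:
 fixes u w :: "'n::{finite,linorder} rvector"
 assumes u: "norm u = 1" and w: "norm w = 1" and n: "CARD('n) \<ge> 2"
 obtains w' h where "norm w' = 1" "norm h = 1" "h $ l = 0" "clifford_vec u \<star> clifford_vec w = clifford_vec w' \<star> clifford_vec h"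
proof -
 note obtained = that
 have step: thesis if h: "norm h = 1" "h $ l = 0" "h = a *\<^sub>R u + b *\<^sub>R w" for h a b
 proof -
  \<comment> \<open>Chosen such that u w h = - w' in the Clifford algebra; multiplying by the unit
    vector h from the right gives u w = w' h.\<close>
  define w' where "w' = b *\<^sub>R u - a *\<^sub>R (w - (2 * (u \<bullet> w)) *\<^sub>R u)"
  let ?u = "clifford_vec u" and ?w = "clifford_vec w" and ?h = "clifford_vec h"
  have "?u \<star> ?w \<star> ?h = a *\<^sub>R (?u \<star> ?w \<star> ?u) + b *\<^sub>R (?u \<star> (?w \<star> ?w))"
   unfolding h(3) clifford_vec_add clifford_vec_scaleR
   by (simp add: clifford.add_right clifford.scaleR_right clifford_assoc)
  also have "\<dots> = - clifford_vec w'"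
   unfolding clifford_vec_reflection[OF u] clifford_vec_unit_square[OF w]
   by (simp add: w'_def clifford_vec_diff clifford_vec_add clifford_vec_scaleR clifford.minus_right algebra_simps)
  finally have e: "?u \<star> ?w \<star> ?h = - clifford_vec w'" .
  have "(?u \<star> ?w \<star> ?h) \<star> ?h = - (?u \<star> ?w)"
   by (simp add: clifford_assoc clifford_vec_unit_square[OF h(1)] clifford.minus_right)
  hence r: "?u \<star> ?w = clifford_vec w' \<star> ?h"
   unfolding e by (simp add: clifford.minus_left)
  \<comment> \<open>The length of \<open>w'\<close> is read off from its square, which is the
    product of three unit vectors times the reversed product.\<close>
  have "clifford_vec w' = clifford_reverse (clifford_vec w')"
   using clifford_reverse_vec_mult[of w' clifford_one] by simp
  also have "\<dots> = - clifford_reverse (vprod [u, w, h])"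
   using e by (simp add: clifford_assoc linear_neg[OF linear_reverse, symmetric])
  also have "\<dots> = - vprod [h, w, u]" unfolding clifford_reverse_vprod by simp
  finally have "clifford_vec w' \<star> clifford_vec w' = (- (vprod [u, w, h])) \<star> (- vprod (rev [u, w, h]))"
   using e by (simp add: clifford_assoc)
  also have "\<dots> = vprod [u, w, h] \<star> vprod (rev [u, w, h])"
   by (simp only: clifford.minus_left clifford.minus_right minus_minus)
  also have "\<dots> = - clifford_one" using vprod_rev[of "[u, w, h]"] u w h(1) by simp
  finally have "(w' \<bullet> w') *\<^sub>R (clifford_one :: 'n clifford) = clifford_one"
   unfolding clifford_vec_square by simp
  hence "((w' \<bullet> w') *\<^sub>R (clifford_one :: 'n clifford)) $ {} = (clifford_one :: 'n clifford) $ {}" by simp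
  hence "w' \<bullet> w' = 1" by (simp add: clifford_one_def axis_component)
  hence "norm w' = 1" by (simp add: norm_eq_sqrt_inner)
  thus thesis using obtained h(1,2) r by blast
 qed
 \<comment> \<open>The combination of \<open>u\<close> and \<open>w\<close> whose coordinate
   \<open>l\<close> is zero.\<close>
 define h where "h = (w $ l) *\<^sub>R u - (u $ l) *\<^sub>R w"
 consider "w $ l = 0" | "w $ l \<noteq> 0" "h = 0" | "h \<noteq> 0" by blast
 thus thesis
 proof cases
  case 1
  thus thesis using that u w by blast
 next
  case 2
  hence uw: "u = (u $ l / w $ l) *\<^sub>R w"
   by (simp add: h_def vec_eq_iff field_simps)
  \<comment> \<open>Here \<open>u\<close> and \<open>w\<close> are parallel and their product is a
    scalar, 1 or -1; any unit vector of the hyperplane and its multiple by \<open>k\<close> can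
    replace them.\<close>
  have "\<not> (UNIV :: 'n set) \<subseteq> {l}"
   using n card_mono[of "{l}" "UNIV :: 'n set"] by auto
  then obtain i :: 'n where i: "i \<noteq> l" by blast
  define e where "e = (axis i 1 :: 'n rvector)"
  have e: "norm e = 1" "e $ l = 0" using i by (simp_all add: e_def norm_axis_1 axis_component)
  define k where "k = u $ l / w $ l"
  have k: "\<bar>k\<bar> = 1" using uw u w by (metis k_def mult.right_neutral norm_scaleR)
  have "clifford_vec u \<star> clifford_vec w = clifford_vec (k *\<^sub>R e) \<star> clifford_vec e"
   by (subst uw) (simp add: clifford_vec_scaleR clifford.scaleR_left clifford_vec_unit_square w e k_def)
  moreover have "norm (k *\<^sub>R e) = 1" using k e by simp
  ultimately show thesis using that e by blast
 next
  case 3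
  define h' where "h' = h /\<^sub>R norm h"
  have "norm h' = 1" "h' $ l = 0" using 3 by (simp_all add: h'_def h_def)
  moreover have "h' = (w $ l / norm h) *\<^sub>R u + (- u $ l / norm h) *\<^sub>R w"
   by (simp add: h'_def h_def algebra_simps divide_inverse)
  ultimately show thesis by (rule step)
 qed
qed

text \<open>Working from the right, each new factor is combined with the one vector that may lie
  outside the hyperplane, and the pair is exchanged for a new such vector followed by one
  inside.\<close>

lemma vprod_split:
 fixes vs :: "'n::{finite,linorder} rvector list"
 assumes "\<forall>v\<in>set vs. norm v = 1" "vs \<noteq> []" and n: "CARD('n) \<ge> 2"
 shows "\<exists>w hs. norm w = 1 \<and> (\<forall>h\<in>set hs. h $ l = 0 \<and> norm h = 1) \<and> Suc (length hs) = length vs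
  \<and> vprod vs = clifford_vec w \<star> vprod hs"
 using assms(1,2)
proof (induction vs)
 case (Cons v vs)
 show ?case
 proof (cases "vs = []")
  case True
  thus ?thesis using Cons.prems by (intro exI[of _ v] exI[of _ "[]"]) simp
 next
  case False
  then obtain w hs where w: "norm w = 1" "\<forall>h\<in>set hs. h $ l = 0 \<and> norm h = 1" "Suc (length hs) = length vs"
   "vprod vs = clifford_vec w \<star> vprod hs" using Cons by auto
  have "norm v = 1" using Cons.prems by simp
  then obtain w' h where "norm w' = 1" "norm h = 1" "h $ l = 0"
   "clifford_vec v \<star> clifford_vec w = clifford_vec w' \<star> clifford_vec h"
   using vec_mult_split[OF _ w(1) n] by blast
  thus ?thesis using w
   by (intro exI[of _ w'] exI[of _ "h # hs"]) (simp flip: clifford_assoc)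
 qed
qed simp

text \<open>Write g as one vector w followed by vectors of the hyperplane. Their number is odd, so
  their product anticommutes with \<open>e\<^sub>l\<close>, while g commutes with
  \<open>e\<^sub>l\<close>. Hence w anticommutes with \<open>e\<^sub>l\<close> too, which means that
  w lies in the hyperplane.\<close>

lemma spin_group_stabilizer:
 fixes g :: "'n::{finite,linorder} clifford"
 assumes g: "g \<in> SpinG" and stab: "spin_cover g *v axis l 1 = axis l 1" and n: "CARD('n) \<ge> 2"
 shows "g \<in> spin_group {v. v $ l = 0}"
proof -
 obtain vs where vs: "g = vprod vs" "even (length vs)" "\<forall>v\<in>set vs. norm v = 1"
  using g unfolding spin_group_iff by blast
 show ?thesis
 proof (cases "vs = []")
  case True
  thus ?thesis using vs spin_group_one by simp
 next
  case False
  then obtain w hs where w: "norm w = 1" "\<forall>h\<in>set hs. h $ l = 0 \<and> norm h = 1" "Suc (length hs) = length vs"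
   "vprod vs = clifford_vec w \<star> vprod hs" using vprod_split[OF vs(3) False n] by blast
  let ?e = "egen l"
  have e_hs: "?e \<star> vprod hs = (-1) ^ length hs *\<^sub>R (vprod hs \<star> ?e)"
   using w(2)
  proof (induction hs)
   case (Cons h hs)
   have "axis l 1 \<bullet> h = 0" using Cons.prems by (simp add: inner_axis')
   hence "?e \<star> clifford_vec h = - (clifford_vec h \<star> ?e)"
    using clifford_vec_anticommute[of "axis l 1" h] by (simp add: eq_neg_iff_add_eq_0)
   hence "?e \<star> (clifford_vec h \<star> vprod hs) = - (clifford_vec h \<star> (?e \<star> vprod hs))"
    by (metis clifford.minus_left clifford_assoc)
   thus ?case using Cons by (simp add: clifford.scaleR_right clifford_assoc)
  qed simp
  have odd: "odd (length hs)" using w(3) vs(2) by presburger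
  have "g \<star> ?e = ?e \<star> g"
  proof -
   have "g \<star> ?e = (g \<star> ?e \<star> clifford_reverse g) \<star> g"
    by (simp add: clifford_assoc spin_group_inverse[OF g])
   thus ?thesis by (simp add: spin_cover(1)[OF g] stab)
  qed
  hence "clifford_vec w \<star> (vprod hs \<star> ?e) = ?e \<star> clifford_vec w \<star> vprod hs"
   by (simp add: vs(1) w(4) clifford_assoc)
  moreover have "vprod hs \<star> ?e = - (?e \<star> vprod hs)" using e_hs odd by simp
  ultimately have z: "(clifford_vec w \<star> ?e + ?e \<star> clifford_vec w) \<star> vprod hs = 0"
   by (simp add: clifford.add_left clifford.minus_right clifford_assoc neg_eq_iff_add_eq_0)
  have r: "vprod hs \<star> vprod (rev hs) = - clifford_one"
   using vprod_rev[of hs] w(2) odd by simp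
  have "(clifford_vec w \<star> ?e + ?e \<star> clifford_vec w) \<star> (vprod hs \<star> vprod (rev hs))
    = (clifford_vec w \<star> ?e + ?e \<star> clifford_vec w) \<star> vprod hs \<star> vprod (rev hs)"
   by (rule clifford_assoc[symmetric])
  also have "\<dots> = 0" unfolding z by (rule clifford.zero_left)
  finally have "(clifford_vec w \<star> ?e + ?e \<star> clifford_vec w) \<star> (vprod hs \<star> vprod (rev hs)) = 0" .
  hence "(clifford_vec w \<star> ?e + ?e \<star> clifford_vec w) \<star> (- clifford_one) = 0"
   by (simp only: r)
  hence "clifford_vec w \<star> ?e + ?e \<star> clifford_vec w = 0"
   by (simp only: clifford.minus_right clifford_one_right neg_equal_0_iff_equal)
  hence "(- 2 * (w \<bullet> axis l 1)) *\<^sub>R (clifford_one :: 'n clifford) = 0"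
   unfolding clifford_vec_anticommute .
  moreover have "(clifford_one :: 'n clifford) \<noteq> 0" by (simp add: clifford_one_def axis_eq_0_iff)
  ultimately have "w $ l = 0" by (simp add: inner_axis)
  hence "\<forall>v\<in>set (w # hs). v \<in> {v. v $ l = 0} \<and> norm v = 1" using w(1,2) by simp
  moreover have "g = vprod (w # hs)" "even (length (w # hs))" using vs w by simp_all
  ultimately show ?thesis unfolding spin_group_iff by blast
 qed
qed

section \<open>Half spin modules\<close>

lemma bounded_bilinear_matrix_mult:
 "bounded_bilinear ((**) :: complex ^ 'k ^ 'k => complex ^ 'k ^ 'k => complex ^ 'k ^ 'k)"
proof -
 have "bilinear ((**) :: complex ^ 'k ^ 'k => complex ^ 'k ^ 'k => complex ^ 'k ^ 'k)"
  unfolding bilinear_def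
  by (auto intro!: linearI simp: vec_eq_iff matrix_matrix_mult_def algebra_simps sum.distrib scaleR_sum_right)
 thus ?thesis by (simp add: bilinear_conv_bounded_bilinear)
qed

interpretation mmult: bounded_bilinear "(**) :: complex ^ 'k ^ 'k => complex ^ 'k ^ 'k => complex ^ 'k ^ 'k"
 by (rule bounded_bilinear_matrix_mult)

lemma bounded_bilinear_matrix_vector:
 "bounded_bilinear ((*v) :: complex ^ 'k ^ 'k => complex ^ 'k => complex ^ 'k)"
proof -
 have "bilinear ((*v) :: complex ^ 'k ^ 'k => complex ^ 'k => complex ^ 'k)"
  unfolding bilinear_def
  by (auto intro!: linearI simp: vec_eq_iff matrix_vector_mult_def algebra_simps sum.distrib scaleR_sum_right)
 thus ?thesis by (simp add: bilinear_conv_bounded_bilinear)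
qed

interpretation mvec: bounded_bilinear "(*v) :: complex ^ 'k ^ 'k => complex ^ 'k => complex ^ 'k"
 by (rule bounded_bilinear_matrix_vector)

lemma smult_matrix_vector: "M *v (a *s u) = a *s (M *v (u :: complex ^ 'k))"
 by (simp add: vec_eq_iff matrix_vector_mult_def sum_distrib_left algebra_simps)

lemma mat_minus_two: "(mat (-2) :: complex ^ 'k ^ 'k) = (-2) *\<^sub>R mat 1"
 by (simp add: vec_eq_iff mat_def scaleR_conv_of_real)

definition cprod :: "('n::{finite,linorder} => complex ^ 'k ^ 'k) => 'n set => complex ^ 'k ^ 'k"
 where "cprod c A = foldr (\<lambda>i M. c i ** M) (sorted_list_of_set A) (mat 1)"

lemma cprod_empty [simp]: "cprod c {} = mat 1"
 by (simp add: cprod_def)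

lemma cprod_insert_min:
 assumes "\<forall>a\<in>A. b < a"
 shows "cprod c (insert b A) = c b ** cprod c A"
proof -
 have "b \<notin> A" using assms by blast
 hence "sorted_list_of_set (insert b A) = insort b (sorted_list_of_set A)"
  by (simp add: sorted_list_of_set_insert)
 also have "\<dots> = b # sorted_list_of_set A"
  using assms by (intro insort_is_Cons) (auto simp: less_imp_le)
 finally show ?thesis by (simp add: cprod_def)
qed

definition clifford_relations :: "('n::{finite,linorder} => complex ^ 'k ^ 'k) => bool"
 where "clifford_relations c \<longleftrightarrow> (\<forall>i j. i \<noteq> last_index \<longrightarrow> j \<noteq> last_index \<longrightarrow>
   c i ** c j + c j ** c i = (if i = j then mat (-2) else 0))"

lemma irreducible_clifford_relations: "irreducible_clifford_module c ==> clifford_relations c"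
 unfolding irreducible_clifford_module_def clifford_relations_def by blast

definition neg_module :: "('n => complex ^ 'k ^ 'k) => 'n => complex ^ 'k ^ 'k"
 where "neg_module c i = - c i"

lemma neg_neg_module [simp]: "neg_module (neg_module c) = c"
 by (simp add: neg_module_def fun_eq_iff)

lemma clifford_relations_neg: "clifford_relations c ==> clifford_relations (neg_module c)"
 by (simp add: clifford_relations_def neg_module_def mmult.minus_left mmult.minus_right)

lemma clifford_relations_square:
 assumes "clifford_relations c" "i \<noteq> last_index"
 shows "c i ** c i = - mat 1"
proof -
 have "c i ** c i + c i ** c i = (-2) *\<^sub>R mat 1"
  using assms unfolding clifford_relations_def mat_minus_two by simp
 hence "2 *\<^sub>R (c i ** c i) = 2 *\<^sub>R (- mat 1)" by (simp add: scaleR_2)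
 thus ?thesis by (simp only: scaleR_cancel_left) simp
qed

lemma clifford_relations_anti:
 assumes "clifford_relations c" "i \<noteq> last_index" "j \<noteq> last_index" "i \<noteq> j"
 shows "c i ** c j = - (c j ** c i)"
 using assms unfolding clifford_relations_def by (simp add: eq_neg_iff_add_eq_0)

lemma clifford_sign_insert:
 "b \<notin> A ==> clifford_sign (insert b A) B = clifford_sign {b} B * clifford_sign A B"
 "b \<notin> A ==> clifford_sign B (insert b A) = clifford_sign B {b} * clifford_sign B A"
proof -
 assume "b \<notin> A"
 hence "insert b A = {b} \<oplus> A" by auto
 thus "clifford_sign (insert b A) B = clifford_sign {b} B * clifford_sign A B"
  "clifford_sign B (insert b A) = clifford_sign B {b} * clifford_sign B A"
  by (simp_all only: clifford_sign_left clifford_sign_right)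
qed

lemma clifford_sign_min: "\<forall>a\<in>A. b < a ==> clifford_sign {b} A = 1"
 by (auto simp: clifford_sign_eq_prod intro!: prod.neutral)

lemma cprod_single_mult:
 fixes A :: "'n::{finite,linorder} set"
 assumes c: "clifford_relations c" and i: "i \<noteq> last_index" and A: "last_index \<notin> A"
 shows "c i ** cprod c A = clifford_sign {i} A *\<^sub>R cprod c ({i} \<oplus> A)"
proof -
 have "finite A" by simp
 thus ?thesis using A
 proof (induction A rule: finite_linorder_min_induct)
  case empty
  show ?case using cprod_insert_min[of "{}" i c] by simp
 next
  case (insert b A)
  have bA: "b \<notin> A" "b \<noteq> last_index" "last_index \<notin> A" using insert.hyps(2) insert.prems by auto
  consider "i < b" | "i = b" | "b < i" by force
  thus ?case
  proof cases
   case 1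
   hence m: "\<forall>a\<in>insert b A. i < a" using insert.hyps(2) by auto
   hence "{i} \<oplus> insert b A = insert i (insert b A)" by auto
   thus ?thesis using cprod_insert_min[OF m, of c] clifford_sign_min[OF m] by simp
  next
   case 2
   have "{b} \<oplus> insert b A = A" using bA by auto
   moreover have "clifford_sign {b} (insert b A) = -1"
    using clifford_sign_insert(2)[OF bA(1), of "{b}"] clifford_sign_min[OF insert.hyps(2)]
    by (simp add: clifford_sign_single)
   ultimately show ?thesis unfolding 2
    by (simp add: cprod_insert_min[OF insert.hyps(2)] matrix_mul_assoc clifford_relations_square[OF c bA(2)]
      mmult.minus_left)
  next
   case 3
   have "c i ** cprod c (insert b A) = - (c b ** (c i ** cprod c A))"
    using clifford_relations_anti[OF c i bA(2)] 3
    by (simp add: cprod_insert_min[OF insert.hyps(2)] matrix_mul_assoc mmult.minus_left)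
   also have "\<dots> = - clifford_sign {i} A *\<^sub>R (c b ** cprod c ({i} \<oplus> A))"
    using insert.IH bA(3) by (simp add: mmult.scaleR_right)
   also have "c b ** cprod c ({i} \<oplus> A) = cprod c (insert b ({i} \<oplus> A))"
    using 3 insert.hyps(2) by (intro cprod_insert_min[symmetric]) auto
   also have "insert b ({i} \<oplus> A) = {i} \<oplus> insert b A" using 3 bA by auto
   also have "- clifford_sign {i} A = clifford_sign {i} (insert b A)"
    using 3 clifford_sign_insert(2)[OF bA(1), of "{i}"] by (simp add: clifford_sign_single)
   finally show ?thesis .
  qed
 qed
qed

text \<open>The matrices multiply with the same signs as the basis products of the Clifford algebra,
  so \<open>c\<close> extends to a representation. The induction removes the smallest index, for
  which no reordering is required.\<close>

lemma cprod_mult: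
 fixes A B :: "'n::{finite,linorder} set"
 assumes c: "clifford_relations c" and A: "last_index \<notin> A" and B: "last_index \<notin> B"
 shows "cprod c A ** cprod c B = clifford_sign A B *\<^sub>R cprod c (A \<oplus> B)"
proof -
 have "finite A" by simp
 thus ?thesis using A
 proof (induction A rule: finite_linorder_min_induct)
  case (insert b A)
  have bA: "b \<notin> A" "b \<noteq> last_index" "last_index \<notin> A" "last_index \<notin> A \<oplus> B"
   using insert.hyps(2) insert.prems B by auto
  have "cprod c (insert b A) ** cprod c B = c b ** (clifford_sign A B *\<^sub>R cprod c (A \<oplus> B))"
   using insert.IH bA(3) by (simp add: cprod_insert_min[OF insert.hyps(2)] matrix_mul_assoc[symmetric])
  also have "\<dots> = (clifford_sign A B * clifford_sign {b} (A \<oplus> B)) *\<^sub>R cprod c ({b} \<oplus> (A \<oplus> B))"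
   by (simp add: mmult.scaleR_right cprod_single_mult[OF c bA(2) bA(4)])
  also have "clifford_sign A B * clifford_sign {b} (A \<oplus> B) = clifford_sign (insert b A) B"
   by (simp add: clifford_sign_right clifford_sign_min[OF insert.hyps(2)] clifford_sign_insert(1)[OF bA(1)])
  also have "{b} \<oplus> (A \<oplus> B) = insert b A \<oplus> B" using bA by auto
  finally show ?case .
 qed simp
qed

text \<open>The even part of the Clifford algebra of \<open>\<real>\<^sup>N\<close> is isomorphic to the Clifford algebra of
 \<open>\<real>\<^sup>N\<^sup>-\<^sup>1\<close> by \<open>e\<^sub>N e\<^sub>i \<mapsto> e\<^sub>i\<close>.  Thus \<open>c\<close> induces the half spin representation \<open>rho c\<close>; the other
 one is \<open>rho (neg_module c)\<close>.  Only the values of \<open>rho\<close> on even elements are meaningful.\<close>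
definition emat :: "('n::{finite,linorder} => complex ^ 'k ^ 'k) => 'n set => complex ^ 'k ^ 'k"
 where "emat c A = (if last_index \<in> A then - cprod c (A - {last_index}) else cprod c A)"

definition rho :: "('n::{finite,linorder} => complex ^ 'k ^ 'k) => 'n clifford => complex ^ 'k ^ 'k"
 where "rho c a = (\<Sum>A\<in>UNIV. a $ A *\<^sub>R emat c A)"

definition even_clifford :: "'n::{finite,linorder} clifford => bool"
 where "even_clifford a \<longleftrightarrow> (\<forall>A. odd (card A) \<longrightarrow> a $ A = 0)"

lemma last_index_max: "i \<le> (last_index :: 'n::{finite,linorder})"
 unfolding last_index_def by (rule Max_ge) auto

lemma clifford_sign_last_left: "clifford_sign {last_index} B = (-1) ^ card B"
 for B :: "'n::{finite,linorder} set"
 by (simp add: clifford_sign_eq_prod last_index_max)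

lemma clifford_sign_last_right:
 fixes A :: "'n::{finite,linorder} set"
 assumes "last_index \<notin> A" shows "clifford_sign A {last_index} = 1"
proof -
 have "\<not> last_index \<le> a" if "a \<in> A" for a
  using last_index_max[of a] that assms by force
 thus ?thesis by (simp add: clifford_sign_eq_prod)
qed

text \<open>The factor \<open>e\<^sub>N\<close> causes no sign: as the largest index it is never out
  of order on the right, and from the left it passes an even number of factors. The minus sign in
  \<open>emat\<close> turns \<open>e\<^sub>i e\<^sub>N\<close> into \<open>- c i\<close>, in
  accordance with \<open>e\<^sub>N e\<^sub>i\<close> being \<open>c i\<close>.\<close>

lemma emat_mult:
 fixes A B :: "'n::{finite,linorder} set"
 assumes c: "clifford_relations c" and A: "even (card A)" and B: "even (card B)"
 shows "emat c A ** emat c B = clifford_sign A B *\<^sub>R emat c (A \<oplus> B)"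
proof -
 let ?l = "last_index :: 'n"
 define A0 B0 where "A0 = A - {?l}" and "B0 = B - {?l}"
 have l: "?l \<notin> A0" "?l \<notin> B0" by (simp_all add: A0_def B0_def)
 have AB0: "A0 \<oplus> B0 = (A \<oplus> B) - {?l}" by (auto simp: A0_def B0_def)
 note prod = cprod_mult[OF c l]
 have sA: "clifford_sign A C = (if ?l \<in> A then (-1) ^ card C * clifford_sign A0 C else clifford_sign A0 C)" for C
 proof (cases "?l \<in> A")
  case True
  hence "A = insert ?l A0" by (auto simp: A0_def)
  with True show ?thesis using clifford_sign_insert(1)[OF l(1), of C] by (simp add: clifford_sign_last_left)
 qed (simp add: A0_def)
 have sB: "clifford_sign A0 B = clifford_sign A0 B0"
 proof (cases "?l \<in> B")
  case True
  hence "B = insert ?l B0" by (auto simp: B0_def)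
  thus ?thesis using clifford_sign_insert(2)[OF l(2), of A0] by (simp add: clifford_sign_last_right[OF l(1)])
 qed (simp add: B0_def)
 have sgn: "clifford_sign A B = clifford_sign A0 B0"
  using sA[of B] sB B by simp
 have eA: "emat c A = (if ?l \<in> A then - cprod c A0 else cprod c A0)"
  and eB: "emat c B = (if ?l \<in> B then - cprod c B0 else cprod c B0)"
  by (simp_all add: emat_def A0_def B0_def)
 have eAB: "emat c (A \<oplus> B) = (if (?l \<in> A) \<noteq> (?l \<in> B) then - cprod c (A0 \<oplus> B0) else cprod c (A0 \<oplus> B0))"
  unfolding AB0 by (auto simp: emat_def)
 show ?thesis
  unfolding eA eB eAB sgn using prod by (simp add: mmult.minus_left mmult.minus_right)
qed

lemma linear_rho: "linear (rho c)"
 unfolding rho_def by (rule linearI) (simp_all add: scaleR_add_left sum.distrib scaleR_sum_right)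

lemmas rho_add = linear_add[OF linear_rho]
 and rho_diff = linear_diff[OF linear_rho]
 and rho_scaleR = linear_cmul[OF linear_rho]
 and rho_minus = linear_neg[OF linear_rho]
 and rho_sum = linear_sum[OF linear_rho]

lemma rho_eprod: "rho c (eprod A) = emat c A"
 by (simp add: rho_def axis_component if_distrib[of "\<lambda>x. x *\<^sub>R _"] cong: if_cong)

lemma rho_one [simp]: "rho c clifford_one = mat 1"
 by (simp add: clifford_one_def rho_eprod emat_def)

lemma rho_mult:
 assumes c: "clifford_relations c" and a: "even_clifford a" and b: "even_clifford b"
 shows "rho c (a \<star> b) = rho c a ** rho c b"
proof -
 have "rho c (a \<star> b) = (\<Sum>A\<in>UNIV. \<Sum>B\<in>UNIV. (a $ A * b $ B * clifford_sign A B) *\<^sub>R emat c (A \<oplus> B))"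
  unfolding clifford_mult_def by (simp add: rho_sum rho_scaleR rho_eprod)
 also have "\<dots> = (\<Sum>A\<in>UNIV. \<Sum>B\<in>UNIV. (a $ A * b $ B) *\<^sub>R (emat c A ** emat c B))"
 proof (intro sum.cong refl)
  fix A B :: "'a set"
  show "(a $ A * b $ B * clifford_sign A B) *\<^sub>R emat c (A \<oplus> B) = (a $ A * b $ B) *\<^sub>R (emat c A ** emat c B)"
   using a b by (cases "even (card A) \<and> even (card B)") (auto simp: emat_mult[OF c] even_clifford_def)
 qed
 also have "\<dots> = rho c a ** rho c b"
  unfolding rho_def mmult.sum_left
  by (simp add: mmult.sum_right mmult.scaleR_left mmult.scaleR_right scaleR_sum_right mult.commute)
 finally show ?thesis .
qed

lemma even_clifford_spin: "g \<in> spin_group W ==> even_clifford g"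
 unfolding even_clifford_def using spin_group_even by blast

lemma even_clifford_vec_vec: "even_clifford (clifford_vec u \<star> clifford_vec v)"
proof -
 have "(clifford_vec u \<star> clifford_vec v) $ A = 0" if "odd (card A)" for A
  using vprod_parity[of A "[u, v]"] that by simp
 thus ?thesis by (simp add: even_clifford_def)
qed

lemma even_clifford_mult:
 assumes "even_clifford a" "even_clifford b" shows "even_clifford (a \<star> b)"
proof -
 have zero: "(a $ A * b $ B * clifford_sign A B) *\<^sub>R (eprod (A \<oplus> B) $ C) = 0" if "odd (card C)" for A B C
 proof (cases "even (card A) \<and> even (card B)")
  case True
  have "card (A \<oplus> B) + 2 * card (A \<inter> B) = card A + card B"
  proof -
   have "card A = card (A - B) + card (A \<inter> B)" "card B = card (B - A) + card (A \<inter> B)"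
    "card (A \<oplus> B) = card (A - B) + card (B - A)"
    by (subst card_Un_disjoint[symmetric]; auto intro: arg_cong[where f = card])+
   thus ?thesis by simp
  qed
  hence "even (card (A \<oplus> B))" using True by presburger
  hence "C \<noteq> A \<oplus> B" using that by blast
  thus ?thesis by (simp add: axis_component)
 qed (use assms in \<open>auto simp: even_clifford_def\<close>)
 show ?thesis unfolding even_clifford_def clifford_mult_def
 proof (intro allI impI)
  fix C :: "'a set" assume "odd (card C)"
  thus "(\<Sum>A\<in>UNIV. \<Sum>B\<in>UNIV. (a $ A * b $ B * clifford_sign A B) *\<^sub>R eprod (A \<oplus> B)) $ C = 0"
   unfolding sum_component vector_scaleR_component by (intro sum.neutral ballI) (rule zero)
 qed
qed

abbreviation e_last :: "'n::{finite,linorder} clifford"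
 where "e_last \<equiv> eprod {last_index}"

lemma e_last_square: "e_last \<star> e_last = - clifford_one"
 by (simp add: eprod_mult clifford_sign_single clifford_one_def)

text \<open>An even product that contains \<open>e\<^sub>N\<close> has an odd number of other
  factors, and each of these changes sign.\<close>

lemma emat_neg:
 fixes A :: "'n::{finite,linorder} set"
 assumes "even (card A)"
 shows "emat (neg_module c) A = (if last_index \<in> A then - emat c A else emat c A)"
proof -
 have "foldr (\<lambda>i M. - c i ** M) xs (mat 1) = (-1) ^ length xs *\<^sub>R foldr (\<lambda>i M. c i ** M) xs (mat 1)" for xs
  by (induction xs) (simp_all add: mmult.minus_left mmult.scaleR_right)
 hence *: "cprod (neg_module c) A = (-1) ^ card A *\<^sub>R cprod c A" for A
  by (simp add: cprod_def neg_module_def length_sorted_list_of_set)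
 have "odd (card (A - {last_index}))" if "last_index \<in> A"
  using assms that by (simp add: card_Diff_singleton) (metis card_gt_0_iff empty_iff even_diff_nat finite gr0_conv_Suc not_less_eq_eq odd_one zero_order(1))
 thus ?thesis using assms by (auto simp: emat_def *)
qed

text \<open>The other half spin module is the first one twisted by conjugation with
  \<open>e\<^sub>N\<close>, whose inverse is its negative.\<close>

lemma rho_neg:
 fixes a :: "'n::{finite,linorder} clifford"
 assumes a: "even_clifford a"
 shows "rho (neg_module c) a = rho c (- (e_last \<star> a \<star> e_last))"
proof -
 have conj: "- (e_last \<star> eprod A \<star> e_last) = (if last_index \<in> A then - eprod A else eprod A)"
  if "even (card A)" for A :: "'n set"
 proof -
  have "clifford_sign {last_index} A * clifford_sign A {last_index} = (if last_index \<in> A then -1 else 1)"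
   using clifford_sign_swap[of last_index A] that by simp
  moreover have "e_last \<star> eprod A \<star> e_last
    = (clifford_sign {last_index} A * clifford_sign A {last_index}) *\<^sub>R (clifford_sign {last_index :: 'n} {last_index} *\<^sub>R eprod A)"
  proof -
   have "({last_index} \<oplus> A) \<oplus> {last_index} = A" by auto
   thus ?thesis
    by (simp add: eprod_mult clifford.scaleR_left clifford_sign_left mult.commute)
  qed
  ultimately show ?thesis by (simp add: clifford_sign_single)
 qed
 have lin: "linear (\<lambda>a. rho c (- (e_last \<star> a \<star> e_last)))"
  by (rule linearI) (simp_all add: clifford.add_right clifford.add_left clifford.scaleR_left clifford.scaleR_right
    rho_minus rho_add rho_diff rho_scaleR)
 have "rho c (- (e_last \<star> a \<star> e_last)) = (\<Sum>A\<in>UNIV. a $ A *\<^sub>R rho c (- (e_last \<star> eprod A \<star> e_last)))"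
  by (subst vec_expand[of a]) (simp only: linear_sum[OF lin] linear_cmul[OF lin])
 also have "\<dots> = rho (neg_module c) a"
  unfolding rho_def[of "neg_module c"]
 proof (intro sum.cong refl)
  fix A :: "'n set"
  show "a $ A *\<^sub>R rho c (- (e_last \<star> eprod A \<star> e_last)) = a $ A *\<^sub>R emat (neg_module c) A"
  proof (cases "even (card A)")
   case True
   thus ?thesis by (simp add: conj emat_neg rho_eprod rho_minus)
  qed (use a in \<open>auto simp: even_clifford_def\<close>)
 qed
 finally show ?thesis by simp
qed

text \<open>Clifford multiplication by \<open>v\<close> as a map from the half spin module of \<open>c\<close> to that of
 \<open>neg_module c\<close>, both identified by means of \<open>e\<^sub>N\<close>.\<close>
definition slash :: "('n::{finite,linorder} => complex ^ 'k ^ 'k) => 'n rvector => complex ^ 'k ^ 'k"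
 where "slash c v = - rho c (e_last \<star> clifford_vec v)"

lemma linear_slash: "linear (slash c)"
 unfolding slash_def
 by (rule linearI) (simp_all add: clifford_vec_add clifford_vec_scaleR clifford.add_right clifford.scaleR_right
   rho_add rho_scaleR)

lemma even_clifford_e_last_vec: "even_clifford (e_last \<star> clifford_vec v)" "even_clifford (clifford_vec v \<star> e_last)"
 unfolding clifford_vec_axis[symmetric] by (rule even_clifford_vec_vec)+

text \<open>The two copies of \<open>e\<^sub>N\<close> meet in the middle and contribute -1. In this
  normalisation Clifford multiplication by u followed by itself is multiplication by plus the
  squared length of u.\<close>

lemma slash_slash:
 assumes c: "clifford_relations c"
 shows "slash (neg_module c) u ** slash c v = - rho c (clifford_vec u \<star> clifford_vec v)"
proof -
 have "slash (neg_module c) u = - rho c (clifford_vec u \<star> e_last)"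
  unfolding slash_def rho_neg[OF even_clifford_e_last_vec(1)]
  by (simp add: clifford_assoc[symmetric] e_last_square clifford.minus_left)
 hence "slash (neg_module c) u ** slash c v = rho c ((clifford_vec u \<star> e_last) \<star> (e_last \<star> clifford_vec v))"
  by (simp add: slash_def mmult.minus_left mmult.minus_right rho_mult[OF c even_clifford_e_last_vec(2,1)])
 also have "(clifford_vec u \<star> e_last) \<star> (e_last \<star> clifford_vec v) = clifford_vec u \<star> (e_last \<star> e_last) \<star> clifford_vec v"
  by (simp add: clifford_assoc)
 finally show ?thesis
  by (simp add: e_last_square clifford.minus_left clifford.minus_right rho_minus)
qed

lemma slash_slash_self:
 assumes c: "clifford_relations c"
 shows "slash (neg_module c) u ** slash c u = (u \<bullet> u) *\<^sub>R mat 1"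
 by (simp add: slash_slash[OF c] clifford_vec_square rho_minus rho_scaleR)

lemma slash_anticommute:
 assumes c: "clifford_relations c"
 shows "slash (neg_module c) u ** slash c v + slash (neg_module c) v ** slash c u = (2 * (u \<bullet> v)) *\<^sub>R mat 1"
proof -
 have "rho c (clifford_vec u \<star> clifford_vec v) + rho c (clifford_vec v \<star> clifford_vec u) = (- 2 * (u \<bullet> v)) *\<^sub>R mat 1"
  by (simp only: linear_add[OF linear_rho, symmetric] clifford_vec_anticommute rho_scaleR rho_one)
 moreover have "slash (neg_module c) u ** slash c v + slash (neg_module c) v ** slash c u
   = - (rho c (clifford_vec u \<star> clifford_vec v) + rho c (clifford_vec v \<star> clifford_vec u))"
  by (simp add: slash_slash[OF c])
 ultimately show ?thesis by simp
qed

text \<open>In the Clifford algebra, the rotated vector times g equals g times v; conjugation by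
  \<open>e\<^sub>N\<close> turns the g on the left into its action on the other half spin
  module.\<close>

lemma slash_equivariant:
 assumes c: "clifford_relations c" and g: "g \<in> spin_group W"
 shows "slash c (spin_cover g *v v) ** rho c g = rho (neg_module c) g ** slash c v"
proof -
 note ev = even_clifford_spin[OF g]
 have "clifford_vec (spin_cover g *v v) \<star> g = g \<star> clifford_vec v"
  unfolding spin_cover(1)[OF g, symmetric] by (simp add: clifford_assoc spin_group_inverse[OF g])
 hence "slash c (spin_cover g *v v) ** rho c g = - rho c (e_last \<star> (g \<star> clifford_vec v))"
  by (simp add: slash_def mmult.minus_left clifford_assoc flip: rho_mult[OF c even_clifford_e_last_vec(1) ev])
 moreover
 obtain vs where vs: "g = vprod vs" "even (length vs)" using g unfolding spin_group_iff by blast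
 have "e_last \<star> g \<star> e_last = vprod (axis last_index 1 # vs @ [axis last_index 1])"
  by (simp add: vprod_append vs clifford_vec_axis clifford_assoc)
 hence m: "even_clifford (- (e_last \<star> g \<star> e_last))"
  using vprod_parity[where vs = "axis last_index 1 # vs @ [axis last_index 1]"] vs(2)
  by (simp add: even_clifford_def)
 have "rho (neg_module c) g ** slash c v = - rho c (- (e_last \<star> g \<star> e_last) \<star> (e_last \<star> clifford_vec v))"
  unfolding rho_neg[OF ev] slash_def rho_mult[OF c m even_clifford_e_last_vec(1)] mmult.minus_right ..
 moreover have "- (e_last \<star> g \<star> e_last) \<star> (e_last \<star> clifford_vec v) = e_last \<star> (g \<star> clifford_vec v)"
 proof -
  have "(e_last \<star> g \<star> e_last) \<star> (e_last \<star> clifford_vec v) = e_last \<star> (g \<star> ((e_last \<star> e_last) \<star> clifford_vec v))"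
   by (simp only: clifford_assoc)
  thus ?thesis by (simp add: e_last_square clifford.minus_left clifford.minus_right)
 qed
 ultimately show ?thesis by simp
qed

lemma clifford_action_spin:
 assumes "h \<in> spin_group {v. v $ last_index = 0}"
 shows "clifford_action c h = rho c h"
 unfolding clifford_action_def rho_def
 using spin_group_support[OF assms] by (intro sum.cong refl) (auto simp: emat_def cprod_def)

lemma rho_e_last_axis:
 assumes "i \<noteq> last_index"
 shows "rho c (e_last \<star> egen i) = c i"
proof -
 have "cprod c {i} = c i" using cprod_insert_min[of "{}" i c] by simp
 moreover have "({last_index} \<oplus> {i}) = insert last_index {i}" using assms by auto
 moreover have "insert last_index {i} - {last_index} = {i}" using assms by auto
 moreover have "i \<le> last_index" by (rule last_index_max)
 ultimately show ?thesis
  by (simp add: clifford_vec_axis eprod_mult rho_scaleR rho_minus rho_eprod clifford_sign_single emat_def)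
qed

section \<open>Homogeneous spinor polynomials\<close>

lemma complex_fun_dim_direct_sum:
 assumes U: "complex_fun.subspace U" "U \<subseteq> complex_fun.span SU" "finite SU"
  and V: "complex_fun.subspace V" "V \<subseteq> complex_fun.span SV" "finite SV"
  and UV: "U \<inter> V \<subseteq> {0}" and W: "W = {u + v | u v. u \<in> U \<and> v \<in> V}"
 shows "complex_fun.dim W = complex_fun.dim U + complex_fun.dim V"
proof -
 obtain BU where BU: "BU \<subseteq> U" "complex_fun.independent BU" "U \<subseteq> complex_fun.span BU" "card BU = complex_fun.dim U"
  by (rule complex_fun.basis_exists)
 obtain BV where BV: "BV \<subseteq> V" "complex_fun.independent BV" "V \<subseteq> complex_fun.span BV" "card BV = complex_fun.dim V"
  by (rule complex_fun.basis_exists)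
 have fin: "finite BU" "finite BV"
  using complex_fun.independent_span_bound[OF U(3) BU(2)] complex_fun.independent_span_bound[OF V(3) BV(2)]
   U(2) V(2) BU(1) BV(1) by blast+
 have spU: "complex_fun.span BU \<subseteq> U" and spV: "complex_fun.span BV \<subseteq> V"
  using complex_fun.span_minimal U(1) V(1) BU(1) BV(1) by blast+
 have "BU \<inter> BV \<subseteq> {0}" using BU(1) BV(1) UV by blast
 moreover have "0 \<notin> BU" using BU(2) complex_fun.dependent_zero by blast
 ultimately have disj: "BU \<inter> BV = {}" by blast
 have "C \<subseteq> BV ==> complex_fun.independent (BU \<union> C)" if "finite C" for C
  using that
 proof (induction C rule: finite_induct)
  case (insert b C)
  have b: "b \<in> BV" "b \<notin> BU" "b \<notin> BU \<union> C" using insert disj by auto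
  have "b \<notin> complex_fun.span (BU \<union> C)"
  proof
   assume "b \<in> complex_fun.span (BU \<union> C)"
   then obtain u v where uv: "b = u + v" "u \<in> complex_fun.span BU" "v \<in> complex_fun.span C"
    unfolding complex_fun.span_Un by blast
   have "v \<in> V" using uv(3) spV insert.prems complex_fun.span_mono by blast
   hence "b - v \<in> V" using b(1) BV(1) V(1) complex_fun.subspace_diff by blast
   moreover have "b - v \<in> U" using uv spU by auto
   ultimately have "b - v = 0" using UV by blast
   hence "b \<in> complex_fun.span C" using uv(3) by simp
   moreover have "complex_fun.independent (insert b C)"
    by (rule complex_fun.independent_mono[OF BV(2) insert.prems])
   ultimately show False using insert.hyps(2) complex_fun.independent_insert[of b C] by simp
  qed
  hence "complex_fun.independent (insert b (BU \<union> C))"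
   by (rule complex_fun.independent_insertI) (use insert in simp)
  thus ?case by simp
 qed (use BU in simp)
 hence ind: "complex_fun.independent (BU \<union> BV)" using fin by blast
 have "W \<subseteq> complex_fun.span (BU \<union> BV)"
  unfolding W complex_fun.span_Un using BU(3) BV(3) by blast
 moreover have "BU \<union> BV \<subseteq> W"
 proof -
  have uv: "u + v \<in> W" if "u \<in> U" "v \<in> V" for u v
   unfolding W using that by blast
  have "b \<in> W" if "b \<in> BU" for b
   using uv[of b 0] that BU(1) complex_fun.subspace_0[OF V(1)] by auto
  moreover have "b \<in> W" if "b \<in> BV" for b
   using uv[of 0 b] that BV(1) complex_fun.subspace_0[OF U(1)] by auto
  ultimately show ?thesis by blast
 qed
 ultimately have "complex_fun.dim W = card (BU \<union> BV)" using ind complex_fun.dim_unique by blast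
 thus ?thesis using BU(4) BV(4) card_Un_disjoint[OF fin disj] by simp
qed

lemma sum_fun_apply: "(\<Sum>i\<in>I. f i) x = (\<Sum>i\<in>I. f i x)"
 by (induction I rule: infinite_finite_induct) simp_all

text \<open>The surrounding function space is infinite dimensional, so \<open>V\<close> comes with a
  finite set that spans it. A basis adapted to an injective linear map yields both the dimension of
  the image and the surjectivity of injective endomorphisms.\<close>

lemma complex_fun_linear_image:
 fixes T :: "('a => complex ^ 'k) => 'b => complex ^ 'k"
 assumes V: "complex_fun.subspace V" "V \<subseteq> complex_fun.span S" "finite S"
  and add: "\<And>f g. f \<in> V ==> g \<in> V ==> T (f + g) = T f + T g"
  and scale: "\<And>a f. f \<in> V ==> T (\<lambda>x. a *s f x) = (\<lambda>x. a *s T f x)"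
  and inj: "\<And>f. f \<in> V ==> T f = 0 ==> f = 0"
 obtains B where "finite B" "B \<subseteq> V" "complex_fun.independent B" "complex_fun.span B = V"
  "complex_fun.independent (T ` B)" "card (T ` B) = card B" "complex_fun.span (T ` B) = T ` V"
proof -
 obtain B where B: "B \<subseteq> V" "complex_fun.independent B" "V \<subseteq> complex_fun.span B" "card B = complex_fun.dim V"
  by (rule complex_fun.basis_exists)
 have fin: "finite B"
  using complex_fun.independent_span_bound[OF V(3) B(2)] V(2) B(1) by blast
 have spB: "complex_fun.span B = V"
  using B V(1) complex_fun.span_minimal by blast
 have zero: "0 \<in> V" by (rule complex_fun.subspace_0[OF V(1)])
 have T0: "T 0 = 0"
  using add[OF zero zero] by simp
 have Tsum: "sum f C \<in> V \<and> T (sum f C) = (\<Sum>i\<in>C. T (f i))"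
  if "finite C" "\<And>i. i \<in> C ==> f i \<in> V" for f and C :: "('a => complex ^ 'k) set"
  using that
 proof (induction C rule: finite_induct)
  case empty
  show ?case unfolding sum.empty using T0 zero by blast
 next
  case (insert i C)
  hence IH: "sum f C \<in> V" "T (sum f C) = (\<Sum>i\<in>C. T (f i))" and fi: "f i \<in> V" by blast+
  show ?case unfolding sum.insert[OF insert.hyps] add[OF fi IH(1)] IH(2)
   using complex_fun.subspace_add[OF V(1) fi IH(1)] by blast
 qed
 have mem: "(\<lambda>x. u b *s b x) \<in> V" if "b \<in> B" for b u
  using complex_fun.subspace_scale[OF V(1)] B(1) that by blast
 have Tcomb: "T (\<Sum>b\<in>B. (\<lambda>x. u b *s b x)) = (\<Sum>b\<in>B. (\<lambda>x. u b *s T b x))" for u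
 proof -
  have "T (\<Sum>b\<in>B. (\<lambda>x. u b *s b x)) = (\<Sum>b\<in>B. T (\<lambda>x. u b *s b x))"
   using Tsum[OF fin, of "\<lambda>b x. u b *s b x"] mem by blast
  also have "\<dots> = (\<Sum>b\<in>B. (\<lambda>x. u b *s T b x))"
   by (rule sum.cong[OF refl]) (use scale B(1) in blast)
  finally show ?thesis .
 qed
 have memB: "(\<Sum>b\<in>B. (\<lambda>x. u b *s b x)) \<in> V" for u
  using Tsum[OF fin, of "\<lambda>b x. u b *s b x"] mem by blast
 have injB: "inj_on T B"
 proof (rule inj_onI)
  fix b b' assume b: "b \<in> B" "b' \<in> B" "T b = T b'"
  have bV: "b \<in> V" "b' \<in> V" using b B(1) by blast+
  have m: "(\<lambda>x. (-1) *s b' x) \<in> V" by (rule complex_fun.subspace_scale[OF V(1) bV(2)])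
  have "T (b + (\<lambda>x. (-1) *s b' x)) = T b + (\<lambda>x. (-1) *s T b' x)"
   unfolding add[OF bV(1) m] scale[OF bV(2)] ..
  also have "\<dots> = 0" using b(3) by (simp add: fun_eq_iff vec_eq_iff)
  finally have "b + (\<lambda>x. (-1) *s b' x) = 0"
   by (rule inj[OF complex_fun.subspace_add[OF V(1) bV(1) m]])
  thus "b = b'" by (simp add: fun_eq_iff vec_eq_iff)
 qed
 have "\<not> complex_fun.dependent (T ` B)"
 proof
  assume "complex_fun.dependent (T ` B)"
  then obtain u v where u: "(\<Sum>w\<in>T ` B. (\<lambda>x. u w *s w x)) = 0" "v \<in> T ` B" "u v \<noteq> 0"
   using complex_fun.dependent_finite[of "T ` B"] fin by blast
  have "T (\<Sum>b\<in>B. (\<lambda>x. u (T b) *s b x)) = 0"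
   unfolding Tcomb using u(1) by (simp only: sum.reindex[OF injB] o_def)
  hence "(\<Sum>b\<in>B. (\<lambda>x. u (T b) *s b x)) = 0" by (rule inj[OF memB])
  moreover obtain b where "b \<in> B" "u (T b) \<noteq> 0" using u(2,3) by blast
  ultimately have "\<exists>u. (\<exists>v\<in>B. u v \<noteq> 0) \<and> (\<Sum>v\<in>B. (\<lambda>x. u v *s v x)) = 0"
   by (intro exI[of _ "\<lambda>b. u (T b)"] conjI bexI[of _ b])
  thus False using B(2) unfolding complex_fun.dependent_finite[OF fin] by contradiction
 qed
 moreover have "complex_fun.span (T ` B) = T ` V"
 proof (intro set_eqI iffI)
  fix g assume "g \<in> complex_fun.span (T ` B)"
  then obtain u where "g = (\<Sum>w\<in>T ` B. (\<lambda>x. u w *s w x))"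
   using complex_fun.span_finite[of "T ` B"] fin by blast
  hence "g = T (\<Sum>b\<in>B. (\<lambda>x. u (T b) *s b x))"
   unfolding Tcomb by (simp only: sum.reindex[OF injB] o_def)
  thus "g \<in> T ` V" by (simp only:) (rule imageI[OF memB])
 next
  fix g assume "g \<in> T ` V"
  then obtain f where f: "f \<in> V" "g = T f" by blast
  hence "f \<in> range (\<lambda>u. \<Sum>b\<in>B. (\<lambda>x. u b *s b x))"
   unfolding complex_fun.span_finite[OF fin, symmetric] spB by simp
  then obtain u where "f = (\<Sum>b\<in>B. (\<lambda>x. u b *s b x))" by (rule rangeE)
  hence "g = T (\<Sum>b\<in>B. (\<lambda>x. u b *s b x))" using f(2) by (simp only:)
  thus "g \<in> complex_fun.span (T ` B)"
   unfolding Tcomb by (simp only:) (rule complex_fun.span_sum, rule complex_fun.span_scale,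
    rule complex_fun.span_base, rule imageI)
 qed
 ultimately show thesis using that fin B(1,2) spB card_image[OF injB] by blast
qed

lemma complex_fun_dim_image:
 fixes T :: "('a => complex ^ 'k) => 'b => complex ^ 'k"
 assumes V: "complex_fun.subspace V" "V \<subseteq> complex_fun.span S" "finite S"
  and add: "\<And>f g. f \<in> V ==> g \<in> V ==> T (f + g) = T f + T g"
  and scale: "\<And>a f. f \<in> V ==> T (\<lambda>x. a *s f x) = (\<lambda>x. a *s T f x)"
  and inj: "\<And>f. f \<in> V ==> T f = 0 ==> f = 0"
 shows "complex_fun.subspace (T ` V)" "complex_fun.dim (T ` V) = complex_fun.dim V"
proof -
 obtain B where B: "finite B" "B \<subseteq> V" "complex_fun.independent B" "complex_fun.span B = V"
  "complex_fun.independent (T ` B)" "card (T ` B) = card B" "complex_fun.span (T ` B) = T ` V"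
  by (rule complex_fun_linear_image[OF V add scale inj])
 show "complex_fun.subspace (T ` V)" unfolding B(7)[symmetric] by (rule complex_fun.subspace_span)
 show "complex_fun.dim (T ` V) = complex_fun.dim V"
  using complex_fun.dim_span_eq_card_independent[OF B(3)] complex_fun.dim_span_eq_card_independent[OF B(5)]
  by (simp add: B(4,6,7))
qed

lemma complex_fun_injective_surjective:
 fixes T :: "('a => complex ^ 'k) => 'a => complex ^ 'k"
 assumes V: "complex_fun.subspace V" "V \<subseteq> complex_fun.span S" "finite S"
  and T: "\<And>f. f \<in> V ==> T f \<in> V"
  and add: "\<And>f g. f \<in> V ==> g \<in> V ==> T (f + g) = T f + T g"
  and scale: "\<And>a f. f \<in> V ==> T (\<lambda>x. a *s f x) = (\<lambda>x. a *s T f x)"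
  and inj: "\<And>f. f \<in> V ==> T f = 0 ==> f = 0" and g: "g \<in> V"
 shows "\<exists>f\<in>V. T f = g"
proof -
 obtain B where B: "finite B" "B \<subseteq> V" "complex_fun.independent B" "complex_fun.span B = V"
  "complex_fun.independent (T ` B)" "card (T ` B) = card B" "complex_fun.span (T ` B) = T ` V"
  by (rule complex_fun_linear_image[OF V add scale inj])
 have "g \<in> complex_fun.span (T ` B)"
 proof (rule ccontr)
  assume n: "g \<notin> complex_fun.span (T ` B)"
  have g': "g \<notin> T ` B"
  proof
   assume "g \<in> T ` B"
   from complex_fun.span_base[OF this] n show False by contradiction
  qed
  have ind: "complex_fun.independent (insert g (T ` B))"
   by (rule complex_fun.independent_insertI[OF n B(5)])
  have "insert g (T ` B) \<subseteq> complex_fun.span B" unfolding B(4) using T g B(2) by blast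
  hence "card (insert g (T ` B)) \<le> card B"
   using complex_fun.independent_span_bound[OF B(1) ind] by blast
  thus False using g' B(1,6) by simp
 qed
 thus ?thesis unfolding B(7) by blast
qed

text \<open>Coefficients are spinors and the variables are the real coordinates. Generation by rules
  makes differentiability, the Euler identity and the behaviour under linear maps plain rule
  inductions.\<close>

inductive homogeneous :: "nat => ('n::{finite,linorder} rvector => complex ^ 'k) => bool"
 where
  const: "homogeneous 0 (\<lambda>x. v)"
 | mult: "homogeneous k P ==> homogeneous (Suc k) (\<lambda>x. x $ i *\<^sub>R P x)"
 | add: "homogeneous k P ==> homogeneous k Q ==> homogeneous k (\<lambda>x. P x + Q x)"

lemma homogeneous_linear: "homogeneous k P ==> linear L ==> homogeneous k (\<lambda>x. L (P x))"
proof (induction rule: homogeneous.induct)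
 case (mult k P i)
 thus ?case using homogeneous.mult[of k "\<lambda>x. L (P x)" i] by (simp add: linear_cmul)
next
 case (add k P Q)
 thus ?case using homogeneous.add by (simp add: linear_add)
qed (rule homogeneous.const)

lemma homogeneous_zero: "homogeneous k (\<lambda>x. 0)"
proof (induction k)
 case (Suc k)
 thus ?case using homogeneous.mult[of k "\<lambda>x. 0"] by simp
qed (rule homogeneous.const)

lemma homogeneous_sum: "(\<And>i. i \<in> I ==> homogeneous k (f i)) ==> homogeneous k (\<lambda>x. \<Sum>i\<in>I. f i x)"
 by (induction I rule: infinite_finite_induct) (simp_all add: homogeneous_zero homogeneous.add)

lemma linear_smult: "linear (\<lambda>v :: complex ^ 'k. a *s v)"
 by (rule linearI) (simp_all add: vec_eq_iff algebra_simps)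

lemma homogeneous_smult: "homogeneous k P ==> homogeneous k (\<lambda>x. a *s P x)"
 by (rule homogeneous_linear[OF _ linear_smult])

lemma homogeneous_matrix:
 "homogeneous k P ==> homogeneous k (\<lambda>x. (M :: complex ^ 'k ^ 'k) *v P x)"
 by (rule homogeneous_linear[OF _ bounded_linear.linear[OF mvec.bounded_linear_right]])

definition partial :: "'n => ('n::{finite,linorder} rvector => 'b::real_normed_vector) => 'n rvector => 'b"
 where "partial i P x = frechet_derivative P (at x) (axis i 1)"

lemma has_derivative_partial:
 fixes P :: "'n::{finite,linorder} rvector => 'b::real_normed_vector"
 assumes "P differentiable at x"
 shows "(P has_derivative (\<lambda>v. \<Sum>i\<in>UNIV. v $ i *\<^sub>R partial i P x)) (at x)"
proof -
 let ?D = "frechet_derivative P (at x)"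
 have D: "(P has_derivative ?D) (at x)" using assms by (simp add: frechet_derivative_works)
 hence "linear ?D" by (rule has_derivative_linear)
 hence "?D v = (\<Sum>i\<in>UNIV. v $ i *\<^sub>R partial i P x)" for v
  unfolding partial_def by (subst vec_expand[of v]) (simp add: linear_sum linear_cmul)
 hence "?D = (\<lambda>v. \<Sum>i\<in>UNIV. v $ i *\<^sub>R partial i P x)" by blast
 with D show ?thesis by simp
qed

lemma partial_eqI: "(P has_derivative D) (at x) ==> partial i P x = D (axis i 1)"
 unfolding partial_def using frechet_derivative_at by metis

lemma homogeneous_differentiable: "homogeneous k P ==> P differentiable at x"
proof (induction rule: homogeneous.induct)
 case (mult k P i)
 have "(\<lambda>x :: 'a rvector. x $ i) differentiable at x"
  by (rule bounded_linear_imp_differentiable[OF bounded_linear_vec_nth])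
 thus ?case using mult.IH by (rule differentiable_scaleR)
next
 case (add k P Q)
 thus ?case by (intro differentiable_add)
qed simp

lemma partial_const: "partial i (\<lambda>x. v) x = 0"
 by (rule partial_eqI[of _ "\<lambda>_. 0"]) simp

lemma partial_add:
 assumes "P differentiable at x" "Q differentiable at x"
 shows "partial i (\<lambda>x. P x + Q x) x = partial i P x + partial i Q x"
 by (subst partial_eqI[OF has_derivative_add[OF assms[unfolded frechet_derivative_works]]])
  (simp add: partial_def)

lemma partial_mult:
 assumes "P differentiable at x"
 shows "partial i (\<lambda>x. x $ j *\<^sub>R P x) x = (if i = j then P x else 0) + x $ j *\<^sub>R partial i P x"
proof -
 have "((\<lambda>x. x $ j *\<^sub>R P x) has_derivative (\<lambda>h. x $ j *\<^sub>R frechet_derivative P (at x) h + h $ j *\<^sub>R P x)) (at x)"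
  by (rule has_derivative_scaleR[OF _ assms[unfolded frechet_derivative_works]])
   (rule bounded_linear_imp_has_derivative[OF bounded_linear_vec_nth])
 thus ?thesis by (subst partial_eqI, assumption) (auto simp: partial_def axis_component)
qed

lemma partial_linear:
 assumes "P differentiable at x" "bounded_linear L"
 shows "partial i (\<lambda>x. L (P x)) x = L (partial i P x)"
 by (subst partial_eqI[OF bounded_linear.has_derivative[OF assms(2) assms(1)[unfolded frechet_derivative_works]]])
  (simp add: partial_def)

lemma homogeneous_partial:
 "homogeneous k P ==> (if k = 0 then partial i P = (\<lambda>x. 0) else homogeneous (k - 1) (partial i P))"
proof (induction rule: homogeneous.induct)
 case (const v)
 thus ?case by (simp add: partial_const fun_eq_iff)
next
 case (mult k P j)
 have e: "partial i (\<lambda>x. x $ j *\<^sub>R P x) = (\<lambda>x. (if i = j then P x else 0) + x $ j *\<^sub>R partial i P x)"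
  using partial_mult[OF homogeneous_differentiable[OF mult.hyps]] by blast
 have "homogeneous k (\<lambda>x. x $ j *\<^sub>R partial i P x)"
  using mult.IH homogeneous.mult[of "k - 1" "partial i P" j] by (cases k) (auto simp: homogeneous_zero)
 moreover have "homogeneous k (\<lambda>x. if i = j then P x else 0)"
  using mult.hyps homogeneous_zero by (cases "i = j") auto
 ultimately show ?case unfolding e by (simp add: homogeneous.add)
next
 case (add k P Q)
 have e: "partial i (\<lambda>x. P x + Q x) = (\<lambda>x. partial i P x + partial i Q x)"
  using partial_add[OF homogeneous_differentiable[OF add.hyps(1)] homogeneous_differentiable[OF add.hyps(2)]] by blast
 show ?case unfolding e using add.IH by (auto simp: homogeneous.add split: if_splits)
qed

lemma homogeneous_euler: "homogeneous k P ==> (\<Sum>i\<in>UNIV. x $ i *\<^sub>R partial i P x) = real k *\<^sub>R P x"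
proof (induction rule: homogeneous.induct)
 case (mult k P j)
 have "(\<Sum>i\<in>UNIV. x $ i *\<^sub>R partial i (\<lambda>x. x $ j *\<^sub>R P x) x)
   = (\<Sum>i\<in>UNIV. (if i = j then x $ j *\<^sub>R P x else 0)) + x $ j *\<^sub>R (\<Sum>i\<in>UNIV. x $ i *\<^sub>R partial i P x)"
  unfolding partial_mult[OF homogeneous_differentiable[OF mult.hyps]] scaleR_sum_right sum.distrib[symmetric]
  by (intro sum.cong refl) (simp add: algebra_simps)
 thus ?case by (simp add: mult.IH algebra_simps)
next
 case (add k P Q)
 thus ?case
  by (simp add: partial_add[OF homogeneous_differentiable[OF add.hyps(1)] homogeneous_differentiable[OF add.hyps(2)]]
    scaleR_add_right sum.distrib)
qed (simp add: partial_const)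

lemma homogeneous_scale: "homogeneous k P ==> P (t *\<^sub>R x) = t ^ k *\<^sub>R P x"
 by (induction rule: homogeneous.induct) (simp_all add: algebra_simps)

lemma homogeneous_continuous: "homogeneous k P ==> continuous_on S P"
 by (intro continuous_at_imp_continuous_on ballI differentiable_imp_continuous_within) (rule homogeneous_differentiable)

section \<open>The Euclidean Dirac operator and the Fischer decomposition\<close>

definition dslash :: "('n::{finite,linorder} => complex ^ 'k ^ 'k) => ('n rvector => complex ^ 'k) => 'n rvector => complex ^ 'k"
 where "dslash c P x = (\<Sum>i\<in>UNIV. slash c (axis i 1) *v partial i P x)"

definition xslash :: "('n::{finite,linorder} => complex ^ 'k ^ 'k) => ('n rvector => complex ^ 'k) => 'n rvector => complex ^ 'k"
 where "xslash c P x = slash c x *v P x"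

lemma slash_expand: "slash c x = (\<Sum>i\<in>UNIV. x $ i *\<^sub>R slash c (axis i 1))"
 by (subst vec_expand[of x]) (simp only: linear_sum[OF linear_slash] linear_cmul[OF linear_slash])

lemma xslash_expand: "xslash c P x = (\<Sum>i\<in>UNIV. x $ i *\<^sub>R (slash c (axis i 1) *v P x))"
 unfolding xslash_def by (subst slash_expand) (simp add: mvec.sum_left mvec.scaleR_left)

lemma homogeneous_xslash: "homogeneous k P ==> homogeneous (Suc k) (xslash c P)"
 unfolding xslash_expand[abs_def] by (intro homogeneous_sum homogeneous.mult homogeneous_matrix)

lemma homogeneous_dslash: "homogeneous (Suc k) P ==> homogeneous k (dslash c P)"
 unfolding dslash_def[abs_def] using homogeneous_partial[of "Suc k" P]
 by (intro homogeneous_sum homogeneous_matrix) simp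

lemma dslash_const: "homogeneous 0 P ==> dslash c P x = 0"
 unfolding dslash_def using homogeneous_partial[of 0 P] by (simp add: mvec.zero_right)

lemma dslash_add:
 assumes "P differentiable at x" "Q differentiable at x"
 shows "dslash c (\<lambda>x. P x + Q x) x = dslash c P x + dslash c Q x"
 by (simp add: dslash_def partial_add[OF assms] mvec.add_right sum.distrib)

lemma dslash_smult:
 assumes "P differentiable at x"
 shows "dslash c (\<lambda>x. a *s P x) x = a *s dslash c P x"
proof -
 have "bounded_linear (\<lambda>v :: complex ^ 'b. a *s v)"
  using linear_smult by (simp add: linear_conv_bounded_linear)
 thus ?thesis
  by (simp add: dslash_def partial_linear[OF assms, of "\<lambda>v. a *s v"] smult_matrix_vector linear_sum[OF linear_smult])
qed

lemma dslash_scaleR: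
 assumes "P differentiable at x"
 shows "dslash c (\<lambda>x. r *\<^sub>R P x) x = r *\<^sub>R dslash c P x"
 by (simp add: dslash_def partial_linear[OF assms bounded_linear_scaleR_right] mvec.scaleR_right scaleR_sum_right)

text \<open>The anticommutator of the Dirac operator with Clifford multiplication by x.
  Differentiating x gives one identity matrix per coordinate, and the remaining terms combine
  through the Clifford relation into twice the Euler operator.\<close>

lemma dslash_xslash:
 fixes c :: "'n::{finite,linorder} => complex ^ 'k ^ 'k"
 assumes c: "clifford_relations c" and Q: "homogeneous m Q"
 shows "dslash (neg_module c) (xslash c Q) x + xslash (neg_module c) (dslash c Q) x = (real CARD('n) + 2 * real m) *\<^sub>R Q x"
proof -
 let ?s = "\<lambda>i. slash c (axis i 1)" and ?t = "\<lambda>i. slash (neg_module c) (axis i 1)"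
 note diff = homogeneous_differentiable[OF Q]
 have pd: "partial j (xslash c Q) x = ?s j *v Q x + (\<Sum>i\<in>UNIV. x $ i *\<^sub>R (?s i *v partial j Q x))" for j
 proof -
  have "((\<lambda>x. slash c x *v Q x) has_derivative
    (\<lambda>h. slash c x *v frechet_derivative Q (at x) h + slash c h *v Q x)) (at x)"
   by (rule mvec.FDERIV[OF _ diff[unfolded frechet_derivative_works]])
    (rule bounded_linear_imp_has_derivative, simp add: linear_slash linear_conv_bounded_linear[symmetric])
  hence "partial j (xslash c Q) x = slash c x *v partial j Q x + ?s j *v Q x"
   unfolding xslash_def[abs_def] by (subst partial_eqI, assumption) (simp add: partial_def)
  thus ?thesis using xslash_expand[of c "\<lambda>_. partial j Q x" x] by (simp add: xslash_def add.commute)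
 qed
 have d: "dslash (neg_module c) (xslash c Q) x
   = (\<Sum>j\<in>UNIV. (?t j ** ?s j) *v Q x) + (\<Sum>j\<in>UNIV. \<Sum>i\<in>UNIV. x $ i *\<^sub>R ((?t j ** ?s i) *v partial j Q x))"
  unfolding dslash_def[of "neg_module c"] pd
  by (simp add: mvec.add_right mvec.sum_right mvec.scaleR_right matrix_vector_mul_assoc sum.distrib)
 have x: "xslash (neg_module c) (dslash c Q) x = (\<Sum>j\<in>UNIV. \<Sum>i\<in>UNIV. x $ i *\<^sub>R ((?t i ** ?s j) *v partial j Q x))"
  unfolding xslash_expand dslash_def
  by (subst sum.swap) (simp add: mvec.sum_right scaleR_sum_right matrix_vector_mul_assoc)
 have "(\<Sum>j\<in>UNIV. (?t j ** ?s j) *v Q x) = real CARD('n) *\<^sub>R Q x"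
 proof -
  have "(?t j ** ?s j) *v Q x = Q x" for j
   by (simp add: slash_slash_self[OF c] inner_axis_axis)
  thus ?thesis by (simp only: sum_constant_scaleR)
 qed
 moreover have "(\<Sum>j\<in>UNIV. \<Sum>i\<in>UNIV. x $ i *\<^sub>R ((?t j ** ?s i) *v partial j Q x))
   + (\<Sum>j\<in>UNIV. \<Sum>i\<in>UNIV. x $ i *\<^sub>R ((?t i ** ?s j) *v partial j Q x)) = (2 * real m) *\<^sub>R Q x"
 proof -
  have "(\<Sum>j\<in>UNIV. \<Sum>i\<in>UNIV. x $ i *\<^sub>R ((?t j ** ?s i) *v partial j Q x))
   + (\<Sum>j\<in>UNIV. \<Sum>i\<in>UNIV. x $ i *\<^sub>R ((?t i ** ?s j) *v partial j Q x))
   = (\<Sum>j\<in>UNIV. \<Sum>i\<in>UNIV. x $ i *\<^sub>R ((?t j ** ?s i + ?t i ** ?s j) *v partial j Q x))"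
   by (simp add: sum.distrib mvec.add_left scaleR_add_right)
  also have "\<dots> = (\<Sum>j\<in>UNIV. \<Sum>i\<in>UNIV. if i = j then (2 * x $ j) *\<^sub>R partial j Q x else 0)"
   by (intro sum.cong refl) (auto simp: slash_anticommute[OF c] mvec.scaleR_left inner_axis_axis)
  also have "\<dots> = 2 *\<^sub>R (\<Sum>j\<in>UNIV. x $ j *\<^sub>R partial j Q x)"
   by (simp add: scaleR_sum_right)
  finally show ?thesis unfolding homogeneous_euler[OF Q] by simp
 qed
 ultimately show ?thesis unfolding d x by (simp add: algebra_simps)
qed

text \<open>The operator \<open>x \<partial>\<close> has only eigenvalues between \<open>0\<close> and \<open>N - 2 + 2 m\<close> in degree \<open>m\<close>, because
 \<open>\<partial>\<close> turns eigenvectors for \<open>\<kappa>\<close> into eigenvectors for \<open>N - 2 + 2 m - \<kappa>\<close> of smaller degree.\<close>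
lemma xslash_dslash_eigenvalue:
 fixes c :: "'n::{finite,linorder} => complex ^ 'k ^ 'k"
 assumes "clifford_relations c" "homogeneous m Q"
  and "\<And>x. xslash (neg_module c) (dslash c Q) x = \<kappa> *\<^sub>R Q x"
  and "\<kappa> < 0 \<or> \<kappa> > real CARD('n) - 2 + 2 * real m"
  and "CARD('n) \<ge> 2"
 shows "Q x = 0"
 using assms
proof (induction m arbitrary: c Q \<kappa> x)
 case 0
 have n: "real CARD('n) \<ge> 2" using 0(5) by simp
 have "\<kappa> *\<^sub>R Q x = 0" using 0(3)[of x] dslash_const[OF 0(2)] by (simp add: xslash_def mvec.zero_right)
 thus ?case using 0(4) n by auto
next
 case (Suc m)
 let ?R = "dslash c Q"
 have R: "homogeneous m ?R" by (rule homogeneous_dslash[OF Suc.prems(2)])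
 note c' = clifford_relations_neg[OF Suc.prems(1)]
 have "xslash (neg_module (neg_module c)) (dslash (neg_module c) ?R) x = (real CARD('n) - 2 + 2 * real (Suc m) - \<kappa>) *\<^sub>R ?R x" for x
 proof -
  have "xslash (neg_module c) ?R = (\<lambda>x. \<kappa> *\<^sub>R Q x)" using Suc.prems(3) by blast
  hence "dslash c (xslash (neg_module c) ?R) x = \<kappa> *\<^sub>R ?R x"
   using dslash_scaleR[OF homogeneous_differentiable[OF Suc.prems(2)]] by simp
  thus ?thesis using dslash_xslash[OF c' R, of x] by (simp add: algebra_simps)
 qed
 \<comment> \<open>The reflected eigenvalue is outside the admissible range for degree m again: a
   negative one becomes too large and a too large one becomes negative.\<close>
 hence "?R x = 0" for x
  using Suc.prems(4,5) by (intro Suc.IH[OF c' R]) auto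
 hence "\<kappa> *\<^sub>R Q x = 0" using Suc.prems(3)[of x] by (simp add: xslash_def mvec.zero_right)
 thus ?case using Suc.prems(4) by auto
qed

text \<open>If the Dirac operator kills x Q, then the anticommutator makes Q an eigenvector of the
  reversed composition with eigenvalue N + 2 m, beyond the possible range.\<close>

lemma dslash_xslash_injective:
 fixes c :: "'n::{finite,linorder} => complex ^ 'k ^ 'k"
 assumes c: "clifford_relations c" and Q: "homogeneous m Q" and n: "CARD('n) \<ge> 2"
  and z: "\<And>x. dslash (neg_module c) (xslash c Q) x = 0"
 shows "Q x = 0"
proof (rule xslash_dslash_eigenvalue[OF c Q _ _ n])
 show "xslash (neg_module c) (dslash c Q) x = (real CARD('n) + 2 * real m) *\<^sub>R Q x" for x
  using dslash_xslash[OF c Q, of x] by (simp add: z)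
qed simp

definition equivariant_poly :: "('n::{finite,linorder} => complex ^ 'k ^ 'k) => 'n clifford => nat => ('n rvector => complex ^ 'k) set"
 where "equivariant_poly c a m = {P. homogeneous m P \<and> (\<forall>x. P (spin_cover a *v x) = rho c a *v P x)}"

text \<open>Spherical monogenics, the spinor analogue of homogeneous harmonic polynomials.\<close>

definition monogenic :: "('n::{finite,linorder} => complex ^ 'k ^ 'k) => 'n clifford => nat => ('n rvector => complex ^ 'k) set"
 where "monogenic c a m = {P \<in> equivariant_poly c a m. \<forall>x. dslash c P x = 0}"

lemma homogeneous_finite_span:
 "\<exists>S :: ('n::{finite,linorder} rvector => complex ^ 'k) set. finite S \<and> Collect (homogeneous m) \<subseteq> complex_fun.span S"
proof (induction m)
 case 0
 let ?S = "range (\<lambda>(i :: 'k) (x :: 'n rvector). axis i (1::complex))"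
 have "P \<in> complex_fun.span ?S" if "homogeneous m P" "m = 0" for m and P :: "'n rvector => complex ^ 'k"
  using that
 proof (induction rule: homogeneous.induct)
  case (const v)
  have "(\<lambda>x :: 'n rvector. v) = (\<Sum>i\<in>UNIV. (\<lambda>x. v $ i *s axis i (1::complex)))"
   by (simp add: fun_eq_iff vec_eq_iff axis_component sum_fun_apply sum_component if_distrib cong: if_cong)
  also have "\<dots> \<in> complex_fun.span ?S"
   by (intro complex_fun.span_sum complex_fun.span_scale complex_fun.span_base) blast
  finally show ?case .
 next
  case (add k P Q)
  hence "P + Q \<in> complex_fun.span ?S" by (intro complex_fun.span_add) auto
  thus ?case by (simp add: plus_fun_def)
 qed simp
 thus ?case by (intro exI[of _ ?S]) auto
next
 case (Suc m)
 then obtain S :: "('n rvector => complex ^ 'k) set" where S: "finite S" "Collect (homogeneous m) \<subseteq> complex_fun.span S" by blast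
 let ?T = "(\<lambda>(i, f) x. x $ i *\<^sub>R f x) ` ((UNIV :: 'n set) \<times> S)"
 have "P \<in> complex_fun.span ?T" if "homogeneous k P" "k = Suc m" for k and P :: "'n rvector => complex ^ 'k"
  using that
 proof (induction rule: homogeneous.induct)
  case (mult k P i)
  hence "P \<in> complex_fun.span S" using S(2) by auto
  thus ?case
  proof (induction rule: complex_fun.span_induct_alt)
   case base
   thus ?case using complex_fun.span_zero[of ?T] by (simp add: zero_fun_def)
  next
   case (step a f g)
   have "(\<lambda>x. x $ i *\<^sub>R f x) \<in> complex_fun.span ?T" using step(1) by (intro complex_fun.span_base) auto
   hence "(\<lambda>x. a *s (x $ i *\<^sub>R f x)) + (\<lambda>x. x $ i *\<^sub>R g x) \<in> complex_fun.span ?T"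
    using step(2) by (intro complex_fun.span_add complex_fun.span_scale)
   moreover have "(\<lambda>x. a *s (x $ i *\<^sub>R f x)) + (\<lambda>x. x $ i *\<^sub>R g x) = (\<lambda>x. x $ i *\<^sub>R (((\<lambda>x. a *s f x) + g) x))"
    by (simp add: fun_eq_iff vec_eq_iff algebra_simps)
   ultimately show ?case by simp
  qed
 next
  case (add k P Q)
  hence "P + Q \<in> complex_fun.span ?T" by (intro complex_fun.span_add) auto
  thus ?case by (simp add: plus_fun_def)
 qed simp
 moreover have "finite ?T" using S(1) by simp
 ultimately show ?case by blast
qed

lemma equivariant_poly_subspace: "complex_fun.subspace (equivariant_poly c a m)"
 unfolding equivariant_poly_def
 by (rule complex_fun.subspaceI)
  (simp_all add: homogeneous_zero homogeneous_smult zero_fun_def plus_fun_def homogeneous.add mvec.add_right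
   mvec.zero_right smult_matrix_vector)

lemma monogenic_subspace: "complex_fun.subspace (monogenic c a m)"
proof -
 have d: "P differentiable at x" if "P \<in> equivariant_poly c a m" for P x
  using that homogeneous_differentiable unfolding equivariant_poly_def by blast
 have "dslash c (P + Q) x = dslash c P x + dslash c Q x" if "P \<in> equivariant_poly c a m" "Q \<in> equivariant_poly c a m" for P Q x
  using dslash_add[OF d[OF that(1)] d[OF that(2)]] by (simp add: plus_fun_def)
 moreover have "dslash c 0 x = 0" for x
  using dslash_const[OF homogeneous_zero] by (simp add: zero_fun_def)
 moreover note equivariant_poly_subspace[of c a m] dslash_smult[OF d]
 ultimately show ?thesis
  unfolding monogenic_def complex_fun.subspace_def by auto
qed

lemma equivariant_poly_finite_span:
 "\<exists>S. finite S \<and> equivariant_poly c a m \<subseteq> complex_fun.span S" "\<exists>S. finite S \<and> monogenic c a m \<subseteq> complex_fun.span S"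
proof -
 obtain S :: "('a rvector => complex ^ 'b) set" where S: "finite S" "Collect (homogeneous m) \<subseteq> complex_fun.span S"
  using homogeneous_finite_span by blast
 have "equivariant_poly c a m \<subseteq> Collect (homogeneous m)" "monogenic c a m \<subseteq> equivariant_poly c a m"
  by (auto simp: equivariant_poly_def monogenic_def)
 with S show "\<exists>S. finite S \<and> equivariant_poly c a m \<subseteq> complex_fun.span S" "\<exists>S. finite S \<and> monogenic c a m \<subseteq> complex_fun.span S"
  by blast+
qed

text \<open>The Dirac operator has the same form in every orthonormal frame; its rotation
  equivariance follows from this.\<close>

lemma dslash_orthogonal:
 fixes P :: "'n::{finite,linorder} rvector => complex ^ 'k" and A :: "'n rmatrix"
 assumes A: "orthogonal_transformation ((*v) A)" and P: "P differentiable at y"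
 shows "dslash c P y = (\<Sum>i\<in>UNIV. slash c (A *v axis i 1) *v frechet_derivative P (at y) (A *v axis i 1))"
proof -
 let ?D = "frechet_derivative P (at y)"
 have linD: "linear ?D" using P frechet_derivative_works has_derivative_linear by blast
 have orth: "(\<Sum>i\<in>UNIV. A $ j $ i * A $ l $ i) = (if j = l then 1 else 0)" for j l
 proof -
  have "orthogonal_matrix A" using A by (simp add: orthogonal_transformation_matrix)
  hence "(A ** transpose A) $ j $ l = (mat 1 :: 'n rmatrix) $ j $ l" by (simp add: orthogonal_matrix_def)
  thus ?thesis by (simp add: matrix_matrix_mult_def transpose_def mat_def)
 qed
 have Ai: "A *v axis i 1 = (\<Sum>j\<in>UNIV. A $ j $ i *\<^sub>R axis j 1)" for i
  by (simp add: vec_eq_iff matrix_vector_mult_basis column_def axis_component sum_component if_distrib cong: if_cong)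
 have "(\<Sum>i\<in>UNIV. slash c (A *v axis i 1) *v ?D (A *v axis i 1))
   = (\<Sum>i\<in>UNIV. \<Sum>j\<in>UNIV. \<Sum>l\<in>UNIV. (A $ j $ i * A $ l $ i) *\<^sub>R (slash c (axis j 1) *v partial l P y))"
  unfolding Ai linear_sum[OF linear_slash] linear_cmul[OF linear_slash] mvec.sum_left
  unfolding linear_sum[OF linD] linear_cmul[OF linD] mvec.sum_right partial_def
  by (simp add: mvec.scaleR_left mvec.scaleR_right mult.commute)
 also have "\<dots> = (\<Sum>j\<in>UNIV. \<Sum>l\<in>UNIV. (\<Sum>i\<in>UNIV. A $ j $ i * A $ l $ i) *\<^sub>R (slash c (axis j 1) *v partial l P y))"
  unfolding scaleR_sum_left by (subst sum.swap) (subst (2) sum.swap, rule refl)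
 also have "\<dots> = dslash c P y"
  unfolding orth dslash_def by (simp add: if_distrib[of "\<lambda>r. r *\<^sub>R _"] cong: if_cong)
 finally show ?thesis by simp
qed

lemma dslash_equivariant:
 fixes c :: "'n::{finite,linorder} => complex ^ 'k ^ 'k"
 assumes c: "clifford_relations c" and a: "a \<in> SpinG" and P: "P \<in> equivariant_poly c a (Suc m)"
 shows "dslash c P \<in> equivariant_poly (neg_module c) a m"
proof -
 have hP: "homogeneous (Suc m) P" and eP: "\<And>x. P (spin_cover a *v x) = rho c a *v P x"
  using P by (auto simp: equivariant_poly_def)
 let ?A = "spin_cover a"
 note d = homogeneous_differentiable[OF hP]
 have D: "frechet_derivative P (at (?A *v x)) (?A *v v) = rho c a *v frechet_derivative P (at x) v" for x v
 proof -
  have "((\<lambda>x. P (?A *v x)) has_derivative (\<lambda>v. frechet_derivative P (at (?A *v x)) (?A *v v))) (at x)"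
   by (rule has_derivative_compose[OF _ d[unfolded frechet_derivative_works]])
    (rule bounded_linear_imp_has_derivative, simp add: matrix_vector_mul_bounded_linear)
  moreover have "((\<lambda>x. P (?A *v x)) has_derivative (\<lambda>v. rho c a *v frechet_derivative P (at x) v)) (at x)"
   unfolding eP by (rule bounded_linear.has_derivative[OF mvec.bounded_linear_right d[unfolded frechet_derivative_works]])
  ultimately show ?thesis using has_derivative_unique by metis
 qed
 have "dslash c P (?A *v x) = rho (neg_module c) a *v dslash c P x" for x
 proof -
  have "dslash c P (?A *v x) = (\<Sum>i\<in>UNIV. (slash c (?A *v axis i 1) ** rho c a) *v frechet_derivative P (at x) (axis i 1))"
   by (simp add: dslash_orthogonal[OF spin_cover(2)[OF a] d] D matrix_vector_mul_assoc)
  also have "\<dots> = rho (neg_module c) a *v dslash c P x"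
   by (simp add: slash_equivariant[OF c a] dslash_def partial_def mvec.sum_right matrix_vector_mul_assoc)
  finally show ?thesis .
 qed
 with homogeneous_dslash[OF hP] show ?thesis by (simp add: equivariant_poly_def)
qed

lemma xslash_equivariant:
 fixes c :: "'n::{finite,linorder} => complex ^ 'k ^ 'k"
 assumes c: "clifford_relations c" and a: "a \<in> SpinG" and P: "P \<in> equivariant_poly c a m"
 shows "xslash c P \<in> equivariant_poly (neg_module c) a (Suc m)"
proof -
 have hP: "homogeneous m P" and eP: "\<And>x. P (spin_cover a *v x) = rho c a *v P x"
  using P by (auto simp: equivariant_poly_def)
 have "xslash c P (spin_cover a *v x) = rho (neg_module c) a *v xslash c P x" for x
  using slash_equivariant[OF c a, of x] by (simp add: xslash_def eP matrix_vector_mul_assoc)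
 with homogeneous_xslash[OF hP] show ?thesis by (simp add: equivariant_poly_def)
qed

text \<open>The composition of the Dirac operator with multiplication by x is injective on a finite
  dimensional space, hence surjective. Choose Q such that x Q and P have the same image under the
  Dirac operator; then P - x Q is monogenic. Equivariance survives because both operators are
  equivariant.\<close>

lemma fischer_decomposition:
 fixes c :: "'n::{finite,linorder} => complex ^ 'k ^ 'k"
 assumes c: "clifford_relations c" and n: "CARD('n) \<ge> 2" and a: "a \<in> SpinG"
  and P: "P \<in> equivariant_poly c a (Suc m)"
 obtains H Q where "H \<in> monogenic c a (Suc m)" "Q \<in> equivariant_poly (neg_module c) a m" "P = H + xslash (neg_module c) Q"
proof -
 let ?c = "neg_module c"
 note c' = clifford_relations_neg[OF c]
 let ?V = "equivariant_poly ?c a m"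
 have d: "Q differentiable at x" if "homogeneous k Q" for Q :: "'n rvector => complex ^ 'k" and k x
  using that homogeneous_differentiable by blast
 have hV: "homogeneous m Q" if "Q \<in> ?V" for Q using that by (simp add: equivariant_poly_def)
 obtain S where S: "finite S" "?V \<subseteq> complex_fun.span S" using equivariant_poly_finite_span(1) by blast
 have "\<exists>Q\<in>?V. dslash c (xslash ?c Q) = dslash c P"
 proof (rule complex_fun_injective_surjective[OF equivariant_poly_subspace S(2,1)])
  fix Q assume Q: "Q \<in> ?V"
  show "dslash c (xslash ?c Q) \<in> ?V"
   using dslash_equivariant[OF c a, of "xslash ?c Q" m] xslash_equivariant[OF c' a Q] by simp
  show "dslash c (xslash ?c (\<lambda>x. b *s Q x)) = (\<lambda>x. b *s dslash c (xslash ?c Q) x)" for b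
  proof -
   have e: "xslash ?c (\<lambda>x. b *s Q x) = (\<lambda>x. b *s xslash ?c Q x)"
    by (simp add: xslash_def[abs_def] smult_matrix_vector)
   show ?thesis unfolding e using dslash_smult[OF d[OF homogeneous_xslash[OF hV[OF Q]]]] by blast
  qed
  show "Q = 0" if "dslash c (xslash ?c Q) = 0"
   using dslash_xslash_injective[OF c' hV[OF Q] n] that by (simp add: fun_eq_iff)
  fix R assume R: "R \<in> ?V"
  have "xslash ?c (Q + R) = (\<lambda>x. xslash ?c Q x + xslash ?c R x)"
   by (simp add: xslash_def[abs_def] mvec.add_right)
  thus "dslash c (xslash ?c (Q + R)) = dslash c (xslash ?c Q) + dslash c (xslash ?c R)"
   using dslash_add[OF d[OF homogeneous_xslash[OF hV[OF Q]]] d[OF homogeneous_xslash[OF hV[OF R]]]]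
   by (intro ext) (simp only: plus_fun_apply)
 qed (rule dslash_equivariant[OF c a P])
 then obtain Q where Q: "Q \<in> ?V" "dslash c (xslash ?c Q) = dslash c P" by blast
 define H where "H = P - xslash ?c Q"
 have xQ: "xslash ?c Q \<in> equivariant_poly c a (Suc m)" using xslash_equivariant[OF c' a Q(1)] by simp
 have H: "H \<in> equivariant_poly c a (Suc m)"
  unfolding H_def by (rule complex_fun.subspace_diff[OF equivariant_poly_subspace P xQ])
 have "dslash c H x = 0" for x
 proof -
  have "P = (\<lambda>x. H x + xslash ?c Q x)" by (simp add: H_def fun_eq_iff)
  hence "dslash c P x = dslash c H x + dslash c (xslash ?c Q) x"
   using dslash_add[of H x "xslash ?c Q" c] d H xQ unfolding equivariant_poly_def by auto
  thus ?thesis using Q(2) by simp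
 qed
 hence "H \<in> monogenic c a (Suc m)" using H by (simp add: monogenic_def)
 moreover have "P = H + xslash ?c Q" by (simp add: H_def)
 ultimately show ?thesis using that Q(1) by blast
qed

text \<open>The Fischer decomposition is direct: if x Q is monogenic, injectivity forces Q = 0.
  Monogenic polynomials are thereby counted by equivariant ones with values in the two half spin
  modules.\<close>

lemma dim_monogenic_Suc:
 fixes c :: "'n::{finite,linorder} => complex ^ 'k ^ 'k"
 assumes c: "clifford_relations c" and n: "CARD('n) \<ge> 2" and a: "a \<in> SpinG"
 shows "complex_fun.dim (equivariant_poly c a (Suc m))
  = complex_fun.dim (monogenic c a (Suc m)) + complex_fun.dim (equivariant_poly (neg_module c) a m)"
proof -
 let ?c = "neg_module c"
 note c' = clifford_relations_neg[OF c]
 let ?V = "equivariant_poly ?c a m"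
 obtain SU where SU: "finite SU" "monogenic c a (Suc m) \<subseteq> complex_fun.span SU" using equivariant_poly_finite_span(2) by blast
 obtain SE where SE: "finite SE" "equivariant_poly c a (Suc m) \<subseteq> complex_fun.span SE" using equivariant_poly_finite_span(1) by blast
 obtain SV where SV: "finite SV" "?V \<subseteq> complex_fun.span SV" using equivariant_poly_finite_span(1) by blast
 have inj: "Q = 0" if Q: "Q \<in> ?V" and z: "xslash ?c Q = 0" for Q
 proof
  fix x
  have "dslash c (xslash ?c Q) x = 0" for x
   unfolding z using dslash_const[OF homogeneous_zero] by (simp add: zero_fun_def)
  thus "Q x = 0 x"
   using dslash_xslash_injective[OF c' _ n, of m Q] Q by (simp add: equivariant_poly_def)
 qed
 have lin: "complex_fun.subspace (xslash ?c ` ?V)" "complex_fun.dim (xslash ?c ` ?V) = complex_fun.dim ?V"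
  by (rule complex_fun_dim_image[OF equivariant_poly_subspace SV(2,1) _ _ inj];
    simp add: xslash_def[abs_def] fun_eq_iff mvec.add_right smult_matrix_vector)+
 have sub: "xslash ?c ` ?V \<subseteq> equivariant_poly c a (Suc m)"
  using xslash_equivariant[OF c' a] by auto
 have "complex_fun.dim (equivariant_poly c a (Suc m)) = complex_fun.dim (monogenic c a (Suc m)) + complex_fun.dim (xslash ?c ` ?V)"
 proof (rule complex_fun_dim_direct_sum[OF monogenic_subspace SU(2,1) lin(1) _ SE(1)])
  show "xslash ?c ` ?V \<subseteq> complex_fun.span SE" using sub SE(2) by blast
  show "monogenic c a (Suc m) \<inter> xslash ?c ` ?V \<subseteq> {0}"
  proof
   fix P assume P: "P \<in> monogenic c a (Suc m) \<inter> xslash ?c ` ?V"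
   then obtain Q where Q: "Q \<in> ?V" "P = xslash ?c Q" by blast
   have "dslash c (xslash ?c Q) x = 0" for x using P Q by (auto simp: monogenic_def)
   hence "Q x = 0" for x
    using dslash_xslash_injective[OF c' _ n, of m Q] Q(1) by (simp add: equivariant_poly_def)
   thus "P \<in> {0}" unfolding Q(2) by (simp add: xslash_def[abs_def] mvec.zero_right zero_fun_def)
  qed
  show "equivariant_poly c a (Suc m) = {u + v |u v. u \<in> monogenic c a (Suc m) \<and> v \<in> xslash ?c ` ?V}"
  proof (intro set_eqI iffI)
   fix P assume "P \<in> equivariant_poly c a (Suc m)"
   then obtain H Q where "H \<in> monogenic c a (Suc m)" "Q \<in> ?V" "P = H + xslash ?c Q"
    using fischer_decomposition[OF c n a] by blast
   thus "P \<in> {u + v |u v. u \<in> monogenic c a (Suc m) \<and> v \<in> xslash ?c ` ?V}" by blast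
  next
   fix P assume "P \<in> {u + v |u v. u \<in> monogenic c a (Suc m) \<and> v \<in> xslash ?c ` ?V}"
   then obtain u v where uv: "P = u + v" "u \<in> monogenic c a (Suc m)" "v \<in> xslash ?c ` ?V" by blast
   show "P \<in> equivariant_poly c a (Suc m)" unfolding uv(1)
    by (rule complex_fun.subspace_add[OF equivariant_poly_subspace]) (use uv(2,3) sub monogenic_def in blast)+
  qed
 qed
 thus ?thesis using lin(2) by simp
qed

lemma monogenic_0: "monogenic c a 0 = equivariant_poly c a 0"
 by (auto simp: monogenic_def equivariant_poly_def dslash_const)

section \<open>Rotation invariant integration on the sphere\<close>

definition plane_rotation :: "'n => 'n => real => 'n::{finite,linorder} rvector => 'n rvector"
 where "plane_rotation k l t x = x + (cos t - 1) *\<^sub>R (x $ k *\<^sub>R axis k 1 + x $ l *\<^sub>R axis l 1)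
  + sin t *\<^sub>R (x $ k *\<^sub>R axis l 1 - x $ l *\<^sub>R axis k 1)"

text \<open>A one-parameter group in the spin group, because the bivector squares to -1; the half
  angle is doubled by the covering. The curve \<open>horizontal_step i\<close> is the case
  \<open>k = last_index\<close>, \<open>l = i\<close>.\<close>

definition plane_spin :: "'n => 'n => real => 'n::{finite,linorder} clifford"
 where "plane_spin k l t = cos (t / 2) *\<^sub>R clifford_one + sin (t / 2) *\<^sub>R (egen k \<star> egen l)"

definition rotation_field :: "'n => 'n => 'n::{finite,linorder} rvector => 'n rvector"
 where "rotation_field k l x = x $ k *\<^sub>R axis l 1 - x $ l *\<^sub>R axis k 1"

lemma plane_spin_product:
 "plane_spin k l t = egen k \<star> clifford_vec (sin (t / 2) *\<^sub>R axis l 1 - cos (t / 2) *\<^sub>R axis k 1)"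
 by (simp add: plane_spin_def clifford_vec_diff clifford_vec_scaleR clifford.diff_right clifford.scaleR_right
   clifford_vec_unit_square norm_axis_1)

lemma plane_spin_mem:
 assumes "k \<noteq> l" "axis k 1 \<in> W" "axis l 1 \<in> W" "subspace W"
 shows "plane_spin k l t \<in> spin_group W"
proof -
 let ?v = "sin (t / 2) *\<^sub>R axis l 1 - cos (t / 2) *\<^sub>R axis k 1 :: 'a rvector"
 have "?v \<bullet> ?v = 1"
  using assms(1) sin_cos_squared_add[of "t / 2"]
  by (simp add: inner_diff_left inner_diff_right inner_axis_axis power2_eq_square)
 hence "norm ?v = 1" by (simp add: norm_eq_sqrt_inner)
 moreover have "?v \<in> W" using assms by (simp add: subspace_diff subspace_scale)
 ultimately show ?thesis unfolding plane_spin_product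
  using assms(2) by (intro spin_group_pair) (simp_all add: norm_axis_1)
qed

lemma plane_spin_UNIV: "k \<noteq> l ==> plane_spin k l t \<in> SpinG"
 by (rule plane_spin_mem) simp_all

lemma ee_square:
 assumes "k \<noteq> l"
 shows "(egen k \<star> egen l) \<star> (egen k \<star> egen l) = - (clifford_one :: 'n::{finite,linorder} clifford)"
proof -
 let ?k = "egen k :: 'n clifford" and ?l = "egen l :: 'n clifford"
 have anti: "?l \<star> ?k = - (?k \<star> ?l)"
  using clifford_vec_anticommute[of "axis l 1 :: 'n rvector" "axis k 1"] assms
  by (simp add: inner_axis_axis eq_neg_iff_add_eq_0)
 have "(?k \<star> ?l) \<star> (?k \<star> ?l) = ?k \<star> (?l \<star> ?k) \<star> ?l" by (simp only: clifford_assoc)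
 also have "\<dots> = - ((?k \<star> ?k) \<star> (?l \<star> ?l))"
  unfolding anti by (simp add: clifford.minus_left clifford.minus_right clifford_assoc)
 finally show ?thesis by (simp add: clifford_vec_unit_square norm_axis_1 clifford.minus_left)
qed

lemma plane_spin_add:
 assumes "k \<noteq> l"
 shows "plane_spin k l (s + t) = plane_spin k l s \<star> plane_spin k l t"
 unfolding plane_spin_def
 by (simp add: clifford.add_left clifford.add_right clifford.scaleR_left clifford.scaleR_right ee_square[OF assms]
   add_divide_distrib cos_add sin_add scaleR_diff_left scaleR_add_left scaleR_add_right scaleR_diff_right mult.commute)

lemma spin_cover_plane_spin:
 assumes "k \<noteq> l"
 shows "spin_cover (plane_spin k l t) *v x = plane_rotation k l t (x :: 'n::{finite,linorder} rvector)"
proof -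
 let ?g = "plane_spin k l t :: 'n clifford"
 let ?v = "sin (t / 2) *\<^sub>R axis l 1 - cos (t / 2) *\<^sub>R axis k 1 :: 'n rvector"
 let ?e = "axis k 1 :: 'n rvector"
 have "?v \<bullet> ?v = 1"
  using assms sin_cos_squared_add[of "t / 2"]
  by (simp add: inner_diff_left inner_diff_right inner_axis_axis power2_eq_square)
 hence nv: "norm ?v = 1" by (simp add: norm_eq_sqrt_inner)
 have g: "?g = vprod [?e, ?v]" by (simp add: plane_spin_product)
 have "?g \<star> clifford_vec x \<star> clifford_reverse ?g
   = clifford_vec ?e \<star> (clifford_vec ?v \<star> clifford_vec x \<star> clifford_vec ?v) \<star> clifford_vec ?e"
  unfolding g clifford_reverse_vprod by (simp add: clifford_assoc)
 also have "\<dots> = clifford_vec ((x - (2 * (?v \<bullet> x)) *\<^sub>R ?v) - (2 * (?e \<bullet> (x - (2 * (?v \<bullet> x)) *\<^sub>R ?v))) *\<^sub>R ?e)"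
  by (simp add: clifford_vec_reflection nv norm_axis_1)
 finally have "spin_cover ?g *v x = (x - (2 * (?v \<bullet> x)) *\<^sub>R ?v) - (2 * (?e \<bullet> (x - (2 * (?v \<bullet> x)) *\<^sub>R ?v))) *\<^sub>R ?e"
  unfolding spin_cover(1)[OF plane_spin_UNIV[OF assms]] clifford_vec_inject .
 also have "\<dots> = plane_rotation k l t x"
 proof -
  have c: "cos t = 1 - 2 * (sin (t/2))\<^sup>2" "cos t = 2 * (cos (t/2))\<^sup>2 - 1" "sin t = 2 * sin (t/2) * cos (t/2)"
   using cos_double_sin[of "t/2"] cos_double_cos[of "t/2"] sin_double[of "t/2"] by simp_all
  have k: "?e \<bullet> ?v = - cos (t/2)" using assms by (simp add: inner_diff_right inner_axis_axis)
  have vx: "?v \<bullet> x = sin (t/2) * x $ l - cos (t/2) * x $ k"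
   by (simp add: inner_diff_left inner_axis')
  show ?thesis
  proof (rule vec_eq_iff[THEN iffD2], rule allI)
   fix i
   consider "i = k" | "i = l" | "i \<noteq> k" "i \<noteq> l" by blast
   thus "((x - (2 * (?v \<bullet> x)) *\<^sub>R ?v) - (2 * (?e \<bullet> (x - (2 * (?v \<bullet> x)) *\<^sub>R ?v))) *\<^sub>R ?e) $ i = plane_rotation k l t x $ i"
   proof cases
    case 1
    have "x $ k - 2 * (sin (t/2) * x $ l - cos (t/2) * x $ k) * (- cos (t/2))
      - 2 * (x $ k - 2 * (sin (t/2) * x $ l - cos (t/2) * x $ k) * - cos (t/2))
     = x $ k + (2 * (cos (t/2))\<^sup>2 - 1 - 1) * x $ k - 2 * sin (t/2) * cos (t/2) * x $ l"
     by (simp add: algebra_simps power2_eq_square)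
    with 1 assms show ?thesis unfolding plane_rotation_def c(2)[symmetric] c(3)[symmetric]
     by (simp add: inner_diff_right k vx inner_axis' axis_component c(3))
   next
    case 2
    have "x $ l - 2 * (sin (t/2) * x $ l - cos (t/2) * x $ k) * sin (t/2)
     = x $ l + (1 - 2 * (sin (t/2))\<^sup>2 - 1) * x $ l + 2 * sin (t/2) * cos (t/2) * x $ k"
     by (simp add: algebra_simps power2_eq_square)
    with 2 assms show ?thesis unfolding plane_rotation_def c(1)[symmetric] c(3)[symmetric]
     by (simp add: vx axis_component c(3))
   next
    case 3
    thus ?thesis by (simp add: plane_rotation_def axis_component)
   qed
  qed
 qed
 finally show ?thesis .
qed

lemma plane_rotation_orthogonal: "k \<noteq> l ==> orthogonal_transformation (plane_rotation k l t)"
 using spin_cover(2)[OF plane_spin_UNIV] spin_cover_plane_spin by (metis ext)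

lemma plane_rotation_norm: "k \<noteq> l ==> norm (plane_rotation k l t x) = norm x"
 by (rule orthogonal_transformation_norm[OF plane_rotation_orthogonal])

lemma plane_rotation_add:
 assumes "k \<noteq> l"
 shows "plane_rotation k l (s + t) x = plane_rotation k l s (plane_rotation k l t x)"
 unfolding spin_cover_plane_spin[OF assms, symmetric] plane_spin_add[OF assms]
 by (simp add: spin_cover_mult[OF plane_spin_UNIV[OF assms] plane_spin_UNIV[OF assms]] matrix_vector_mul_assoc)

lemma plane_rotation_0 [simp]: "plane_rotation k l 0 x = x"
 by (simp add: plane_rotation_def)

lemma plane_rotation_swap: "plane_rotation l k t x = plane_rotation k l (- t) x"
 by (simp add: plane_rotation_def algebra_simps)

lemma plane_rotation_derivative:
 "((\<lambda>t. plane_rotation k l t x) has_vector_derivative rotation_field k l x) (at 0)"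
 unfolding plane_rotation_def rotation_field_def has_vector_derivative_def
 by (auto intro!: derivative_eq_intros)

lemma lborel_orthogonal:
 fixes R :: "'n::{finite,wellorder} rvector => 'n rvector"
 assumes R: "orthogonal_transformation R"
 shows "distr lborel borel R = lborel"
proof (rule lborel_eqI[symmetric])
 have linR: "linear R" using R by (rule orthogonal_transformation_linear)
 have mR: "R \<in> borel_measurable borel"
  by (rule borel_measurable_continuous_onI) (simp add: linR linear_continuous_on linear_conv_bounded_linear[symmetric])
 show "sets (distr lborel borel R) = sets borel" by simp
 fix a b :: "'n rvector" assume ab: "\<And>i. i \<in> Basis ==> a \<bullet> i \<le> b \<bullet> i"
 let ?S = "inv R"
 have S: "orthogonal_transformation ?S" by (rule orthogonal_transformation_inv[OF R])
 have linS: "linear ?S" using S by (rule orthogonal_transformation_linear)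
 have im: "R -` box a b = ?S ` box a b"
  using orthogonal_transformation_bij[OF R] by (metis bij_vimage_eq_inv_image)
 have lm: "box a b \<in> lmeasurable" "?S ` box a b \<in> lmeasurable"
  by (simp_all add: measurable_linear_image[OF linS])
 have "measure lebesgue (?S ` box a b) = measure lebesgue (box a b)"
  using measure_linear_image[OF linS lm(1)] orthogonal_transformation_det[OF S] by simp
 moreover have "?S ` box a b \<in> sets borel"
  unfolding im[symmetric] using measurable_sets_borel[OF mR, of "box a b"] by simp
 ultimately have "measure lborel (?S ` box a b) = measure lborel (box a b)" by simp
 moreover have "emeasure lborel (?S ` box a b) < \<infinity>"
 proof -
  have "bounded (?S ` box a b)"
   using bounded_linear_image[OF bounded_box] linS linear_conv_bounded_linear by blast
  thus ?thesis by (rule emeasure_bounded_finite)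
 qed
 moreover have "emeasure lborel (box a b) < \<infinity>" by (rule emeasure_bounded_finite) simp
 ultimately have "emeasure lborel (?S ` box a b) = emeasure lborel (box a b)"
  by (metis emeasure_eq_ennreal_measure infinity_ennreal_def less_irrefl)
 thus "emeasure (distr lborel borel R) (box a b) = (\<Prod>i\<in>Basis. (b - a) \<bullet> i)"
  using ab by (simp add: emeasure_distr mR im emeasure_lborel_box)
qed

text \<open>A rotation invariant integral over the unit sphere, obtained from the Lebesgue integral over
 the shell \<open>1 \<le> \<bar>x\<bar> \<le> 2\<close>; its normalisation is irrelevant.\<close>
definition shell :: "'n::{finite,wellorder} rvector set"
 where "shell = {x. 1 \<le> norm x \<and> norm x \<le> 2}"

definition sphere_integral :: "('n::{finite,wellorder} rvector => complex) => complex"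
 where "sphere_integral \<psi> = (LINT x|lborel. indicat_real shell x *\<^sub>R \<psi> (x /\<^sub>R norm x))"

lemma compact_shell: "compact (shell :: 'n::{finite,wellorder} rvector set)"
proof -
 have "shell = cball 0 2 - ball (0 :: 'n rvector) 1" by (auto simp: shell_def)
 moreover have "compact (cball 0 2 - ball (0 :: 'n rvector) 1)" by (intro compact_diff) simp_all
 ultimately show ?thesis by (simp only:)
qed

lemma shell_normalize:
 assumes "x \<in> shell" shows "norm (x /\<^sub>R norm x) = 1"
proof -
 have "norm x \<noteq> 0" using assms unfolding shell_def by auto
 thus ?thesis by simp
qed

lemma continuous_shell:
 fixes \<psi> :: "'n::{finite,wellorder} rvector => 'b::topological_space"
 assumes "cts_sphere \<psi>"
 shows "continuous_on shell (\<lambda>x. \<psi> (x /\<^sub>R norm x))"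
proof (rule continuous_on_compose2[OF assms])
 show "continuous_on shell (\<lambda>x :: 'n rvector. x /\<^sub>R norm x)"
  by (intro continuous_intros) (auto simp: shell_def)
 show "(\<lambda>x :: 'n rvector. x /\<^sub>R norm x) ` shell \<subseteq> sphere 0 1"
  by (intro image_subsetI) (simp only: mem_sphere_0 shell_normalize)
qed

lemma sphere_integrable:
 "cts_sphere \<psi> ==> integrable lborel (\<lambda>x :: 'n::{finite,wellorder} rvector. indicat_real shell x *\<^sub>R (\<psi> (x /\<^sub>R norm x) :: complex))"
 by (intro borel_integrable_compact compact_shell continuous_shell)

lemma sphere_integral_add:
 assumes "cts_sphere f" "cts_sphere g"
 shows "sphere_integral (\<lambda>x. f x + g x) = sphere_integral f + sphere_integral g"
 unfolding sphere_integral_def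
 using Bochner_Integration.integral_add[OF sphere_integrable[OF assms(1)] sphere_integrable[OF assms(2)]]
 by (simp add: scaleR_add_right)

lemma sphere_integral_mult: "sphere_integral (\<lambda>x. c * f x) = c * sphere_integral f"
proof -
 have e: "(\<lambda>x. indicat_real shell x *\<^sub>R (c * f (x /\<^sub>R norm x))) = (\<lambda>x. c * (indicat_real shell x *\<^sub>R f (x /\<^sub>R norm x)))"
  by simp
 show ?thesis unfolding sphere_integral_def e by (rule integral_mult_right_zero)
qed

lemma sphere_integral_zero [simp]: "sphere_integral (\<lambda>x. 0) = 0"
 by (simp add: sphere_integral_def)

lemma sphere_integral_diff:
 assumes "cts_sphere f" "cts_sphere g"
 shows "sphere_integral (\<lambda>x. f x - g x) = sphere_integral f - sphere_integral g"
 using sphere_integral_add[OF assms(1), of "\<lambda>x. -1 * g x"] assms(2) sphere_integral_mult[of "-1" g]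
 by (simp add: continuous_on_minus)

lemma sphere_integral_sum:
 fixes f :: "'i => 'n::{finite,wellorder} rvector => complex"
 assumes "finite I" "\<And>i. i \<in> I ==> cts_sphere (f i)"
 shows "sphere_integral (\<lambda>x. \<Sum>i\<in>I. f i x) = (\<Sum>i\<in>I. sphere_integral (f i))"
 using assms
proof (induction I rule: finite_induct)
 case (insert i I)
 thus ?case
  using sphere_integral_add[of "f i" "\<lambda>x. \<Sum>i\<in>I. f i x"] continuous_on_sum[of I "sphere 0 1" f] by simp
qed simp

lemma sphere_integral_cong:
 fixes f g :: "'n::{finite,wellorder} rvector => complex"
 assumes "\<And>x. norm x = 1 ==> f x = g x"
 shows "sphere_integral f = sphere_integral g"
 unfolding sphere_integral_def
proof (rule Bochner_Integration.integral_cong[OF refl])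
 fix x :: "'n rvector"
 show "indicat_real shell x *\<^sub>R f (x /\<^sub>R norm x) = indicat_real shell x *\<^sub>R g (x /\<^sub>R norm x)"
  using assms[OF shell_normalize[of x]] by (cases "x \<in> shell") simp_all
qed

lemma sphere_integral_bound:
 fixes f :: "'n::{finite,wellorder} rvector => complex"
 assumes f: "cts_sphere f" and M: "\<And>x. norm x = 1 ==> cmod (f x) \<le> M"
 shows "cmod (sphere_integral f) \<le> M * (LINT x|lborel. indicat_real (shell :: 'n rvector set) x)"
proof -
 have i: "integrable lborel (indicat_real (shell :: 'n rvector set))"
  using borel_integrable_compact[OF compact_shell, of "\<lambda>_ :: 'n rvector. 1 :: real"] by simp
 have "cmod (sphere_integral f) \<le> (LINT x|lborel. M * indicat_real (shell :: 'n rvector set) x)"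
  unfolding sphere_integral_def
 proof (rule Bochner_Integration.integral_norm_bound_integral[OF sphere_integrable[OF f]])
  show "integrable lborel (\<lambda>x. M * indicat_real (shell :: 'n rvector set) x)" using i by simp
  fix x :: "'n rvector"
  show "norm (indicat_real shell x *\<^sub>R f (x /\<^sub>R norm x)) \<le> M * indicat_real shell x"
   using M[OF shell_normalize, of x] by (cases "x \<in> shell") simp_all
 qed
 thus ?thesis by simp
qed

lemma sphere_integral_orthogonal:
 fixes R :: "'n::{finite,wellorder} rvector => 'n rvector"
 assumes R: "orthogonal_transformation R" and f: "cts_sphere f"
 shows "sphere_integral (\<lambda>x. f (R x)) = sphere_integral f"
proof -
 have linR: "linear R" using R by (rule orthogonal_transformation_linear)
 have mR: "R \<in> borel_measurable borel"
  by (rule borel_measurable_continuous_onI) (simp add: linR linear_continuous_on linear_conv_bounded_linear[symmetric])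
 let ?g = "\<lambda>x. indicat_real shell x *\<^sub>R f (x /\<^sub>R norm x)"
 have m: "?g \<in> borel_measurable borel"
  using borel_measurable_integrable[OF sphere_integrable[OF f]] by simp
 have "sphere_integral f = (LINT x|distr lborel borel R. ?g x)"
  unfolding sphere_integral_def lborel_orthogonal[OF R] ..
 also have "\<dots> = (LINT x|lborel. ?g (R x))"
  by (rule integral_distr) (use mR m in simp_all)
 also have "\<dots> = sphere_integral (\<lambda>x. f (R x))"
  unfolding sphere_integral_def
  by (simp add: orthogonal_transformation_norm[OF R] shell_def indicator_def linear_cmul[OF linR] cong: if_cong)
 finally show ?thesis by simp
qed

lemma sphere_integral_nonneg_zero:
 fixes f :: "'n::{finite,wellorder} rvector => real"
 assumes f: "cts_sphere f" and nn: "\<And>x. norm x = 1 ==> f x \<ge> 0"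
  and z: "sphere_integral (\<lambda>x. of_real (f x)) = 0" and x: "norm x = 1"
 shows "f x = 0"
proof (rule ccontr)
 assume nz: "f x \<noteq> 0"
 let ?g = "\<lambda>y. indicat_real shell y *\<^sub>R f (y /\<^sub>R norm y)"
 have i: "integrable lborel ?g"
  by (intro borel_integrable_compact compact_shell continuous_shell f)
 have "sphere_integral (\<lambda>x. of_real (f x)) = of_real (LINT y|lborel. ?g y)"
  unfolding sphere_integral_def by (subst integral_complex_of_real[symmetric]) (simp add: scaleR_conv_of_real)
 hence "(LINT y|lborel. ?g y) = 0" using z by simp
 moreover have "AE y in lborel. 0 \<le> ?g y"
  using nn[OF shell_normalize] by (intro AE_I2) (auto simp: indicator_def)
 ultimately have ae: "AE y in lborel. ?g y = 0"
  using integral_nonneg_eq_0_iff_AE[OF i] by simp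
 define U where "U = {y :: 'n rvector. 1 < norm y \<and> norm y < 2 \<and> f (y /\<^sub>R norm y) \<noteq> 0}"
 have "open U"
 proof -
  let ?O = "{y :: 'n rvector. 1 < norm y \<and> norm y < 2}"
  have o: "open ?O" by (intro open_Collect_conj open_Collect_less continuous_intros)
  have "continuous_on ?O (\<lambda>y. f (y /\<^sub>R norm y))"
   by (rule continuous_on_subset[OF continuous_shell[OF f]]) (auto simp: shell_def)
  hence "open (?O \<inter> (\<lambda>y. f (y /\<^sub>R norm y)) -` (- {0}))"
   using continuous_open_preimage[OF _ o] open_Compl[of "{0::real}"] by blast
  moreover have "?O \<inter> (\<lambda>y. f (y /\<^sub>R norm y)) -` (- {0}) = U" by (auto simp: U_def)
  ultimately show ?thesis by simp
 qed
 \<comment> \<open>This multiple of \<open>x\<close> lies in the interior of the shell, so that a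
   nonzero value is inherited by an open set of positive measure.\<close>
 moreover have "(3 / 2) *\<^sub>R x \<in> U" using x nz by (simp add: U_def)
 ultimately have "\<not> negligible U" using open_not_negligible by blast
 moreover have "negligible U"
 proof -
  have g: "?g y \<noteq> 0" if "y \<in> U" for y using that by (simp add: U_def shell_def)
  have "AE y in lebesgue. ?g y = 0" using ae by (rule AE_completion)
  hence "AE y in lebesgue. y \<notin> U"
   by (rule eventually_mono) (use g in blast)
  moreover have "U \<in> sets lebesgue" using \<open>open U\<close> by simp
  ultimately show ?thesis
   by (simp only: negligible_iff_null_sets AE_iff_null_sets)
 qed
 ultimately show False by blast
qed

text \<open>Continuously differentiable functions on the sphere, with their derivatives \<open>L\<^sub>k\<^sub>l\<close> along the
 infinitesimal rotations \<open>x\<^sub>k \<partial>\<^sub>l - x\<^sub>l \<partial>\<^sub>k\<close>.\<close>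
definition rotC1 :: "('n::{finite,wellorder} rvector => 'b::real_normed_vector) => ('n => 'n => 'n rvector => 'b) => bool"
 where "rotC1 f f' \<longleftrightarrow> cts_sphere f \<and>
  (\<forall>k l. k \<noteq> l \<longrightarrow> cts_sphere (f' k l) \<and>
   (\<forall>x. norm x = 1 \<longrightarrow> ((\<lambda>t. f (plane_rotation k l t x)) has_vector_derivative f' k l x) (at 0)))"

lemma rotC1_D:
 assumes "rotC1 f f'"
 shows "cts_sphere f" "k \<noteq> l ==> cts_sphere (f' k l)"
  "k \<noteq> l ==> norm x = 1 ==> ((\<lambda>t. f (plane_rotation k l t x)) has_vector_derivative f' k l x) (at 0)"
 using assms unfolding rotC1_def by blast+

lemma rotC1_linear:
 assumes "bounded_linear L"
 shows "rotC1 L (\<lambda>k l x. L (rotation_field k l x))"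
 unfolding rotC1_def rotation_field_def[symmetric]
proof (intro conjI allI impI)
 show "cts_sphere L" by (rule linear_continuous_on[OF assms])
 have "continuous_on UNIV (rotation_field k l)" for k l :: 'a
  unfolding rotation_field_def by (intro continuous_intros)
 thus "cts_sphere (\<lambda>x. L (rotation_field k l x))" for k l
  by (intro continuous_on_compose2[OF linear_continuous_on[OF assms, of UNIV]]) (auto intro: continuous_on_subset)
 show "((\<lambda>t. L (plane_rotation k l t x)) has_vector_derivative L (rotation_field k l x)) (at 0)" for k l x
  by (rule bounded_linear.has_vector_derivative[OF assms plane_rotation_derivative])
qed

lemma rotC1_bilinear:
 fixes f :: "'n::{finite,wellorder} rvector => 'a::real_normed_vector" and g :: "'n rvector => 'b::real_normed_vector"
 assumes b: "bounded_bilinear pr" and f: "rotC1 f f'" and g: "rotC1 g g'"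
 shows "rotC1 (\<lambda>x. pr (f x) (g x)) (\<lambda>k l x. pr (f x) (g' k l x) + pr (f' k l x) (g x))"
 unfolding rotC1_def
proof (intro conjI allI impI)
 show "cts_sphere (\<lambda>x. pr (f x) (g x))"
  by (intro bounded_bilinear.continuous_on[OF b] rotC1_D[OF f] rotC1_D[OF g])
 fix k l :: 'n assume kl: "k \<noteq> l"
 show "cts_sphere (\<lambda>x. pr (f x) (g' k l x) + pr (f' k l x) (g x))"
  by (intro continuous_on_add bounded_bilinear.continuous_on[OF b] rotC1_D[OF f] rotC1_D[OF g] kl)
 fix x :: "'n rvector" assume x: "norm x = 1"
 show "((\<lambda>t. pr (f (plane_rotation k l t x)) (g (plane_rotation k l t x))) has_vector_derivative
   pr (f x) (g' k l x) + pr (f' k l x) (g x)) (at 0)"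
  using bounded_bilinear.has_vector_derivative[OF b rotC1_D(3)[OF f kl x] rotC1_D(3)[OF g kl x]] by simp
qed

lemma rotC1_add:
 assumes "rotC1 f f'" "rotC1 g g'"
 shows "rotC1 (\<lambda>x. f x + g x) (\<lambda>k l x. f' k l x + g' k l x)"
 using assms unfolding rotC1_def by (auto intro!: continuous_on_add has_vector_derivative_add)

lemma rotC1_compose_linear:
 assumes L: "bounded_linear L" and f: "rotC1 f f'"
 shows "rotC1 (\<lambda>x. L (f x)) (\<lambda>k l x. L (f' k l x))"
 using f unfolding rotC1_def
 by (auto intro!: bounded_linear.continuous_on[OF L] bounded_linear.has_vector_derivative[OF L])

lemma rotC1_swap:
 assumes f: "rotC1 f f'" and kl: "k \<noteq> l" and x: "norm x = 1"
 shows "f' l k x = - f' k l x"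
proof -
 have "((\<lambda>t. - t) has_vector_derivative -1) (at (0::real))"
  by (auto intro!: derivative_eq_intros)
 moreover have "((\<lambda>t. f (plane_rotation k l t x)) has_vector_derivative f' k l x) (at (- 0))"
  using rotC1_D(3)[OF f kl x] by simp
 ultimately have "((\<lambda>t. f (plane_rotation k l (- t) x)) has_vector_derivative -1 *\<^sub>R f' k l x) (at 0)"
  using vector_diff_chain_at[of uminus "-1" 0 "\<lambda>t. f (plane_rotation k l t x)"] by (simp add: o_def)
 moreover have "((\<lambda>t. f (plane_rotation k l (- t) x)) has_vector_derivative f' l k x) (at 0)"
  using rotC1_D(3)[OF f not_sym[OF kl] x] by (simp only: plane_rotation_swap[of l k])
 ultimately have "-1 *\<^sub>R f' k l x = f' l k x" by (rule vector_derivative_unique_at)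
 thus ?thesis by simp
qed

text \<open>Integration by parts on the sphere. The difference quotients integrate to zero by
  rotation invariance; they converge to the derivative, and the mean value inequality bounds them
  uniformly, so dominated convergence applies.\<close>

lemma sphere_integral_rotation_derivative:
 fixes f :: "'n::{finite,wellorder} rvector => complex"
 assumes f: "rotC1 f f'" and kl: "k \<noteq> l"
 shows "sphere_integral (f' k l) = 0"
proof -
 let ?R = "plane_rotation k l"
 have cf: "cts_sphere f" and cf': "cts_sphere (f' k l)"
  using rotC1_D[OF f] kl by blast+
 have "compact ((f' k l) ` sphere 0 1)" by (rule compact_continuous_image[OF cf']) simp
 then obtain M where M: "\<And>x. norm x = 1 ==> cmod (f' k l x) \<le> M"
  unfolding bounded_iff using compact_imp_bounded bounded_iff by (metis imageI mem_sphere_0)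
 have der: "((\<lambda>t. f (?R t x)) has_vector_derivative f' k l (?R s x)) (at s)" if x: "norm x = 1" for x s
 proof -
  have "((\<lambda>t. f (?R t (?R s x))) has_vector_derivative f' k l (?R s x)) (at (s - s))"
   using rotC1_D(3)[OF f kl, of "?R s x"] x plane_rotation_norm[OF kl] by simp
  moreover have "((\<lambda>t. t - s) has_vector_derivative 1) (at s)"
   by (auto intro!: derivative_eq_intros)
  ultimately have "((\<lambda>t. f (?R (t - s) (?R s x))) has_vector_derivative 1 *\<^sub>R f' k l (?R s x)) (at s)"
   using vector_diff_chain_at[of "\<lambda>t. t - s" 1 s "\<lambda>t. f (?R t (?R s x))"] by (simp add: o_def)
  thus ?thesis by (simp flip: plane_rotation_add[OF kl])
 qed
 \<comment> \<open>Difference quotients with steps 1 / (n + 1), a sequence as required for dominated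
   convergence.\<close>
 define q where "q n x = of_nat (Suc n) * (f (?R (1 / real (Suc n)) x) - f x)" for n x
 have contR: "cts_sphere (\<lambda>x. f (?R t x))" for t
 proof (rule continuous_on_compose2[OF cf])
  show "cts_sphere (?R t)"
   using orthogonal_transformation_linear[OF plane_rotation_orthogonal[OF kl]]
   by (simp add: linear_continuous_on linear_conv_bounded_linear[symmetric])
 qed (auto simp: plane_rotation_norm[OF kl])
 have contq: "cts_sphere (q n)" for n
  unfolding q_def by (intro continuous_intros contR cf)
 have int0: "sphere_integral (q n) = 0" for n
  unfolding q_def[abs_def] sphere_integral_mult
  by (simp add: sphere_integral_diff[OF contR cf] sphere_integral_orthogonal[OF plane_rotation_orthogonal[OF kl] cf])
 have bound: "cmod (q n x) \<le> M" if x: "norm x = 1" for n x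
 proof -
  let ?t = "1 / real (Suc n)"
  have b: "norm (f (?R ?t x) - f (?R 0 x)) \<le> M * norm (?t - 0)"
  proof (rule differentiable_bound[where S = "{0..?t}" and f' = "\<lambda>s h. h *\<^sub>R f' k l (?R s x)"])
   fix s assume "s \<in> {0..?t}"
   show "((\<lambda>t. f (?R t x)) has_derivative (\<lambda>h. h *\<^sub>R f' k l (?R s x))) (at s within {0..?t})"
    using der[OF x, of s] has_derivative_at_withinI unfolding has_vector_derivative_def by blast
   show "onorm (\<lambda>h. h *\<^sub>R f' k l (?R s x)) \<le> M"
   proof (rule onorm_bound)
    have m: "cmod (f' k l (?R s x)) \<le> M" using M[of "?R s x"] x by (simp add: plane_rotation_norm[OF kl])
    thus "0 \<le> M" using norm_ge_zero order_trans by blast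
    show "norm (h *\<^sub>R f' k l (?R s x)) \<le> M * norm h" for h
     using mult_left_mono[OF m, of "\<bar>h\<bar>"] by (simp add: mult.commute)
   qed
  qed auto
  have "cmod (q n x) = real (Suc n) * norm (f (?R ?t x) - f (?R 0 x))"
   by (simp only: q_def norm_mult norm_of_nat plane_rotation_0)
  also have "\<dots> \<le> real (Suc n) * (M * norm (?t - 0))"
   by (rule mult_left_mono[OF b]) simp
  also have "\<dots> = M" by simp
  finally show ?thesis .
 qed
 have lim: "(\<lambda>n. q n x) \<longlonglongrightarrow> f' k l x" if x: "norm x = 1" for x
 proof -
  have "(\<lambda>h. norm (f (?R (0 + h) x) - f (?R 0 x) - h *\<^sub>R f' k l x) / norm h) \<midarrow>0\<rightarrow> 0"
   using rotC1_D(3)[OF f kl x] unfolding has_vector_derivative_def has_derivative_at by blast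
  moreover have "filterlim (\<lambda>n. 1 / real (Suc n)) (at 0) sequentially"
   unfolding filterlim_at using LIMSEQ_inverse_real_of_nat by (auto simp: inverse_eq_divide)
  ultimately have "(\<lambda>n. norm (f (?R (0 + 1 / real (Suc n)) x) - f (?R 0 x) - (1 / real (Suc n)) *\<^sub>R f' k l x) / norm (1 / real (Suc n))) \<longlonglongrightarrow> 0"
   by (rule filterlim_compose)
  moreover have "norm (f (?R (0 + 1 / real (Suc n)) x) - f (?R 0 x) - (1 / real (Suc n)) *\<^sub>R f' k l x) / norm (1 / real (Suc n))
    = norm (q n x - f' k l x)" for n
  proof -
   have "q n x - f' k l x = real (Suc n) *\<^sub>R (f (?R (0 + 1 / real (Suc n)) x) - f (?R 0 x) - (1 / real (Suc n)) *\<^sub>R f' k l x)"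
   proof -
    have "real (Suc n) *\<^sub>R (D - (1 / real (Suc n)) *\<^sub>R L) = of_nat (Suc n) * D - L" for D L :: complex
     by (simp add: scaleR_conv_of_real right_diff_distrib del: of_nat_Suc)
    thus ?thesis by (simp only: q_def add_0_left plane_rotation_0)
   qed
   thus ?thesis by (simp only: norm_scaleR) (simp add: field_simps)
  qed
  ultimately have "(\<lambda>n. norm (q n x - f' k l x)) \<longlonglongrightarrow> 0" by (simp only:)
  thus ?thesis by (rule LIM_zero_cancel[OF tendsto_norm_zero_cancel])
 qed
 let ?g = "\<lambda>\<psi> x. indicat_real shell x *\<^sub>R (\<psi> (x /\<^sub>R norm x) :: complex)"
 have "(\<lambda>n. sphere_integral (q n)) \<longlonglongrightarrow> sphere_integral (f' k l)"
  unfolding sphere_integral_def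
 proof (rule integral_dominated_convergence[where w = "\<lambda>x. \<bar>M\<bar> * indicat_real shell x"])
  show "?g (f' k l) \<in> borel_measurable lborel" "?g (q n) \<in> borel_measurable lborel" for n
   by (rule borel_measurable_integrable[OF sphere_integrable[OF cf']], rule borel_measurable_integrable[OF sphere_integrable[OF contq]])
  have "integrable lborel (indicat_real (shell :: 'n rvector set))"
   using borel_integrable_compact[OF compact_shell, of "\<lambda>_ :: 'n rvector. 1 :: real"] by simp
  thus "integrable lborel (\<lambda>x. \<bar>M\<bar> * indicat_real (shell :: 'n rvector set) x)" by simp
  show "AE x in lborel. (\<lambda>n. ?g (q n) x) \<longlonglongrightarrow> ?g (f' k l) x"
   using lim[OF shell_normalize] by (intro AE_I2) (auto simp: indicator_def)
  show "AE x in lborel. norm (?g (q n) x) \<le> \<bar>M\<bar> * indicat_real shell x" for n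
   using order_trans[OF bound[OF shell_normalize] abs_ge_self] by (intro AE_I2) (auto simp: indicator_def)
 qed
 thus ?thesis using LIMSEQ_unique[OF _ tendsto_const] by (simp add: int0)
qed

lemma rotC1_homogeneous:
 assumes P: "homogeneous m P"
 shows "rotC1 P (\<lambda>k l x. x $ k *\<^sub>R partial l P x - x $ l *\<^sub>R partial k P x)"
 unfolding rotC1_def
proof (intro conjI allI impI)
 show "cts_sphere P" by (rule homogeneous_continuous[OF P])
 have cp: "cts_sphere (partial i P)" for i
  using homogeneous_partial[OF P, of i] homogeneous_continuous by (auto split: if_splits)
 show "cts_sphere (\<lambda>x. x $ k *\<^sub>R partial l P x - x $ l *\<^sub>R partial k P x)" for k l
  by (intro continuous_intros cp)
 fix k l :: 'a and x :: "'a rvector"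
 have D: "(P has_derivative (\<lambda>v. \<Sum>i\<in>UNIV. v $ i *\<^sub>R partial i P x)) (at (plane_rotation k l 0 x))"
  using has_derivative_partial[OF homogeneous_differentiable[OF P]] by simp
 have "((\<lambda>t. P (plane_rotation k l t x)) has_derivative (\<lambda>h. \<Sum>i\<in>UNIV. (h *\<^sub>R rotation_field k l x) $ i *\<^sub>R partial i P x)) (at 0)"
  by (rule has_derivative_compose[OF plane_rotation_derivative[unfolded has_vector_derivative_def] D])
 moreover have "(\<Sum>i\<in>UNIV. (h *\<^sub>R rotation_field k l x) $ i *\<^sub>R partial i P x)
   = h *\<^sub>R (x $ k *\<^sub>R partial l P x - x $ l *\<^sub>R partial k P x)" for h
 proof -
  have "(\<Sum>i\<in>UNIV. (h *\<^sub>R rotation_field k l x) $ i *\<^sub>R partial i P x)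
   = h *\<^sub>R (\<Sum>i\<in>UNIV. (if i = l then x $ k *\<^sub>R partial i P x else 0) - (if i = k then x $ l *\<^sub>R partial i P x else 0))"
   unfolding scaleR_sum_right
   by (intro sum.cong refl) (simp add: rotation_field_def axis_component algebra_simps)
  thus ?thesis by (simp add: sum_subtractf)
 qed
 ultimately show "((\<lambda>t. P (plane_rotation k l t x)) has_vector_derivative
   x $ k *\<^sub>R partial l P x - x $ l *\<^sub>R partial k P x) (at 0)"
  unfolding has_vector_derivative_def by simp
qed

section \<open>Weights of the half spin modules\<close>

definition plane_bivector :: "nat => 'n::{finite,linorder} clifford"
 where "plane_bivector j = egen (idx (2 * j)) \<star> egen (idx (2 * j + 1))"

definition volume_element :: "8 clifford"
 where "volume_element = plane_bivector 0 \<star> (plane_bivector 1 \<star> (plane_bivector 2 \<star> plane_bivector 3))"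

lemma idx8_eq_iff [simp]: "p < 8 ==> p' < 8 ==> (idx p :: 8) = idx p' \<longleftrightarrow> p = p'"
 by (simp add: idx_eq_iff)

lemma last_index_8: "(last_index :: 8) = idx 7"
 by (simp add: last_index_idx)

lemma even_plane_bivector: "even_clifford (plane_bivector j)"
 unfolding plane_bivector_def by (rule even_clifford_vec_vec)

lemma clifford_vec_anti:
 assumes "i \<noteq> j"
 shows "egen i \<star> egen j = - (egen j \<star> egen i)"
 using clifford_vec_anticommute[of "axis i 1" "axis j 1"] assms
 by (simp add: inner_axis_axis eq_neg_iff_add_eq_0)

lemma clifford_vec_anti_assoc:
 assumes "i \<noteq> j"
 shows "egen i \<star> (egen j \<star> a) = - (egen j \<star> (egen i \<star> a))"
 by (simp only: clifford_assoc[symmetric] clifford_vec_anti[OF assms] clifford.minus_left)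

lemma clifford_vec_axis_square: "egen i \<star> egen i = - clifford_one"
 by (simp add: clifford_vec_unit_square norm_axis_1)

lemma clifford_vec_axis_square_assoc: "egen i \<star> (egen i \<star> a) = - a"
 by (simp only: clifford_assoc[symmetric] clifford_vec_axis_square clifford.minus_left clifford_one_left)

lemma plane_bivector_square: "j < 4 ==> plane_bivector j \<star> plane_bivector j = - (clifford_one :: 8 clifford)"
 unfolding plane_bivector_def by (rule ee_square) simp

text \<open>A vector of one plane anticommutes with both factors of the bivector of another plane.\<close>
lemma vec_plane_bivector:
 assumes "p < 8" "j < 4" "p \<noteq> 2 * j" "p \<noteq> 2 * j + 1"
 shows "egen (idx p :: 8) \<star> plane_bivector j = plane_bivector j \<star> egen (idx p)"
proof -
 have "(idx p :: 8) \<noteq> idx (2 * j)" "(idx p :: 8) \<noteq> idx (2 * j + 1)" using assms by simp_all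
 thus ?thesis unfolding plane_bivector_def
  by (simp add: clifford_assoc clifford_vec_anti_assoc[of "idx p"] clifford_vec_anti[of "idx p"] clifford.minus_right)
qed

lemma vec_plane_bivector_same:
 assumes "j < 4" "p = 2 * j \<or> p = 2 * j + 1"
 shows "egen (idx p :: 8) \<star> plane_bivector j = - (plane_bivector j \<star> egen (idx p))"
proof -
 have ne: "(idx (2 * j) :: 8) \<noteq> idx (2 * j + 1)" "(idx (2 * j + 1) :: 8) \<noteq> idx (2 * j)" using assms(1) by simp_all
 from assms(2) show ?thesis
 proof
  assume "p = 2 * j"
  thus ?thesis unfolding plane_bivector_def
   by (simp only: clifford_assoc clifford_vec_axis_square_assoc clifford_vec_anti[OF ne(2)] clifford.minus_right minus_minus)
 next
  assume "p = 2 * j + 1"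
  thus ?thesis unfolding plane_bivector_def
   by (simp only: clifford_assoc clifford_vec_anti_assoc[OF ne(2)])
 qed
qed

lemma plane_bivector_commute:
 assumes "j < 4" "k < 4"
 shows "plane_bivector j \<star> plane_bivector k = plane_bivector k \<star> (plane_bivector j :: 8 clifford)"
proof (cases "j = k")
 case False
 have f: "egen (idx (2 * j) :: 8) \<star> plane_bivector k = plane_bivector k \<star> egen (idx (2 * j))"
  "egen (idx (2 * j + 1) :: 8) \<star> plane_bivector k = plane_bivector k \<star> egen (idx (2 * j + 1))"
  by (rule vec_plane_bivector; use assms False in presburger)+
 thus ?thesis unfolding plane_bivector_def[of j]
  by (simp only: clifford_assoc f(2)) (simp only: clifford_assoc[symmetric] f(1))
qed simp

text \<open>A basis vector anticommutes with the bivector of its own plane and commutes with the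
  bivectors of the three other planes.\<close>

lemma volume_anticommute:
 fixes p :: nat
 assumes "p < 8"
 shows "egen (idx p) \<star> volume_element = - (volume_element \<star> egen (idx p))"
proof -
 let ?v = "egen (idx p :: 8)"
 define \<sigma> where "\<sigma> j = (if p = 2 * j \<or> p = 2 * j + 1 then -1 else 1 :: real)" for j :: nat
 have one: "?v \<star> plane_bivector j = \<sigma> j *\<^sub>R (plane_bivector j \<star> ?v)" if "j < 4" for j
  using vec_plane_bivector[OF assms that] vec_plane_bivector_same[OF that, of p] by (auto simp: \<sigma>_def)
 have oneA: "?v \<star> (plane_bivector j \<star> a) = \<sigma> j *\<^sub>R (plane_bivector j \<star> (?v \<star> a))" if "j < 4" for j a
  by (simp only: clifford_assoc[symmetric] one[OF that] clifford.scaleR_left)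
 have "?v \<star> volume_element = (\<sigma> 0 * \<sigma> 1 * \<sigma> 2 * \<sigma> 3) *\<^sub>R (volume_element \<star> ?v)"
  unfolding volume_element_def by (simp add: oneA one clifford.scaleR_right clifford_assoc mult_ac)
 moreover have "\<sigma> 0 * \<sigma> 1 * \<sigma> 2 * \<sigma> 3 = -1"
 proof -
  have "p = 0 \<or> p = 1 \<or> p = 2 \<or> p = 3 \<or> p = 4 \<or> p = 5 \<or> p = 6 \<or> p = 7" using assms by arith
  thus ?thesis by (elim disjE) (simp_all add: \<sigma>_def)
 qed
 ultimately show ?thesis by simp
qed

lemma volume_even: "even_clifford volume_element"
 unfolding volume_element_def by (intro even_clifford_mult even_plane_bivector)

text \<open>The four bivectors commute and each squares to -1, an even number of minus
  signs.\<close>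

lemma volume_square: "volume_element \<star> volume_element = clifford_one"
proof -
 let ?B = "plane_bivector :: nat => 8 clifford"
 have c: "?B j \<star> (?B k \<star> a) = ?B k \<star> (?B j \<star> a)" if "j < 4" "k < 4" for j k a
  by (simp only: clifford_assoc[symmetric] plane_bivector_commute[OF that])
 have s: "?B j \<star> (?B j \<star> a) = - a" if "j < 4" for j a
  by (simp only: clifford_assoc[symmetric] plane_bivector_square[OF that] clifford.minus_left clifford_one_left)
 have "volume_element \<star> volume_element = ?B 0 \<star> (?B 1 \<star> (?B 2 \<star> (?B 3 \<star> (?B 0 \<star> (?B 1 \<star> (?B 2 \<star> ?B 3))))))"
  by (simp add: volume_element_def clifford_assoc)
 also have "\<dots> = ?B 0 \<star> (?B 0 \<star> (?B 1 \<star> (?B 1 \<star> (?B 2 \<star> (?B 2 \<star> (?B 3 \<star> ?B 3))))))"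
  using c[of 3 0] c[of 2 0] c[of 1 0] c[of 3 1] c[of 2 1] c[of 3 2] by simp
 also have "\<dots> = clifford_one"
  by (simp add: s plane_bivector_square clifford.minus_right)
 finally show ?thesis .
qed

text \<open>The chirality \<eta> tells which half spin module \<open>c\<close> represents.
  Irreducibility enters the count only through this scalar; \<open>neg_module\<close> reverses it,
  so that both modules are treated alike.\<close>

definition chiral_module :: "(8 => complex ^ 8 ^ 8) => int => bool"
 where "chiral_module c \<eta> \<longleftrightarrow> clifford_relations c \<and> (\<eta> = 1 \<or> \<eta> = -1) \<and>
  (\<forall>u. rho c volume_element *v u = of_int \<eta> *s u)"

text \<open>Schur's lemma for the volume element, which is central in the even Clifford algebra.\<close>
lemma irreducible_chiral:
 assumes "irreducible_clifford_module c"
 shows "\<exists>\<eta>. chiral_module c \<eta>"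
proof -
 note c = irreducible_clifford_relations[OF assms]
 let ?V = "rho c volume_element"
 have VV: "?V *v (?V *v u) = u" for u
  by (simp add: matrix_vector_mul_assoc rho_mult[OF c volume_even volume_even, symmetric] volume_square)
 define W where "W = {u. ?V *v u = u}"
 have "vec.subspace W"
  unfolding vec.subspace_def W_def by (auto simp: mvec.zero_right mvec.add_right smult_matrix_vector)
 moreover have "c i *v u \<in> W" if i: "i \<noteq> last_index" and u: "u \<in> W" for i u
 proof -
  let ?e = "e_last \<star> egen i"
  have p: "position i < 8" using position_less_card[of i] by simp
  have "?e \<star> volume_element = volume_element \<star> ?e"
  proof -
   have "?e \<star> volume_element = e_last \<star> (egen (idx (position i)) \<star> volume_element)"
    by (simp add: clifford_assoc idx_position)
   also have "\<dots> = - (egen (idx 7) \<star> volume_element) \<star> egen i"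
    unfolding volume_anticommute[OF p]
    by (simp add: clifford_assoc idx_position clifford.minus_left clifford.minus_right last_index_8 clifford_vec_axis)
   also have "\<dots> = volume_element \<star> ?e"
    using volume_anticommute[of 7]
    by (simp add: clifford.minus_left clifford_assoc last_index_8 clifford_vec_axis)
   finally show ?thesis .
  qed
  hence "c i ** ?V = ?V ** c i"
   unfolding rho_e_last_axis[OF i, of c, symmetric]
   by (simp add: rho_mult[OF c even_clifford_e_last_vec(1) volume_even, symmetric]
     rho_mult[OF c volume_even even_clifford_e_last_vec(1), symmetric])
  hence "?V *v (c i *v u) = c i *v (?V *v u)" by (simp add: matrix_vector_mul_assoc)
  thus ?thesis using u by (simp add: W_def)
 qed
 ultimately have "W = {0} \<or> W = UNIV"
  using assms unfolding irreducible_clifford_module_def by blast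
 thus ?thesis
 proof
  assume W: "W = {0}"
  \<comment> \<open>As the volume element is an involution, \<open>?V u + u\<close> is fixed by it
    and hence vanishes.\<close>
  have "?V *v u = - u" for u
  proof -
   have "?V *v u + u \<in> W" by (simp add: W_def mvec.add_right VV add.commute)
   thus ?thesis using W by (simp add: eq_neg_iff_add_eq_0)
  qed
  hence "chiral_module c (-1)" using c by (simp add: chiral_module_def vec_eq_iff)
  thus ?thesis by blast
 next
  assume "W = UNIV"
  hence "chiral_module c 1" using c by (auto simp: chiral_module_def W_def)
  thus ?thesis by blast
 qed
qed

lemma chiral_module_neg:
 assumes "chiral_module c \<eta>"
 shows "chiral_module (neg_module c) (- \<eta>)"
proof -
 have c: "clifford_relations c" using assms by (simp add: chiral_module_def)
 have "- (e_last \<star> volume_element \<star> e_last) = - volume_element"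
  using volume_anticommute[of 7]
  by (simp add: last_index_8 clifford_vec_axis clifford.minus_left clifford_assoc)
   (simp add: eprod_mult clifford_sign_single clifford_one_def[symmetric] clifford.minus_right)
 hence "rho (neg_module c) volume_element = - rho c volume_element"
  by (simp add: rho_neg[OF volume_even] rho_minus)
 hence "rho (neg_module c) volume_element *v u = - (rho c volume_element *v u)" for u
  by (simp only: mvec.minus_left)
 thus ?thesis
  using assms clifford_relations_neg[OF c] by (auto simp: chiral_module_def vec_eq_iff)
qed

section \<open>Simultaneous eigenvectors of the plane bivectors\<close>

definition spin_weight :: "(8 => complex ^ 8 ^ 8) => int list => complex ^ 8 => bool"
 where "spin_weight c \<epsilon> v \<longleftrightarrow> v \<noteq> 0 \<and> (\<forall>j<4. rho c (plane_bivector j) *v v = (\<i> * of_int (\<epsilon> ! j)) *s v)"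

lemma rho_bivector_square:
 fixes c :: "8 => complex ^ 8 ^ 8"
 assumes "clifford_relations c" "j < 4"
 shows "rho c (plane_bivector j) *v (rho c (plane_bivector j) *v v) = - v"
 by (simp add: matrix_vector_mul_assoc rho_mult[OF assms(1) even_plane_bivector even_plane_bivector, symmetric]
   plane_bivector_square[OF assms(2)] rho_minus mvec.minus_left)

lemma rho_bivector_commute:
 fixes c :: "8 => complex ^ 8 ^ 8"
 assumes "clifford_relations c" "j < 4" "k < 4"
 shows "rho c (plane_bivector j) *v (rho c (plane_bivector k) *v v) = rho c (plane_bivector k) *v (rho c (plane_bivector j) *v v)"
 by (simp add: matrix_vector_mul_assoc rho_mult[OF assms(1) even_plane_bivector even_plane_bivector, symmetric]
   plane_bivector_commute[OF assms(2,3)])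

text \<open>Commuting operators of square -1 are diagonalised one after the other: the vector found
  so far is projected to an eigenspace of the next operator on which the projection is
  nonzero.\<close>

lemma spin_weight_exists:
 assumes c: "clifford_relations c"
 shows "\<exists>\<epsilon> v. length \<epsilon> = 4 \<and> set \<epsilon> \<subseteq> {1, -1} \<and> spin_weight c \<epsilon> v"
proof -
 let ?T = "\<lambda>j. rho c (plane_bivector j)"
 have "n \<le> 4 ==> \<exists>\<epsilon> v. length \<epsilon> = n \<and> set \<epsilon> \<subseteq> {1, -1 :: int} \<and> v \<noteq> 0 \<and> (\<forall>j<n. ?T j *v v = (\<i> * of_int (\<epsilon> ! j)) *s v)" for n
 proof (induction n)
  case 0
  show ?case by (rule exI[of _ "[]"], rule exI[of _ "axis undefined 1"]) (simp add: axis_eq_0_iff)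
 next
  case (Suc n)
  then obtain \<epsilon> v where v: "length \<epsilon> = n" "set \<epsilon> \<subseteq> {1, -1 :: int}" "v \<noteq> 0"
   "\<And>j. j < n ==> ?T j *v v = (\<i> * of_int (\<epsilon> ! j)) *s v" by auto
  have n: "n < 4" using Suc.prems by simp
  \<comment> \<open>Twice the projections of v to the two eigenspaces. Their sum is 2 v, so at least
    one of them is nonzero.\<close>
  define w where "w e = v - (\<i> * of_int e) *s (?T n *v v)" for e :: int
  have "w 1 + w (-1) = 2 *s v" by (simp add: w_def vec_eq_iff)
  hence "w 1 \<noteq> 0 \<or> w (-1) \<noteq> 0" using v(3) by (auto simp: vec_eq_iff)
  then obtain e where e: "e = 1 \<or> e = -1" "w e \<noteq> 0" by blast
  have "?T n *v w e = (\<i> * of_int e) *s w e"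
   using e(1) by (auto simp: w_def mvec.diff_right smult_matrix_vector rho_bivector_square[OF c n] vec_eq_iff algebra_simps)
  moreover have "?T j *v w e = (\<i> * of_int (\<epsilon> ! j)) *s w e" if j: "j < n" for j
  proof -
   have "?T j *v (?T n *v v) = ?T n *v (?T j *v v)" using j n by (intro rho_bivector_commute[OF c]) auto
   hence "?T j *v (?T n *v v) = (\<i> * of_int (\<epsilon> ! j)) *s (?T n *v v)"
    by (simp only: v(4)[OF j] smult_matrix_vector)
   thus ?thesis
    using v(4)[OF j] by (simp add: w_def mvec.diff_right smult_matrix_vector vec_eq_iff algebra_simps)
  qed
  ultimately show ?case
   using v(1,2) e by (intro exI[of _ "\<epsilon> @ [e]"] exI[of _ "w e"]) (auto simp: nth_append less_Suc_eq)
 qed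
 from this[of 4] show ?thesis unfolding spin_weight_def by auto
qed

lemma spin_weight_chirality:
 assumes c: "chiral_module c \<eta>" and \<epsilon>: "length \<epsilon> = 4" "spin_weight c \<epsilon> v"
 shows "prod_list \<epsilon> = \<eta>"
proof -
 have rel: "clifford_relations c" and vol: "\<And>u. rho c volume_element *v u = of_int \<eta> *s u"
  using c by (auto simp: chiral_module_def)
 have T: "rho c (plane_bivector j) *v v = (\<i> * of_int (\<epsilon> ! j)) *s v" if "j < 4" for j
  using \<epsilon>(2) that by (simp add: spin_weight_def)
 have A: "rho c volume_element *v v = (of_int (\<epsilon> ! 0) * of_int (\<epsilon> ! 1) * of_int (\<epsilon> ! 2) * of_int (\<epsilon> ! 3)) *s v"
  unfolding volume_element_def
  by (simp add: rho_mult[OF rel] even_clifford_mult even_plane_bivector matrix_vector_mul_assoc[symmetric] T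
    smult_matrix_vector vector_smult_assoc)
   (simp add: mult_ac)
 have p: "prod_list \<epsilon> = \<epsilon> ! 0 * \<epsilon> ! 1 * \<epsilon> ! 2 * \<epsilon> ! 3"
  by (rule length_4_cases[OF \<epsilon>(1)]) simp
 have "of_int (prod_list \<epsilon>) *s v = of_int \<eta> *s v" by (simp only: p of_int_mult A[symmetric] vol)
 moreover have "v \<noteq> 0" using \<epsilon>(2) by (simp add: spin_weight_def)
 ultimately have "(of_int (prod_list \<epsilon>) :: complex) = of_int \<eta>"
  by (auto simp: vec_eq_iff)
 thus ?thesis by simp
qed

text \<open>The product of a vector from plane j with one from plane 3 anticommutes with exactly the
  bivectors of these two planes. It therefore reverses these two signs, and it is
  invertible.\<close>

lemma spin_weight_flip:
 assumes c: "clifford_relations c" and v: "spin_weight c \<epsilon> v" and j: "j < 3" and len: "length \<epsilon> = 4"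
 shows "\<exists>w. spin_weight c (\<epsilon>[j := - \<epsilon> ! j, 3 := - \<epsilon> ! 3]) w"
proof -
 let ?a = "egen (idx (2 * j) :: 8)" and ?b = "egen (idx 6 :: 8)"
 let ?K = "rho c (?a \<star> ?b)"
 have ev: "even_clifford (?a \<star> ?b)" by (rule even_clifford_vec_vec)
 have KK: "?K *v (?K *v u) = - u" for u
  using ee_square[of "idx (2 * j) :: 8" "idx 6"] j
  by (simp add: matrix_vector_mul_assoc rho_mult[OF c ev ev, symmetric] rho_minus mvec.minus_left)
 have "?K *v v \<noteq> 0"
 proof
  assume "?K *v v = 0"
  hence "- v = 0" using KK[of v] by (simp add: mvec.zero_right)
  thus False using v by (simp add: spin_weight_def)
 qed
 moreover have "rho c (plane_bivector k) *v (?K *v v) = (\<i> * of_int ((\<epsilon>[j := - \<epsilon> ! j, 3 := - \<epsilon> ! 3]) ! k)) *s (?K *v v)"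
  if k: "k < 4" for k
 proof -
  define \<sigma> :: real where "\<sigma> = (if k = j \<or> k = 3 then -1 else 1)"
  have a: "?a \<star> plane_bivector k = (if k = j then -1 else 1) *\<^sub>R (plane_bivector k \<star> ?a)"
  proof (cases "k = j")
   case True
   thus ?thesis using vec_plane_bivector_same[of k "2 * j"] k by simp
  next
   case False
   have "?a \<star> plane_bivector k = plane_bivector k \<star> ?a"
    by (rule vec_plane_bivector; use j k False in presburger)
   thus ?thesis using False by simp
  qed
  have b: "?b \<star> plane_bivector k = (if k = 3 then -1 else 1) *\<^sub>R (plane_bivector k \<star> ?b)"
  proof (cases "k = 3")
   case True
   thus ?thesis using vec_plane_bivector_same[of k 6] by simp
  next
   case False
   have "?b \<star> plane_bivector k = plane_bivector k \<star> ?b"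
    by (rule vec_plane_bivector; use k False in presburger)
   thus ?thesis using False by simp
  qed
  have "(?a \<star> ?b) \<star> plane_bivector k = ?a \<star> (?b \<star> plane_bivector k)" by (rule clifford_assoc)
  also have "\<dots> = \<sigma> *\<^sub>R (plane_bivector k \<star> (?a \<star> ?b))"
   unfolding b clifford.scaleR_right clifford_assoc[symmetric] a clifford.scaleR_left
   using j by (auto simp: \<sigma>_def)
  finally have "?K ** rho c (plane_bivector k) = \<sigma> *\<^sub>R (rho c (plane_bivector k) ** ?K)"
   by (simp add: rho_mult[OF c ev even_plane_bivector, symmetric] rho_mult[OF c even_plane_bivector ev, symmetric]
     rho_scaleR)
  hence "?K *v (rho c (plane_bivector k) *v v) = \<sigma> *\<^sub>R (rho c (plane_bivector k) *v (?K *v v))"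
   by (simp add: matrix_vector_mul_assoc mvec.scaleR_left)
  moreover have "rho c (plane_bivector k) *v v = (\<i> * of_int (\<epsilon> ! k)) *s v"
   using v k by (simp add: spin_weight_def)
  ultimately have e: "(\<i> * of_int (\<epsilon> ! k)) *s (?K *v v) = \<sigma> *\<^sub>R (rho c (plane_bivector k) *v (?K *v v))"
   by (simp add: smult_matrix_vector)
  have "(\<epsilon>[j := - \<epsilon> ! j, 3 := - \<epsilon> ! 3]) ! k = (if k = j \<or> k = 3 then - \<epsilon> ! k else \<epsilon> ! k)"
   using j k len by (auto simp: nth_list_update)
  thus ?thesis using e by (auto simp: \<sigma>_def vec_eq_iff split: if_splits)
 qed
 ultimately show ?thesis unfolding spin_weight_def by blast
qed

text \<open>From any one weight, flips against plane 3 correct the first three signs. The last sign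
  is then forced by the chirality.\<close>

lemma spin_weight_all:
 assumes c: "chiral_module c \<eta>" and \<epsilon>: "\<epsilon> \<in> spin_signs \<eta>"
 shows "\<exists>v. spin_weight c \<epsilon> v"
proof -
 have rel: "clifford_relations c" using c by (simp add: chiral_module_def)
 obtain \<delta> v where \<delta>: "length \<delta> = 4" "set \<delta> \<subseteq> {1, -1 :: int}" "spin_weight c \<delta> v"
  using spin_weight_exists[OF rel] by blast
 note p\<delta> = spin_weight_chirality[OF c \<delta>(1,3)]
 have \<epsilon>': "length \<epsilon> = 4" "set \<epsilon> \<subseteq> {1, -1}" "prod_list \<epsilon> = \<eta>" using \<epsilon> by (auto simp: spin_signs_def)
 have flip: "\<exists>w. spin_weight c (\<xi>[j := - \<xi> ! j, 3 := - \<xi> ! 3]) w" if "\<exists>w. spin_weight c \<xi> w" "j < 3" "length \<xi> = 4" for \<xi> j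
  using spin_weight_flip[OF rel] that by blast
 obtain d0 d1 d2 d3 where d: "\<delta> = [d0, d1, d2, d3]" using length_4_cases[OF \<delta>(1)] .
 obtain e0 e1 e2 e3 where e: "\<epsilon> = [e0, e1, e2, e3]" using length_4_cases[OF \<epsilon>'(1)] .
 have f0: "\<exists>w. spin_weight c [- x0, x1, x2, - x3] w" and f1: "\<exists>w. spin_weight c [x0, - x1, x2, - x3] w"
  and f2: "\<exists>w. spin_weight c [x0, x1, - x2, - x3] w" if "\<exists>w. spin_weight c [x0, x1, x2, x3] w" for x0 x1 x2 x3
  using flip[OF that, of 0] flip[OF that, of 1] flip[OF that, of 2] by (simp_all add: eval_nat_numeral)
 have pm: "e = d \<or> e = - d" if "d = 1 \<or> d = -1" "e = 1 \<or> e = -1" for d e :: int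
  using that by auto
 have signs: "d0 = 1 \<or> d0 = -1" "d1 = 1 \<or> d1 = -1" "d2 = 1 \<or> d2 = -1" "e0 = 1 \<or> e0 = -1" "e1 = 1 \<or> e1 = -1" "e2 = 1 \<or> e2 = -1"
  using \<delta>(2) \<epsilon>'(2) unfolding d e by simp_all
 have "\<exists>w. spin_weight c [d0, d1, d2, d3] w" using \<delta>(3) unfolding d by (rule exI)
 then obtain x0 where x0: "\<exists>w. spin_weight c [e0, d1, d2, x0] w"
  using pm[OF signs(1,4)] f0[of d0 d1 d2 d3] by (elim disjE) simp_all
 then obtain x1 where x1: "\<exists>w. spin_weight c [e0, e1, d2, x1] w"
  using pm[OF signs(2,5)] f1[of e0 d1 d2 x0] by (elim disjE) simp_all
 then obtain x2 where "\<exists>w. spin_weight c [e0, e1, e2, x2] w"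
  using pm[OF signs(3,6)] f2[of e0 e1 d2 x1] by (elim disjE) simp_all
 then obtain x w where x: "spin_weight c [e0, e1, e2, x] w" by blast
 have "prod_list [e0, e1, e2, x] = \<eta>" by (rule spin_weight_chirality[OF c _ x]) simp
 hence "e0 * e1 * e2 * x = e0 * e1 * e2 * e3" using \<epsilon>'(3) unfolding e by (simp add: mult.assoc)
 moreover have "e0 * e1 * e2 \<noteq> 0" using \<epsilon>'(2) unfolding e by auto
 ultimately have "x = e3" by simp
 thus ?thesis using x e by blast
qed

definition weight_vector :: "(8 => complex ^ 8 ^ 8) => int list => complex ^ 8"
 where "weight_vector c \<epsilon> = (SOME v. spin_weight c \<epsilon> v)"

lemma weight_vector:
 assumes "chiral_module c \<eta>" "\<epsilon> \<in> spin_signs \<eta>"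
 shows "spin_weight c \<epsilon> (weight_vector c \<epsilon>)"
 unfolding weight_vector_def using spin_weight_all[OF assms] by (rule someI_ex)

lemma card_spin_signs:
 assumes "\<eta> = 1 \<or> \<eta> = -1"
 shows "card (spin_signs \<eta>) = 8"
proof -
 let ?f = "\<lambda>(a, b, c). [a, b, c, \<eta> * a * b * c]"
 let ?S = "{1, -1} \<times> {1, -1} \<times> {1, -1 :: int}"
 have "spin_signs \<eta> = ?f ` ?S"
 proof (intro set_eqI iffI)
  fix \<epsilon> assume "\<epsilon> \<in> spin_signs \<eta>"
  hence e: "length \<epsilon> = 4" "set \<epsilon> \<subseteq> {1, -1}" "prod_list \<epsilon> = \<eta>" by (auto simp: spin_signs_def)
  obtain e0 e1 e2 e3 where l: "\<epsilon> = [e0, e1, e2, e3]" using length_4_cases[OF e(1)] .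
  hence "e0 \<in> {1, -1}" "e1 \<in> {1, -1}" "e2 \<in> {1, -1}" "\<eta> = e0 * e1 * e2 * e3" using e by (auto simp: mult.assoc)
  hence "\<epsilon> = ?f (e0, e1, e2)" "(e0, e1, e2) \<in> ?S" unfolding l by auto
  thus "\<epsilon> \<in> ?f ` ?S" by blast
 next
  fix \<epsilon> assume "\<epsilon> \<in> ?f ` ?S"
  thus "\<epsilon> \<in> spin_signs \<eta>" using assms by (auto simp: spin_signs_def)
 qed
 moreover have "inj_on ?f ?S" by (auto simp: inj_on_def)
 ultimately show ?thesis by (simp add: card_image card_cartesian_product)
qed

text \<open>Twice the projection to the eigenspace of the j-th bivector for the eigenvalue
  \<open>\<i> \<epsilon>\<^sub>j\<close>.\<close>

definition weight_projection :: "(8 => complex ^ 8 ^ 8) => int list => nat => complex ^ 8 => complex ^ 8"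
 where "weight_projection c \<epsilon> j u = u - (\<i> * of_int (\<epsilon> ! j)) *s (rho c (plane_bivector j) *v u)"

lemma weight_projection_sum:
 "weight_projection c \<epsilon> j (\<Sum>i\<in>I. a i *s u i) = (\<Sum>i\<in>I. a i *s weight_projection c \<epsilon> j (u i))"
 by (induction I rule: infinite_finite_induct)
  (simp_all add: weight_projection_def mvec.add_right mvec.zero_right smult_matrix_vector vec_eq_iff algebra_simps)

lemma weight_projection_weight:
 "spin_weight c \<delta> v ==> j < 4 ==> weight_projection c \<epsilon> j v = (1 + of_int (\<epsilon> ! j * \<delta> ! j)) *s v"
 by (simp add: weight_projection_def spin_weight_def vec_eq_iff algebra_simps)

lemma weight_projection_smult: "weight_projection c \<epsilon> j (a *s u) = a *s weight_projection c \<epsilon> j u"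
 using weight_projection_sum[of c \<epsilon> j "\<lambda>_. a" "\<lambda>_. u" "{()}"] by simp

text \<open>The product of the four doubled projections for \<epsilon> annihilates every other
  weight vector and multiplies the one of \<epsilon> by 2 to the fourth, that is 16.\<close>

lemma weight_vectors_independent:
 assumes c: "chiral_module c \<eta>" and z: "(\<Sum>\<epsilon>\<in>spin_signs \<eta>. a \<epsilon> *s weight_vector c \<epsilon>) = 0" and \<epsilon>: "\<epsilon> \<in> spin_signs \<eta>"
 shows "a \<epsilon> = 0"
proof -
 let ?p = "weight_projection c \<epsilon>"
 let ?q = "\<lambda>u. ?p 0 (?p 1 (?p 2 (?p 3 u)))"
 have e4: "length \<delta> = 4 \<and> set \<delta> \<subseteq> {1, -1}" if "\<delta> \<in> spin_signs \<eta>" for \<delta>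
  using that by (simp add: spin_signs_def)
 have q: "?q (weight_vector c \<delta>) = (if \<delta> = \<epsilon> then 16 *s weight_vector c \<epsilon> else 0)" if \<delta>: "\<delta> \<in> spin_signs \<eta>" for \<delta>
 proof -
  have "?q (weight_vector c \<delta>) = ((1 + of_int (\<epsilon> ! 3 * \<delta> ! 3)) * (1 + of_int (\<epsilon> ! 2 * \<delta> ! 2)) *
    (1 + of_int (\<epsilon> ! 1 * \<delta> ! 1)) * (1 + of_int (\<epsilon> ! 0 * \<delta> ! 0))) *s weight_vector c \<delta>"
  proof -
   have W: "?p j (weight_vector c \<delta>) = (1 + of_int (\<epsilon> ! j * \<delta> ! j)) *s weight_vector c \<delta>" if "j < 4" for j
    by (rule weight_projection_weight[OF weight_vector[OF c \<delta>] that])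
   have lt: "(0::nat) < 4" "(1::nat) < 4" "(2::nat) < 4" "(3::nat) < 4" by simp_all
   show ?thesis by (simp only: W[OF lt(1)] W[OF lt(2)] W[OF lt(3)] W[OF lt(4)] weight_projection_smult vector_smult_assoc)
  qed
  moreover have pm: "\<xi> ! j = 1 \<or> \<xi> ! j = -1" if "\<xi> \<in> spin_signs \<eta>" "j < 4" for \<xi> j
  proof -
   have "\<xi> ! j \<in> set \<xi>" using e4[OF that(1)] that(2) by (intro nth_mem) simp
   thus ?thesis using e4[OF that(1)] by blast
  qed
  ultimately show ?thesis
  proof (cases "\<delta> = \<epsilon>")
   case True
   have "\<epsilon> ! j * \<epsilon> ! j = 1" if "j < 4" for j using pm[OF \<epsilon> that] by auto
   thus ?thesis using \<open>?q (weight_vector c \<delta>) = _\<close> unfolding True by simp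
  next
   case False
   then obtain j where j: "j < 4" "\<delta> ! j \<noteq> \<epsilon> ! j"
    using e4[OF \<delta>] e4[OF \<epsilon>] nth_equalityI[of \<delta> \<epsilon>] by metis
   hence "\<epsilon> ! j * \<delta> ! j = -1" using pm[OF \<delta> j(1)] pm[OF \<epsilon> j(1)] by auto
   hence z: "(1 + of_int (\<epsilon> ! j * \<delta> ! j) :: complex) = 0" by simp
   have "j = 0 \<or> j = 1 \<or> j = 2 \<or> j = 3" using j(1) by arith
   hence "(1 + of_int (\<epsilon> ! 3 * \<delta> ! 3) :: complex) * (1 + of_int (\<epsilon> ! 2 * \<delta> ! 2)) *
     (1 + of_int (\<epsilon> ! 1 * \<delta> ! 1)) * (1 + of_int (\<epsilon> ! 0 * \<delta> ! 0)) = 0"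
    using z by (elim disjE) (simp_all only: mult_zero_left mult_zero_right)
   thus ?thesis using \<open>?q (weight_vector c \<delta>) = _\<close> False by (simp only: if_False vector_smult_lzero)
  qed
 qed
 have "?q 0 = 0" by (simp add: weight_projection_def mvec.zero_right)
 hence "(\<Sum>\<delta>\<in>spin_signs \<eta>. a \<delta> *s ?q (weight_vector c \<delta>)) = 0"
  using z by (simp add: weight_projection_sum[symmetric])
 moreover have "(\<Sum>\<delta>\<in>spin_signs \<eta>. a \<delta> *s ?q (weight_vector c \<delta>)) = (\<Sum>\<delta>\<in>spin_signs \<eta>. if \<delta> = \<epsilon> then a \<epsilon> *s (16 *s weight_vector c \<epsilon>) else 0)"
  by (intro sum.cong refl) (simp only: q if_distrib[of "\<lambda>u. _ *s u"] vector_smult_rzero, simp cong: if_cong)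
 ultimately have "a \<epsilon> *s (16 *s weight_vector c \<epsilon>) = 0" using \<epsilon> by simp
 moreover have "weight_vector c \<epsilon> \<noteq> 0" using weight_vector[OF c \<epsilon>] by (simp add: spin_weight_def)
 ultimately show ?thesis by (auto simp: vec_eq_iff)
qed

text \<open>There are eight sign vectors of a given product, as many as the dimension of the module,
  so the independent weight vectors form a basis.\<close>

lemma weight_vectors_span:
 assumes c: "chiral_module c \<eta>"
 obtains a where "u = (\<Sum>\<epsilon>\<in>spin_signs \<eta>. a \<epsilon> *s weight_vector c \<epsilon>)"
proof -
 let ?w = "weight_vector c" and ?S = "spin_signs \<eta>"
 have \<eta>: "\<eta> = 1 \<or> \<eta> = -1" using c by (auto simp: chiral_module_def)
 have inj: "inj_on ?w ?S"
 proof (rule inj_onI)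
  fix \<delta> \<epsilon> assume d: "\<delta> \<in> ?S" "\<epsilon> \<in> ?S" "?w \<delta> = ?w \<epsilon>"
  show "\<delta> = \<epsilon>"
  proof (rule ccontr)
   assume ne: "\<delta> \<noteq> \<epsilon>"
   define a :: "int list => complex" where "a = (\<lambda>\<xi>. if \<xi> = \<delta> then 1 else if \<xi> = \<epsilon> then -1 else 0)"
   have "(\<Sum>\<xi>\<in>?S. a \<xi> *s ?w \<xi>) = (\<Sum>\<xi>\<in>?S. (if \<xi> = \<delta> then ?w \<delta> else 0) - (if \<xi> = \<epsilon> then ?w \<epsilon> else 0))"
    using ne by (intro sum.cong refl) (auto simp: a_def vec_eq_iff)
   also have "\<dots> = 0" using d by (simp add: sum_subtractf)
   finally have "a \<delta> = 0" using weight_vectors_independent[OF c] d(1) by blast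
   thus False by (simp add: a_def)
  qed
 qed
 have fin: "finite (?w ` ?S)" by simp
 have "vec.independent (?w ` ?S)"
  unfolding vec.dependent_finite[OF fin]
 proof (intro notI, elim exE conjE bexE)
  fix b v assume b: "v \<in> ?w ` ?S" "b v \<noteq> 0" "(\<Sum>v\<in>?w ` ?S. b v *s v) = 0"
  hence "(\<Sum>\<epsilon>\<in>?S. b (?w \<epsilon>) *s ?w \<epsilon>) = 0" by (simp add: sum.reindex[OF inj])
  thus False using weight_vectors_independent[OF c, of "\<lambda>\<epsilon>. b (?w \<epsilon>)"] b(1,2) by blast
 qed
 moreover have "vec.dim (UNIV :: (complex ^ 8) set) \<le> card (?w ` ?S)"
  using card_image[OF inj] card_spin_signs[OF \<eta>] by (subst vec_dim_card) simp
 ultimately have "UNIV \<subseteq> vec.span (?w ` ?S)" by (intro vec.card_ge_dim_independent) auto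
 hence "u \<in> range (\<lambda>b. \<Sum>v\<in>?w ` ?S. b v *s v)" unfolding vec.span_finite[OF fin, symmetric] by blast
 then obtain b where "u = (\<Sum>v\<in>?w ` ?S. b v *s v)" by blast
 hence "u = (\<Sum>\<epsilon>\<in>?S. b (?w \<epsilon>) *s ?w \<epsilon>)" by (simp add: sum.reindex[OF inj])
 thus thesis by (rule that)
qed

section \<open>A basis of weight vectors\<close>

lemma scaleR_smult: "a *\<^sub>R (v :: complex ^ 'k) = complex_of_real a *s v"
 by (simp add: vec_eq_iff scaleR_conv_of_real[where 'a = complex])

lemma homogeneous_zcoord:
 assumes "homogeneous m P"
 shows "homogeneous (Suc m) (\<lambda>x. zcoord j x *s P x)" "homogeneous (Suc m) (\<lambda>x. cnj (zcoord j x) *s P x)"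
proof -
 have "(\<lambda>x. zcoord j x *s P x) = (\<lambda>x. x $ idx (2 * j) *\<^sub>R P x + x $ idx (2 * j + 1) *\<^sub>R (\<i> *s P x))"
  "(\<lambda>x. cnj (zcoord j x) *s P x) = (\<lambda>x. x $ idx (2 * j) *\<^sub>R P x + x $ idx (2 * j + 1) *\<^sub>R ((- \<i>) *s P x))"
  by (simp_all add: fun_eq_iff vec_eq_iff zcoord_def Complex_eq scaleR_smult algebra_simps)
 thus "homogeneous (Suc m) (\<lambda>x. zcoord j x *s P x)" "homogeneous (Suc m) (\<lambda>x. cnj (zcoord j x) *s P x)"
  using assms by (simp_all only: homogeneous.add homogeneous.mult homogeneous_smult)
qed

lemma homogeneous_zcoord_power:
 "homogeneous m P ==> homogeneous (a + m) (\<lambda>x. zcoord j x ^ a *s P x)"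
 "homogeneous m P ==> homogeneous (a + m) (\<lambda>x. cnj (zcoord j x) ^ a *s P x)"
proof (induction a)
 case (Suc a)
 {
  case 1
  thus ?case using homogeneous_zcoord(1)[OF Suc(1)] by (simp add: vector_smult_assoc)
 next
  case 2
  thus ?case using homogeneous_zcoord(2)[OF Suc(2)] by (simp add: vector_smult_assoc)
 }
qed simp_all

definition torus_monomial :: "nat list \<times> nat list => nat => (nat => complex) => complex"
 where "torus_monomial ab n z = (\<Prod>j<n. z j ^ (fst ab ! j) * cnj (z j) ^ (snd ab ! j))"

definition weight_function ::
  "(8 => complex ^ 8 ^ 8) => (nat list \<times> nat list) \<times> int list => 8 rvector => complex ^ 8"
 where "weight_function c i x = torus_monomial (fst i) 4 (\<lambda>j. zcoord j x) *s weight_vector c (snd i)"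

lemma homogeneous_torus_monomial:
 "homogeneous (\<Sum>j<n. fst ab ! j + snd ab ! j) (\<lambda>x. torus_monomial ab n (\<lambda>j. zcoord j x) *s v)"
proof (induction n)
 case 0
 show ?case by (simp add: torus_monomial_def homogeneous.const)
next
 case (Suc n)
 from homogeneous_zcoord_power(1)[where a = "fst ab ! n" and j = n, OF homogeneous_zcoord_power(2)[where a = "snd ab ! n" and j = n, OF Suc]]
 show ?case by (simp add: torus_monomial_def vector_smult_assoc mult_ac add_ac)
qed

lemma weight_function_homogeneous:
 assumes "i \<in> weight_index m \<eta>"
 shows "homogeneous m (weight_function c i)"
proof -
 have "length (fst (fst i)) = 4" "length (snd (fst i)) = 4" "sum_list (fst (fst i)) + sum_list (snd (fst i)) = m"
  using assms by (auto simp: weight_index_def)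
 hence "(\<Sum>j<4. fst (fst i) ! j + snd (fst i) ! j) = m"
  by (simp add: sum_list_sum_nth atLeast0LessThan sum.distrib)
 thus ?thesis using homogeneous_torus_monomial[of "fst i" 4] unfolding weight_function_def[abs_def] by simp
qed

lemma torus_monomial_raise:
 assumes "j < 4" "length \<alpha> = 4" "length \<beta> = 4"
 shows "z j * torus_monomial (\<alpha>, \<beta>) 4 z = torus_monomial (\<alpha>[j := Suc (\<alpha> ! j)], \<beta>) 4 z"
  "cnj (z j) * torus_monomial (\<alpha>, \<beta>) 4 z = torus_monomial (\<alpha>, \<beta>[j := Suc (\<beta> ! j)]) 4 z"
 using assms unfolding torus_monomial_def prod.remove[OF finite_lessThan, of j 4, simplified, OF assms(1)]
 by (auto simp: mult_ac intro!: prod.cong)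

lemma weight_index_raise:
 assumes "((\<alpha>, \<beta>), \<epsilon>) \<in> weight_index m \<eta>" "j < 4"
 shows "((\<alpha>[j := Suc (\<alpha> ! j)], \<beta>), \<epsilon>) \<in> weight_index (Suc m) \<eta>" "((\<alpha>, \<beta>[j := Suc (\<beta> ! j)]), \<epsilon>) \<in> weight_index (Suc m) \<eta>"
proof -
 have "sum_list (\<xi>[j := Suc (\<xi> ! j)]) = Suc (sum_list \<xi>)" if "length \<xi> = 4" for \<xi> :: "nat list"
  using that assms(2) sum_list_update[of j \<xi> "Suc (\<xi> ! j)"] member_le_sum_list[of "\<xi> ! j" \<xi>] by simp
 thus "((\<alpha>[j := Suc (\<alpha> ! j)], \<beta>), \<epsilon>) \<in> weight_index (Suc m) \<eta>" "((\<alpha>, \<beta>[j := Suc (\<beta> ! j)]), \<epsilon>) \<in> weight_index (Suc m) \<eta>"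
  using assms(1) by (auto simp: weight_index_def)
qed

lemma span_weight_functions_zcoord:
 assumes "P \<in> complex_fun.span (weight_function c ` weight_index m \<eta>)" "j < 4"
 shows "(\<lambda>x. zcoord j x *s P x) \<in> complex_fun.span (weight_function c ` weight_index (Suc m) \<eta>)" (is "?A P \<in> ?S")
  and "(\<lambda>x. cnj (zcoord j x) *s P x) \<in> complex_fun.span (weight_function c ` weight_index (Suc m) \<eta>)" (is "?B P \<in> ?S")
proof -
 have base: "?A b \<in> ?S" "?B b \<in> ?S" if b: "b \<in> weight_function c ` weight_index m \<eta>" for b
 proof -
  obtain \<alpha> \<beta> \<epsilon> where i: "((\<alpha>, \<beta>), \<epsilon>) \<in> weight_index m \<eta>" "b = weight_function c ((\<alpha>, \<beta>), \<epsilon>)" using b by auto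
  hence l: "length \<alpha> = 4" "length \<beta> = 4" by (auto simp: weight_index_def)
  have "?A b = weight_function c ((\<alpha>[j := Suc (\<alpha> ! j)], \<beta>), \<epsilon>)"
   by (simp add: fun_eq_iff i(2) weight_function_def vector_smult_assoc torus_monomial_raise(1)[OF assms(2) l, where z = "\<lambda>j. zcoord j _"])
  moreover have "?B b = weight_function c ((\<alpha>, \<beta>[j := Suc (\<beta> ! j)]), \<epsilon>)"
   by (simp add: fun_eq_iff i(2) weight_function_def vector_smult_assoc torus_monomial_raise(2)[OF assms(2) l, where z = "\<lambda>j. zcoord j _"])
  ultimately show "?A b \<in> ?S" "?B b \<in> ?S"
   using weight_index_raise[OF i(1) assms(2)] by (simp_all only: complex_fun.span_base imageI)
 qed
 have "?A P \<in> ?S \<and> ?B P \<in> ?S"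
  using assms(1)
 proof (induction rule: complex_fun.span_induct_alt)
  case base
  thus ?case using complex_fun.span_zero[of "weight_function c ` weight_index (Suc m) \<eta>"] by (simp add: zero_fun_def)
 next
  case (step a f g)
  have "(\<lambda>x. a *s ?A f x) + ?A g \<in> ?S" "(\<lambda>x. a *s ?B f x) + ?B g \<in> ?S"
   using step base[OF step(1)] by (intro complex_fun.span_add complex_fun.span_scale; blast)+
  moreover have "(\<lambda>x. a *s ?A f x) + ?A g = ?A ((\<lambda>x. a *s f x) + g)" "(\<lambda>x. a *s ?B f x) + ?B g = ?B ((\<lambda>x. a *s f x) + g)"
   by (simp_all add: fun_eq_iff vec_eq_iff algebra_simps)
  ultimately show ?case by (simp only:)
 qed
 thus "?A P \<in> ?S" "?B P \<in> ?S" by blast+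
qed

text \<open>A real coordinate is a combination of a complex coordinate and its conjugate, and
  multiplication by either of these raises one exponent. Constants are covered by the basis of
  weight vectors.\<close>

lemma homogeneous_span_weight_functions:
 assumes c: "chiral_module c \<eta>" and P: "homogeneous m P"
 shows "P \<in> complex_fun.span (weight_function c ` weight_index m \<eta>)"
 using P
proof (induction rule: homogeneous.induct)
 case (const v)
 obtain a where a: "v = (\<Sum>\<epsilon>\<in>spin_signs \<eta>. a \<epsilon> *s weight_vector c \<epsilon>)" by (rule weight_vectors_span[OF c])
 let ?o = "[0, 0, 0, 0] :: nat list"
 have "(\<lambda>x :: 8 rvector. v) = (\<Sum>\<epsilon>\<in>spin_signs \<eta>. (\<lambda>x. a \<epsilon> *s weight_function c ((?o, ?o), \<epsilon>) x))"
  by (simp add: fun_eq_iff sum_fun_apply a weight_function_def torus_monomial_def prod_lessThan_4)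
 moreover have "\<dots> \<in> complex_fun.span (weight_function c ` weight_index 0 \<eta>)"
  by (intro complex_fun.span_sum complex_fun.span_scale complex_fun.span_base imageI) (simp add: weight_index_def)
 ultimately show ?case by (simp only:)
next
 case (mult m P i)
 let ?S = "complex_fun.span (weight_function c ` weight_index (Suc m) \<eta>)"
 define p where "p = position i"
 have p: "p < 8" "idx p = i" using position_less_card[of i] by (auto simp: p_def idx_position)
 define j where "j = p div 2"
 have j: "j < 4" using p by (simp add: j_def)
 note z = span_weight_functions_zcoord[OF mult.IH j]
 have "p = 2 * j \<or> p = 2 * j + 1" unfolding j_def by linarith
 thus ?case
 proof
  assume "p = 2 * j"
  hence "i = idx (2 * j)" using p(2) by simp
  hence "(\<lambda>x. x $ i *\<^sub>R P x) = (\<lambda>x. (1 / 2) *s (zcoord j x *s P x)) + (\<lambda>x. (1 / 2) *s (cnj (zcoord j x) *s P x))"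
   by (simp add: fun_eq_iff vec_eq_iff zcoord_def Complex_eq scaleR_smult algebra_simps)
  moreover have "\<dots> \<in> ?S" by (intro complex_fun.span_add complex_fun.span_scale z)
  ultimately show ?case by (simp only:)
 next
  assume "p = 2 * j + 1"
  hence "i = idx (2 * j + 1)" using p(2) by simp
  hence "(\<lambda>x. x $ i *\<^sub>R P x) = (\<lambda>x. (- \<i> / 2) *s (zcoord j x *s P x)) + (\<lambda>x. (\<i> / 2) *s (cnj (zcoord j x) *s P x))"
   by (simp add: fun_eq_iff vec_eq_iff zcoord_def Complex_eq scaleR_smult algebra_simps)
  moreover have "\<dots> \<in> ?S" by (intro complex_fun.span_add complex_fun.span_scale z)
  ultimately show ?case by (simp only:)
 qed
next
 case (add m P Q)
 thus ?case using complex_fun.span_add[of P _ Q] by (simp add: plus_fun_def)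
qed

section \<open>Independence of monomials in complex coordinates and their conjugates\<close>

lemma power_sum_zero:
 fixes f :: "nat => complex"
 assumes "finite K" "infinite A" "\<And>t. t \<in> A ==> (\<Sum>k\<in>K. f k * t ^ k) = 0" "k \<in> K"
 shows "f k = 0"
proof (rule ccontr)
 assume "f k \<noteq> 0"
 define n where "n = Max K"
 let ?g = "\<lambda>i. if i \<in> K then f i else 0"
 have K: "K \<subseteq> {..n}" using assms(1) by (auto simp: n_def)
 have "(\<Sum>i\<le>n. ?g i * t ^ i) = (\<Sum>k\<in>K. f k * t ^ k)" for t
  using K assms(1) by (intro sum.mono_neutral_cong_right) auto
 hence "A \<subseteq> {t. (\<Sum>i\<le>n. ?g i * t ^ i) = 0}" using assms(3) by auto
 hence "infinite {t. (\<Sum>i\<le>n. ?g i * t ^ i) = 0}" using assms(2) finite_subset by blast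
 moreover have "\<exists>i\<le>n. ?g i \<noteq> 0" using assms(4) \<open>f k \<noteq> 0\<close> K by (intro exI[of _ k]) auto
 ultimately show False using polyfun_finite_roots[of ?g n] by blast
qed

text \<open>Polar coordinates: the radius separates the total degrees, the angle the rest.\<close>
lemma conjugate_monomials_independent:
 fixes f :: "nat \<times> nat => complex"
 assumes I: "finite I" and z: "\<And>z. (\<Sum>p\<in>I. f p * (z ^ fst p * cnj z ^ snd p)) = 0" and p: "p \<in> I"
 shows "f p = 0"
proof -
 define deg where "deg = (\<lambda>p :: nat \<times> nat. fst p + snd p)"
 \<comment> \<open>Replacing z by t u with real t turns the total degree into the exponent of t, so
   each total degree vanishes separately.\<close>
 have unit: "(\<Sum>p\<in>{p \<in> I. deg p = d}. f p * (u ^ fst p * cnj u ^ snd p)) = 0" if "d \<in> deg ` I" for u d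
 proof (rule power_sum_zero[of "deg ` I" "range complex_of_real"])
  fix t assume "t \<in> range complex_of_real"
  then obtain s where s: "t = complex_of_real s" by blast
  have "(\<Sum>d\<in>deg ` I. (\<Sum>p\<in>{p \<in> I. deg p = d}. f p * (u ^ fst p * cnj u ^ snd p)) * t ^ d)
    = (\<Sum>d\<in>deg ` I. \<Sum>p\<in>{p \<in> I. deg p = d}. f p * ((t * u) ^ fst p * cnj (t * u) ^ snd p))"
   unfolding sum_distrib_right
   by (intro sum.cong refl) (auto simp: deg_def s power_mult_distrib power_add mult_ac)
  also have "\<dots> = (\<Sum>p\<in>I. f p * ((t * u) ^ fst p * cnj (t * u) ^ snd p))"
   by (rule sum.image_gen[OF I, symmetric])
  also have "\<dots> = 0" by (rule z)
  finally show "(\<Sum>d\<in>deg ` I. (\<Sum>p\<in>{p \<in> I. deg p = d}. f p * (u ^ fst p * cnj u ^ snd p)) * t ^ d) = 0" .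
 next
  show "infinite (range complex_of_real)" using finite_imageD[OF _ inj_of_real] infinite_UNIV_char_0 by blast
 qed (use I that in auto)
 let ?J = "{p' \<in> I. deg p' = deg p}"
 have inj: "inj_on fst ?J" by (auto simp: inj_on_def deg_def)
 have "(\<Sum>k\<in>fst ` ?J. f (k, deg p - k) * v ^ k) = 0" if v: "v \<in> sphere 0 1" for v
 proof -
  \<comment> \<open>A square root of v. Multiplication by \<open>u ^ deg p\<close> turns
    \<open>u ^ a * cnj u ^ b\<close> into \<open>v ^ a\<close> on the unit circle, which leaves an
    ordinary polynomial in v with infinitely many zeros.\<close>
  obtain u where u: "u\<^sup>2 = v" using power2_csqrt by blast
  hence "(cmod u)\<^sup>2 = 1\<^sup>2" using v by (simp add: norm_power[symmetric])
  hence "cmod u = 1" using power2_eq_imp_eq[of "cmod u" 1] by simp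
  hence uu: "u * cnj u = 1" by (simp add: complex_norm_square[symmetric])
  have "(\<Sum>k\<in>fst ` ?J. f (k, deg p - k) * v ^ k) = (\<Sum>p'\<in>?J. f p' * v ^ fst p')"
  proof -
   have "(fst p', deg p - fst p') = p'" if "p' \<in> ?J" for p' using that by (auto simp: deg_def prod_eq_iff)
   thus ?thesis unfolding sum.reindex[OF inj] o_def by (intro sum.cong refl) simp
  qed
  also have "\<dots> = u ^ deg p * (\<Sum>p'\<in>?J. f p' * (u ^ fst p' * cnj u ^ snd p'))"
   unfolding sum_distrib_left
  proof (intro sum.cong refl)
   fix p' assume "p' \<in> ?J"
   hence d: "deg p = fst p' + snd p'" by (auto simp: deg_def)
   have "u ^ deg p * (u ^ fst p' * cnj u ^ snd p') = (u ^ fst p' * u ^ fst p') * (u * cnj u) ^ snd p'"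
    by (simp add: d power_add power_mult_distrib mult_ac)
   thus "f p' * v ^ fst p' = u ^ deg p * (f p' * (u ^ fst p' * cnj u ^ snd p'))"
    by (simp add: uu u[symmetric] power_mult[symmetric] power_add[symmetric] mult_2 mult.left_commute[of _ "f p'"])
  qed
  finally show ?thesis using unit[of "deg p" u] p by simp
 qed
 moreover have "infinite (sphere 0 1 :: complex set)"
 proof -
  have "connected (sphere 0 1 :: complex set)" by (rule connected_sphere) simp
  moreover have "1 \<in> (sphere 0 1 :: complex set)" "-1 \<in> (sphere 0 1 :: complex set)" by simp_all
  ultimately show ?thesis using connected_finite_iff_sing[of "sphere 0 1 :: complex set"] by (metis empty_iff singletonD one_neq_neg_one)
 qed
 moreover have "finite (fst ` ?J)" "fst p \<in> fst ` ?J" using I p by simp_all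
 ultimately have "f (fst p, deg p - fst p) = 0"
  using power_sum_zero[of "fst ` ?J" "sphere 0 1" "\<lambda>k. f (k, deg p - k)" "fst p"] by blast
 thus ?thesis by (simp add: deg_def)
qed

text \<open>Induction on the number of variables. With the other variables fixed, the result for one
  variable separates the terms by their first exponent pair; the coefficients found there are sums
  of the same kind in one variable less.\<close>

lemma monomial_lists_independent:
 fixes a :: "(nat \<times> nat) list => complex"
 assumes "finite I" "\<And>l. l \<in> I ==> length l = n"
  and "\<And>z. (\<Sum>l\<in>I. a l * (\<Prod>j<n. z j ^ fst (l ! j) * cnj (z j) ^ snd (l ! j))) = 0" and "l \<in> I"
 shows "a l = 0"
 using assms
proof (induction n arbitrary: I a l)
 case 0
 hence "I = {[]}" "l = []" by auto
 thus ?case using "0.prems"(3) by simp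
next
 case (Suc n)
 define M where "M l z = (\<Prod>j<n. z j ^ fst (l ! j) * cnj (z j) ^ snd (l ! j))" for l :: "(nat \<times> nat) list" and z :: "nat => complex"
 obtain p l' where l: "l = p # l'" using Suc.prems(2)[OF Suc.prems(4)] by (cases l) auto
 have part: "(\<Sum>l\<in>{l \<in> I. hd l = p}. a l * M (tl l) z) = 0" for z
 proof (rule conjugate_monomials_independent[of "hd ` I" "\<lambda>p. \<Sum>l\<in>{l \<in> I. hd l = p}. a l * M (tl l) z" p])
  fix w :: complex
  have e: "a l * (\<Prod>j<Suc n. case_nat w z j ^ fst (l ! j) * cnj (case_nat w z j) ^ snd (l ! j))
    = a l * M (tl l) z * (w ^ fst (hd l) * cnj w ^ snd (hd l))" if l: "l \<in> I" for l
  proof -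
   obtain q k where "l = q # k" using Suc.prems(2)[OF l] by (cases l) auto
   thus ?thesis unfolding prod.lessThan_Suc_shift M_def by (simp add: mult_ac)
  qed
  have "(\<Sum>l\<in>I. a l * M (tl l) z * (w ^ fst (hd l) * cnj w ^ snd (hd l)))
   = (\<Sum>l\<in>I. a l * (\<Prod>j<Suc n. case_nat w z j ^ fst (l ! j) * cnj (case_nat w z j) ^ snd (l ! j)))"
   by (intro sum.cong refl) (simp only: e)
  also have "\<dots> = 0" by (rule Suc.prems(3))
  finally have "(\<Sum>l\<in>I. a l * M (tl l) z * (w ^ fst (hd l) * cnj w ^ snd (hd l))) = 0" .
  thus "(\<Sum>p\<in>hd ` I. (\<Sum>l\<in>{l \<in> I. hd l = p}. a l * M (tl l) z) * (w ^ fst p * cnj w ^ snd p)) = 0"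
   unfolding sum.image_gen[OF Suc.prems(1), of _ hd] sum_distrib_right by (simp cong: sum.cong_simp)
 qed (use Suc.prems(1,4) l in \<open>auto intro!: image_eqI[of _ hd l]\<close>)
 let ?J = "{l \<in> I. hd l = p}"
 have inj: "inj_on tl ?J"
 proof (rule inj_onI)
  fix k k' assume "k \<in> ?J" "k' \<in> ?J" "tl k = tl k'"
  thus "k = k'" using Suc.prems(2)[of k] Suc.prems(2)[of k'] by (cases k; cases k') auto
 qed
 have "a (p # l') = 0"
 proof (rule Suc.IH[of "tl ` ?J" "\<lambda>k. a (p # k)"])
  show "(\<Sum>k\<in>tl ` ?J. a (p # k) * (\<Prod>j<n. z j ^ fst (k ! j) * cnj (z j) ^ snd (k ! j))) = 0" for z
  proof -
   have "(\<Sum>k\<in>tl ` ?J. a (p # k) * M k z) = (\<Sum>l\<in>?J. a l * M (tl l) z)"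
    unfolding sum.reindex[OF inj] o_def
   proof (intro sum.cong refl)
    fix k assume "k \<in> ?J"
    thus "a (p # tl k) * M (tl k) z = a k * M (tl k) z" using Suc.prems(2)[of k] by (cases k) auto
   qed
   thus ?thesis using part by (simp add: M_def)
  qed
  show "l' \<in> tl ` ?J" using Suc.prems(4) l by (auto intro!: image_eqI[of _ tl l])
 qed (use Suc.prems(1,2) in auto)
 thus ?case using l by simp
qed

lemma torus_monomials_independent:
 fixes a :: "nat list \<times> nat list => complex"
 assumes I: "finite I" "\<And>ab. ab \<in> I ==> length (fst ab) = 4 \<and> length (snd ab) = 4"
  and z: "\<And>x :: 8 rvector. (\<Sum>ab\<in>I. a ab * torus_monomial ab 4 (\<lambda>j. zcoord j x)) = 0" and ab: "ab \<in> I"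
 shows "a ab = 0"
proof -
 let ?zip = "\<lambda>ab :: nat list \<times> nat list. zip (fst ab) (snd ab)" and ?unzip = "\<lambda>l :: (nat \<times> nat) list. (map fst l, map snd l)"
 have inv: "?unzip (?zip ab) = ab" if "ab \<in> I" for ab using I(2)[OF that] by (simp add: prod_eq_iff)
 have inj: "inj_on ?zip I" using inv by (rule inj_on_inverseI)
 have "a (?unzip (?zip ab)) = 0"
 proof (rule monomial_lists_independent[of "?zip ` I" 4 "\<lambda>l. a (?unzip l)"])
  fix w :: "nat => complex"
  define x :: "8 rvector" where "x = (\<chi> i. if even (position i) then Re (w (position i div 2)) else Im (w (position i div 2)))"
  have "zcoord j x = w j" if "j < 4" for j
   using that by (simp add: zcoord_def x_def position_idx complex_eq_iff)
  hence t: "torus_monomial ab 4 (\<lambda>j. zcoord j x) = (\<Prod>j<4. w j ^ fst (?zip ab ! j) * cnj (w j) ^ snd (?zip ab ! j))" if "ab \<in> I" for ab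
   using I(2)[OF that] unfolding torus_monomial_def by (intro prod.cong refl) simp
  have "(\<Sum>l\<in>?zip ` I. a (?unzip l) * (\<Prod>j<4. w j ^ fst (l ! j) * cnj (w j) ^ snd (l ! j)))
   = (\<Sum>ab\<in>I. a ab * torus_monomial ab 4 (\<lambda>j. zcoord j x))"
   unfolding sum.reindex[OF inj] o_def by (intro sum.cong refl) (simp only: inv t)
  thus "(\<Sum>l\<in>?zip ` I. a (?unzip l) * (\<Prod>j<4. w j ^ fst (l ! j) * cnj (w j) ^ snd (l ! j))) = 0" using z by simp
 qed (use I ab in auto)
 thus ?thesis by (simp only: inv[OF ab])
qed

lemma weight_functions_independent:
 assumes c: "chiral_module c \<eta>" and z: "\<And>x. (\<Sum>i\<in>weight_index m \<eta>. a i *s weight_function c i x) = 0"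
  and i: "i \<in> weight_index m \<eta>"
 shows "a i = 0"
proof -
 define I where "I = {(\<alpha>, \<beta>). length \<alpha> = 4 \<and> length \<beta> = 4 \<and> sum_list \<alpha> + sum_list \<beta> = m}"
 have W: "weight_index m \<eta> = I \<times> spin_signs \<eta>" by (simp add: I_def weight_index_def)
 have I: "finite I" unfolding I_def bidegree_eq by simp
 have e: "snd i \<in> spin_signs \<eta>" and "fst i \<in> I" using i unfolding W by auto
 have "(\<Sum>ab\<in>I. a (ab, snd i) * torus_monomial ab 4 (\<lambda>j. zcoord j x)) = 0" for x :: "8 rvector"
 proof (rule weight_vectors_independent[OF c _ e, of "\<lambda>\<epsilon>. \<Sum>ab\<in>I. a (ab, \<epsilon>) * torus_monomial ab 4 (\<lambda>j. zcoord j x)"])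
  have "(\<Sum>\<epsilon>\<in>spin_signs \<eta>. (\<Sum>ab\<in>I. a (ab, \<epsilon>) * torus_monomial ab 4 (\<lambda>j. zcoord j x)) *s weight_vector c \<epsilon>)
   = (\<Sum>\<epsilon>\<in>spin_signs \<eta>. \<Sum>ab\<in>I. a (ab, \<epsilon>) *s weight_function c (ab, \<epsilon>) x)"
   by (simp add: vec.scale_sum_left weight_function_def vector_smult_assoc)
  also have "\<dots> = (\<Sum>ab\<in>I. \<Sum>\<epsilon>\<in>spin_signs \<eta>. a (ab, \<epsilon>) *s weight_function c (ab, \<epsilon>) x)"
   by (rule sum.swap)
  also have "\<dots> = 0" using z[of x] unfolding W sum.cartesian_product by (simp add: case_prod_unfold)
  finally show "(\<Sum>\<epsilon>\<in>spin_signs \<eta>. (\<Sum>ab\<in>I. a (ab, \<epsilon>) * torus_monomial ab 4 (\<lambda>j. zcoord j x)) *s weight_vector c \<epsilon>) = 0" .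
 qed
 moreover have "length (fst ab) = 4 \<and> length (snd ab) = 4" if "ab \<in> I" for ab
  using that by (auto simp: I_def)
 ultimately have "a (fst i, snd i) = 0"
  using torus_monomials_independent[OF I, of "\<lambda>ab. a (ab, snd i)" "fst i"] \<open>fst i \<in> I\<close> by blast
 thus ?thesis by simp
qed

text \<open>Independence is assumed for the indexed family, so that injectivity of the indexing
  comes out as well; it is needed to count the basis by its indices.\<close>

lemma complex_fun_independent_family:
 fixes b :: "'i => 'a => complex ^ 'k"
 assumes I: "finite I" and ind: "\<And>a i. (\<And>x. (\<Sum>i\<in>I. a i *s b i x) = 0) ==> i \<in> I ==> a i = 0"
 shows "inj_on b I" "complex_fun.independent (b ` I)"
proof -
 show inj: "inj_on b I"
 proof (rule inj_onI, rule ccontr)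
  fix i j assume ij: "i \<in> I" "j \<in> I" "b i = b j" "i \<noteq> j"
  define a :: "'i => complex" where "a = (\<lambda>k. if k = i then 1 else if k = j then -1 else 0)"
  have "(\<Sum>k\<in>I. a k *s b k x) = (\<Sum>k\<in>I. (if k = i then b i x else 0) - (if k = j then b j x else 0))" for x
   using ij(4) by (intro sum.cong refl) (auto simp: a_def vec_eq_iff)
  also have "\<dots> x = 0" for x using ij I by (simp add: sum_subtractf)
  finally have "a i = 0" using ind ij(1) by blast
  thus False by (simp add: a_def)
 qed
 have fin: "finite (b ` I)" using I by simp
 show "complex_fun.independent (b ` I)"
  unfolding complex_fun.dependent_finite[OF fin]
 proof (intro notI, elim exE conjE bexE)
  fix u f assume f: "f \<in> b ` I" "u f \<noteq> 0" "(\<Sum>f\<in>b ` I. (\<lambda>x. u f *s f x)) = 0"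
  have "(\<Sum>i\<in>I. u (b i) *s b i x) = 0" for x
   using fun_cong[OF f(3), of x] by (simp add: sum_fun_apply sum.reindex[OF inj])
  thus False using ind[of "\<lambda>i. u (b i)"] f(1,2) by blast
 qed
qed

lemma homogeneous_weight_expansion:
 assumes c: "chiral_module c \<eta>" and P: "homogeneous m P"
 obtains a where "P = (\<lambda>x. \<Sum>i\<in>weight_index m \<eta>. a i *s weight_function c i x)"
proof -
 let ?I = "weight_index m \<eta>"
 have inj: "inj_on (weight_function c) ?I"
 proof (rule complex_fun_independent_family(1))
  fix a i assume "\<And>x. (\<Sum>i\<in>?I. a i *s weight_function c i x) = 0" "i \<in> ?I"
  thus "a i = 0" by (rule weight_functions_independent[OF c])
 qed simp
 have fin: "finite (weight_function c ` ?I)" by simp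
 have "P \<in> range (\<lambda>u. \<Sum>f\<in>weight_function c ` ?I. (\<lambda>x. u f *s f x))"
  using homogeneous_span_weight_functions[OF c P] unfolding complex_fun.span_finite[OF fin] .
 then obtain u where "P = (\<Sum>f\<in>weight_function c ` ?I. (\<lambda>x. u f *s f x))" by (rule rangeE)
 hence "P = (\<lambda>x. \<Sum>i\<in>?I. u (weight_function c i) *s weight_function c i x)"
  by (simp add: fun_eq_iff sum_fun_apply sum.reindex[OF inj])
 thus thesis by (rule that)
qed

section \<open>Spin structures of lens spaces\<close>

definition block_rotor :: "nat => real => 8 clifford"
 where "block_rotor j t = plane_spin (idx (2 * j)) (idx (2 * j + 1)) (2 * t)"

text \<open>The product of the exponentials of \<open>\<phi>\<^sub>j\<close> times the j-th plane
  bivector; it lies over the rotation of plane j by the angle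
  \<open>2 \<phi>\<^sub>j\<close>.\<close>

definition block_spin :: "(nat => real) => 8 clifford"
 where "block_spin \<phi> = block_rotor 0 (\<phi> 0) \<star> (block_rotor 1 (\<phi> 1) \<star> (block_rotor 2 (\<phi> 2) \<star> block_rotor 3 (\<phi> 3)))"

lemma block_rotor_eq: "block_rotor j t = cos t *\<^sub>R clifford_one + sin t *\<^sub>R plane_bivector j"
 by (simp add: block_rotor_def plane_spin_def plane_bivector_def)

lemma block_rotor_spin: "j < 4 ==> block_rotor j t \<in> SpinG"
 unfolding block_rotor_def by (rule plane_spin_UNIV) simp

lemma block_rotor_add: "j < 4 ==> block_rotor j (s + t) = block_rotor j s \<star> block_rotor j t"
 unfolding block_rotor_def distrib_left by (rule plane_spin_add) simp

lemma block_rotor_commute: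
 "j < 4 ==> k < 4 ==> block_rotor j s \<star> block_rotor k t = block_rotor k t \<star> block_rotor j s"
 unfolding block_rotor_eq
 by (simp add: clifford.add_left clifford.add_right clifford.scaleR_left clifford.scaleR_right
   plane_bivector_commute[of j k] algebra_simps)

lemma block_rotor_zcoord:
 assumes "j < 4" "k < 4"
 shows "zcoord j (spin_cover (block_rotor k t) *v x) = (if j = k then cis (2 * t) else 1) * zcoord j x"
proof -
 have ne: "(idx (2 * k) :: 8) \<noteq> idx (2 * k + 1)" using assms by simp
 have i: "((idx (2 * j) :: 8) = idx (2 * k)) = (j = k)" "((idx (2 * j + 1) :: 8) = idx (2 * k + 1)) = (j = k)"
  "(idx (2 * j) :: 8) \<noteq> idx (2 * k + 1)" "(idx (2 * j + 1) :: 8) \<noteq> idx (2 * k)"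
  using assms by (subst idx8_eq_iff; presburger)+
 show ?thesis
  unfolding block_rotor_def spin_cover_plane_spin[OF ne] zcoord_def plane_rotation_def complex_eq_iff
   vector_add_component vector_scaleR_component vector_minus_component axis_component i
  using i(3,4) by (auto simp: algebra_simps)
qed

lemma block_spin_mem: "block_spin \<phi> \<in> SpinG"
 unfolding block_spin_def by (intro spin_group_mult block_rotor_spin) simp_all

lemma block_spin_zcoord:
 assumes "j < 4"
 shows "zcoord j (spin_cover (block_spin \<phi>) *v x) = cis (2 * \<phi> j) * zcoord j x"
proof -
 have "zcoord j (spin_cover (block_spin \<phi>) *v x)
   = zcoord j (spin_cover (block_rotor 0 (\<phi> 0)) *v (spin_cover (block_rotor 1 (\<phi> 1)) *v
     (spin_cover (block_rotor 2 (\<phi> 2)) *v (spin_cover (block_rotor 3 (\<phi> 3)) *v x))))"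
  unfolding block_spin_def
  by (simp add: spin_cover_mult[of _ UNIV] spin_group_mult block_rotor_spin matrix_vector_mul_assoc matrix_mul_assoc)
 moreover have "j = 0 \<or> j = 1 \<or> j = 2 \<or> j = 3" using assms by arith
 ultimately show ?thesis using assms by (elim disjE) (simp_all add: block_rotor_zcoord)
qed

lemma block_spin_add: "block_spin (\<lambda>j. \<phi> j + \<psi> j) = block_spin \<phi> \<star> block_spin \<psi>"
proof -
 let ?R = block_rotor
 have c: "?R j s \<star> (?R k t \<star> a) = ?R k t \<star> (?R j s \<star> a)" if "j < 4" "k < 4" for j k s t a
  by (simp only: clifford_assoc[symmetric] block_rotor_commute[OF that])
 have "block_spin \<phi> \<star> block_spin \<psi> = ?R 0 (\<phi> 0) \<star> (?R 1 (\<phi> 1) \<star> (?R 2 (\<phi> 2) \<star> (?R 3 (\<phi> 3) \<star>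
   (?R 0 (\<psi> 0) \<star> (?R 1 (\<psi> 1) \<star> (?R 2 (\<psi> 2) \<star> ?R 3 (\<psi> 3)))))))"
  by (simp add: block_spin_def clifford_assoc)
 also have "\<dots> = ?R 0 (\<phi> 0) \<star> (?R 0 (\<psi> 0) \<star> (?R 1 (\<phi> 1) \<star> (?R 1 (\<psi> 1) \<star>
   (?R 2 (\<phi> 2) \<star> (?R 2 (\<psi> 2) \<star> (?R 3 (\<phi> 3) \<star> ?R 3 (\<psi> 3)))))))"
  using c[of 3 0] c[of 2 0] c[of 1 0] c[of 3 1] c[of 2 1] c[of 3 2] by simp
 finally show ?thesis by (simp add: block_spin_def block_rotor_add clifford_assoc)
qed

lemma block_spin_zero: "block_spin (\<lambda>j. 0) = clifford_one"
 by (simp add: block_spin_def block_rotor_eq)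

lemma block_spin_cong:
 assumes "\<And>j. j < 4 ==> \<exists>n :: int. \<phi> j = \<psi> j + 2 * pi * n"
 shows "block_spin \<phi> = block_spin \<psi>"
proof -
 have "block_rotor j (\<phi> j) = block_rotor j (\<psi> j)" if j: "j < 4" for j
 proof -
  obtain n :: int where "\<phi> j = \<psi> j + 2 * pi * n" using assms[OF j] by blast
  thus ?thesis by (simp add: block_rotor_eq cos_add sin_add)
 qed
 thus ?thesis by (simp add: block_spin_def)
qed

lemma rho_block_spin:
 assumes c: "clifford_relations c" and v: "spin_weight c \<epsilon> v" and \<epsilon>: "length \<epsilon> = 4" "set \<epsilon> \<subseteq> {1, -1}"
 shows "rho c (block_spin \<phi>) *v v = cis (\<Sum>j<4. real_of_int (\<epsilon> ! j) * \<phi> j) *s v"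
proof -
 have R: "rho c (block_rotor j t) *v v = cis (real_of_int (\<epsilon> ! j) * t) *s v" if j: "j < 4" for j t
 proof -
  have "\<epsilon> ! j \<in> set \<epsilon>" using \<epsilon> j by (intro nth_mem) simp
  hence "\<epsilon> ! j \<in> {1, -1}" using \<epsilon> by blast
  hence "cis (real_of_int (\<epsilon> ! j) * t) = cos t + (\<i> * of_int (\<epsilon> ! j)) * sin t" by (auto simp: complex_eq_iff)
  moreover have "rho c (block_rotor j t) *v v = complex_of_real (cos t) *s v + complex_of_real (sin t) *s ((\<i> * of_int (\<epsilon> ! j)) *s v)"
   using v j by (simp add: block_rotor_eq rho_add rho_scaleR mvec.add_left mvec.scaleR_left
     spin_weight_def scaleR_smult)
  ultimately show ?thesis by (simp add: vec_eq_iff algebra_simps)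
 qed
 have ev: "even_clifford (block_rotor j t)" if "j < 4" for j t
  using even_clifford_spin[OF block_rotor_spin[OF that]] .
 have "rho c (block_spin \<phi>) *v v = rho c (block_rotor 0 (\<phi> 0)) *v (rho c (block_rotor 1 (\<phi> 1)) *v
   (rho c (block_rotor 2 (\<phi> 2)) *v (rho c (block_rotor 3 (\<phi> 3)) *v v)))"
  unfolding block_spin_def
  by (simp add: rho_mult[OF c] even_clifford_mult ev matrix_vector_mul_assoc matrix_mul_assoc)
 thus ?thesis
  by (simp add: R smult_matrix_vector vector_smult_assoc cis_mult sum_lessThan_4 add_ac)
qed

lemma cis_sum: "cis (\<Sum>j<n. f j) = (\<Prod>j<(n::nat). cis (f j))"
 by (induction n) (simp_all add: cis_mult[symmetric])

lemma torus_monomial_rotate: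
 "torus_monomial ab n (\<lambda>j. cis (t j) * z j)
  = cis (\<Sum>j<n. t j * (real (fst ab ! j) - real (snd ab ! j))) * torus_monomial ab n z"
proof -
 have "(cis t * z) ^ a * cnj (cis t * z) ^ b = cis (t * (real a - real b)) * (z ^ a * cnj z ^ b)" for t z and a b :: nat
 proof -
  have "cis t ^ a * cnj (cis t) ^ b = cis (t * (real a - real b))"
   by (simp only: cis_cnj Complex.DeMoivre cis_mult) (simp add: algebra_simps)
  thus ?thesis by (simp add: power_mult_distrib mult_ac)
 qed
 thus ?thesis by (simp add: torus_monomial_def cis_sum prod.distrib)
qed

text \<open>In the basis of weight functions the torus acts diagonally, by \<open>A i\<close> on the
  argument and by \<open>B i\<close> on the value. Equivariance keeps exactly the indices with equal
  factors, and the quotient of the factors is the character of the weight.\<close>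

lemma dim_equivariant_block_spin:
 assumes c: "chiral_module c \<eta>"
 shows "complex_fun.dim (equivariant_poly c (block_spin \<phi>) m)
  = card {i \<in> weight_index m \<eta>. cis (\<Sum>j<4. \<phi> j * weight i j) = 1}"
proof -
 let ?I = "weight_index m \<eta>" and ?b = "weight_function c" and ?V = "equivariant_poly c (block_spin \<phi>) m"
 let ?J = "{i \<in> ?I. cis (\<Sum>j<4. \<phi> j * weight i j) = 1}"
 have rel: "clifford_relations c" using c by (simp add: chiral_module_def)
 define A where "A i = cis (\<Sum>j<4. 2 * \<phi> j * (real (fst (fst i) ! j) - real (snd (fst i) ! j)))" for i :: "(nat list \<times> nat list) \<times> int list"
 define B where "B i = cis (\<Sum>j<4. real_of_int (snd i ! j) * \<phi> j)" for i :: "(nat list \<times> nat list) \<times> int list"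
 have bA: "?b i (spin_cover (block_spin \<phi>) *v x) = A i *s ?b i x" for i x
 proof -
  have "torus_monomial (fst i) 4 (\<lambda>j. zcoord j (spin_cover (block_spin \<phi>) *v x))
    = torus_monomial (fst i) 4 (\<lambda>j. cis (2 * \<phi> j) * zcoord j x)"
   unfolding torus_monomial_def by (intro prod.cong refl) (simp add: block_spin_zcoord)
  thus ?thesis by (simp add: weight_function_def torus_monomial_rotate A_def vector_smult_assoc)
 qed
 have bB: "rho c (block_spin \<phi>) *v ?b i x = B i *s ?b i x" if "i \<in> ?I" for i x
 proof -
  have s: "snd i \<in> spin_signs \<eta>" using that by (auto simp: weight_index_def)
  hence l: "length (snd i) = 4" "set (snd i) \<subseteq> {1, -1}" by (auto simp: spin_signs_def)
  show ?thesis using rho_block_spin[OF rel weight_vector[OF c s] l]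
   by (simp add: weight_function_def smult_matrix_vector B_def vector_smult_assoc mult.commute)
 qed
 have AB: "A i = cis (\<Sum>j<4. \<phi> j * weight i j) * B i" for i
  unfolding A_def B_def cis_mult sum.distrib[symmetric] weight_def
  by (intro arg_cong[of _ _ cis] sum.cong refl) (simp add: case_prod_unfold algebra_simps)
 have B0: "B i \<noteq> 0" for i by (simp add: B_def)
 have J: "?J = {i \<in> ?I. A i = B i}" using B0 by (auto simp: AB)
 have sub: "?b ` ?J \<subseteq> ?V"
 proof
  fix f assume "f \<in> ?b ` ?J"
  then obtain i where "i \<in> ?I" "A i = B i" "f = ?b i" unfolding J by auto
  thus "f \<in> ?V" using weight_function_homogeneous[of i m \<eta> c] bA bB unfolding equivariant_poly_def by auto
 qed
 have span: "?V \<subseteq> complex_fun.span (?b ` ?J)"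
 proof
  fix P assume P: "P \<in> ?V"
  hence "homogeneous m P" by (simp add: equivariant_poly_def)
  then obtain a where a: "P = (\<lambda>x. \<Sum>i\<in>?I. a i *s ?b i x)" by (rule homogeneous_weight_expansion[OF c])
  \<comment> \<open>Equivariance is compared coefficientwise; where \<open>A i\<close> and
    \<open>B i\<close> differ, the coefficient must vanish.\<close>
  have "(\<Sum>i\<in>?I. (a i * (A i - B i)) *s ?b i x) = 0" for x
  proof -
   have "P (spin_cover (block_spin \<phi>) *v x) = rho c (block_spin \<phi>) *v P x" using P by (simp add: equivariant_poly_def)
   hence "(\<Sum>i\<in>?I. a i *s (A i *s ?b i x)) = (\<Sum>i\<in>?I. a i *s (B i *s ?b i x))"
    unfolding a by (simp add: bA bB mvec.sum_right smult_matrix_vector cong: sum.cong_simp)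
   hence "(\<Sum>i\<in>?I. a i *s (A i *s ?b i x)) - (\<Sum>i\<in>?I. a i *s (B i *s ?b i x)) = 0" by simp
   thus ?thesis unfolding sum_subtractf[symmetric]
    by (simp add: vector_smult_assoc vector_ssub_ldistrib algebra_simps vec.scale_left_diff_distrib)
  qed
  hence z: "a i * (A i - B i) = 0" if "i \<in> ?I" for i
   using weight_functions_independent[OF c, where m = m and a = "\<lambda>i. a i * (A i - B i)" and i = i] that by blast
  have "P = (\<Sum>i\<in>?I. (\<lambda>x. a i *s ?b i x))" by (simp add: a fun_eq_iff sum_fun_apply)
  moreover have "\<dots> \<in> complex_fun.span (?b ` ?J)"
  proof (rule complex_fun.span_sum)
   fix i assume i: "i \<in> ?I"
   show "(\<lambda>x. a i *s ?b i x) \<in> complex_fun.span (?b ` ?J)"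
   proof (cases "i \<in> ?J")
    case True
    thus ?thesis by (intro complex_fun.span_scale complex_fun.span_base imageI)
   next
    case False
    hence "a i = 0" using z[OF i] i unfolding J by simp
    thus ?thesis using complex_fun.span_zero[of "?b ` ?J"] by (simp add: zero_fun_def)
   qed
  qed
  ultimately show "P \<in> complex_fun.span (?b ` ?J)" by (simp only:)
 qed
 have ind: "inj_on ?b ?I" "complex_fun.independent (?b ` ?I)"
 proof -
  show "inj_on ?b ?I"
  proof (rule complex_fun_independent_family(1))
   fix a i assume "\<And>x. (\<Sum>i\<in>?I. a i *s ?b i x) = 0" "i \<in> ?I"
   thus "a i = 0" by (rule weight_functions_independent[OF c])
  qed simp
  show "complex_fun.independent (?b ` ?I)"
  proof (rule complex_fun_independent_family(2))
   fix a i assume "\<And>x. (\<Sum>i\<in>?I. a i *s ?b i x) = 0" "i \<in> ?I"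
   thus "a i = 0" by (rule weight_functions_independent[OF c])
  qed simp
 qed
 have ss: "?J \<subseteq> ?I" by blast
 have "complex_fun.independent (?b ` ?J)" by (rule complex_fun.independent_mono[OF ind(2) image_mono[OF ss]])
 thus ?thesis
  by (rule complex_fun.dim_unique[OF sub span _ card_image[OF inj_on_subset[OF ind(1) ss]]])
qed

text \<open>Half of the rotation angle, shifted by a multiple of \<pi>. Because q + 1 is even for
  odd q, q times this angle is a multiple of 2 \<pi>, so the lift of the generator has order
  dividing q and not just 2 q.\<close>

definition lens_angle :: "nat => int list => nat => real"
 where "lens_angle q s j = real (q + 1) * real_of_int (s ! j) * pi / real q"

definition lens_spin :: "nat => int list => nat => 8 clifford"
 where "lens_spin q s k = block_spin (\<lambda>j. real k * lens_angle q s j)"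

text \<open>The angles contribute the factor h = (q + 1) / 2 to the divisibility condition. Since 2
  h - q = 1, h is a unit modulo q and can be cancelled.\<close>

lemma dim_equivariant_lens_spin:
 assumes c: "chiral_module c \<eta>" and q: "odd q"
 shows "complex_fun.dim (equivariant_poly c (lens_spin q s 1) m)
  = card {i \<in> weight_index m \<eta>. int q dvd (\<Sum>j<4. s ! j * weight i j)}"
proof -
 obtain h where h: "q + 1 = 2 * h" using q by (metis even_plus_one_iff evenE)
 have q0: "q > 0" using q by (cases q) auto
 have "coprime (int q) (int h)"
 proof (rule coprimeI)
  fix d assume "d dvd int q" "d dvd int h"
  hence "d dvd 2 * int h - int q" by simp
  moreover have "2 * int h - int q = 1" using h by linarith
  ultimately show "is_unit d" by simp
 qed
 moreover have "cis (\<Sum>j<4. 1 * lens_angle q s j * weight i j) = unity q (int h * (\<Sum>j<4. s ! j * weight i j))" for i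
 proof -
  have "(\<Sum>j<4. lens_angle q s j * weight i j) = real (q + 1) * pi * (\<Sum>j<4. s ! j * weight i j) / real q"
   by (simp add: lens_angle_def sum_distrib_left sum_divide_distrib mult_ac)
  also have "\<dots> = 2 * pi * (int h * (\<Sum>j<4. s ! j * weight i j)) / real q"
   unfolding h by simp
  finally show ?thesis by (simp add: unity_def)
 qed
 ultimately show ?thesis
  unfolding lens_spin_def dim_equivariant_block_spin[OF c]
  by (simp add: unity_eq_1_iff[OF q0] coprime_dvd_mult_right_iff)
qed

lemma lens_spin_mem: "lens_spin q s k \<in> SpinG"
 unfolding lens_spin_def by (rule block_spin_mem)

lemma lens_spin_add: "lens_spin q s (k + l) = lens_spin q s k \<star> lens_spin q s l"
 unfolding lens_spin_def block_spin_add[symmetric] by (simp add: distrib_right)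

lemma lens_spin_0: "lens_spin q s 0 = clifford_one"
 by (simp add: lens_spin_def block_spin_zero)

lemma spin_cover_lens_spin:
 assumes q: "q > 0"
 shows "spin_cover (lens_spin q s k) = lens_power q s k"
proof (rule matrix_eq[THEN iffD2], rule allI)
 fix x :: "8 rvector"
 have n: "CARD(8) = 2 * 4" by simp
 show "spin_cover (lens_spin q s k) *v x = lens_power q s k *v x"
 proof (rule zcoord_eqI[OF n])
  fix j :: nat assume j: "j < 4"
  have "2 * (real k * lens_angle q s j) = 2 * pi * real_of_int (int k * s ! j) / real q + 2 * pi * real_of_int (int k * s ! j)"
   using q by (simp add: lens_angle_def field_simps)
  hence "cis (2 * (real k * lens_angle q s j)) = unity q (int k * s ! j)"
   by (simp add: unity_def cis_mult[symmetric] cis_multiple_2pi)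
  thus "zcoord j (spin_cover (lens_spin q s k) *v x) = zcoord j (lens_power q s k *v x)"
   by (simp add: lens_spin_def block_spin_zcoord[OF j] lens_power_zcoord[OF n j])
 qed
qed

lemma lens_spin_cong:
 assumes q: "odd q" and kl: "k mod q = l mod q"
 shows "lens_spin q s k = lens_spin q s l"
 unfolding lens_spin_def
proof (rule block_spin_cong)
 fix j :: nat
 obtain h where h: "q + 1 = 2 * h" using q by (metis even_plus_one_iff evenE)
 have q0: "q > 0" using q by (cases q) auto
 have "int q dvd int k - int l" using kl by (metis mod_eq_dvd_iff of_nat_mod)
 then obtain n where "int k - int l = int q * n" by (rule dvdE)
 hence "real k - real l = real q * of_int n" by (metis of_int_diff of_int_mult of_int_of_nat_eq)
 hence "real k = real l + real q * of_int n" by simp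
 hence "real k * lens_angle q s j = real l * lens_angle q s j + of_int n * (real q * lens_angle q s j)"
  by (simp add: distrib_right)
 also have "real q * lens_angle q s j = 2 * real h * s ! j * pi"
  using q0 unfolding lens_angle_def h by simp
 finally have "real k * lens_angle q s j = real l * lens_angle q s j + 2 * pi * of_int (n * int h * s ! j)"
  by (simp add: mult_ac)
 thus "\<exists>n :: int. real k * lens_angle q s j = real l * lens_angle q s j + 2 * pi * n" by blast
qed

section \<open>Existence and uniqueness of the spin structure\<close>

lemma spin_cover_one: "spin_cover clifford_one = (mat 1 :: 'n::{finite,linorder} rmatrix)"
proof -
 have rev: "clifford_reverse clifford_one = (clifford_one :: 'n clifford)"
  using spin_group_inverse(1)[OF spin_group_one[of "UNIV :: 'n rvector set"]] by simp
 have "spin_cover clifford_one *v x = x" for x :: "'n rvector"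
  using spin_cover(1)[OF spin_group_one[of UNIV], of x] by (simp add: rev clifford_vec_inject)
 thus ?thesis by (simp add: matrix_eq)
qed

lemma spin_cover_lift_unique:
 fixes g h :: "'n::{finite,linorder} clifford"
 assumes "g \<in> SpinG" "h \<in> SpinG" "spin_cover g = spin_cover h"
 shows "g = h \<or> g = - h"
proof -
 have r: "clifford_reverse h \<in> SpinG" by (rule spin_group_reverse[OF assms(2)])
 have "spin_cover (g \<star> clifford_reverse h) = spin_cover (h \<star> clifford_reverse h)"
  by (simp add: spin_cover_mult[OF assms(1) r] spin_cover_mult[OF assms(2) r] assms(3))
 also have "\<dots> = mat 1"
  by (simp add: spin_group_inverse(1)[OF assms(2)] spin_cover_one)
 finally have "g \<star> clifford_reverse h = clifford_one \<or> g \<star> clifford_reverse h = - clifford_one"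
  by (rule spin_cover_kernel[OF spin_group_mult[OF assms(1) r]])
 moreover have "g \<star> clifford_reverse h \<star> h = g"
  by (simp add: clifford_assoc spin_group_inverse(2)[OF assms(2)])
 ultimately show ?thesis by (metis clifford.minus_left clifford_one_left)
qed

text \<open>The first parameter is 1, so the action on the first complex coordinate determines the
  exponent modulo q.\<close>

lemma lens_power_inj:
 assumes q: "q > 0" and s: "s ! 0 = 1" and e: "(lens_power q s k :: 8 rmatrix) = lens_power q s l"
 shows "k mod q = l mod q"
proof -
 have n: "CARD(8) = 2 * 4" by simp
 let ?x = "axis (idx 0) 1 :: 8 rvector"
 have "zcoord 0 ?x \<noteq> 0" by (simp add: zcoord_def complex_eq_iff axis_component)
 moreover have "unity q (int k) * zcoord 0 ?x = unity q (int l) * zcoord 0 ?x"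
 proof -
  have "zcoord 0 (lens_power q s k *v ?x) = unity q (int k) * zcoord 0 ?x" for k
   using lens_power_zcoord[OF n, of 0 q s k ?x] s by simp
  from this[of k] this[of l] show ?thesis unfolding e by (rule trans[OF sym])
 qed
 ultimately have "int q dvd int k - int l" by (simp add: unity_eq_iff[OF q])
 thus ?thesis by (metis mod_eq_dvd_iff of_nat_eq_iff of_nat_mod)
qed

text \<open>A second lift of the generator differs from the given one by a sign. With the other sign
  its q-th power would be -1, as q is odd, although it lies over the identity element, whose lift is
  1.\<close>

theorem lens_spin_structure:
 assumes q: "odd q" and s: "s ! 0 = 1"
 obtains \<tau> where "\<And>\<sigma>. spin_structure (lens_group q s) \<sigma> \<longleftrightarrow> \<sigma> = \<tau>" "\<And>k. \<tau> (lens_power q s k) = lens_spin q s k"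
proof -
 have q0: "q > 0" using q by (cases q) auto
 let ?G = "lens_group q s :: 8 rmatrix set"
 \<comment> \<open>The chosen exponent is determined modulo q, and \<open>lens_spin\<close> depends
   on nothing more.\<close>
 define \<tau> where "\<tau> = (\<lambda>A \<in> ?G. lens_spin q s (SOME k. lens_power q s k = A))"
 have \<tau>: "\<tau> (lens_power q s k) = lens_spin q s k" for k
 proof -
  have "lens_power q s (SOME l. lens_power q s l = (lens_power q s k :: 8 rmatrix)) = (lens_power q s k :: 8 rmatrix)"
   by (rule someI) (rule refl)
  hence "lens_spin q s (SOME l. lens_power q s l = (lens_power q s k :: 8 rmatrix)) = lens_spin q s k"
   by (intro lens_spin_cong[OF q] lens_power_inj[OF q0 s])
  thus ?thesis by (simp add: \<tau>_def lens_group_eq)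
 qed
 have ss: "spin_structure ?G \<tau>"
  unfolding spin_structure_def lens_group_eq
 proof (intro conjI ballI)
  show "\<tau> \<in> range (lens_power q s) \<rightarrow>\<^sub>E SpinG"
   by (rule PiE_I) (auto simp: \<tau> lens_spin_mem, auto simp: \<tau>_def lens_group_eq)
 qed (auto simp: \<tau> lens_spin_add spin_cover_lens_spin[OF q0] simp flip: lens_power_add)
 have "\<sigma> = \<tau>" if \<sigma>: "spin_structure ?G \<sigma>" for \<sigma>
 proof -
  note \<sigma> = \<sigma>[unfolded spin_structure_def lens_group_eq]
  have mem: "\<sigma> (lens_power q s k) \<in> SpinG" and cov: "spin_cover (\<sigma> (lens_power q s k)) = lens_power q s k"
   and mult: "\<sigma> (lens_power q s (k + l)) = \<sigma> (lens_power q s k) \<star> \<sigma> (lens_power q s l)" for k l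
   using \<sigma> by (auto simp: lens_power_add)
  let ?e = "\<lambda>k. \<sigma> (lens_power q s k)"
  have one: "?e 0 = clifford_one"
  proof -
   have "clifford_reverse (?e 0) \<star> (?e 0 \<star> ?e 0) = clifford_reverse (?e 0) \<star> ?e 0" using mult[of 0 0] by simp
   thus ?thesis by (simp only: clifford_assoc[symmetric] spin_group_inverse(2)[OF mem] clifford_one_left)
  qed
  have q1: "lens_power q s q = (lens_power q s 0 :: 8 rmatrix)" by (rule lens_power_cong[of 4]) (use q0 in simp_all)
  have g: "?e 1 = lens_spin q s 1"
  proof (rule ccontr)
   assume "?e 1 \<noteq> lens_spin q s 1"
   moreover have "?e 1 = lens_spin q s 1 \<or> ?e 1 = - lens_spin q s 1"
    by (rule spin_cover_lift_unique[OF mem lens_spin_mem]) (simp only: cov spin_cover_lens_spin[OF q0])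
   ultimately have neg: "?e 1 = - lens_spin q s 1" by blast
   have "?e k = (-1) ^ k *\<^sub>R lens_spin q s k" for k
   proof (induction k)
    case (Suc k)
    have "?e (Suc k) = ?e 1 \<star> ?e k" using mult[of 1 k] by simp
    thus ?case using lens_spin_add[of q s 1 k, unfolded plus_1_eq_Suc] by (simp add: neg Suc clifford.minus_left clifford.scaleR_right del: One_nat_def)
   qed (simp only: one lens_spin_0 power_0 scaleR_one)
   from this[of q] have "clifford_one = - lens_spin q s q" using q one by (simp add: q1)
   also have "lens_spin q s q = clifford_one" using lens_spin_cong[OF q, of q 0 s] by (simp add: lens_spin_0)
   finally show False by (simp add: clifford_one_def vec_eq_iff axis_component) (drule spec[of _ "{}"], simp)
  qed
  have "?e k = lens_spin q s k" for k
  proof (induction k)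
   case (Suc k)
   have "?e (Suc k) = ?e 1 \<star> ?e k" using mult[of 1 k] by simp
   thus ?case using lens_spin_add[of q s 1 k, unfolded plus_1_eq_Suc] by (simp add: g Suc del: One_nat_def)
  qed (simp only: one lens_spin_0)
  hence "\<sigma> A = \<tau> A" if "A \<in> ?G" for A using that \<tau> by (auto simp: lens_group_eq)
  moreover have "\<sigma> \<in> extensional ?G" "\<tau> \<in> extensional ?G"
   using \<sigma> by (auto simp: PiE_def \<tau>_def lens_group_eq)
  ultimately show ?thesis by (intro extensionalityI[of \<sigma> ?G \<tau>])
 qed
 with ss that \<tau> show thesis by blast
qed

section \<open>The Dirac operator on the sphere\<close>

definition cdot :: "complex ^ 'k => complex ^ 'k => complex"
 where "cdot u v = (\<Sum>i\<in>UNIV. u $ i * cnj (v $ i))"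

text \<open>A Hermitian form for which the \<open>c i\<close> are skew: the average over the finite group generated by them.\<close>
definition herm :: "('n::{finite,linorder} => complex ^ 'k ^ 'k) => complex ^ 'k => complex ^ 'k => complex"
 where "herm c u v = (\<Sum>A\<in>{A. last_index \<notin> A}. cdot (cprod c A *v u) (cprod c A *v v))"

lemma bounded_bilinear_herm: "bounded_bilinear (herm c)"
 unfolding bilinear_conv_bounded_bilinear[symmetric] bilinear_def herm_def cdot_def
 by (auto intro!: linearI simp: mvec.add_right mvec.scaleR_right sum.distrib algebra_simps scaleR_sum_right)

interpretation herm: bounded_bilinear "herm c" for c :: "'n::{finite,linorder} => complex ^ 'k ^ 'k"
 by (rule bounded_bilinear_herm)

lemma herm_smult_left: "herm c (a *s u) v = a * herm c u v"
 by (simp add: herm_def cdot_def smult_matrix_vector sum_distrib_left mult.assoc)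

lemma herm_cnj: "cnj (herm c u v) = herm c v u"
 by (simp add: herm_def cdot_def mult.commute)

lemma herm_smult_right: "herm c u (a *s v) = cnj a * herm c u v"
 by (metis herm_cnj herm_smult_left complex_cnj_mult)

lemma cdot_self: "cdot u u = of_real (\<Sum>i\<in>UNIV. (cmod (u $ i))\<^sup>2)"
 by (simp add: cdot_def complex_norm_square[symmetric])

lemma herm_self: "herm c u u = of_real (Re (herm c u u))" "Re (herm c u u) \<ge> 0"
 by (simp_all add: herm_def cdot_self sum_nonneg flip: of_real_sum)

lemma herm_self_zero:
 assumes "herm c u u = 0"
 shows "u = 0"
proof -
 let ?f = "\<lambda>A. \<Sum>i\<in>UNIV. (cmod ((cprod c A *v u) $ i))\<^sup>2"
 have "of_real (\<Sum>A\<in>{A. last_index \<notin> A}. ?f A) = (0 :: complex)"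
  using assms by (simp add: herm_def cdot_self)
 hence "(\<Sum>A\<in>{A. last_index \<notin> A}. ?f A) = 0" unfolding of_real_eq_0_iff .
 hence "?f {} = 0" by (subst (asm) sum_nonneg_eq_0_iff) (auto simp: sum_nonneg)
 hence "(\<Sum>i\<in>UNIV. (cmod (u $ i))\<^sup>2) = 0" by simp
 hence "\<forall>i. (cmod (u $ i))\<^sup>2 = 0" by (subst (asm) sum_nonneg_eq_0_iff) auto
 thus ?thesis by (simp add: vec_eq_iff)
qed

text \<open>Multiplication by \<open>c i\<close> permutes the products \<open>cprod c A\<close> up
  to signs, and each sign occurs in both arguments of the form.\<close>

lemma herm_module_invariant:
 fixes c :: "'n::{finite,linorder} => complex ^ 'k ^ 'k"
 assumes c: "clifford_relations c" and i: "i \<noteq> last_index"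
 shows "herm c (c i *v u) (c i *v v) = herm c u v"
proof -
 have ci: "cprod c {i} = c i" using cprod_insert_min[of "{}" i c] by simp
 have "cdot (cprod c A *v (c i *v u)) (cprod c A *v (c i *v v)) = cdot (cprod c (A \<oplus> {i}) *v u) (cprod c (A \<oplus> {i}) *v v)"
  if A: "last_index \<notin> A" for A
 proof -
  have "cprod c A *v (c i *v w) = clifford_sign A {i} *\<^sub>R (cprod c (A \<oplus> {i}) *v w)" for w
   using cprod_mult[OF c A, of "{i}"] i by (simp add: ci matrix_vector_mul_assoc mvec.scaleR_left)
  moreover have "clifford_sign A {i} * clifford_sign A {i} = 1"
   by (simp add: clifford_sign_def power_mult_distrib[symmetric])
  hence "complex_of_real (clifford_sign A {i}) * complex_of_real (clifford_sign A {i}) = 1"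
   unfolding of_real_mult[symmetric] by simp
  ultimately show ?thesis
   by (simp add: cdot_def scaleR_conv_of_real[where 'a = complex] mult_ac) (simp add: mult.assoc[symmetric])
 qed
 hence "herm c (c i *v u) (c i *v v) = (\<Sum>A\<in>{A. last_index \<notin> A}. cdot (cprod c (A \<oplus> {i}) *v u) (cprod c (A \<oplus> {i}) *v v))"
  unfolding herm_def by (intro sum.cong refl) simp
 also have "\<dots> = herm c u v"
  unfolding herm_def
  by (rule sum.reindex_bij_witness[where i = "\<lambda>A. A \<oplus> {i}" and j = "\<lambda>A. A \<oplus> {i}"]) (use i in auto)
 finally show ?thesis .
qed

lemma slash_axis: "slash c (axis i 1) = (if i = last_index then mat 1 else - c i)"
proof (cases "i = last_index")
 case True
 thus ?thesis by (simp add: slash_def clifford_vec_axis e_last_square rho_minus)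
next
 case False
 thus ?thesis by (simp add: slash_def rho_e_last_axis[OF False])
qed

text \<open>Each \<open>c i\<close> is isometric with square -1, hence skew. The maps for
  \<open>c\<close> and \<open>neg_module c\<close> differ exactly in the sign of these skew parts,
  so they are adjoint to each other.\<close>

lemma herm_slash:
 fixes c :: "'n::{finite,linorder} => complex ^ 'k ^ 'k"
 assumes c: "clifford_relations c"
 shows "herm c (slash c x *v u) v = herm c u (slash (neg_module c) x *v v)"
  and "herm c (slash (neg_module c) x *v u) v = herm c u (slash c x *v v)"
proof -
 have "herm c (slash c (axis i 1) *v u) v = herm c u (slash (neg_module c) (axis i 1) *v v)" for i u v
 proof (cases "i = last_index")
  case False
  have "c i *v (c i *v v) = - v"
   using clifford_relations_square[OF c False] by (simp add: matrix_vector_mul_assoc mvec.minus_left)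
  hence "herm c (c i *v u) (- v) = herm c u (c i *v v)"
   by (metis herm_module_invariant[OF c False])
  hence "herm c (c i *v u) v = - herm c u (c i *v v)" by (metis herm.minus_right minus_minus)
  thus ?thesis using False
   by (simp add: slash_axis neg_module_def mvec.minus_left herm.minus_left herm.minus_right)
 qed (simp add: slash_axis)
 thus 1: "herm c (slash c x *v u) v = herm c u (slash (neg_module c) x *v v)" for u v
  unfolding slash_expand[of c x] slash_expand[of "neg_module c" x]
  by (simp add: mvec.sum_left herm.sum_left herm.sum_right mvec.scaleR_left herm.scaleR_left herm.scaleR_right)
 show "herm c (slash (neg_module c) x *v u) v = herm c u (slash c x *v v)"
  using 1[of v u] by (metis herm_cnj)
qed

text \<open>On the unit sphere the sum of \<open>x\<^sub>k (x\<^sub>k \<partial>\<^sub>l - x\<^sub>l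
  \<partial>\<^sub>k)\<close> over k is \<open>\<partial>\<^sub>l\<close> minus
  \<open>x\<^sub>l\<close> times the radial derivative: the l-th component of the tangential
  gradient, written with rotation derivatives only.\<close>

definition sphere_grad :: "('n => 'n => 'n::finite rvector => 'b::real_normed_vector) => 'n => 'n rvector => 'b"
 where "sphere_grad f' l x = (\<Sum>k\<in>UNIV - {l}. x $ k *\<^sub>R f' k l x)"

text \<open>On the sphere, this is the Dirac operator up to a constant, in the trivialisation of the spinor
 bundle by restrictions of constant spinors of the ambient space.\<close>
definition sphere_dirac ::
  "('n::{finite,linorder} => complex ^ 'k ^ 'k) => ('n => 'n => 'n rvector => complex ^ 'k) => 'n rvector => complex ^ 'k"
 where "sphere_dirac c f' x = - (slash (neg_module c) x *v (\<Sum>l\<in>UNIV. slash c (axis l 1) *v sphere_grad f' l x))"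

text \<open>The gradient is tangential because the rotation derivatives are antisymmetric in their
  indices while the coefficients are symmetric.\<close>

lemma sphere_grad_radial:
 assumes f: "rotC1 f f'" and x: "norm x = 1"
 shows "(\<Sum>l\<in>UNIV. x $ l *\<^sub>R sphere_grad f' l x) = 0"
proof -
 define a where "a k l = (if k = l then 0 else (x $ k * x $ l) *\<^sub>R f' k l x)" for k l
 have "x $ l *\<^sub>R sphere_grad f' l x = (\<Sum>k\<in>UNIV. a k l)" for l
  unfolding sphere_grad_def scaleR_sum_right
  by (rule sum.mono_neutral_cong_left) (auto simp: a_def mult.commute)
 hence e: "(\<Sum>l\<in>UNIV. x $ l *\<^sub>R sphere_grad f' l x) = (\<Sum>l\<in>UNIV. \<Sum>k\<in>UNIV. a k l)" by simp
 have A: "a k l = - a l k" for k l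
  using rotC1_swap[OF f _ x, of l k] by (simp add: a_def mult.commute)
 have "(\<Sum>l\<in>UNIV. \<Sum>k\<in>UNIV. a k l) = (\<Sum>l\<in>UNIV. \<Sum>k\<in>UNIV. - a l k)" by (intro sum.cong refl A)
 also have "\<dots> = - (\<Sum>l\<in>UNIV. \<Sum>k\<in>UNIV. a l k)" by (simp only: sum_negf)
 also have "(\<Sum>l\<in>UNIV. \<Sum>k\<in>UNIV. a l k) = (\<Sum>l\<in>UNIV. \<Sum>k\<in>UNIV. a k l)" by (rule sum.swap)
 finally have "2 *\<^sub>R (\<Sum>l\<in>UNIV. \<Sum>k\<in>UNIV. a k l) = 0"
  unfolding scaleR_2 eq_neg_iff_add_eq_0 .
 thus ?thesis unfolding e by simp
qed

lemma sum_squares_unit: "norm (x :: 'n::finite rvector) = 1 ==> (\<Sum>k\<in>UNIV. x $ k * x $ k) = 1"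
 using norm_eq_1[of x] by (simp add: inner_vec_def)

lemma sphere_continuous_grad:
 assumes "rotC1 f f'"
 shows "cts_sphere (sphere_grad f' l)"
 unfolding sphere_grad_def[abs_def]
 by (intro continuous_on_sum continuous_on_scaleR rotC1_D(2)[OF assms] continuous_intros) auto

lemma continuous_slash: "continuous_on S (slash c)"
 using linear_slash by (rule linear_continuous_on[OF linear_conv_bounded_linear[THEN iffD1]])

lemma sphere_continuous_dirac:
 assumes "rotC1 f f'"
 shows "cts_sphere (sphere_dirac c f')"
 unfolding sphere_dirac_def[abs_def]
 by (intro continuous_on_minus mvec.continuous_on continuous_slash continuous_on_sum continuous_on_const sphere_continuous_grad[OF assms])

text \<open>The product rule for the factor that appears after integration by parts. Differentiating
  the Clifford factor x gives (N - 1) g and differentiating the coefficient \<open>x\<^sub>k\<close>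
  gives (1 - N) g; they cancel. In the rest, moving x past the basis vector reproduces the operator
  up to a radial derivative, which vanishes.\<close>

lemma sphere_dirac_adjoint_pointwise:
 fixes c :: "'n::{finite,wellorder} => complex ^ 'k ^ 'k"
 assumes c: "clifford_relations c" and g: "rotC1 g g'" and x: "norm x = 1"
 shows "(\<Sum>l\<in>UNIV. \<Sum>k\<in>UNIV - {l}.
   x $ k *\<^sub>R (slash (neg_module c) (axis l 1) *v (slash c x *v g' k l x + slash c (rotation_field k l x) *v g x))
   + (rotation_field k l x $ k) *\<^sub>R (slash (neg_module c) (axis l 1) *v (slash c x *v g x))) = sphere_dirac c g' x"
proof -
 let ?E = "\<lambda>l. slash (neg_module c) (axis l 1)" and ?e = "\<lambda>l. slash c (axis l 1)"
 let ?X = "slash (neg_module c) x" and ?x = "slash c x"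
 have XE: "?X *v u = (\<Sum>l\<in>UNIV. x $ l *\<^sub>R (?E l *v u))" for u
  by (subst slash_expand) (simp add: mvec.sum_left mvec.scaleR_left)
 have Xx: "?X *v (?x *v u) = u" for u
  using slash_slash_self[OF c, of x] x by (simp add: matrix_vector_mul_assoc dot_square_norm)
 have Ee: "?E l *v (?e l *v u) = u" for l u
  using slash_slash_self[OF c, of "axis l 1"] by (simp add: matrix_vector_mul_assoc inner_axis_axis)
 have Ex: "?E l *v (?x *v u) = (2 * x $ l) *\<^sub>R u - ?X *v (?e l *v u)" for l u
  using arg_cong[OF slash_anticommute[OF c, of "axis l 1" x], of "\<lambda>M. M *v u"]
  by (simp add: matrix_vector_mul_assoc matrix_vector_mult_add_rdistrib mvec.add_left mvec.scaleR_left inner_axis' algebra_simps)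
 have p1: "(\<Sum>k\<in>UNIV - {l}. x $ k *\<^sub>R (?E l *v (?x *v g' k l x))) = ?E l *v (?x *v sphere_grad g' l x)" for l
  by (simp add: sphere_grad_def mvec.sum_right mvec.scaleR_right)
 have r1: "(\<Sum>k\<in>UNIV. x $ k *\<^sub>R rotation_field k l x) = axis l 1 - x $ l *\<^sub>R x" for l
 proof -
  have "(\<Sum>k\<in>UNIV. x $ k *\<^sub>R rotation_field k l x)
   = (\<Sum>k\<in>UNIV. x $ k * x $ k) *\<^sub>R axis l 1 - x $ l *\<^sub>R (\<Sum>k\<in>UNIV. x $ k *\<^sub>R axis k 1)"
   by (simp add: rotation_field_def scaleR_diff_right sum_subtractf scaleR_sum_left scaleR_sum_right mult.commute)
  thus ?thesis using sum_squares_unit[OF x] vec_expand[of x] by simp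
 qed
 have p2: "(\<Sum>k\<in>UNIV - {l}. x $ k *\<^sub>R (?E l *v (slash c (rotation_field k l x) *v g x))) = g x - x $ l *\<^sub>R (?E l *v (?x *v g x))" for l
 proof -
  have "(\<Sum>k\<in>UNIV - {l}. x $ k *\<^sub>R (?E l *v (slash c (rotation_field k l x) *v g x)))
   = (\<Sum>k\<in>UNIV. x $ k *\<^sub>R (?E l *v (slash c (rotation_field k l x) *v g x)))"
   by (rule sum.mono_neutral_left) (auto simp: rotation_field_def linear_0[OF linear_slash] mvec.zero_left mvec.zero_right)
  also have "\<dots> = ?E l *v (slash c (\<Sum>k\<in>UNIV. x $ k *\<^sub>R rotation_field k l x) *v g x)"
   by (simp add: linear_sum[OF linear_slash] linear_cmul[OF linear_slash] mvec.sum_left mvec.sum_right mvec.scaleR_left mvec.scaleR_right)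
  finally show ?thesis
   unfolding r1 by (simp add: linear_diff[OF linear_slash] linear_cmul[OF linear_slash] mvec.diff_left mvec.diff_right
     mvec.scaleR_left mvec.scaleR_right Ee)
 qed
 have r2: "(\<Sum>k\<in>UNIV - {l}. rotation_field k l x $ k) = (1 - real CARD('n)) * x $ l" for l
 proof -
  have "(\<Sum>k\<in>UNIV - {l}. rotation_field k l x $ k) = (\<Sum>k\<in>UNIV - {l}. - x $ l)"
   by (intro sum.cong refl) (auto simp: rotation_field_def axis_component)
  thus ?thesis by (simp add: card_Diff_singleton of_nat_diff Suc_leI algebra_simps)
 qed
 have "(\<Sum>l\<in>UNIV. \<Sum>k\<in>UNIV - {l}.
   x $ k *\<^sub>R (?E l *v (?x *v g' k l x + slash c (rotation_field k l x) *v g x))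
   + (rotation_field k l x $ k) *\<^sub>R (?E l *v (?x *v g x)))
  = (\<Sum>l\<in>UNIV. ?E l *v (?x *v sphere_grad g' l x) + (g x - x $ l *\<^sub>R (?E l *v (?x *v g x)))
    + ((1 - real CARD('n)) * x $ l) *\<^sub>R (?E l *v (?x *v g x)))"
  by (intro sum.cong refl)
   (simp add: mvec.add_right scaleR_add_right sum.distrib p1 p2 r2 flip: scaleR_sum_left)
 also have "\<dots> = (\<Sum>l\<in>UNIV. ?E l *v (?x *v sphere_grad g' l x)) + (real CARD('n) *\<^sub>R g x - ?X *v (?x *v g x))
    + (1 - real CARD('n)) *\<^sub>R (?X *v (?x *v g x))"
  unfolding XE[of "?x *v g x"] by (simp add: sum.distrib sum_subtractf scaleR_sum_right sum_constant_scaleR del: sum_constant)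
 also have "\<dots> = (\<Sum>l\<in>UNIV. ?E l *v (?x *v sphere_grad g' l x))"
  unfolding Xx by (simp add: scaleR_diff_left)
 also have "\<dots> = 2 *\<^sub>R (\<Sum>l\<in>UNIV. x $ l *\<^sub>R sphere_grad g' l x) + sphere_dirac c g' x"
  unfolding Ex by (simp add: sum_subtractf sphere_dirac_def mvec.sum_right scaleR_sum_right)
 finally show ?thesis unfolding sphere_grad_radial[OF g x] by simp
qed

definition sphere_ip :: "('n::{finite,wellorder} => complex ^ 'k ^ 'k) => ('n rvector => complex ^ 'k) => ('n rvector => complex ^ 'k) => complex"
 where "sphere_ip c f g = sphere_integral (\<lambda>x. herm c (f x) (g x))"

lemma sphere_ip_continuous:
 "cts_sphere f ==> cts_sphere g ==> cts_sphere (\<lambda>x. herm c (f x) (g x))"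
 by (rule herm.continuous_on)

text \<open>\<open>D k l\<close> is the rotation derivative of a function on the sphere and
  integrates to zero. Summed over all pairs it is the difference of the two Hermitian
  products.\<close>

theorem sphere_dirac_symmetric:
 fixes c :: "'n::{finite,wellorder} => complex ^ 'k ^ 'k"
 assumes c: "clifford_relations c" and f: "rotC1 f f'" and g: "rotC1 g g'"
 shows "sphere_ip c (sphere_dirac c f') g = sphere_ip c f (sphere_dirac c g')"
proof -
 let ?E = "\<lambda>l. slash (neg_module c) (axis l 1)"
 define K where "K k l x = x $ k *\<^sub>R (?E l *v (slash c x *v g x))" for k l x
 define K' where "K' k l i j x = x $ k *\<^sub>R (?E l *v (slash c x *v g' i j x + slash c (rotation_field i j x) *v g x))
   + (rotation_field i j x $ k) *\<^sub>R (?E l *v (slash c x *v g x))" for k l i j x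
 have bl: "bounded_linear (slash c)" using linear_slash linear_conv_bounded_linear by blast
 have K: "rotC1 (K k l) (K' k l)" for k l
  unfolding K_def[abs_def] K'_def[abs_def]
  by (rule rotC1_bilinear[OF bounded_bilinear_scaleR rotC1_linear[OF bounded_linear_vec_nth]
     rotC1_compose_linear[OF mvec.bounded_linear_right rotC1_bilinear[OF bounded_bilinear_matrix_vector rotC1_linear[OF bl] g]]])
 define D where "D k l x = herm c (f x) (K' k l k l x) + herm c (f' k l x) (K k l x)" for k l x
 note fK = rotC1_bilinear[OF bounded_bilinear_herm f K]
 have D0: "sphere_integral (D k l) = 0" if "k \<noteq> l" for k l
  using sphere_integral_rotation_derivative[OF fK[of c k l] that] unfolding D_def .
 have Dc: "cts_sphere (D k l)" if "k \<noteq> l" for k l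
  using rotC1_D(2)[OF fK[of c k l] that] unfolding D_def .
 have pw: "(\<Sum>l\<in>UNIV. \<Sum>k\<in>UNIV - {l}. D k l x) = herm c (f x) (sphere_dirac c g' x) - herm c (sphere_dirac c f' x) (g x)"
  if x: "norm x = 1" for x
 proof -
  have "(\<Sum>l\<in>UNIV. \<Sum>k\<in>UNIV - {l}. herm c (f x) (K' k l k l x)) = herm c (f x) (sphere_dirac c g' x)"
   unfolding sphere_dirac_adjoint_pointwise[OF c g x, symmetric] K'_def by (simp only: herm.sum_right)
  moreover have "(\<Sum>k\<in>UNIV - {l}. herm c (f' k l x) (K k l x)) = herm c (slash c (axis l 1) *v sphere_grad f' l x) (slash c x *v g x)" for l
   unfolding herm_slash(1)[OF c] K_def sphere_grad_def
   by (simp add: herm.sum_left herm.scaleR_left herm.scaleR_right)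
  hence "(\<Sum>l\<in>UNIV. \<Sum>k\<in>UNIV - {l}. herm c (f' k l x) (K k l x)) = - herm c (sphere_dirac c f' x) (g x)"
   unfolding sphere_dirac_def by (simp add: herm.minus_left herm_slash(2)[OF c] herm.sum_left)
  ultimately show ?thesis unfolding D_def by (simp add: sum.distrib)
 qed
 have "0 = (\<Sum>l\<in>UNIV. \<Sum>k\<in>UNIV - {l}. sphere_integral (D k l))"
  by (rule sum.neutral[symmetric]) (auto intro!: sum.neutral D0)
 also have "\<dots> = (\<Sum>l\<in>UNIV. sphere_integral (\<lambda>x. \<Sum>k\<in>UNIV - {l}. D k l x))"
  by (intro sum.cong refl sphere_integral_sum[symmetric] Dc) auto
 also have "\<dots> = sphere_integral (\<lambda>x. \<Sum>l\<in>UNIV. \<Sum>k\<in>UNIV - {l}. D k l x)"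
  by (intro sphere_integral_sum[symmetric] continuous_on_sum Dc) auto
 also have "\<dots> = sphere_integral (\<lambda>x. herm c (f x) (sphere_dirac c g' x) - herm c (sphere_dirac c f' x) (g x))"
  by (rule sphere_integral_cong) (rule pw)
 also have "\<dots> = sphere_ip c f (sphere_dirac c g') - sphere_ip c (sphere_dirac c f') g"
  unfolding sphere_ip_def
  by (intro sphere_integral_diff sphere_ip_continuous rotC1_D(1)[OF f] rotC1_D(1)[OF g] sphere_continuous_dirac[OF f] sphere_continuous_dirac[OF g])
 finally show ?thesis by simp
qed

definition poly_rotation :: "('n::{finite,linorder} rvector => 'b::real_normed_vector) => 'n => 'n => 'n rvector => 'b"
 where "poly_rotation P k l x = x $ k *\<^sub>R partial l P x - x $ l *\<^sub>R partial k P x"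

text \<open>The full derivative is split into tangential and radial parts; the radial part is m P by
  the Euler identity, and x squares to one on the unit sphere.\<close>

lemma sphere_dirac_homogeneous:
 fixes c :: "'n::{finite,wellorder} => complex ^ 'k ^ 'k"
 assumes c: "clifford_relations c" and P: "homogeneous m P" and x: "norm x = 1"
 shows "sphere_dirac c (poly_rotation P) x = real m *\<^sub>R P x - slash (neg_module c) x *v dslash c P x"
proof -
 have g: "sphere_grad (poly_rotation P) l x = partial l P x - (x $ l * real m) *\<^sub>R P x" for l
 proof -
  have "sphere_grad (poly_rotation P) l x = (\<Sum>k\<in>UNIV. x $ k *\<^sub>R poly_rotation P k l x)"
   unfolding sphere_grad_def by (rule sum.mono_neutral_left) (auto simp: poly_rotation_def)
  also have "\<dots> = (\<Sum>k\<in>UNIV. x $ k * x $ k) *\<^sub>R partial l P x - x $ l *\<^sub>R (\<Sum>k\<in>UNIV. x $ k *\<^sub>R partial k P x)"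
   by (simp add: poly_rotation_def scaleR_diff_right sum_subtractf scaleR_sum_left scaleR_sum_right mult.commute)
  finally show ?thesis by (simp add: sum_squares_unit[OF x] homogeneous_euler[OF P])
 qed
 have "(\<Sum>l\<in>UNIV. slash c (axis l 1) *v sphere_grad (poly_rotation P) l x) = dslash c P x - real m *\<^sub>R (slash c x *v P x)"
  unfolding g slash_expand[of c x]
  by (simp add: dslash_def mvec.diff_right mvec.scaleR_right sum_subtractf mvec.sum_left mvec.scaleR_left scaleR_sum_right mult.commute)
 moreover have "slash (neg_module c) x *v (slash c x *v P x) = P x"
  using slash_slash_self[OF c, of x] x by (simp add: matrix_vector_mul_assoc dot_square_norm)
 ultimately show ?thesis
  by (simp add: sphere_dirac_def mvec.diff_right mvec.scaleR_right)
qed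

lemma rotC1_poly: "homogeneous m P ==> rotC1 P (poly_rotation P)"
 unfolding poly_rotation_def[abs_def] by (rule rotC1_homogeneous)

section \<open>Orthogonal projection and density of polynomials\<close>

lemma sphere_ip_cong:
 "(\<And>x. norm x = 1 ==> f x = f1 x) ==> (\<And>x. norm x = 1 ==> g x = g1 x) ==> sphere_ip c f g = sphere_ip c f1 g1"
 unfolding sphere_ip_def by (rule sphere_integral_cong) simp

lemma sphere_ip_smult_left: "sphere_ip c (\<lambda>x. a *s f x) g = a * sphere_ip c f g"
 by (simp add: sphere_ip_def herm_smult_left sphere_integral_mult)

lemma sphere_ip_smult_right: "sphere_ip c f (\<lambda>x. a *s g x) = cnj a * sphere_ip c f g"
 by (simp add: sphere_ip_def herm_smult_right sphere_integral_mult)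

lemma sphere_ip_diff_left:
 assumes "cts_sphere f" "cts_sphere g" "cts_sphere h"
 shows "sphere_ip c (\<lambda>x. f x - g x) h = sphere_ip c f h - sphere_ip c g h"
 unfolding sphere_ip_def herm.diff_left by (intro sphere_integral_diff sphere_ip_continuous assms)

lemma sphere_ip_diff_right:
 assumes "cts_sphere f" "cts_sphere g" "cts_sphere h"
 shows "sphere_ip c h (\<lambda>x. f x - g x) = sphere_ip c h f - sphere_ip c h g"
 unfolding sphere_ip_def herm.diff_right by (intro sphere_integral_diff sphere_ip_continuous assms)

lemma sphere_ip_add_right:
 assumes "cts_sphere f" "cts_sphere g" "cts_sphere h"
 shows "sphere_ip c h (\<lambda>x. f x + g x) = sphere_ip c h f + sphere_ip c h g"
 unfolding sphere_ip_def herm.add_right by (intro sphere_integral_add sphere_ip_continuous assms)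

lemma sphere_ip_zero_right [simp]: "sphere_ip c f (\<lambda>x. 0) = 0"
 by (simp add: sphere_ip_def herm.zero_right)

lemma sphere_ip_self_zero:
 assumes f: "cts_sphere f" and z: "sphere_ip c f f = 0" and x: "norm x = 1"
 shows "f x = 0"
proof -
 have "sphere_integral (\<lambda>x. of_real (Re (herm c (f x) (f x)))) = 0"
  using z unfolding sphere_ip_def by (simp only: herm_self(1)[symmetric])
 hence "Re (herm c (f x) (f x)) = 0"
  by (intro sphere_integral_nonneg_zero[OF _ herm_self(2) _ x] continuous_intros sphere_ip_continuous f)
 thus ?thesis using herm_self(1)[of c "f x"] herm_self_zero[of c "f x"] by simp
qed

lemma continuous_smult: "continuous_on S f ==> continuous_on S (\<lambda>x. a *s (f x :: complex ^ 'k))"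
 by (rule bounded_linear.continuous_on[OF linear_conv_bounded_linear[THEN iffD1, OF linear_smult]])

lemma span_continuous:
 assumes B: "\<And>b. b \<in> B ==> continuous_on S b" and f: "f \<in> complex_fun.span B"
 shows "continuous_on S f"
 using f
proof (induction rule: complex_fun.span_induct_alt)
 case base
 show ?case by (simp add: zero_fun_def)
next
 case (step a b g)
 have "continuous_on S (\<lambda>x. a *s b x)"
  by (intro continuous_smult B step(1))
 thus ?case using step(2) unfolding plus_fun_def by (rule continuous_on_add)
qed

lemma sphere_ip_span:
 assumes B: "\<And>b. b \<in> B ==> cts_sphere b" and f: "cts_sphere f"
  and z: "\<And>b. b \<in> B ==> sphere_ip c f b = 0" and P: "P \<in> complex_fun.span B"
 shows "sphere_ip c f P = 0"
proof -
 have "cts_sphere P \<and> sphere_ip c f P = 0"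
 using P
proof (induction rule: complex_fun.span_induct_alt)
 case base
 show ?case unfolding zero_fun_def by simp
next
 case (step a b g)
 have "cts_sphere (\<lambda>x. a *s b x)"
  by (intro continuous_smult B step(1))
 thus ?case
  using z[OF step(1)] step(2) unfolding plus_fun_def
  by (simp add: sphere_ip_add_right f sphere_ip_smult_right continuous_on_add)
qed
 thus ?thesis ..
qed

text \<open>One Gram-Schmidt step per element: the part of b orthogonal to the span of
  \<open>B\<close> serves to correct the projection obtained for \<open>B\<close>.\<close>

lemma sphere_projection:
 assumes "finite B" "\<And>b. b \<in> B ==> cts_sphere b" "cts_sphere f"
 shows "\<exists>P\<in>complex_fun.span B. \<forall>b\<in>B. sphere_ip c (\<lambda>x. f x - P x) b = 0"
 using assms
proof (induction B arbitrary: f rule: finite_induct)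
 case empty
 show ?case using complex_fun.span_zero by blast
next
 case (insert b B)
 have cB: "cts_sphere b'" if "b' \<in> B" for b' using that insert.prems(1) by blast
 have cb: "cts_sphere b" using insert.prems(1) by blast
 obtain P where P: "P \<in> complex_fun.span B" "\<forall>b\<in>B. sphere_ip c (\<lambda>x. f x - P x) b = 0"
  using insert.IH[OF cB insert.prems(2)] by blast
 obtain R where R: "R \<in> complex_fun.span B" "\<forall>b'\<in>B. sphere_ip c (\<lambda>x. b x - R x) b' = 0"
  using insert.IH[OF cB cb] by blast
 have cP: "cts_sphere P" and cR: "cts_sphere R"
  using span_continuous[OF cB] P(1) R(1) by blast+
 define e where "e = (\<lambda>x. b x - R x)"
 define h where "h = (\<lambda>x. f x - P x)"
 define a where "a = sphere_ip c h e / sphere_ip c e e"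
 define Q where "Q = (\<lambda>x. P x + a *s e x)"
 have ce: "cts_sphere e" unfolding e_def by (rule continuous_on_diff[OF cb cR])
 have ch: "cts_sphere h" unfolding h_def by (rule continuous_on_diff[OF insert.prems(2) cP])
 have cae: "cts_sphere (\<lambda>x. a *s e x)"
  by (rule continuous_smult[OF ce])
 have fQ: "(\<lambda>x. f x - Q x) = (\<lambda>x. h x - a *s e x)" by (simp add: h_def Q_def fun_eq_iff)
 have cfQ: "cts_sphere (\<lambda>x. h x - a *s e x)" by (rule continuous_on_diff[OF ch cae])
 have ip: "sphere_ip c (\<lambda>x. h x - a *s e x) k = sphere_ip c h k - a * sphere_ip c e k" if "cts_sphere k" for k
  by (simp add: sphere_ip_diff_left[OF ch cae that] sphere_ip_smult_left)
 have zB: "sphere_ip c (\<lambda>x. h x - a *s e x) b' = 0" if "b' \<in> B" for b'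
 proof -
  have "sphere_ip c h b' = 0" "sphere_ip c e b' = 0" using P(2) R(2) that unfolding h_def e_def by blast+
  thus ?thesis by (simp only: ip[OF cB[OF that]] mult_zero_right diff_self)
 qed
 have ze: "sphere_ip c (\<lambda>x. h x - a *s e x) e = 0"
 proof (cases "sphere_ip c e e = 0")
  case True
  \<comment> \<open>A function of norm zero vanishes on the sphere, so both terms are zero for any
    value of \<open>a\<close>, including the one given by division by zero.\<close>
  hence "sphere_ip c h e = sphere_ip c h (\<lambda>x. 0)" by (intro sphere_ip_cong refl sphere_ip_self_zero[OF ce])
  thus ?thesis by (simp add: ip[OF ce] True)
 next
  case False
  thus ?thesis unfolding ip[OF ce] by (simp add: a_def)
 qed
 have zR: "sphere_ip c (\<lambda>x. h x - a *s e x) R = 0" by (rule sphere_ip_span[OF cB cfQ zB R(1)])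
 have "sphere_ip c (\<lambda>x. h x - a *s e x) b = 0"
 proof -
  have "b = (\<lambda>x. e x + R x)" by (simp add: e_def)
  thus ?thesis using ze zR sphere_ip_add_right[OF ce cR cfQ, of c] by simp
 qed
 moreover have "Q \<in> complex_fun.span (insert b B)"
 proof -
  have sB: "complex_fun.span B \<subseteq> complex_fun.span (insert b B)" by (rule complex_fun.span_mono) blast
  have "Q = P + (\<lambda>x. a *s (b - R) x)" by (simp add: Q_def e_def fun_eq_iff)
  moreover have "\<dots> \<in> complex_fun.span (insert b B)"
   using P(1) R(1) sB
   by (intro complex_fun.span_add complex_fun.span_scale complex_fun.span_diff) (auto intro: complex_fun.span_base)
  ultimately show ?thesis by (simp only:)
 qed
 ultimately show ?case using zB unfolding fQ[symmetric] by blast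
qed

text \<open>Stated with a spinor valued factor G, so that a product of real polynomials becomes two
  successive multiplications.\<close>

lemma real_polynomial_span:
 fixes G :: "'n::{finite,linorder} rvector => complex ^ 'k"
 assumes "real_polynomial_function p" "G \<in> complex_fun.span (\<Union>m. Collect (homogeneous m))"
 shows "(\<lambda>x. p x *\<^sub>R G x) \<in> complex_fun.span (\<Union>m. Collect (homogeneous m))" (is "_ \<in> ?S")
 using assms
proof (induction arbitrary: G rule: real_polynomial_function.induct)
 case (linear p)
 have coord: "(\<lambda>x. x $ i *\<^sub>R G x) \<in> ?S" for i
  using linear(2)
 proof (induction rule: complex_fun.span_induct_alt)
  case base
  show ?case using complex_fun.span_zero by (simp add: zero_fun_def)
 next
  case (step a b g)
  then obtain m where "homogeneous m b" by blast
  hence "(\<lambda>x. x $ i *\<^sub>R b x) \<in> ?S" using homogeneous.mult by (intro complex_fun.span_base) blast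
  hence "(\<lambda>x. a *s (x $ i *\<^sub>R b x)) + (\<lambda>x. x $ i *\<^sub>R g x) \<in> ?S"
   using step(2) by (intro complex_fun.span_add complex_fun.span_scale)
  moreover have "(\<lambda>x. a *s (x $ i *\<^sub>R b x)) + (\<lambda>x. x $ i *\<^sub>R g x) = (\<lambda>x. x $ i *\<^sub>R (((\<lambda>x. a *s b x) + g) x))"
   by (simp add: fun_eq_iff vec_eq_iff algebra_simps)
  ultimately show ?case by simp
 qed
 have lin: "linear p" using linear(1) by (simp add: linear_conv_bounded_linear)
 have p: "p x = (\<Sum>i\<in>UNIV. p (axis i 1) * x $ i)" for x
  by (subst vec_expand[of x]) (simp add: linear_sum[OF lin] linear_cmul[OF lin] mult.commute)
 have "(\<lambda>x. p x *\<^sub>R G x) = (\<Sum>i\<in>UNIV. (\<lambda>x. complex_of_real (p (axis i 1)) *s (x $ i *\<^sub>R G x)))"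
  unfolding fun_eq_iff sum_fun_apply
  by (subst p) (simp add: scaleR_smult[symmetric] scaleR_sum_left)
 also have "\<dots> \<in> ?S" by (intro complex_fun.span_sum complex_fun.span_scale coord)
 finally show ?case .
next
 case (const r)
 thus ?case unfolding scaleR_smult by (rule complex_fun.span_scale)
next
 case (add p q)
 hence "(\<lambda>x. p x *\<^sub>R G x) + (\<lambda>x. q x *\<^sub>R G x) \<in> ?S" by (intro complex_fun.span_add) blast+
 thus ?case by (simp add: plus_fun_def scaleR_add_left)
next
 case (mult p q)
 hence "(\<lambda>x. p x *\<^sub>R (q x *\<^sub>R G x)) \<in> ?S" by blast
 thus ?case by simp
qed

lemma polynomial_function_span:
 fixes g :: "'n::{finite,linorder} rvector => complex ^ 'k"
 assumes "polynomial_function g"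
 shows "g \<in> complex_fun.span (\<Union>m. Collect (homogeneous m))" (is "_ \<in> ?S")
proof -
 have "(\<lambda>x. (g x \<bullet> b) *\<^sub>R b) \<in> ?S" for b
 proof (rule real_polynomial_span)
  show "real_polynomial_function (\<lambda>x. g x \<bullet> b)"
   using assms bounded_linear_inner_left[of b] unfolding polynomial_function_def o_def by blast
  show "(\<lambda>x. b) \<in> ?S" using homogeneous.const[of b] by (intro complex_fun.span_base) blast
 qed
 hence "(\<Sum>b\<in>Basis. (\<lambda>x. (g x \<bullet> b) *\<^sub>R b)) \<in> ?S" by (intro complex_fun.span_sum)
 moreover have "(\<Sum>b\<in>Basis. (\<lambda>x. (g x \<bullet> b) *\<^sub>R b)) = g"
  by (simp add: fun_eq_iff sum_fun_apply euclidean_representation)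
 ultimately show ?thesis by simp
qed

text \<open>For a polynomial g uniformly close to f, orthogonality gives that the product of f with
  itself equals the product of f with f - g, which is arbitrarily small.\<close>

lemma sphere_dense:
 fixes c :: "'n::{finite,wellorder} => complex ^ 'k ^ 'k"
 assumes f: "cts_sphere f" and z: "\<And>m P. homogeneous m P ==> sphere_ip c f P = 0" and x: "norm x = 1"
 shows "f x = 0"
proof -
 obtain K where K: "K > 0" "\<And>u v. norm (herm c u v) \<le> norm u * norm v * K"
  using bounded_bilinear.pos_bounded[OF bounded_bilinear_herm] by blast
 have "compact (f ` sphere 0 1)" by (rule compact_continuous_image[OF f]) simp
 hence "bounded (f ` sphere 0 1)" by (rule compact_imp_bounded)
 then obtain C where C0: "\<forall>u\<in>f ` sphere 0 1. norm u \<le> C" unfolding bounded_iff by blast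
 have C: "norm (f y) \<le> C" if "norm y = 1" for y using C0 that by simp
 define V where "V = (LINT x|lborel. indicat_real (shell :: 'n rvector set) x)"
 have small: "cmod (sphere_ip c f f) \<le> e * (C * K * V)" if e: "e > 0" for e
 proof -
  obtain g where g1: "polynomial_function g" and g2: "\<forall>y\<in>sphere 0 1. norm (f y - g y) < e"
   using Stone_Weierstrass_polynomial_function[OF compact_sphere f e] by blast
  note g = g1 g2[rule_format, unfolded mem_sphere_0]
  have gS: "g \<in> complex_fun.span (\<Union>m. Collect (homogeneous m))" by (rule polynomial_function_span[OF g(1)])
  have cb: "cts_sphere b" if "b \<in> (\<Union>m. Collect (homogeneous m))" for b :: "'n rvector => complex ^ 'k"
   using that homogeneous_continuous by blast
  have "sphere_ip c f g = 0"
  proof (rule sphere_ip_span[OF cb f _ gS])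
   fix b :: "'n rvector => complex ^ 'k" assume "b \<in> (\<Union>m. Collect (homogeneous m))"
   thus "sphere_ip c f b = 0" using z by blast
  qed
  moreover have cg: "cts_sphere g" by (rule span_continuous[OF cb gS])
  ultimately have "sphere_ip c f f = sphere_ip c f (\<lambda>y. f y - g y)" by (simp add: sphere_ip_diff_right f)
  also have "cmod \<dots> \<le> (C * e * K) * V"
   unfolding sphere_ip_def V_def
  proof (rule sphere_integral_bound)
   show "cts_sphere (\<lambda>x. herm c (f x) (f x - g x))"
    by (intro sphere_ip_continuous continuous_on_diff f cg)
   fix y :: "'n rvector" assume y: "norm y = 1"
   have "norm (f y) * norm (f y - g y) \<le> C * e"
    using C[OF y] g(2)[OF y] by (intro mult_mono) (auto intro: order_trans[OF norm_ge_zero C[OF y]])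
   hence "norm (f y) * norm (f y - g y) * K \<le> C * e * K" using K(1) by (intro mult_right_mono) auto
   thus "cmod (herm c (f y) (f y - g y)) \<le> C * e * K" using K(2) order_trans by blast
  qed
  finally show ?thesis by (simp add: mult_ac)
 qed
 have "cmod (sphere_ip c f f) \<le> 0"
 proof (rule field_le_epsilon)
  fix d :: real assume d: "d > 0"
  \<comment> \<open>The summand 1 keeps the denominator positive even if the constants
    vanish.\<close>
  have "d / (\<bar>C * K * V\<bar> + 1) * (C * K * V) \<le> d / (\<bar>C * K * V\<bar> + 1) * (\<bar>C * K * V\<bar> + 1)"
   using d by (intro mult_left_mono) auto
  also have "\<dots> = d" by simp
  finally show "cmod (sphere_ip c f f) \<le> 0 + d"
   using small[of "d / (\<bar>C * K * V\<bar> + 1)"] d by (simp add: add_pos_nonneg)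
 qed
 thus ?thesis by (intro sphere_ip_self_zero[OF f _ x, of c]) simp
qed

text \<open>The restrictions to the sphere are the eigenspinors of \<^const>\<open>sphere_dirac\<close> for the eigenvalue \<open>z\<close>.\<close>
definition eigen_poly ::
  "('n::{finite,linorder} => complex ^ 'k ^ 'k) => 'n clifford => int => ('n rvector => complex ^ 'k) set"
 where "eigen_poly c a z =
  (if z \<ge> 0 then monogenic c a (nat z)
   else if z \<le> 1 - int CARD('n)
   then xslash (neg_module c) ` monogenic (neg_module c) a (nat (1 - int CARD('n) - z))
   else {\<lambda>x. 0})"

section \<open>Polynomial eigenspinors of the sphere and their completeness\<close>

lemma monogenic_D: "P \<in> monogenic c a m ==> homogeneous m P" "P \<in> monogenic c a m ==> dslash c P x = 0"
 by (auto simp: monogenic_def equivariant_poly_def)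

lemma eigen_poly_homogeneous: "P \<in> eigen_poly c a z ==> \<exists>m. homogeneous m P"
 using homogeneous_xslash homogeneous_zero monogenic_D(1) unfolding eigen_poly_def by (fastforce split: if_splits)

text \<open>In degree m the operator is m minus multiplication by x after the Dirac operator. It is
  m on monogenic polynomials. For monogenic Q of degree m, x Q has degree m + 1 and the Dirac
  operator maps it to (N + 2 m) Q, which gives m + 1 - (N + 2 m) = 1 - N - m.\<close>

lemma eigen_poly_dirac:
 fixes c :: "'n::{finite,wellorder} => complex ^ 'k ^ 'k"
 assumes c: "clifford_relations c" and P: "P \<in> eigen_poly c a z" and x: "norm x = 1"
 shows "sphere_dirac c (poly_rotation P) x = of_int z *\<^sub>R P x"
proof -
 consider "z \<ge> 0" "P \<in> monogenic c a (nat z)"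
  | Q where "z < 0" "z \<le> 1 - int CARD('n)" "Q \<in> monogenic (neg_module c) a (nat (1 - int CARD('n) - z))" "P = xslash (neg_module c) Q"
  | "P = (\<lambda>x. 0)"
  using P unfolding eigen_poly_def by (auto split: if_splits)
 thus ?thesis
 proof cases
  case 1
  thus ?thesis
   by (simp add: sphere_dirac_homogeneous[OF c monogenic_D(1)[OF 1(2)] x] monogenic_D(2)[OF 1(2)] mvec.zero_right)
 next
  case 2
  let ?c = "neg_module c" and ?m = "nat (1 - int CARD('n) - z)"
  note c' = clifford_relations_neg[OF c]
  have hQ: "homogeneous ?m Q" by (rule monogenic_D(1)[OF 2(3)])
  have "dslash c P x = (real CARD('n) + 2 * real ?m) *\<^sub>R Q x"
   using dslash_xslash[OF c' hQ, of x] monogenic_D(2)[OF 2(3)] by (simp add: 2(4) xslash_def mvec.zero_right)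
  hence "sphere_dirac c (poly_rotation P) x = real (Suc ?m) *\<^sub>R P x - (real CARD('n) + 2 * real ?m) *\<^sub>R P x"
   unfolding sphere_dirac_homogeneous[OF c homogeneous_xslash[OF hQ, of ?c, folded 2(4)] x]
   by (simp add: mvec.scaleR_right 2(4) xslash_def)
  also have "\<dots> = (real (Suc ?m) - (real CARD('n) + 2 * real ?m)) *\<^sub>R P x" by (simp only: scaleR_diff_left)
  also have "real (Suc ?m) - (real CARD('n) + 2 * real ?m) = of_int z" using 2(2) by simp
  finally show ?thesis .
 next
  case 3
  hence "homogeneous 0 P" by (simp add: homogeneous_zero)
  thus ?thesis using sphere_dirac_homogeneous[OF c _ x, of 0 P] dslash_const[of P c x] 3 by (simp add: mvec.zero_right)
 qed
qed

lemma xslash_eq_0_iff: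
 assumes c: "clifford_relations c" and P: "homogeneous m P" and z: "\<And>x. xslash c P x = 0"
 shows "P x = 0"
proof -
 have nz: "P y = 0" if "y \<noteq> 0" for y
 proof -
  have "slash (neg_module c) y *v (slash c y *v P y) = 0" using z[of y] by (simp add: xslash_def mvec.zero_right)
  hence "(y \<bullet> y) *\<^sub>R P y = 0"
   using slash_slash_self[OF c, of y] by (simp add: matrix_vector_mul_assoc mvec.scaleR_left)
  thus ?thesis using that by simp
 qed
 \<comment> \<open>Multiplication by x is invertible away from the origin only; the value there
   follows from homogeneity.\<close>
 have "P (0 *\<^sub>R axis undefined 1) = 0 ^ m *\<^sub>R P (axis undefined 1)" by (rule homogeneous_scale[OF P])
 hence "P 0 = 0" using nz[of "axis undefined 1"] by (simp add: axis_eq_0_iff)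
 thus ?thesis using nz by (cases "x = 0") auto
qed

lemma eigen_poly_basis:
 fixes c :: "'n::{finite,linorder} => complex ^ 'k ^ 'k"
 assumes c: "clifford_relations c"
 obtains B where "finite B" "complex_fun.span B = eigen_poly c a z"
  "complex_fun.dim (eigen_poly c a z) = (if z \<ge> 0 then complex_fun.dim (monogenic c a (nat z))
   else if z \<le> 1 - int CARD('n) then complex_fun.dim (monogenic (neg_module c) a (nat (1 - int CARD('n) - z))) else 0)"
proof -
 consider "z \<ge> 0" | "z < 0" "z \<le> 1 - int CARD('n)" | "z < 0" "z > 1 - int CARD('n)" by linarith
 thus thesis
 proof cases
  case 1
  obtain S where S: "finite S" "monogenic c a (nat z) \<subseteq> complex_fun.span S"
   using equivariant_poly_finite_span(2) by blast
  obtain B where "finite B" "complex_fun.span B = monogenic c a (nat z)"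
   by (rule complex_fun_linear_image[OF monogenic_subspace S(2,1), of "\<lambda>f. f"]) auto
  thus thesis using 1 that[of B] by (simp add: eigen_poly_def)
 next
  case 2
  let ?c = "neg_module c" and ?V = "monogenic (neg_module c) a (nat (1 - int CARD('n) - z))"
  obtain S where S: "finite S" "?V \<subseteq> complex_fun.span S"
   using equivariant_poly_finite_span(2) by blast
  have add: "xslash ?c (f + g) = xslash ?c f + xslash ?c g" for f g
   by (simp add: fun_eq_iff xslash_def mvec.add_right)
  have scale: "xslash ?c (\<lambda>x. b *s f x) = (\<lambda>x. b *s xslash ?c f x)" for b f
   by (simp add: fun_eq_iff xslash_def smult_matrix_vector)
  have inj: "f = 0" if "f \<in> ?V" "xslash ?c f = 0" for f
  proof -
   have "xslash ?c f x = 0" for x using that(2) by (simp add: fun_eq_iff)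
   hence "f x = 0" for x by (rule xslash_eq_0_iff[OF clifford_relations_neg[OF c] monogenic_D(1)[OF that(1)]])
   thus ?thesis by (simp add: fun_eq_iff)
  qed
  obtain B where "finite B" "complex_fun.span (xslash ?c ` B) = xslash ?c ` ?V"
   by (rule complex_fun_linear_image[OF monogenic_subspace S(2,1) add scale inj])
  moreover have "complex_fun.dim (xslash ?c ` ?V) = complex_fun.dim ?V"
   by (rule complex_fun_dim_image(2)[OF monogenic_subspace S(2,1) add scale inj])
  ultimately show thesis using 2 that[of "xslash ?c ` B"] by (simp add: eigen_poly_def)
 next
  case 3
  have "complex_fun.dim {\<lambda>x :: 'n rvector. 0 :: complex ^ 'k} = 0"
   by (rule complex_fun.dim_unique[of "{}"]) (auto simp: zero_fun_def complex_fun.independent_empty)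
  thus thesis using 3 that[of "{}"] by (simp add: eigen_poly_def zero_fun_def)
 qed
qed

text \<open>For the identity element equivariance is no condition, so the sphere itself is the case
  of the trivial group.\<close>

lemma homogeneous_equivariant_one: "homogeneous m P ==> P \<in> equivariant_poly c clifford_one m"
 by (simp add: equivariant_poly_def spin_cover_one)

text \<open>Two Fischer steps write P as H + x H' + x x Q' with monogenic H and H'. On the unit
  sphere the double multiplication by x is the identity, so Q' has the degree of P lowered by two
  and the induction hypothesis applies.\<close>

lemma sphere_ip_eigen_poly:
 fixes c :: "'n::{finite,wellorder} => complex ^ 'k ^ 'k"
 assumes c: "clifford_relations c" and n: "CARD('n) \<ge> 2" and f: "cts_sphere f"
  and z: "\<And>z Q. Q \<in> eigen_poly c clifford_one z ==> sphere_ip c f Q = 0" and P: "homogeneous m P"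
 shows "sphere_ip c f P = 0"
 using P
proof (induction m arbitrary: P rule: less_induct)
 case (less m)
 note c' = clifford_relations_neg[OF c]
 have mono: "sphere_ip c f H = 0" if "H \<in> monogenic c clifford_one k" for H k
  using z[of H "int k"] that by (simp add: eigen_poly_def)
 have xmono: "sphere_ip c f (xslash (neg_module c) H) = 0" if "H \<in> monogenic (neg_module c) clifford_one k" for H k
  using z[of "xslash (neg_module c) H" "1 - int CARD('n) - int k"] that n by (simp add: eigen_poly_def)
 show ?case
 proof (cases m)
  case 0
  hence "homogeneous 0 P" using less.prems by simp
  hence "P \<in> monogenic c clifford_one 0" unfolding monogenic_0 by (rule homogeneous_equivariant_one)
  thus ?thesis by (rule mono)
 next
  case (Suc k)
  hence "P \<in> equivariant_poly c clifford_one (Suc k)" using less.prems by (simp add: homogeneous_equivariant_one)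
  then obtain H Q where HQ: "H \<in> monogenic c clifford_one (Suc k)" "Q \<in> equivariant_poly (neg_module c) clifford_one k"
   "P = H + xslash (neg_module c) Q"
   by (rule fischer_decomposition[OF c n spin_group_one])
  have hQ: "homogeneous k Q" using HQ(2) by (simp add: equivariant_poly_def)
  have Q0: "sphere_ip c f (xslash (neg_module c) Q) = 0"
  proof (cases k)
   case 0
   thus ?thesis using HQ(2) xmono[of Q 0] by (simp add: monogenic_0)
  next
   case k: (Suc j)
   obtain H' Q' where HQ': "H' \<in> monogenic (neg_module c) clifford_one (Suc j)"
    "Q' \<in> equivariant_poly (neg_module (neg_module c)) clifford_one j" "Q = H' + xslash (neg_module (neg_module c)) Q'"
    by (rule fischer_decomposition[OF c' n spin_group_one HQ(2)[unfolded k]])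
   have hQ': "homogeneous j Q'" using HQ'(2) by (simp add: equivariant_poly_def)
   have "xslash (neg_module c) Q x = xslash (neg_module c) H' x + Q' x" if x: "norm x = 1" for x
   proof -
    have "slash (neg_module c) x *v (slash c x *v Q' x) = Q' x"
     using slash_slash_self[OF c, of x] x by (simp add: matrix_vector_mul_assoc dot_square_norm)
    thus ?thesis by (simp add: HQ'(3) xslash_def mvec.add_right)
   qed
   hence "sphere_ip c f (xslash (neg_module c) Q) = sphere_ip c f (\<lambda>x. xslash (neg_module c) H' x + Q' x)"
    by (intro sphere_ip_cong refl)
   also have "\<dots> = sphere_ip c f (xslash (neg_module c) H') + sphere_ip c f Q'"
    by (rule sphere_ip_add_right[OF homogeneous_continuous[OF homogeneous_xslash[OF monogenic_D(1)[OF HQ'(1)]]]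
       homogeneous_continuous[OF hQ'] f])
   also have "\<dots> = 0" using xmono[OF HQ'(1)] less.IH[OF _ hQ'] Suc k by simp
   finally show ?thesis .
  qed
  have "sphere_ip c f P = sphere_ip c f (\<lambda>x. H x + xslash (neg_module c) Q x)" by (simp add: HQ(3) plus_fun_def)
  also have "\<dots> = sphere_ip c f H + sphere_ip c f (xslash (neg_module c) Q)"
   by (rule sphere_ip_add_right[OF homogeneous_continuous[OF monogenic_D(1)[OF HQ(1)]]
      homogeneous_continuous[OF homogeneous_xslash[OF hQ]] f])
  finally show ?thesis using Q0 mono[OF HQ(1)] by simp
 qed
qed

text \<open>Eigenfunctions of a symmetric operator for different eigenvalues are orthogonal; the
  eigenvalue of Q is an integer, so conjugation does not change it.\<close>

lemma sphere_ip_eigenvalues: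
 fixes c :: "'n::{finite,wellorder} => complex ^ 'k ^ 'k"
 assumes c: "clifford_relations c" and f: "rotC1 f f'" and e: "\<And>x. norm x = 1 ==> sphere_dirac c f' x = \<kappa> *s f x"
  and Q: "Q \<in> eigen_poly c a z" and ne: "\<kappa> \<noteq> of_int z"
 shows "sphere_ip c f Q = 0"
proof -
 obtain m where m: "homogeneous m Q" using eigen_poly_homogeneous[OF Q] by blast
 have "\<kappa> * sphere_ip c f Q = sphere_ip c (\<lambda>x. \<kappa> *s f x) Q" by (simp add: sphere_ip_smult_left)
 also have "\<dots> = sphere_ip c (sphere_dirac c f') Q" by (rule sphere_ip_cong) (simp_all add: e)
 also have "\<dots> = sphere_ip c f (sphere_dirac c (poly_rotation Q))" by (rule sphere_dirac_symmetric[OF c f rotC1_poly[OF m]])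
 also have "\<dots> = sphere_ip c f (\<lambda>x. of_int z *s Q x)"
  by (rule sphere_ip_cong) (simp_all add: eigen_poly_dirac[OF c Q] scaleR_smult)
 also have "\<dots> = of_int z * sphere_ip c f Q" by (simp add: sphere_ip_smult_right)
 finally show ?thesis using ne by simp
qed

text \<open>A \<kappa> that is not an integer would make f orthogonal to all polynomial
  eigenspinors, hence zero. For an integer, f minus its projection to the polynomial eigenspinors
  for \<kappa> is again an eigenfunction, now orthogonal to all of them, and therefore zero.\<close>

theorem sphere_dirac_complete:
 fixes c :: "'n::{finite,wellorder} => complex ^ 'k ^ 'k"
 assumes c: "clifford_relations c" and n: "CARD('n) \<ge> 2" and f: "rotC1 f f'"
  and e: "\<And>x. norm x = 1 ==> sphere_dirac c f' x = \<kappa> *s f x" and nz: "norm y = 1" "f y \<noteq> 0"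
 obtains z P where "\<kappa> = of_int z" "P \<in> eigen_poly c clifford_one z" "\<And>x. norm x = 1 ==> f x = P x"
proof -
 have zero: "h x = 0" if "rotC1 h h'" "\<And>z Q. Q \<in> eigen_poly c clifford_one z ==> sphere_ip c h Q = 0" "norm x = 1" for h h' x
  using sphere_dense[OF rotC1_D(1)[OF that(1)] sphere_ip_eigen_poly[OF c n rotC1_D(1)[OF that(1)] that(2)] that(3)] .
 have "\<exists>z. \<kappa> = of_int z"
 proof (rule ccontr)
  assume "\<nexists>z. \<kappa> = of_int z"
  hence "sphere_ip c f Q = 0" if "Q \<in> eigen_poly c clifford_one z" for z Q
   using sphere_ip_eigenvalues[OF c f e that] by blast
  thus False using zero[OF f _ nz(1)] nz(2) by blast
 qed
 then obtain z where z: "\<kappa> = of_int z" by blast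
 obtain B where B: "finite B" "complex_fun.span B = eigen_poly c clifford_one z" using eigen_poly_basis[OF c] by metis
 have cB: "cts_sphere b" if "b \<in> B" for b
 proof -
  have "b \<in> eigen_poly c clifford_one z" using complex_fun.span_base[OF that] B(2) by simp
  thus ?thesis using eigen_poly_homogeneous homogeneous_continuous by blast
 qed
 obtain P where P: "P \<in> complex_fun.span B" "\<forall>b\<in>B. sphere_ip c (\<lambda>x. f x - P x) b = 0"
  using sphere_projection[OF B(1) cB rotC1_D(1)[OF f], of c] by blast
 have P': "P \<in> eigen_poly c clifford_one z" using P(1) B(2) by simp
 obtain m where m: "homogeneous m P" using eigen_poly_homogeneous[OF P'] by blast
 define h where "h x = f x - P x" for x
 define h' where "h' k l x = f' k l x - poly_rotation P k l x" for k l x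
 have h: "rotC1 h h'"
  using rotC1_add[OF f rotC1_compose_linear[OF bounded_linear_minus[OF bounded_linear_ident] rotC1_poly[OF m]]]
  by (simp add: h_def[abs_def] h'_def[abs_def])
 have eh: "sphere_dirac c h' x = \<kappa> *s h x" if x: "norm x = 1" for x
 proof -
  have "sphere_grad h' l x = sphere_grad f' l x - sphere_grad (poly_rotation P) l x" for l
   by (simp add: sphere_grad_def h'_def scaleR_diff_right sum_subtractf)
  hence "sphere_dirac c h' x = sphere_dirac c f' x - sphere_dirac c (poly_rotation P) x"
   by (simp add: sphere_dirac_def mvec.diff_right sum_subtractf)
  thus ?thesis by (simp add: e[OF x] eigen_poly_dirac[OF c P' x] z h_def scaleR_smult vector_ssub_ldistrib)
 qed
 have "sphere_ip c h Q = 0" if Q: "Q \<in> eigen_poly c clifford_one w" for w Q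
 proof (cases "w = z")
  case True
  hence QB: "Q \<in> complex_fun.span B" using Q B(2) by simp
  have hB: "sphere_ip c h b = 0" if "b \<in> B" for b
   using P(2) that unfolding h_def[abs_def] by blast
  show ?thesis by (rule sphere_ip_span[OF cB rotC1_D(1)[OF h] hB QB])
 next
  case False
  hence ne: "\<kappa> \<noteq> of_int w" using z by simp
  show ?thesis by (rule sphere_ip_eigenvalues[OF c h _ Q ne]) (rule eh)
 qed
 note orth = this
 have "h x = 0" if "norm x = 1" for x by (rule zero[OF h _ that]) (rule orth)
 hence "f x = P x" if "norm x = 1" for x using that by (simp add: h_def)
 with z P' that show thesis by blast
qed

section \<open>Spinor fields on quotients of the sphere\<close>

definition base_point :: "'n::{finite,linorder} clifford => 'n rvector"
 where "base_point g = spin_cover g *v axis last_index 1"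

lemma base_point_norm: "g \<in> SpinG ==> norm (base_point g) = 1"
 unfolding base_point_def by (simp add: orthogonal_transformation_norm[OF spin_cover(2)] norm_axis_1)

lemma base_point_mult:
 "g \<in> SpinG ==> h \<in> SpinG ==> base_point (h \<star> g) = spin_cover h *v base_point g"
 by (simp add: base_point_def spin_cover_mult matrix_vector_mul_assoc)

lemma clifford_vec_base_point:
 assumes "g \<in> SpinG"
 shows "clifford_vec (base_point g) = g \<star> e_last \<star> clifford_reverse g"
 by (simp add: base_point_def spin_cover(1)[OF assms, symmetric] clifford_vec_axis)

text \<open>The product of two reflections that moves \<open>x\<close> to \<open>y\<close>, unless \<open>y = -x\<close>.\<close>
definition transvection :: "'n::{finite,linorder} rvector => 'n rvector => 'n clifford"
 where "transvection x y = clifford_vec ((y + x) /\<^sub>R norm (y + x)) \<star> clifford_vec x"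

lemma transvection:
 assumes x: "norm x = 1" and y: "norm y = 1" and ne: "y + x \<noteq> 0"
 shows "transvection x y \<in> SpinG" "spin_cover (transvection x y) *v x = y"
proof -
 let ?w = "(y + x) /\<^sub>R norm (y + x)"
 have w: "norm ?w = 1" using ne by simp
 show mem: "transvection x y \<in> SpinG"
  unfolding transvection_def by (rule spin_group_pair[OF w x]) simp_all
 have rev: "clifford_reverse (transvection x y) = clifford_vec x \<star> clifford_vec ?w"
  using clifford_reverse_vprod[of "[?w, x]"] by (simp add: transvection_def)
 have xx: "clifford_vec x \<star> clifford_vec x = - clifford_one" by (rule clifford_vec_unit_square[OF x])
 have "clifford_vec (spin_cover (transvection x y) *v x)
   = clifford_vec ?w \<star> ((clifford_vec x \<star> clifford_vec x) \<star> (clifford_vec x \<star> clifford_vec ?w))"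
  unfolding spin_cover(1)[OF mem, symmetric] rev by (simp add: transvection_def clifford_assoc)
 also have "\<dots> = - (clifford_vec ?w \<star> clifford_vec x \<star> clifford_vec ?w)"
  unfolding xx by (simp add: clifford.minus_left clifford.minus_right clifford_assoc)
 also have "\<dots> = clifford_vec ((2 * (?w \<bullet> x)) *\<^sub>R ?w - x)"
  unfolding clifford_vec_reflection[OF w] clifford_vec_minus[symmetric] by simp
 also have "(2 * (?w \<bullet> x)) *\<^sub>R ?w - x = y"
 proof -
  have n: "(norm (y + x))\<^sup>2 = 2 * ((y + x) \<bullet> x)"
   using x y by (simp add: power2_norm_eq_inner inner_add_left inner_add_right inner_commute norm_eq_1)
  have nz: "norm (y + x) \<noteq> 0" using ne by simp
  have "2 * (?w \<bullet> x) = inverse (norm (y + x)) * (norm (y + x))\<^sup>2"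
   unfolding inner_scaleR_left n by simp
  also have "\<dots> = norm (y + x)" using nz by (simp add: power2_eq_square)
  finally have "(2 * (?w \<bullet> x)) *\<^sub>R ?w = (norm (y + x) * inverse (norm (y + x))) *\<^sub>R (y + x)" by simp
  also have "\<dots> = y + x" unfolding right_inverse[OF nz] by simp
  finally show ?thesis by simp
 qed
 finally show "spin_cover (transvection x y) *v x = y" by (simp add: clifford_vec_inject)
qed

text \<open>Transvections reach every point except the antipode of the base point, and a half turn
  reaches that one.\<close>

lemma base_point_surj:
 fixes x :: "'n::{finite,linorder} rvector"
 assumes n: "CARD('n) \<ge> 2" and x: "norm x = 1"
 shows "\<exists>g\<in>SpinG. base_point g = x"
proof (cases "x + axis last_index 1 = 0")
 case False
 thus ?thesis
  using transvection[OF norm_axis_1 x False] unfolding base_point_def by blast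
next
 case True
 have "\<exists>k :: 'n. k \<noteq> last_index"
 proof (rule ccontr)
  assume "\<nexists>k :: 'n. k \<noteq> last_index"
  hence "(UNIV :: 'n set) = {last_index}" by auto
  hence "CARD('n) = 1" by (metis card.empty card.insert empty_iff finite.emptyI One_nat_def)
  thus False using n by simp
 qed
 then obtain k :: 'n where k: "last_index \<noteq> k" by metis
 have "base_point (plane_spin last_index k pi) = - axis last_index 1"
  unfolding base_point_def spin_cover_plane_spin[OF k]
  using k by (simp add: plane_rotation_def axis_component vec_eq_iff)
 moreover have "x = - axis last_index 1" using True by (simp add: eq_neg_iff_add_eq_0)
 ultimately show ?thesis using plane_spin_UNIV[OF k] by metis
qed

text \<open>Two frames over one point differ by an element of the stabilizer, and on the stabilizer
  \<open>rho\<close> extends the action in the equivariance of f. So \<open>rho c g *v f g\<close>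
  depends only on the base point; this is the trivialisation by constant spinors.\<close>

lemma spinor_descends:
 assumes c: "clifford_relations c" and n: "CARD('n::{finite,linorder}) \<ge> 2"
  and f: "\<And>g h. g \<in> SpinG ==> h \<in> spin_group {v :: 'n rvector. v $ last_index = 0} ==> clifford_action c h *v f (g \<star> h) = f g"
  and g: "g \<in> SpinG" "g' \<in> SpinG" "base_point g = base_point g'"
 shows "rho c g *v f g = rho c g' *v f g'"
proof -
 define h where "h = clifford_reverse g \<star> g'"
 have r: "clifford_reverse g \<in> SpinG" by (rule spin_group_reverse[OF g(1)])
 have h: "h \<in> SpinG" unfolding h_def by (rule spin_group_mult[OF r g(2)])
 have gh: "g \<star> h = g'" by (simp add: h_def clifford_assoc[symmetric] spin_group_inverse(1)[OF g(1)])
 have "spin_cover h *v axis last_index 1 = spin_cover (clifford_reverse g) *v base_point g"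
  unfolding h_def spin_cover_mult[OF r g(2)] g(3) by (simp add: base_point_def matrix_vector_mul_assoc)
 also have "\<dots> = spin_cover (clifford_reverse g \<star> g) *v axis last_index 1"
  by (simp add: spin_cover_mult[OF r g(1)] base_point_def matrix_vector_mul_assoc)
 also have "\<dots> = axis last_index 1" by (simp add: spin_group_inverse(2)[OF g(1)] spin_cover_one)
 finally have h': "h \<in> spin_group {v. v $ last_index = 0}" by (rule spin_group_stabilizer[OF h _ n])
 have "f g = rho c h *v f g'" using f[OF g(1) h'] by (simp add: clifford_action_spin[OF h'] gh)
 hence "rho c g *v f g = rho c (g \<star> h) *v f g'"
  by (simp add: rho_mult[OF c even_clifford_spin[OF g(1)] even_clifford_spin[OF h]] matrix_vector_mul_assoc)
 thus ?thesis by (simp only: gh)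
qed

text \<open>Smoothness on a subset means local extension; along a curve inside the subset the
  derivative can be computed from any extension H.\<close>

lemma smooth_along_curve:
 fixes q :: "real => 'a::real_normed_vector"
 assumes U: "open U" "smooth_on_open H U" "\<And>y. y \<in> U ==> y \<in> S ==> H y = f y"
  and q: "q 0 \<in> U" "\<And>t. q t \<in> S" "continuous_on UNIV q" "(q has_vector_derivative q') (at 0)"
 shows "((\<lambda>t. f (q t)) has_vector_derivative frechet_derivative H (at (q 0)) q') (at 0)"
proof (rule has_vector_derivative_transform_within_open[of "\<lambda>t. H (q t)" _ _ "q -` U"])
 have D: "(H has_derivative frechet_derivative H (at (q 0))) (at (q 0))"
  by (rule smooth_on_open_has_derivative[OF U(2) q(1)])
 have "((\<lambda>t. H (q t)) has_derivative (\<lambda>h. frechet_derivative H (at (q 0)) (h *\<^sub>R q'))) (at 0)"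
  by (rule has_derivative_compose[OF q(4)[unfolded has_vector_derivative_def] D])
 thus "((\<lambda>t. H (q t)) has_vector_derivative frechet_derivative H (at (q 0)) q') (at 0)"
  unfolding has_vector_derivative_def by (simp add: linear_cmul[OF has_derivative_linear[OF D]])
 show "open (q -` U)" by (rule open_vimage[OF U(1) q(3)])
qed (use q U in auto)

lemma plane_spin_derivative:
 "((\<lambda>t. plane_spin k l t) has_vector_derivative (1 / 2) *\<^sub>R (egen k \<star> egen l)) (at 0)"
 unfolding plane_spin_def has_vector_derivative_def by (auto intro!: derivative_eq_intros)

lemma plane_spin_continuous: "continuous_on S (plane_spin k l)"
 unfolding plane_spin_def[abs_def] by (intro continuous_intros) simp_all

lemma plane_spin_0 [simp]: "plane_spin k l 0 = clifford_one"
 by (simp add: plane_spin_def)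

text \<open>The curve of left multiples of g by \<open>plane_spin k l t\<close> lies over the
  rotated base point, so the product rule for \<open>rho c q *v f q\<close> along it gives the
  derivative of F.\<close>

lemma spinor_rotation_derivative:
 fixes c :: "'n::{finite,linorder} => complex ^ 'k ^ 'k"
 assumes F: "\<And>g. g \<in> SpinG ==> F (base_point g) = rho c g *v f g"
  and U: "open U" "smooth_on_open H U" "\<And>y. y \<in> U ==> y \<in> SpinG ==> H y = f y"
  and g: "g \<in> SpinG" "g \<in> U" and kl: "k \<noteq> l"
 shows "((\<lambda>t. F (plane_rotation k l t (base_point g))) has_vector_derivative
   rho c g *v frechet_derivative H (at g) (((1 / 2) *\<^sub>R (egen k \<star> egen l)) \<star> g)
   + rho c (((1 / 2) *\<^sub>R (egen k \<star> egen l)) \<star> g) *v f g) (at 0)"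
proof -
 let ?q = "\<lambda>t. plane_spin k l t \<star> g" and ?e = "((1 / 2) *\<^sub>R (egen k \<star> egen l)) \<star> g"
 have mem: "?q t \<in> SpinG" for t by (rule spin_group_mult[OF plane_spin_UNIV[OF kl] g(1)])
 have q': "(?q has_vector_derivative ?e) (at 0)"
  by (rule bounded_linear.has_vector_derivative[OF clifford.bounded_linear_left plane_spin_derivative])
 have cq: "continuous_on UNIV ?q"
  by (rule clifford.continuous_on[OF plane_spin_continuous continuous_on_const])
 have f': "((\<lambda>t. f (?q t)) has_vector_derivative frechet_derivative H (at g) ?e) (at 0)"
 proof -
  have "((\<lambda>t. f (?q t)) has_vector_derivative frechet_derivative H (at (?q 0)) ?e) (at 0)"
  proof (rule smooth_along_curve[OF U(1,2), where S = "SpinG"])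
   show "H y = f y" if "y \<in> U" "y \<in> SpinG" for y by (rule U(3)[OF that])
   show "?q 0 \<in> U" using g(2) by simp
  qed (rule mem cq q')+
  thus ?thesis by simp
 qed
 have r': "((\<lambda>t. rho c (?q t)) has_vector_derivative rho c ?e) (at 0)"
  by (rule bounded_linear.has_vector_derivative[OF linear_conv_bounded_linear[THEN iffD1, OF linear_rho] q'])
 have "F (plane_rotation k l t (base_point g)) = rho c (?q t) *v f (?q t)" for t
  unfolding F[OF mem, symmetric] base_point_mult[OF g(1) plane_spin_UNIV[OF kl]] spin_cover_plane_spin[OF kl] ..
 thus ?thesis using mvec.has_vector_derivative[OF r' f'] by simp
qed

lemma continuous_on_local:
 fixes f :: "'a::t2_space => 'b::topological_space"
 assumes "\<And>x. x \<in> S ==> \<exists>T. open T \<and> x \<in> T \<and> continuous_on (S \<inter> T) f"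
 shows "continuous_on S f"
 unfolding continuous_on_eq_continuous_within
proof
 fix x assume x: "x \<in> S"
 then obtain T where T: "open T" "x \<in> T" "continuous_on (S \<inter> T) f" using assms by blast
 have "at x within S = at x within (S \<inter> T)"
  by (rule at_within_nhd[OF T(2,1)]) blast
 thus "continuous (at x within S) f"
  using T(3) x T(2) unfolding continuous_on_eq_continuous_within by simp
qed

text \<open>Near a given point, transvections form a continuous local section of the frame bundle.
  Along it, F and its rotation derivatives are expressed by an extension of f and its first
  derivatives, which are continuous.\<close>

lemma spinor_rotC1:
 fixes c :: "'n::{finite,wellorder} => complex ^ 'k ^ 'k"
 assumes n: "CARD('n) \<ge> 2" and f: "smooth_on_subset f SpinG"
  and F: "\<And>g. g \<in> SpinG ==> F (base_point g) = rho c g *v f g"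
 shows "\<exists>F'. rotC1 F F'"
proof -
 define F' where "F' k l x = vector_derivative (\<lambda>t. F (plane_rotation k l t x)) (at 0)" for k l x
 let ?ee = "\<lambda>k l. (1 / 2) *\<^sub>R (egen k \<star> egen l) :: 'n clifford"
 have loc: "\<exists>T. open T \<and> x0 \<in> T \<and> continuous_on (sphere 0 1 \<inter> T) F \<and> (\<forall>k l. k \<noteq> l \<longrightarrow> continuous_on (sphere 0 1 \<inter> T) (F' k l)
   \<and> ((\<lambda>t. F (plane_rotation k l t x0)) has_vector_derivative F' k l x0) (at 0))"
  if x0: "norm x0 = 1" for x0
 proof -
  obtain g0 where g0: "g0 \<in> SpinG" "base_point g0 = x0" using base_point_surj[OF n x0] by blast
  define s where "s x = transvection x0 x \<star> g0" for x
  \<comment> \<open>The complement of the antipode of \<open>x0\<close>, where transvections from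
    \<open>x0\<close> depend continuously on their target.\<close>
  define O0 where "O0 = {x. x + x0 \<noteq> 0}"
  have xO: "x0 \<in> O0"
  proof -
   have "x0 + x0 = 2 *\<^sub>R x0" by (simp add: scaleR_2)
   thus ?thesis using x0 by (auto simp: O0_def)
  qed
  have oO: "open O0" unfolding O0_def by (rule open_Collect_neq) (intro continuous_intros)+
  have s: "s x \<in> SpinG" "base_point (s x) = x" if "norm x = 1" "x \<in> O0" for x
  proof -
   have t: "transvection x0 x \<in> SpinG" "spin_cover (transvection x0 x) *v x0 = x"
    using that by (auto simp: O0_def intro!: transvection[OF x0])
   show "s x \<in> SpinG" unfolding s_def by (rule spin_group_mult[OF t(1) g0(1)])
   show "base_point (s x) = x" unfolding s_def base_point_mult[OF g0(1) t(1)] g0(2) by (rule t(2))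
  qed
  have cs: "continuous_on O0 s"
  proof -
   have "continuous_on O0 (\<lambda>x. (x + x0) /\<^sub>R norm (x + x0))"
    by (intro continuous_intros) (auto simp: O0_def)
   hence "continuous_on O0 (\<lambda>x. clifford_vec ((x + x0) /\<^sub>R norm (x + x0)))"
    by (rule bounded_linear.continuous_on[OF linear_conv_bounded_linear[THEN iffD1, OF linear_clifford_vec]])
   thus ?thesis unfolding s_def[abs_def] transvection_def
    by (intro clifford.continuous_on continuous_on_const)
  qed
  have "s x0 \<in> SpinG" using s(1)[OF x0 xO] .
  then obtain U H where U: "open U" "s x0 \<in> U" "smooth_on_open H U" and Hf: "\<forall>y\<in>U \<inter> SpinG. H y = f y"
   using f unfolding smooth_on_subset_def by blast
  have Hf': "H y = f y" if "y \<in> U" "y \<in> SpinG" for y using Hf that by blast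
  define T where "T = O0 \<inter> s -` U"
  have T: "open T" unfolding T_def by (rule continuous_open_preimage[OF cs oO U(1)])
  have xT: "x0 \<in> T" using xO U(2) by (simp add: T_def)
  have cs': "continuous_on (sphere 0 1 \<inter> T) s" by (rule continuous_on_subset[OF cs]) (auto simp: T_def)
  have sU: "s ` (sphere 0 1 \<inter> T) \<subseteq> U" by (auto simp: T_def)
  have cH: "continuous_on (sphere 0 1 \<inter> T) (\<lambda>x. H (s x))"
   by (rule continuous_on_compose2[OF smooth_on_open_continuous[OF U(3)] cs' sU])
  have cr: "continuous_on (sphere 0 1 \<inter> T) (\<lambda>x. rho c (u x))" if "continuous_on (sphere 0 1 \<inter> T) u" for u
   by (rule bounded_linear.continuous_on[OF linear_conv_bounded_linear[THEN iffD1, OF linear_rho] that])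
  have sT: "s x \<in> SpinG" "base_point (s x) = x" "s x \<in> U" if "x \<in> sphere 0 1 \<inter> T" for x
   using s[of x] that by (auto simp: T_def)
  have FT: "rho c (s x) *v H (s x) = F x" if "x \<in> sphere 0 1 \<inter> T" for x
   using F[OF sT(1)[OF that]] Hf'[OF sT(3)[OF that] sT(1)[OF that]] by (simp only: sT(2)[OF that])
  have cFT: "continuous_on (sphere 0 1 \<inter> T) F"
   by (rule continuous_on_eq[OF mvec.continuous_on[OF cr[OF cs'] cH] FT])
  have p: "continuous_on (sphere 0 1 \<inter> T) (F' k l)
   \<and> ((\<lambda>t. F (plane_rotation k l t x0)) has_vector_derivative F' k l x0) (at 0)" if kl: "k \<noteq> l" for k l
  proof -
   let ?G = "\<lambda>x. rho c (s x) *v frechet_derivative H (at (s x)) (?ee k l \<star> s x) + rho c (?ee k l \<star> s x) *v H (s x)"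
   have D: "((\<lambda>t. F (plane_rotation k l t x)) has_vector_derivative ?G x) (at 0)" if x: "x \<in> sphere 0 1 \<inter> T" for x
   proof -
    have "((\<lambda>t. F (plane_rotation k l t (base_point (s x)))) has_vector_derivative
      rho c (s x) *v frechet_derivative H (at (s x)) (?ee k l \<star> s x) + rho c (?ee k l \<star> s x) *v f (s x)) (at 0)"
     by (rule spinor_rotation_derivative[OF _ U(1,3) _ sT(1)[OF x] sT(3)[OF x] kl]) (simp_all only: F Hf')
    thus ?thesis unfolding sT(2)[OF x] Hf'[OF sT(3)[OF x] sT(1)[OF x]] .
   qed
   have e: "?G x = F' k l x" if "x \<in> sphere 0 1 \<inter> T" for x
    using vector_derivative_at[OF D[OF that]] unfolding F'_def by (rule sym)
   have ces: "continuous_on (sphere 0 1 \<inter> T) (\<lambda>x. ?ee k l \<star> s x)"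
    by (intro clifford.continuous_on continuous_on_const cs')
   have "continuous_on (sphere 0 1 \<inter> T) ?G"
    by (intro continuous_on_add mvec.continuous_on cr cs' ces cH continuous_on_derivative_apply[OF U(3) cs' sU ces])
   hence "continuous_on (sphere 0 1 \<inter> T) (F' k l)" by (rule continuous_on_eq) (rule e)
   moreover have "x0 \<in> sphere 0 1 \<inter> T" using x0 xT by simp
   ultimately show ?thesis using D[of x0] e[of x0] by simp
  qed
  show ?thesis
  proof (intro exI[of _ T] conjI allI impI)
   fix k l :: 'n assume kl: "k \<noteq> l"
   show "continuous_on (sphere 0 1 \<inter> T) (F' k l)" by (rule p[OF kl, THEN conjunct1])
   show "((\<lambda>t. F (plane_rotation k l t x0)) has_vector_derivative F' k l x0) (at 0)" by (rule p[OF kl, THEN conjunct2])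
  qed (rule T xT cFT)+
 qed
 have "rotC1 F F'"
  unfolding rotC1_def
 proof (intro conjI allI impI)
  show "cts_sphere F"
  proof (rule continuous_on_local)
   fix x :: "'n rvector" assume "x \<in> sphere 0 1"
   hence nx: "norm x = 1" by simp
   obtain T where T: "open T" "x \<in> T" "continuous_on (sphere 0 1 \<inter> T) F" using loc[OF nx] by (elim exE conjE) (rule that)
   thus "\<exists>T. open T \<and> x \<in> T \<and> continuous_on (sphere 0 1 \<inter> T) F" by (intro exI[of _ T] conjI)
  qed
  fix k l :: 'n assume kl: "k \<noteq> l"
  have lk: "\<exists>T. open T \<and> x \<in> T \<and> continuous_on (sphere 0 1 \<inter> T) (F' k l) \<and> ((\<lambda>t. F (plane_rotation k l t x)) has_vector_derivative F' k l x) (at 0)"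
   if nx: "norm x = 1" for x
  proof -
   obtain T where T: "open T" "x \<in> T" and all: "\<forall>k l. k \<noteq> l \<longrightarrow> continuous_on (sphere 0 1 \<inter> T) (F' k l)
    \<and> ((\<lambda>t. F (plane_rotation k l t x)) has_vector_derivative F' k l x) (at 0)"
    using loc[OF nx] by (elim exE conjE) (rule that)
   show ?thesis using T all[rule_format, OF kl] by (intro exI[of _ T] conjI) simp_all
  qed
  show "cts_sphere (F' k l)"
  proof (rule continuous_on_local)
   fix x :: "'n rvector" assume "x \<in> sphere 0 1"
   hence nx: "norm x = 1" by simp
   show "\<exists>T. open T \<and> x \<in> T \<and> continuous_on (sphere 0 1 \<inter> T) (F' k l)"
    using lk[OF nx] by (elim exE conjE) (intro exI conjI)
  qed
  show "((\<lambda>t. F (plane_rotation k l t x)) has_vector_derivative F' k l x) (at 0)" if "norm x = 1" for x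
   using lk[OF that] by (elim exE conjE)
 qed
 thus ?thesis by blast
qed

text \<open>The diagonal terms add up to minus the inner product, which is zero, so that only
  infinitesimal rotations remain.\<close>

lemma clifford_vec_mult_expand:
 assumes "x \<bullet> v = 0"
 shows "clifford_vec x \<star> clifford_vec v = (\<Sum>l\<in>UNIV. \<Sum>k\<in>UNIV - {l}. (x $ k * v $ l) *\<^sub>R (egen k \<star> egen l))"
proof -
 let ?ee = "\<lambda>k l. egen k \<star> egen l :: 'a clifford"
 have "clifford_vec x = (\<Sum>k\<in>UNIV. x $ k *\<^sub>R egen k)"
  and "clifford_vec v = (\<Sum>l\<in>UNIV. v $ l *\<^sub>R egen l)"
  by (simp_all only: clifford_vec_axis) (simp_all only: clifford_vec_def)
 hence "clifford_vec x \<star> clifford_vec v = (\<Sum>l\<in>UNIV. \<Sum>k\<in>UNIV. (x $ k * v $ l) *\<^sub>R ?ee k l)"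
  by (simp add: clifford.sum_left clifford.sum_right clifford.scaleR_left clifford.scaleR_right scaleR_sum_right mult.commute)
 also have "\<dots> = (\<Sum>l\<in>UNIV. (x $ l * v $ l) *\<^sub>R ?ee l l + (\<Sum>k\<in>UNIV - {l}. (x $ k * v $ l) *\<^sub>R ?ee k l))"
  by (intro sum.cong refl sum.remove) simp_all
 also have "\<dots> = (\<Sum>l\<in>UNIV. (x $ l * v $ l) *\<^sub>R ?ee l l) + (\<Sum>l\<in>UNIV. \<Sum>k\<in>UNIV - {l}. (x $ k * v $ l) *\<^sub>R ?ee k l)"
  by (rule sum.distrib)
 also have "(\<Sum>l\<in>UNIV. (x $ l * v $ l) *\<^sub>R ?ee l l) = - (x \<bullet> v) *\<^sub>R clifford_one"
  by (simp add: clifford_vec_unit_square norm_axis_1 inner_vec_def scaleR_sum_left sum_negf)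
 finally show ?thesis by (simp add: assms)
qed

text \<open>A horizontal motion of the frame on the right is an infinitesimal rotation on the left.
  So a covariant derivative becomes a tangential derivative of F, corrected by half the action of a
  bivector. Clifford multiplication squares that bivector to -1, and each of the N - 1 tangent
  directions contributes 1 / 2.\<close>

theorem dirac_operator_sphere:
 fixes c :: "'n::{finite,wellorder} => complex ^ 'k ^ 'k"
 assumes c: "clifford_relations c" and f: "smooth_on_subset f SpinG" and F': "rotC1 F F'"
  and F: "\<And>g. g \<in> SpinG ==> F (base_point g) = rho c g *v f g" and g: "g \<in> SpinG"
 shows "rho c g *v dirac_operator c f g
  = sphere_dirac c F' (base_point g) + ((real CARD('n) - 1) / 2) *\<^sub>R F (base_point g)"
proof -
 let ?ee = "\<lambda>k l. egen k \<star> egen l :: 'n clifford"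
 define x where "x = base_point g"
 define v where "v i = spin_cover g *v axis i 1" for i
 have nx: "norm x = 1" unfolding x_def by (rule base_point_norm[OF g])
 note ev = even_clifford_spin[OF g]
 obtain U H where U: "open U" "g \<in> U" "smooth_on_open H U" and Hf: "\<forall>y\<in>U \<inter> SpinG. H y = f y"
  using f g unfolding smooth_on_subset_def by blast
 have Hf': "H y = f y" if "y \<in> U" "y \<in> SpinG" for y using Hf that by blast
 let ?D = "frechet_derivative H (at g)"
 have linD: "linear ?D" by (rule has_derivative_linear[OF smooth_on_open_has_derivative[OF U(3,2)]])
 have orth: "v i \<bullet> v j = (if i = j then 1 else 0)" for i j
  using orthogonal_transformation_def[of "(*v) (spin_cover g)"] spin_cover(2)[OF g] by (simp add: v_def inner_axis_axis)
 have xv: "x \<bullet> v i = 0" if "i \<noteq> last_index" for i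
  using orth[of last_index i] that by (simp add: x_def v_def base_point_def)
 have rot: "rho c g *v ?D ((1 / 2) *\<^sub>R ?ee k l \<star> g) = F' k l x - (1 / 2) *\<^sub>R (rho c (?ee k l) *v F x)" if kl: "k \<noteq> l" for k l
 proof -
  have "((\<lambda>t. F (plane_rotation k l t x)) has_vector_derivative
    rho c g *v ?D ((1 / 2) *\<^sub>R ?ee k l \<star> g) + rho c ((1 / 2) *\<^sub>R ?ee k l \<star> g) *v f g) (at 0)"
   unfolding x_def by (rule spinor_rotation_derivative[OF _ U(1,3) _ g U(2) kl]) (simp_all only: F Hf')
  hence "F' k l x = rho c g *v ?D ((1 / 2) *\<^sub>R ?ee k l \<star> g) + rho c ((1 / 2) *\<^sub>R ?ee k l \<star> g) *v f g"
   by (rule vector_derivative_unique_at[OF rotC1_D(3)[OF F' kl nx]])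
  moreover have "rho c ((1 / 2) *\<^sub>R ?ee k l \<star> g) *v f g = (1 / 2) *\<^sub>R (rho c (?ee k l) *v F x)"
   unfolding x_def F[OF g]
   by (simp add: clifford.scaleR_left rho_scaleR rho_mult[OF c even_clifford_vec_vec ev] mvec.scaleR_left
     matrix_vector_mul_assoc)
  ultimately show ?thesis by simp
 qed
 \<comment> \<open>Moving \<open>e\<^sub>N e\<^sub>i\<close> through g replaces the two vectors by
   their images under the frame, the base point x and the tangent vector \<open>v i\<close>.\<close>
 have lift: "g \<star> ?ee last_index i = clifford_vec x \<star> clifford_vec (v i) \<star> g" for i
 proof -
  have "clifford_vec x \<star> clifford_vec (v i) \<star> g
   = g \<star> egen last_index \<star> (clifford_reverse g \<star> g) \<star> egen i \<star> (clifford_reverse g \<star> g)"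
   unfolding x_def v_def base_point_def spin_cover(1)[OF g, symmetric] by (simp add: clifford_assoc)
  thus ?thesis by (simp add: spin_group_inverse(2)[OF g] clifford_assoc)
 qed
 have cov: "rho c g *v covariant_derivative i f g
   = (\<Sum>l\<in>UNIV. v i $ l *\<^sub>R sphere_grad F' l x) - (1 / 2) *\<^sub>R (rho c (clifford_vec x \<star> clifford_vec (v i)) *v F x)"
  if i: "i \<noteq> last_index" for i
 proof -
  let ?q = "\<lambda>t. g \<star> plane_spin last_index i t"
  note ne = not_sym[OF i]
  have "((\<lambda>t. f (?q t)) has_vector_derivative frechet_derivative H (at (?q 0)) (g \<star> (1 / 2) *\<^sub>R ?ee last_index i)) (at 0)"
  proof (rule smooth_along_curve[OF U(1,3), where S = "SpinG"])
   show "H y = f y" if "y \<in> U" "y \<in> SpinG" for y by (rule Hf'[OF that])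
   show "?q t \<in> SpinG" for t by (rule spin_group_mult[OF g plane_spin_UNIV[OF ne]])
   show "continuous_on UNIV ?q" by (intro clifford.continuous_on continuous_on_const plane_spin_continuous)
   show "(?q has_vector_derivative g \<star> (1 / 2) *\<^sub>R ?ee last_index i) (at 0)"
    by (rule bounded_linear.has_vector_derivative[OF clifford.bounded_linear_right plane_spin_derivative])
  qed (use U(2) in simp_all)
  moreover have "horizontal_step i t = plane_spin last_index i t" for t
   by (simp add: horizontal_step_def plane_spin_def)
  ultimately have "covariant_derivative i f g = ?D (g \<star> (1 / 2) *\<^sub>R ?ee last_index i)"
   unfolding covariant_derivative_def by (simp add: vector_derivative_at)
  also have "g \<star> (1 / 2) *\<^sub>R ?ee last_index i = (1 / 2) *\<^sub>R (clifford_vec x \<star> clifford_vec (v i)) \<star> g"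
   by (simp only: clifford.scaleR_right clifford.scaleR_left lift)
  also have "\<dots> = (\<Sum>l\<in>UNIV. \<Sum>k\<in>UNIV - {l}. (x $ k * v i $ l) *\<^sub>R ((1 / 2) *\<^sub>R ?ee k l \<star> g))"
   unfolding clifford_vec_mult_expand[OF xv[OF i]]
   by (simp add: scaleR_sum_right clifford.sum_left clifford.scaleR_left mult.commute)
  finally have "rho c g *v covariant_derivative i f g
    = (\<Sum>l\<in>UNIV. \<Sum>k\<in>UNIV - {l}. (x $ k * v i $ l) *\<^sub>R (rho c g *v ?D ((1 / 2) *\<^sub>R ?ee k l \<star> g)))"
   by (simp only: linear_sum[OF linD] linear_cmul[OF linD] mvec.sum_right mvec.scaleR_right)
  also have "\<dots> = (\<Sum>l\<in>UNIV. \<Sum>k\<in>UNIV - {l}. v i $ l *\<^sub>R (x $ k *\<^sub>R F' k l x)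
    - (1 / 2) *\<^sub>R ((x $ k * v i $ l) *\<^sub>R (rho c (?ee k l) *v F x)))"
  proof (intro sum.cong refl)
   fix l k :: 'n assume "k \<in> UNIV - {l}"
   hence kl: "k \<noteq> l" by simp
   show "(x $ k * v i $ l) *\<^sub>R (rho c g *v ?D ((1 / 2) *\<^sub>R ?ee k l \<star> g)) = v i $ l *\<^sub>R (x $ k *\<^sub>R F' k l x)
    - (1 / 2) *\<^sub>R ((x $ k * v i $ l) *\<^sub>R (rho c (?ee k l) *v F x))"
    unfolding rot[OF kl] by (simp add: scaleR_diff_right mult_ac)
  qed
  also have "\<dots> = (\<Sum>l\<in>UNIV. v i $ l *\<^sub>R sphere_grad F' l x)
    - (1 / 2) *\<^sub>R (\<Sum>l\<in>UNIV. \<Sum>k\<in>UNIV - {l}. (x $ k * v i $ l) *\<^sub>R (rho c (?ee k l) *v F x))"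
   by (simp only: sum_subtractf sphere_grad_def scaleR_sum_right)
  also have "(\<Sum>l\<in>UNIV. \<Sum>k\<in>UNIV - {l}. (x $ k * v i $ l) *\<^sub>R (rho c (?ee k l) *v F x))
    = rho c (clifford_vec x \<star> clifford_vec (v i)) *v F x"
   unfolding clifford_vec_mult_expand[OF xv[OF i]]
   by (simp only: rho_sum rho_scaleR mvec.sum_left mvec.scaleR_left)
  finally show ?thesis .
 qed
 have sq: "rho c (clifford_vec x \<star> clifford_vec (v i)) *v (rho c (clifford_vec x \<star> clifford_vec (v i)) *v u) = - u"
  if i: "i \<noteq> last_index" for i u
 proof -
  have anti: "clifford_vec (v i) \<star> clifford_vec x = - (clifford_vec x \<star> clifford_vec (v i))"
   using clifford_vec_anticommute[of "v i" x] xv[OF i] by (simp add: inner_commute eq_neg_iff_add_eq_0)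
  have nv: "norm (v i) = 1" using orth[of i i] by (simp add: norm_eq_1)
  have "(clifford_vec x \<star> clifford_vec (v i)) \<star> (clifford_vec x \<star> clifford_vec (v i))
   = clifford_vec x \<star> (clifford_vec (v i) \<star> clifford_vec x) \<star> clifford_vec (v i)" by (simp only: clifford_assoc)
  also have "\<dots> = - ((clifford_vec x \<star> clifford_vec x) \<star> (clifford_vec (v i) \<star> clifford_vec (v i)))"
   unfolding anti by (simp add: clifford.minus_left clifford.minus_right clifford_assoc)
  also have "\<dots> = - clifford_one" by (simp add: clifford_vec_unit_square nx nv clifford.minus_left)
  finally show ?thesis
   by (simp add: matrix_vector_mul_assoc rho_mult[OF c even_clifford_vec_vec even_clifford_vec_vec, symmetric]
     rho_minus mvec.minus_left)
 qed
 have ci: "rho c g *v (c i *v u) = rho c (clifford_vec x \<star> clifford_vec (v i)) *v (rho c g *v u)" if i: "i \<noteq> last_index" for i u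
 proof -
  have "rho c g ** c i = rho c (g \<star> ?ee last_index i)"
   unfolding rho_mult[OF c ev even_clifford_vec_vec] by (simp add: clifford_vec_axis[of last_index] rho_e_last_axis[OF i])
  also have "\<dots> = rho c (clifford_vec x \<star> clifford_vec (v i)) ** rho c g"
   unfolding lift by (rule rho_mult[OF c even_clifford_vec_vec ev])
  finally show ?thesis by (simp add: matrix_vector_mul_assoc)
 qed
 \<comment> \<open>Completeness of the orthonormal frame: without its last member, which is x, it
   yields the projection of a basis vector to the tangent space.\<close>
 have frame: "(\<Sum>i\<in>UNIV - {last_index}. v i $ l *\<^sub>R v i) = axis l 1 - x $ l *\<^sub>R x" for l
 proof -
  let ?R = "spin_cover g"
  have "orthogonal_matrix ?R"
   using spin_cover(2)[OF g] by (simp add: orthogonal_transformation_matrix matrix_of_matrix_vector_mul)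
  hence RR: "?R ** transpose ?R = mat 1" by (simp add: orthogonal_matrix_def)
  have vR: "v i $ m = ?R $ m $ i" for i m
   by (simp add: v_def matrix_vector_mult_basis column_def)
  have "(\<Sum>i\<in>UNIV. v i $ l *\<^sub>R v i) = axis l 1"
  proof (rule vec_eq_iff[THEN iffD2], rule allI)
   fix m
   have "(\<Sum>i\<in>UNIV. v i $ l *\<^sub>R v i) $ m = (?R ** transpose ?R) $ m $ l"
    by (simp add: vR matrix_matrix_mult_def transpose_def mult.commute)
   thus "(\<Sum>i\<in>UNIV. v i $ l *\<^sub>R v i) $ m = axis l 1 $ m"
    unfolding RR by (simp add: mat_def axis_component)
  qed
  moreover have "v last_index = x" by (simp add: v_def x_def base_point_def)
  ultimately show ?thesis by (simp add: sum.remove[of UNIV last_index] algebra_simps)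
 qed
 have "rho c g *v dirac_operator c f g = (\<Sum>i\<in>UNIV - {last_index}. rho c g *v (c i *v covariant_derivative i f g))"
  using g by (simp add: dirac_operator_def mvec.sum_right)
 also have "\<dots> = (\<Sum>i\<in>UNIV - {last_index}. (\<Sum>l\<in>UNIV. v i $ l *\<^sub>R (rho c (clifford_vec x \<star> clifford_vec (v i)) *v sphere_grad F' l x)) + (1 / 2) *\<^sub>R F x)"
  by (intro sum.cong refl) (simp add: ci cov mvec.diff_right mvec.scaleR_right sq mvec.sum_right)
 also have "\<dots> = (\<Sum>i\<in>UNIV - {last_index}. \<Sum>l\<in>UNIV. v i $ l *\<^sub>R (rho c (clifford_vec x \<star> clifford_vec (v i)) *v sphere_grad F' l x))
   + ((real CARD('n) - 1) / 2) *\<^sub>R F x"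
  by (simp add: sum.distrib sum_constant_scaleR card_Diff_singleton of_nat_diff Suc_leI del: sum_constant)
 also have "(\<Sum>i\<in>UNIV - {last_index}. \<Sum>l\<in>UNIV. v i $ l *\<^sub>R (rho c (clifford_vec x \<star> clifford_vec (v i)) *v sphere_grad F' l x))
   = (\<Sum>l\<in>UNIV. rho c (clifford_vec x \<star> clifford_vec (\<Sum>i\<in>UNIV - {last_index}. v i $ l *\<^sub>R v i)) *v sphere_grad F' l x)"
  by (subst sum.swap)
   (simp add: linear_sum[OF linear_clifford_vec] clifford_vec_scaleR clifford.sum_right clifford.scaleR_right
    rho_sum rho_scaleR mvec.sum_left mvec.scaleR_left)
 also have "\<dots> = (\<Sum>l\<in>UNIV. rho c (clifford_vec x \<star> egen l) *v sphere_grad F' l x)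
   - rho c (clifford_vec x \<star> clifford_vec x) *v (\<Sum>l\<in>UNIV. x $ l *\<^sub>R sphere_grad F' l x)"
  unfolding frame
  by (simp add: clifford_vec_diff clifford_vec_scaleR clifford.diff_right clifford.scaleR_right rho_diff
    rho_scaleR mvec.diff_left mvec.scaleR_left mvec.scaleR_right sum_subtractf mvec.sum_right)
 also have "\<dots> = sphere_dirac c F' x"
 proof -
  have "rho c (clifford_vec x \<star> egen l) = - (slash (neg_module c) x ** slash c (axis l 1))" for l
   by (simp add: slash_slash[OF c])
  thus ?thesis unfolding sphere_grad_radial[OF F' nx]
   by (simp add: sphere_dirac_def mvec.zero_right mvec.minus_left mvec.sum_right sum_negf matrix_vector_mul_assoc)
 qed
 finally show ?thesis unfolding x_def .
qed

section \<open>Smoothness of the spinor fields built from polynomials\<close>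

lemma differentiable_times_mono: "differentiable_times_on (Suc k) f U ==> differentiable_times_on k f U"
proof (induction k arbitrary: f)
 case 0
 thus ?case
  using differentiable_imp_continuous_within continuous_at_imp_continuous_on by (auto, blast)
next
 case (Suc k)
 thus ?case by (metis differentiable_times_on.simps(2))
qed

lemma differentiable_times_const: "differentiable_times_on k (\<lambda>x. a) U"
 by (induction k arbitrary: a) (simp_all add: frechet_derivative_const)

lemma differentiable_times_linear:
 assumes L: "bounded_linear L"
 shows "differentiable_times_on k L UNIV"
proof (cases k)
 case 0
 thus ?thesis by (simp add: linear_continuous_on[OF L])
next
 case (Suc j)
 have d: "(L has_derivative L) (at x)" for x by (rule bounded_linear_imp_has_derivative[OF L])
 hence "frechet_derivative L (at x) = L" for x by (rule frechet_derivative_at[symmetric])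
 thus ?thesis unfolding Suc using d by (auto simp: differentiable_times_const differentiable_def)
qed

lemma differentiable_times_add:
 "differentiable_times_on k f UNIV ==> differentiable_times_on k g UNIV ==> differentiable_times_on k (\<lambda>x. f x + g x) UNIV"
proof (induction k arbitrary: f g)
 case 0
 thus ?case by (simp add: continuous_on_add)
next
 case (Suc k)
 have d: "f differentiable (at x)" "g differentiable (at x)" for x using Suc.prems by simp_all
 have D: "((\<lambda>x. f x + g x) has_derivative (\<lambda>v. frechet_derivative f (at x) v + frechet_derivative g (at x) v)) (at x)" for x
  by (rule has_derivative_add[OF d[unfolded frechet_derivative_works]])
 have e: "frechet_derivative (\<lambda>x. f x + g x) (at x) = (\<lambda>v. frechet_derivative f (at x) v + frechet_derivative g (at x) v)" for x
  by (rule frechet_derivative_at[OF D, symmetric])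
 show ?case using Suc.IH Suc.prems D unfolding differentiable_times_on.simps(2) e by (auto simp: differentiable_def)
qed

lemma differentiable_times_compose_linear:
 assumes L: "bounded_linear L"
 shows "differentiable_times_on k f UNIV ==> differentiable_times_on k (\<lambda>x. L (f x)) UNIV"
proof (induction k arbitrary: f)
 case 0
 thus ?case by (simp add: bounded_linear.continuous_on[OF L])
next
 case (Suc k)
 have d: "f differentiable (at x)" for x using Suc.prems by simp
 have D: "((\<lambda>x. L (f x)) has_derivative (\<lambda>v. L (frechet_derivative f (at x) v))) (at x)" for x
  by (rule bounded_linear.has_derivative[OF L d[unfolded frechet_derivative_works]])
 have e: "frechet_derivative (\<lambda>x. L (f x)) (at x) = (\<lambda>v. L (frechet_derivative f (at x) v))" for x
  by (rule frechet_derivative_at[OF D, symmetric])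
 show ?case using Suc.IH Suc.prems D unfolding differentiable_times_on.simps(2) e by (auto simp: differentiable_def)
qed

text \<open>Differentiating once leaves two products in which one factor has lost an order; the
  other factor is lowered by monotonicity to match.\<close>

lemma differentiable_times_bilinear:
 assumes b: "bounded_bilinear pr"
 shows "differentiable_times_on k f UNIV ==> differentiable_times_on k g UNIV ==> differentiable_times_on k (\<lambda>x. pr (f x) (g x)) UNIV"
proof (induction k arbitrary: f g)
 case 0
 thus ?case by (simp add: bounded_bilinear.continuous_on[OF b])
next
 case (Suc k)
 have d: "f differentiable (at x)" "g differentiable (at x)" for x using Suc.prems by simp_all
 have D: "((\<lambda>x. pr (f x) (g x)) has_derivative
   (\<lambda>v. pr (f x) (frechet_derivative g (at x) v) + pr (frechet_derivative f (at x) v) (g x))) (at x)" for x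
  by (rule bounded_bilinear.FDERIV[OF b d[unfolded frechet_derivative_works]])
 have e: "frechet_derivative (\<lambda>x. pr (f x) (g x)) (at x)
   = (\<lambda>v. pr (f x) (frechet_derivative g (at x) v) + pr (frechet_derivative f (at x) v) (g x))" for x
  by (rule frechet_derivative_at[OF D, symmetric])
 have f': "differentiable_times_on k (\<lambda>x. frechet_derivative f (at x) v) UNIV"
  and g': "differentiable_times_on k (\<lambda>x. frechet_derivative g (at x) v) UNIV" for v
  using Suc.prems by simp_all
 have "differentiable_times_on k (\<lambda>x. pr (f x) (frechet_derivative g (at x) v) + pr (frechet_derivative f (at x) v) (g x)) UNIV" for v
  by (intro differentiable_times_add Suc.IH f' g' differentiable_times_mono[OF Suc.prems(1)] differentiable_times_mono[OF Suc.prems(2)])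
 thus ?case using D unfolding differentiable_times_on.simps(2) e by (auto simp: differentiable_def)
qed

lemma homogeneous_differentiable_times:
 assumes "homogeneous m P" and w: "\<And>i. differentiable_times_on k (\<lambda>y. w y $ i) UNIV"
 shows "differentiable_times_on k (\<lambda>y. P (w y)) UNIV"
 using assms(1)
 by (induction rule: homogeneous.induct)
  (auto intro: differentiable_times_const differentiable_times_add differentiable_times_bilinear[OF bounded_bilinear_scaleR] w)

text \<open>The inverse of the trivialisation by constant spinors; outside the spin group it is
  zero, as required of spinor fields.\<close>

definition spinor_of :: "('n::{finite,linorder} => complex ^ 'k ^ 'k) => ('n rvector => complex ^ 'k) => 'n clifford => complex ^ 'k"
 where "spinor_of c P g = (if g \<in> SpinG then rho c (clifford_reverse g) *v P (base_point g) else 0)"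

lemma rho_reverse:
 assumes c: "clifford_relations c" and g: "g \<in> SpinG"
 shows "rho c (clifford_reverse g) *v (rho c g *v u) = u" "rho c g *v (rho c (clifford_reverse g) *v u) = u"
proof -
 have ev: "even_clifford g" "even_clifford (clifford_reverse g)"
  using even_clifford_spin[OF g] even_clifford_spin[OF spin_group_reverse[OF g]] by blast+
 show "rho c (clifford_reverse g) *v (rho c g *v u) = u" "rho c g *v (rho c (clifford_reverse g) *v u) = u"
  by (simp_all add: matrix_vector_mul_assoc rho_mult[OF c ev(2,1), symmetric] rho_mult[OF c ev(1,2), symmetric] spin_group_inverse[OF g])
qed

lemma spinor_of_smooth:
 assumes P: "homogeneous m P"
 shows "smooth_on_subset (spinor_of c P) SpinG"
proof -
 \<comment> \<open>A quadratic map on the whole Clifford algebra that agrees with the base point on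
   the spin group, so that one global extension serves at every point.\<close>
 let ?w = "\<lambda>g :: 'a clifford. (\<chi> i. (g \<star> e_last \<star> clifford_reverse g) $ {i}) :: 'a rvector"
 let ?H = "\<lambda>g. rho c (clifford_reverse g) *v P (?w g)"
 have br: "bounded_linear (clifford_reverse :: 'a clifford => 'a clifford)" and brho: "bounded_linear (rho c)"
  using linear_reverse linear_rho linear_conv_bounded_linear by blast+
 have rev: "differentiable_times_on k (clifford_reverse :: 'a clifford => 'a clifford) UNIV" for k
  by (rule differentiable_times_linear[OF br])
 have w: "differentiable_times_on k (\<lambda>g. ?w g $ i) UNIV" for k i
  unfolding vec_lambda_beta
  by (rule differentiable_times_compose_linear[OF bounded_linear_vec_nth
     differentiable_times_bilinear[OF bounded_bilinear_clifford differentiable_times_linear[OF clifford.bounded_linear_left] rev]])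
 have "differentiable_times_on k ?H UNIV" for k
  by (intro differentiable_times_bilinear[OF bounded_bilinear_matrix_vector] differentiable_times_compose_linear[OF brho] rev
    homogeneous_differentiable_times[OF P w])
 hence "smooth_on_open ?H UNIV" unfolding smooth_on_open_def by blast
 moreover have "?H g = spinor_of c P g" if "g \<in> SpinG" for g
 proof -
  have "?w g = base_point g"
   by (simp add: vec_eq_iff clifford_vec_base_point[OF that, symmetric] clifford_vec_nth(1))
  thus ?thesis using that by (simp add: spinor_of_def)
 qed
 ultimately show ?thesis
  unfolding smooth_on_subset_def by (intro ballI exI[of _ UNIV] exI[of _ ?H]) auto
qed

text \<open>The converse of \<open>spin_group_stabilizer\<close>: an even number of vectors
  orthogonal to \<open>e\<^sub>N\<close>, each anticommuting with it, gives a product that commutes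
  with it.\<close>

lemma spin_cover_last:
 assumes h: "h \<in> spin_group {v. v $ last_index = 0}"
 shows "spin_cover h *v axis last_index 1 = axis last_index 1"
proof -
 obtain vs where vs: "h = vprod vs" "even (length vs)" "\<forall>v\<in>set vs. v $ last_index = 0"
  using h unfolding spin_group_iff by blast
 have "vprod vs \<star> e_last = (-1) ^ length vs *\<^sub>R (e_last \<star> vprod vs)"
  using vs(3)
 proof (induction vs)
  case (Cons v vs)
  have "clifford_vec v \<star> e_last = - (e_last \<star> clifford_vec v)"
   using clifford_vec_anticommute[of v "axis last_index 1"] Cons.prems
   by (simp add: clifford_vec_axis inner_axis eq_neg_iff_add_eq_0)
  hence "clifford_vec v \<star> (e_last \<star> vprod vs) = - (e_last \<star> (clifford_vec v \<star> vprod vs))"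
   by (simp only: clifford_assoc[symmetric] clifford.minus_left)
  thus ?case using Cons by (simp add: clifford_assoc clifford.scaleR_right)
 qed simp
 hence "h \<star> e_last = e_last \<star> h" using vs(1,2) by simp
 hence "h \<star> e_last \<star> clifford_reverse h = e_last"
  by (simp add: clifford_assoc spin_group_inverse(1)[OF h])
 hence "clifford_vec (spin_cover h *v axis last_index 1) = egen last_index"
  unfolding spin_cover(1)[OF h, symmetric] by (simp add: clifford_vec_axis)
 thus ?thesis by (simp add: clifford_vec_inject)
qed

lemma spinor_field_spinor_of:
 fixes c :: "'n::{finite,linorder} => complex ^ 'k ^ 'k"
 assumes c: "clifford_relations c" and P: "homogeneous m P"
  and G: "\<And>A. A \<in> G ==> \<tau> A \<in> SpinG" "\<And>A x. A \<in> G ==> P (spin_cover (\<tau> A) *v x) = rho c (\<tau> A) *v P x"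
 shows "spinor_field c G \<tau> (spinor_of c P)"
 unfolding spinor_field_def
proof (intro conjI ballI allI impI)
 show "smooth_on_subset (spinor_of c P) SpinG" by (rule spinor_of_smooth[OF P])
 show "spinor_of c P g = 0" if "g \<notin> SpinG" for g using that by (simp add: spinor_of_def)
 fix g :: "'n clifford" assume g: "g \<in> SpinG"
 note r = spin_group_reverse
 {
  fix h :: "'n clifford" assume h: "h \<in> spin_group {v. v $ last_index = 0}"
  have h': "h \<in> SpinG" using h spin_group_mono[of "{v. v $ last_index = 0}" UNIV] by blast
  have "base_point (g \<star> h) = base_point g"
   unfolding base_point_def spin_cover_mult[OF g h'] matrix_vector_mul_assoc[symmetric] spin_cover_last[OF h] ..
  moreover have "rho c (clifford_reverse (g \<star> h)) = rho c (clifford_reverse h) ** rho c (clifford_reverse g)"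
   unfolding clifford_reverse_mult_spin[OF g h'] by (rule rho_mult[OF c even_clifford_spin[OF r[OF h']] even_clifford_spin[OF r[OF g]]])
  ultimately show "clifford_action c h *v spinor_of c P (g \<star> h) = spinor_of c P g"
   using g spin_group_mult[OF g h']
   by (simp add: spinor_of_def clifford_action_spin[OF h] matrix_vector_mul_assoc[symmetric] rho_reverse[OF c h'])
 }
 fix A assume A: "A \<in> G"
 have "rho c (clifford_reverse (\<tau> A \<star> g)) = rho c (clifford_reverse g) ** rho c (clifford_reverse (\<tau> A))"
  unfolding clifford_reverse_mult_spin[OF G(1)[OF A] g]
  by (rule rho_mult[OF c even_clifford_spin[OF r[OF g]] even_clifford_spin[OF r[OF G(1)[OF A]]]])
 thus "spinor_of c P (\<tau> A \<star> g) = spinor_of c P g"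
  using g spin_group_mult[OF G(1)[OF A] g]
  by (simp add: spinor_of_def base_point_mult[OF g G(1)[OF A]] G(2)[OF A] matrix_vector_mul_assoc[symmetric] rho_reverse[OF c G(1)[OF A]])
qed

lemma dirac_spinor_of:
 fixes c :: "'n::{finite,wellorder} => complex ^ 'k ^ 'k"
 assumes c: "clifford_relations c" and P: "P \<in> eigen_poly c a z"
 shows "dirac_operator c (spinor_of c P) g = (of_int z + (of_nat CARD('n) - 1) / 2) *s spinor_of c P g"
proof (cases "g \<in> SpinG")
 case True
 obtain m where m: "homogeneous m P" using eigen_poly_homogeneous[OF P] by blast
 have F: "P (base_point g) = rho c g *v spinor_of c P g" if "g \<in> SpinG" for g
  using that by (simp add: spinor_of_def rho_reverse[OF c])
 have "rho c g *v dirac_operator c (spinor_of c P) g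
   = sphere_dirac c (poly_rotation P) (base_point g) + ((real CARD('n) - 1) / 2) *\<^sub>R P (base_point g)"
  by (rule dirac_operator_sphere[OF c spinor_of_smooth[OF m] rotC1_poly[OF m] F True])
 also have "\<dots> = (of_int z + (of_nat CARD('n) - 1) / 2) *s P (base_point g)"
  by (simp add: eigen_poly_dirac[OF c P base_point_norm[OF True]] scaleR_smult vector_sadd_rdistrib)
 also have "\<dots> = rho c g *v ((of_int z + (of_nat CARD('n) - 1) / 2) *s spinor_of c P g)"
  by (simp only: smult_matrix_vector F[OF True])
 finally show ?thesis by (metis rho_reverse(1)[OF c True])
next
 case False
 thus ?thesis by (simp add: dirac_operator_def spinor_of_def)
qed

section \<open>Eigenspinors on the quotient\<close>

lemma unit_scale:
 obtains u where "norm u = 1" "x = norm x *\<^sub>R (u :: 'n::finite rvector)"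
proof (cases "x = 0")
 case True
 thus thesis using that[of "axis undefined 1"] by (simp add: norm_axis_1)
next
 case False
 thus thesis using that[of "x /\<^sub>R norm x"] by simp
qed

lemma homogeneous_equivariant_sphere:
 assumes P: "homogeneous m P" and e: "\<And>x. norm x = 1 ==> P (spin_cover a *v x) = rho c a *v P x"
 shows "P \<in> equivariant_poly c a m"
proof -
 have "P (spin_cover a *v x) = rho c a *v P x" for x
 proof -
  obtain u where u: "norm u = 1" "x = norm x *\<^sub>R u" by (rule unit_scale)
  have "P (spin_cover a *v (norm x *\<^sub>R u)) = rho c a *v P (norm x *\<^sub>R u)"
   by (simp add: matrix_vector_mult_scaleR homogeneous_scale[OF P] e[OF u(1)] mvec.scaleR_right)
  thus ?thesis using u(2) by simp
 qed
 thus ?thesis using P by (simp add: equivariant_poly_def)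
qed

text \<open>Equivariance on the sphere determines it everywhere by homogeneity. For P = x Q it
  passes to Q, since multiplication by x intertwines the two modules and is invertible on the unit
  sphere.\<close>

lemma eigen_poly_equivariant:
 fixes c :: "'n::{finite,linorder} => complex ^ 'k ^ 'k"
 assumes c: "clifford_relations c" and a: "a \<in> SpinG" and P: "P \<in> eigen_poly c b z"
  and e: "\<And>x. norm x = 1 ==> P (spin_cover a *v x) = rho c a *v P x"
 shows "P \<in> eigen_poly c a z"
proof -
 let ?c = "neg_module c" and ?m = "nat (1 - int CARD('n) - z)"
 consider "z \<ge> 0" "P \<in> monogenic c b (nat z)"
  | Q where "z < 0" "z \<le> 1 - int CARD('n)" "Q \<in> monogenic ?c b ?m" "P = xslash ?c Q"
  | "z < 0" "\<not> z \<le> 1 - int CARD('n)" "P = (\<lambda>x. 0)"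
  using P unfolding eigen_poly_def by (auto split: if_splits)
 thus ?thesis
 proof cases
  case 1
  hence "P \<in> monogenic c a (nat z)"
   using homogeneous_equivariant_sphere[OF monogenic_D(1)[OF 1(2)] e] monogenic_D(2)[OF 1(2)] by (simp add: monogenic_def)
  thus ?thesis using 1(1) by (simp add: eigen_poly_def)
 next
  case 2
  note c' = clifford_relations_neg[OF c]
  have "Q (spin_cover a *v x) = rho ?c a *v Q x" if x: "norm x = 1" for x
  proof -
   let ?y = "spin_cover a *v x"
   have y: "norm ?y = 1" using orthogonal_transformation_norm[OF spin_cover(2)[OF a]] x by simp
   have s: "slash c ?y *v (slash ?c ?y *v u) = u" for u
    using slash_slash_self[OF c', of ?y] y by (simp add: matrix_vector_mul_assoc dot_square_norm)
   have "slash ?c ?y *v Q ?y = rho c a *v (slash ?c x *v Q x)"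
    using e[OF x] by (simp add: 2(4) xslash_def)
   also have "\<dots> = slash ?c ?y *v (rho ?c a *v Q x)"
    using slash_equivariant[OF c' a, of x] by (simp add: matrix_vector_mul_assoc)
   finally show ?thesis by (metis s)
  qed
  hence "Q \<in> monogenic ?c a ?m"
   using homogeneous_equivariant_sphere[OF monogenic_D(1)[OF 2(3)]] monogenic_D(2)[OF 2(3)] by (simp add: monogenic_def)
  thus ?thesis using 2 by (simp add: eigen_poly_def)
 next
  case 3
  thus ?thesis by (simp add: eigen_poly_def)
 qed
qed

text \<open>The lifted group consists of powers of \<open>a\<close>, so that invariance of a spinor
  field is a condition on the single element \<open>a\<close>.\<close>

definition cyclic_spin :: "'n::{finite,linorder} rmatrix set => ('n rmatrix => 'n clifford) => 'n clifford => bool"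
 where "cyclic_spin G \<tau> a \<longleftrightarrow> a \<in> SpinG \<and> a \<in> \<tau> ` G \<and> (\<forall>A\<in>G. \<exists>k. \<tau> A = ((\<star>) a ^^ k) clifford_one)"

lemma cyclic_spin_equivariant:
 assumes c: "clifford_relations c" and G: "cyclic_spin G \<tau> a" and P: "\<And>x. P (spin_cover a *v x) = rho c a *v P x" and A: "A \<in> G"
 shows "\<tau> A \<in> SpinG" "P (spin_cover (\<tau> A) *v x) = rho c (\<tau> A) *v P x"
proof -
 have a: "a \<in> SpinG" using G by (simp add: cyclic_spin_def)
 have "((\<star>) a ^^ k) clifford_one \<in> SpinG \<and> (\<forall>x. P (spin_cover (((\<star>) a ^^ k) clifford_one) *v x) = rho c (((\<star>) a ^^ k) clifford_one) *v P x)" for k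
 proof (induction k)
  case 0
  show ?case by (simp add: spin_group_one spin_cover_one)
 next
  case (Suc k)
  let ?b = "((\<star>) a ^^ k) clifford_one"
  have b: "?b \<in> SpinG" "\<And>x. P (spin_cover ?b *v x) = rho c ?b *v P x" using Suc by blast+
  have "P (spin_cover (a \<star> ?b) *v x) = rho c (a \<star> ?b) *v P x" for x
   unfolding spin_cover_mult[OF a b(1)] rho_mult[OF c even_clifford_spin[OF a] even_clifford_spin[OF b(1)]]
    matrix_vector_mul_assoc[symmetric] P b(2) ..
  thus ?case using spin_group_mult[OF a b(1)] by simp
 qed
 moreover obtain k where "\<tau> A = ((\<star>) a ^^ k) clifford_one" using G A unfolding cyclic_spin_def by blast
 ultimately show "\<tau> A \<in> SpinG" "P (spin_cover (\<tau> A) *v x) = rho c (\<tau> A) *v P x" by simp_all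
qed

lemma eigen_poly_D:
 fixes c :: "'n::{finite,linorder} => complex ^ 'k ^ 'k"
 assumes c: "clifford_relations c" and a: "a \<in> SpinG" and P: "P \<in> eigen_poly c a z"
 shows "P (spin_cover a *v x) = rho c a *v P x"
proof -
 have "Q (spin_cover a *v x) = rho c' a *v Q x" if "Q \<in> monogenic c' a m" for Q m and c' :: "'n => complex ^ 'k ^ 'k"
  using that by (simp add: monogenic_def equivariant_poly_def)
 moreover have "xslash (neg_module c) Q (spin_cover a *v x) = rho c a *v xslash (neg_module c) Q x" if "Q \<in> monogenic (neg_module c) a m" for Q m
  using xslash_equivariant[OF clifford_relations_neg[OF c] a, of Q m] that by (simp add: monogenic_def equivariant_poly_def)
 ultimately show ?thesis using P unfolding eigen_poly_def by (auto split: if_splits simp: mvec.zero_right)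
qed

lemma dirac_eigenspace_spinor_of:
 fixes c :: "'n::{finite,wellorder} => complex ^ 'k ^ 'k"
 assumes c: "clifford_relations c" and G: "cyclic_spin G \<tau> a"
 shows "spinor_of c ` eigen_poly c a z \<subseteq> dirac_eigenspace c G \<tau> (of_int z + (of_nat CARD('n) - 1) / 2)"
proof
 fix f assume "f \<in> spinor_of c ` eigen_poly c a z"
 then obtain P where P: "P \<in> eigen_poly c a z" "f = spinor_of c P" by blast
 obtain m where m: "homogeneous m P" using eigen_poly_homogeneous[OF P(1)] by blast
 have a: "a \<in> SpinG" using G by (simp add: cyclic_spin_def)
 have e: "P (spin_cover a *v x) = rho c a *v P x" for x by (rule eigen_poly_D[OF c a P(1)])
 have "spinor_field c G \<tau> f"
  unfolding P(2)
 proof (rule spinor_field_spinor_of[OF c m])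
  fix A assume A: "A \<in> G"
  show "\<tau> A \<in> SpinG" by (rule cyclic_spin_equivariant(1)[where P = P, OF c G e A])
  show "P (spin_cover (\<tau> A) *v x) = rho c (\<tau> A) *v P x" for x
   by (rule cyclic_spin_equivariant(2)[where P = P, OF c G e A])
 qed
 thus "f \<in> dirac_eigenspace c G \<tau> (of_int z + (of_nat CARD('n) - 1) / 2)"
  unfolding dirac_eigenspace_def P(2) using dirac_spinor_of[OF c P(1)] by (simp add: fun_eq_iff)
qed

text \<open>Completeness is applied on the sphere, without the group; the invariance of f under the
  lift \<open>a\<close> then becomes equivariance of the polynomial found there.\<close>

theorem dirac_eigenspinor_polynomial:
 fixes c :: "'n::{finite,wellorder} => complex ^ 'k ^ 'k"
 assumes c: "clifford_relations c" and n: "CARD('n) \<ge> 2" and G: "cyclic_spin G \<tau> a"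
  and f: "f \<in> dirac_eigenspace c G \<tau> \<mu>" and nz: "f \<noteq> (\<lambda>_. 0)"
 obtains z P where "\<mu> = of_int z + (of_nat CARD('n) - 1) / 2" "P \<in> eigen_poly c a z" "f = spinor_of c P"
proof -
 have a: "a \<in> SpinG" and aG: "\<exists>A\<in>G. \<tau> A = a" using G by (auto simp: cyclic_spin_def)
 have smooth: "smooth_on_subset f SpinG" and out: "\<And>g. g \<notin> SpinG ==> f g = 0"
  and eqv: "\<And>g h. g \<in> SpinG ==> h \<in> spin_group {v :: 'n rvector. v $ last_index = 0} ==> clifford_action c h *v f (g \<star> h) = f g"
  and inv: "\<And>A g. A \<in> G ==> g \<in> SpinG ==> f (\<tau> A \<star> g) = f g"
  and ev: "dirac_operator c f = (\<lambda>g. \<mu> *s f g)"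
  using f unfolding dirac_eigenspace_def spinor_field_def by blast+
 \<comment> \<open>An arbitrary frame over each point; the value of F does not depend on it by
   \<open>spinor_descends\<close>.\<close>
 define fr where "fr x = (SOME g. g \<in> SpinG \<and> base_point g = x)" for x :: "'n rvector"
 define F where "F x = rho c (fr x) *v f (fr x)" for x
 have F: "F (base_point g) = rho c g *v f g" if g: "g \<in> SpinG" for g
 proof -
  have "fr (base_point g) \<in> SpinG \<and> base_point (fr (base_point g)) = base_point g"
   unfolding fr_def by (rule someI[of _ g]) (use g in simp)
  thus ?thesis unfolding F_def by (intro spinor_descends[OF c n eqv]) (use g in simp_all)
 qed
 obtain F' where F': "rotC1 F F'" using spinor_rotC1[OF n smooth F] by blast
 let ?\<kappa> = "\<mu> - (of_nat CARD('n) - 1) / 2"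
 have e: "sphere_dirac c F' x = ?\<kappa> *s F x" if x: "norm x = 1" for x
 proof -
  obtain g where g: "g \<in> SpinG" "base_point g = x" using base_point_surj[OF n x] by blast
  have "\<mu> *s F x = sphere_dirac c F' x + ((real CARD('n) - 1) / 2) *\<^sub>R F x"
   using dirac_operator_sphere[OF c smooth F' F g(1)] F[OF g(1)] by (simp add: ev smult_matrix_vector g(2))
  thus ?thesis by (simp add: scaleR_smult vec.scale_left_diff_distrib)
 qed
 have fF: "f g = rho c (clifford_reverse g) *v F (base_point g)" if "g \<in> SpinG" for g
  by (simp add: F[OF that] rho_reverse[OF c that])
 obtain g0 where g0: "f g0 \<noteq> 0" using nz by blast
 hence "g0 \<in> SpinG" using out by blast
 hence y: "norm (base_point g0) = 1" "F (base_point g0) \<noteq> 0"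
  using base_point_norm[of g0] fF[of g0] g0 by (auto simp: mvec.zero_right)
 obtain z P where zP: "?\<kappa> = of_int z" "P \<in> eigen_poly c clifford_one z" "\<And>x. norm x = 1 ==> F x = P x"
  by (rule sphere_dirac_complete[OF c n F' _ y]) (rule e, assumption, rule that, assumption+)
 have "P (spin_cover a *v x) = rho c a *v P x" if x: "norm x = 1" for x
 proof -
  obtain g where g: "g \<in> SpinG" "base_point g = x" using base_point_surj[OF n x] by blast
  have y: "norm (spin_cover a *v x) = 1" using orthogonal_transformation_norm[OF spin_cover(2)[OF a]] x by simp
  have "F (spin_cover a *v x) = rho c (a \<star> g) *v f (a \<star> g)"
   unfolding g(2)[symmetric] base_point_mult[OF g(1) a, symmetric] by (rule F[OF spin_group_mult[OF a g(1)]])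
  also have "f (a \<star> g) = f g" using inv[OF _ g(1)] aG by blast
  also have "rho c (a \<star> g) *v f g = rho c a *v F x"
   by (simp add: rho_mult[OF c even_clifford_spin[OF a] even_clifford_spin[OF g(1)]] F[OF g(1), unfolded g(2)] matrix_vector_mul_assoc)
  finally show ?thesis by (simp only: zP(3)[OF x] zP(3)[OF y])
 qed
 hence "P \<in> eigen_poly c a z" by (rule eigen_poly_equivariant[OF c a zP(2)])
 moreover have "f = spinor_of c P"
  using out by (auto simp: fun_eq_iff spinor_of_def fF zP(3)[OF base_point_norm])
 moreover have "\<mu> = of_int z + (of_nat CARD('n) - 1) / 2" using zP(1) by (simp add: algebra_simps)
 ultimately show thesis using that by blast
qed

lemma complex_fun_dim_eq_0:
 assumes "V \<subseteq> complex_fun.span S" "finite S"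
 shows "complex_fun.dim V = 0 \<longleftrightarrow> V \<subseteq> {0}"
proof
 assume d: "complex_fun.dim V = 0"
 obtain B where B: "B \<subseteq> V" "complex_fun.independent B" "V \<subseteq> complex_fun.span B" "card B = complex_fun.dim V"
  by (rule complex_fun.basis_exists)
 have "finite B" using complex_fun.independent_span_bound[OF assms(2) B(2)] B(1) assms(1) by blast
 hence "B = {}" using B(4) d by simp
 thus "V \<subseteq> {0}" using B(3) by simp
next
 assume "V \<subseteq> {0}"
 thus "complex_fun.dim V = 0"
  by (intro complex_fun.dim_unique[of "{}"]) (auto simp: complex_fun.independent_empty)
qed

lemma dirac_eigenspace_dim:
 fixes c :: "'n::{finite,wellorder} => complex ^ 'k ^ 'k"
 assumes c: "clifford_relations c" and n: "CARD('n) \<ge> 2" and G: "cyclic_spin G \<tau> a"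
 shows "complex_fun.dim (dirac_eigenspace c G \<tau> (of_int z + (of_nat CARD('n) - 1) / 2)) = complex_fun.dim (eigen_poly c a z)"
  and "dirac_eigenvalue c G \<tau> (of_int z + (of_nat CARD('n) - 1) / 2) \<longleftrightarrow> complex_fun.dim (eigen_poly c a z) \<noteq> 0"
proof -
 let ?\<mu> = "of_int z + (of_nat CARD('n) - 1) / 2 :: complex" and ?V = "eigen_poly c a z"
 have a: "a \<in> SpinG" using G by (simp add: cyclic_spin_def)
 obtain B where B: "finite B" "complex_fun.span B = ?V" using eigen_poly_basis[OF c] by metis
 have sub: "complex_fun.subspace ?V" unfolding B(2)[symmetric] by (rule complex_fun.subspace_span)
 have VB: "?V \<subseteq> complex_fun.span B" using B(2) by simp
 have sum: "spinor_of c (P + Q) = spinor_of c P + spinor_of c Q" for P Q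
  by (simp add: fun_eq_iff spinor_of_def mvec.add_right)
 have scale: "spinor_of c (\<lambda>x. b *s P x) = (\<lambda>x. b *s spinor_of c P x)" for b P
  by (simp add: fun_eq_iff spinor_of_def smult_matrix_vector)
 have inj: "P = 0" if P: "P \<in> ?V" "spinor_of c P = 0" for P
 proof -
  obtain m where m: "homogeneous m P" using eigen_poly_homogeneous[OF P(1)] by blast
  have "P x = 0" for x
  proof -
   obtain u where u: "norm u = 1" "x = norm x *\<^sub>R u" by (rule unit_scale)
   obtain g where g: "g \<in> SpinG" "base_point g = u" using base_point_surj[OF n u(1)] by blast
   have "spinor_of c P g = 0" using P(2) by simp
   hence "rho c (clifford_reverse g) *v P u = 0" using g by (simp add: spinor_of_def)
   hence "P u = 0" using rho_reverse(2)[OF c g(1), of "P u"] by (simp add: mvec.zero_right)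
   hence "P (norm x *\<^sub>R u) = 0" by (simp add: homogeneous_scale[OF m])
   thus ?thesis using u(2) by simp
  qed
  thus ?thesis by (simp add: fun_eq_iff)
 qed
 have E: "dirac_eigenspace c G \<tau> ?\<mu> = spinor_of c ` ?V"
 proof
  show "dirac_eigenspace c G \<tau> ?\<mu> \<subseteq> spinor_of c ` ?V"
  proof
   fix f assume f: "f \<in> dirac_eigenspace c G \<tau> ?\<mu>"
   show "f \<in> spinor_of c ` ?V"
   proof (cases "f = (\<lambda>_. 0)")
    case True
    have "f = spinor_of c 0" by (simp add: True fun_eq_iff spinor_of_def mvec.zero_right)
    thus ?thesis using complex_fun.subspace_0[OF sub] by blast
   next
    case False
    obtain z' P where "?\<mu> = of_int z' + (of_nat CARD('n) - 1) / 2" "P \<in> eigen_poly c a z'" "f = spinor_of c P"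
     by (rule dirac_eigenspinor_polynomial[OF c n G f False])
    thus ?thesis by simp
   qed
  qed
 qed (rule dirac_eigenspace_spinor_of[OF c G])
 show dim: "complex_fun.dim (dirac_eigenspace c G \<tau> ?\<mu>) = complex_fun.dim ?V"
  unfolding E by (rule complex_fun_dim_image(2)[OF sub VB B(1) sum scale inj])
 have "(\<exists>f\<in>spinor_of c ` ?V. f \<noteq> (\<lambda>_. 0)) \<longleftrightarrow> \<not> ?V \<subseteq> {0}"
 proof -
  have z: "spinor_of c 0 = (\<lambda>_. 0)" by (simp add: fun_eq_iff spinor_of_def mvec.zero_right)
  have "P = 0" if "P \<in> ?V" "spinor_of c P = (\<lambda>_. 0)" for P using inj[OF that(1)] that(2) by (simp add: zero_fun_def)
  thus ?thesis using z by blast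
 qed
 thus "dirac_eigenvalue c G \<tau> ?\<mu> \<longleftrightarrow> complex_fun.dim ?V \<noteq> 0"
  unfolding dirac_eigenvalue_def E complex_fun_dim_eq_0[OF VB B(1)] .
qed

text \<open>Eigenvalues on the two sides of the spectral gap come from monogenic polynomials for
  \<open>c\<close> and for \<open>neg_module c\<close>, so both families of dimensions
  enter.\<close>

theorem dirac_isospectral_if_dim_eq:
 fixes c :: "'n::{finite,wellorder} => complex ^ 'k ^ 'k"
 assumes c: "clifford_relations c" and n: "CARD('n) \<ge> 2" and G: "cyclic_spin G \<tau> a" and H: "cyclic_spin H \<sigma> b"
  and dim: "\<And>m. complex_fun.dim (monogenic c a m) = complex_fun.dim (monogenic c b m)"
   "\<And>m. complex_fun.dim (monogenic (neg_module c) a m) = complex_fun.dim (monogenic (neg_module c) b m)"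
 shows "dirac_isospectral c G \<tau> H \<sigma>"
proof -
 have d: "complex_fun.dim (eigen_poly c a z) = complex_fun.dim (eigen_poly c b z)" for z
  using eigen_poly_basis[OF c, of a z] eigen_poly_basis[OF c, of b z] dim by metis
 have "(dirac_eigenvalue c G \<tau> \<mu> \<longleftrightarrow> dirac_eigenvalue c H \<sigma> \<mu>) \<and> dirac_multiplicity c G \<tau> \<mu> = dirac_multiplicity c H \<sigma> \<mu>" for \<mu>
 proof (cases "\<exists>z. \<mu> = of_int z + (of_nat CARD('n) - 1) / 2")
  case True
  then obtain z where "\<mu> = of_int z + (of_nat CARD('n) - 1) / 2" by blast
  thus ?thesis by (simp add: dirac_multiplicity_def dirac_eigenspace_dim[OF c n G] dirac_eigenspace_dim[OF c n H] d)
 next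
  case False
  \<comment> \<open>A number that is not an integer shifted by (N - 1) / 2 has only the zero
    eigenspinor, on either space.\<close>
  have sub: "dirac_eigenspace c K \<rho> \<mu> \<subseteq> {0}" if "cyclic_spin K \<rho> e" for K \<rho> e
  proof
   fix f assume f: "f \<in> dirac_eigenspace c K \<rho> \<mu>"
   have "f = (\<lambda>_. 0)"
   proof (rule ccontr)
    assume "f \<noteq> (\<lambda>_. 0)"
    thus False using dirac_eigenspinor_polynomial[OF c n that f] False by metis
   qed
   thus "f \<in> {0}" by (simp add: zero_fun_def)
  qed
  have "complex_fun.dim V = 0" if "V \<subseteq> {0}" for V :: "('n clifford => complex ^ 'k) set"
   using complex_fun_dim_eq_0[of V "{}"] that by simp
  moreover have "\<not> dirac_eigenvalue c K \<rho> \<mu>" if "cyclic_spin K \<rho> e" for K \<rho> e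
   using sub[OF that] unfolding dirac_eigenvalue_def zero_fun_def by blast
  ultimately show ?thesis using sub[OF G] sub[OF H] G H by (simp add: dirac_multiplicity_def)
 qed
 thus ?thesis unfolding dirac_isospectral_def by blast
qed

section \<open>Isospectrality\<close>

lemma lens_spin_cyclic:
 assumes \<tau>: "\<And>k. \<tau> (lens_power q s k) = lens_spin q s k"
 shows "cyclic_spin (lens_group q s) \<tau> (lens_spin q s 1)"
proof -
 have "lens_spin q s k = ((\<star>) (lens_spin q s 1) ^^ k) clifford_one" for k
 proof (induction k)
  case (Suc k)
  thus ?case using lens_spin_add[of q s 1 k, unfolded plus_1_eq_Suc] by (simp del: One_nat_def)
 qed (simp add: lens_spin_0)
 thus ?thesis
  unfolding cyclic_spin_def lens_group_eq using \<tau> lens_spin_mem by (metis rangeE rangeI imageI)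
qed

text \<open>The recursion subtracts from the equivariant polynomials of degree m those of degree m -
  1 for the opposite chirality, which is why the equality is assumed for all chiral modules and
  degrees.\<close>

lemma dim_monogenic_lens_spin_eq:
 assumes c: "chiral_module c \<eta>"
  and eq: "\<And>c \<eta> m. chiral_module c \<eta> ==> complex_fun.dim (equivariant_poly c (lens_spin q s 1) m)
   = complex_fun.dim (equivariant_poly c (lens_spin q s' 1) m)"
 shows "complex_fun.dim (monogenic c (lens_spin q s 1) m) = complex_fun.dim (monogenic c (lens_spin q s' 1) m)"
proof (cases m)
 case 0
 thus ?thesis by (simp only: monogenic_0 eq[OF c])
next
 case (Suc k)
 have rel: "clifford_relations c" and n: "CARD(8) \<ge> 2" using c by (simp_all add: chiral_module_def)
 show ?thesis
  unfolding Suc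
  using dim_monogenic_Suc[OF rel n lens_spin_mem[of q s 1], of k] dim_monogenic_Suc[OF rel n lens_spin_mem[of q s' 1], of k]
   eq[OF c, of "Suc k"] eq[OF chiral_module_neg[OF c], of k] by linarith
qed

theorem theorem5p5:
  fixes r :: nat
    and c :: "8 \<Rightarrow> complex ^ 8 ^ 8"
    and \<Gamma> \<Gamma>' :: "(real ^ 8 ^ 8) set"
  assumes "odd r" and "r \<ge> 7"
    and "irreducible_clifford_module c"
    and "\<Gamma> = lens_group (r\<^sup>2) [1, 1 + int r, 1 + 2 * int r, 1 + 4 * int r]"
    and "\<Gamma>' = lens_group (r\<^sup>2) [1, 1 - int r, 1 - 2 * int r, 1 - 4 * int r]"
  shows "\<not> isometric_space_forms \<Gamma> \<Gamma>' \<and>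
    (\<exists>\<tau> \<tau>'. (\<forall>\<sigma>. spin_structure \<Gamma> \<sigma> \<longleftrightarrow> \<sigma> = \<tau>) \<and>
            (\<forall>\<sigma>. spin_structure \<Gamma>' \<sigma> \<longleftrightarrow> \<sigma> = \<tau>') \<and>
            dirac_isospectral c \<Gamma> \<tau> \<Gamma>' \<tau>')"
proof -
 let ?s = "[1, 1 + int r, 1 + 2 * int r, 1 + 4 * int r]" and ?s' = "[1, 1 - int r, 1 - 2 * int r, 1 - 4 * int r]"
 have q: "odd (r\<^sup>2)" using assms(1) by simp
 obtain \<tau> where \<tau>: "\<And>\<sigma>. spin_structure (lens_group (r\<^sup>2) ?s) \<sigma> \<longleftrightarrow> \<sigma> = \<tau>" "\<And>k. \<tau> (lens_power (r\<^sup>2) ?s k) = lens_spin (r\<^sup>2) ?s k"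
  by (rule lens_spin_structure[OF q, of ?s]) simp_all
 obtain \<tau>' where \<tau>': "\<And>\<sigma>. spin_structure (lens_group (r\<^sup>2) ?s') \<sigma> \<longleftrightarrow> \<sigma> = \<tau>'" "\<And>k. \<tau>' (lens_power (r\<^sup>2) ?s' k) = lens_spin (r\<^sup>2) ?s' k"
  by (rule lens_spin_structure[OF q, of ?s']) simp_all
 have eq: "complex_fun.dim (equivariant_poly c (lens_spin (r\<^sup>2) ?s 1) m) = complex_fun.dim (equivariant_poly c (lens_spin (r\<^sup>2) ?s' 1) m)"
  if "chiral_module c \<eta>" for c \<eta> m
 proof -
  have "(\<Sum>j<4. ?s ! j * weight i j) = (\<Sum>j<4. (1 + lens_offset j * int r) * weight i j)"
   "(\<Sum>j<4. ?s' ! j * weight i j) = (\<Sum>j<4. (1 - lens_offset j * int r) * weight i j)" for i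
   by (simp_all add: sum_lessThan_4 lens_offset_def)
  thus ?thesis unfolding dim_equivariant_lens_spin[OF that q] by (simp only: card_lens_weights[OF assms(1)])
 qed
 obtain \<eta> where c: "chiral_module c \<eta>" using irreducible_chiral[OF assms(3)] by blast
 have "dirac_isospectral c (lens_group (r\<^sup>2) ?s) \<tau> (lens_group (r\<^sup>2) ?s') \<tau>'"
  by (rule dirac_isospectral_if_dim_eq[OF irreducible_clifford_relations[OF assms(3)] _ lens_spin_cyclic[OF \<tau>(2)] lens_spin_cyclic[OF \<tau>'(2)]
     dim_monogenic_lens_spin_eq[OF c eq] dim_monogenic_lens_spin_eq[OF chiral_module_neg[OF c] eq]]) simp_all
 moreover have "\<not> isometric_space_forms \<Gamma> \<Gamma>'"
  unfolding assms(4,5) by (rule lens_spaces_not_isometric) (use assms(1,2) in simp_all)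
 ultimately show ?thesis unfolding assms(4,5) using \<tau>(1) \<tau>'(1) by blast
qed

end
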